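(* Let $A = \mathrm{UD}(m,n)$ with its $\mathrm{GL}_m$-action, where $m \ge 2$ and $m \ge n^2$. Then (a) $A^{\mathrm{GL}_m} = k$; (b) $\operatorname{trdeg}_{\mathrm{Z}(A)} L \ge n^2 - 1$ for every $\mathrm{GL}_m$-splitting field $L$ of $A$ of the form $L = k(X_0)$, where $X_0$ is a $\mathrm{GL}_m$-variety.
   Context: $k$ is an algebraically closed field of characteristic zero; $\mathrm{GL}_m=\mathrm{GL}_m(k)$; $\mathrm{Z}(A)$ is the center of $A$ and $A^{\mathrm{GL}_m}$ is the subalgebra of $\mathrm{GL}_m$-fixed elements. Universal division algebra: let $m\ge 2$, let $x_{ij}^{(h)}$ ($1\le i,j\le n$, $1\le h\le m$) be independent commuting variables over $k$, and let $X^{(h)}=(x_{ij}^{(h)})\in M_n\bigl(k(x_{ij}^{(h)})\bigr)$ be the generic $n\times n$ matrices. $\mathrm{UD}(m,n)$ is the division subalgebra of $M_n\bigl(k(x_{ij}^{(h)})\bigr)$ generated by $X^{(1)},\dots,X^{(m)}$; equivalently, it is the algebra of $\mathrm{PGL}_n$-equivariant rational maps $(M_n(k))^m\dashrightarrow M_n(k)$, where $\mathrm{PGL}_n$ acts on $(M_n(k))^m$ by simultaneous conjugation and on $M_n(k)$ by conjugation, with $X^{(h)}$ corresponding to the $h$-th projection. It is a division algebra of degree $n$. The group $\mathrm{GL}_m$ acts on $(M_n(k))^m$ by $g\cdot(a_1,\dots,a_m)=(\sum_j g_{1j}a_j,\dots,\sum_j g_{mj}a_j)$ for $g=(g_{ij})$,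 and acts on $\mathrm{UD}(m,n)$ by $(gf)(x)=f(g^{-1}x)$; explicitly $g\cdot X^{(h)}=\sum_{j=1}^m g'_{hj}X^{(j)}$, where $g^{-1}=(g'_{ij})$. For an algebraic group $G$, a $G$-variety is a variety over $k$ with a regular $G$-action; $G$ acts on the function field $k(X_0)$ of an irreducible $G$-variety $X_0$ by $(gf)(x)=f(g^{-1}x)$. If $G$ acts on a central simple algebra $A$ of degree $n$, then $A$ is $G$-split if it is $G$-equivariantly isomorphic to $M_n(k)\otimes_k \mathrm{Z}(A)$, where $G$ acts via the second factor (trivially on $M_n(k)$). A field extension $L/\mathrm{Z}(A)$ with a $G$-action on $L$ extending that on $\mathrm{Z}(A)$ is a $G$-splitting field for $A$ if $A\otimes_{\mathrm{Z}(A)} L$ is $G$-split. *)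

theory Defs
  imports
    Jordan_Normal_Form.Matrix
    "HOL-Algebra.QuotRing"
    "HOL-Algebra.Group_Action"
    "HOL-Library.Poly_Mapping"
    "HOL-Library.Product_Lexorder"
    "HOL-Library.Extended_Nat"
    "HOL-Computational_Algebra.Polynomial"
    "HOL-Computational_Algebra.Fraction_Field"
    "HOL-Analysis.Abstract_Topology"
begin

section \<open>Algebras with a group action\<close>

text \<open>
  An algebra over the field \<open>'k\<close> (given by its structure map \<open>sclr\<close>) on which a group
  with elements of type \<open>'g\<close> acts.
\<close>

record ('a, 'k, 'g) galg = "'a ring" +
  sclr :: "'k \<Rightarrow> 'a"
  act :: "'g \<Rightarrow> 'a \<Rightarrow> 'a"

definition galg_hom ::
  "('g, 'z) monoid_scheme \<Rightarrow> ('a, 'k, 'g) galg \<Rightarrow> ('b, 'k, 'g) galg \<Rightarrow> ('a \<Rightarrow> 'b) set" where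
  "galg_hom G A B = {\<phi> \<in> ring_hom A B.
     (\<forall>c. \<phi> (sclr A c) = sclr B c) \<and>
     (\<forall>g\<in>carrier G. \<forall>a\<in>carrier A. \<phi> (act A g a) = act B g (\<phi> a))}"

definition galg_iso ::
  "('g, 'z) monoid_scheme \<Rightarrow> ('a, 'k, 'g) galg \<Rightarrow> ('b, 'k, 'g) galg \<Rightarrow> ('a \<Rightarrow> 'b) set" where
  "galg_iso G A B = {\<phi> \<in> galg_hom G A B. bij_betw \<phi> (carrier A) (carrier B)}"

definition galg_center :: "('a, 'k, 'g) galg \<Rightarrow> ('a, 'k, 'g) galg" where
  "galg_center A =
     A\<lparr>carrier := {z \<in> carrier A. \<forall>a\<in>carrier A. z \<otimes>\<^bsub>A\<^esub> a = a \<otimes>\<^bsub>A\<^esub> z}\<rparr>"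

definition galg_fixed :: "('g, 'z) monoid_scheme \<Rightarrow> ('a, 'k, 'g) galg \<Rightarrow> 'a set" where
  "galg_fixed G A = {a \<in> carrier A. \<forall>g\<in>carrier G. act A g a = a}"

text \<open>\<open>M\<^sub>n(k)\<close> with trivial action.\<close>

definition mat_galg :: "nat \<Rightarrow> ('k::field mat, 'k, 'g) galg" where
  "mat_galg n = \<lparr>carrier = carrier_mat n n, mult = (*), one = 1\<^sub>m n,
     zero = 0\<^sub>m n n, add = (+), sclr = (\<lambda>c. c \<cdot>\<^sub>m 1\<^sub>m n), act = (\<lambda>_ a. a)\<rparr>"


subsection \<open>Tensor products\<close>

text \<open>
  The free abelian group on the set \<open>A \<times> B\<close> with the bilinear multiplication
  \<open>(a,b)(a',b') = (aa',bb')\<close>.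
\<close>

definition tensor_free :: "('a, 'm) ring_scheme \<Rightarrow> ('b, 'n) ring_scheme \<Rightarrow> ('a \<times> 'b \<Rightarrow>\<^sub>0 int) ring" where
  "tensor_free A B =
     \<lparr>carrier = {p. Poly_Mapping.keys p \<subseteq> carrier A \<times> carrier B},
      mult = (\<lambda>p q. frag_extend (\<lambda>(a, b).
                frag_extend (\<lambda>(a', b'). frag_of (a \<otimes>\<^bsub>A\<^esub> a', b \<otimes>\<^bsub>B\<^esub> b')) q) p),
      one = frag_of (\<one>\<^bsub>A\<^esub>, \<one>\<^bsub>B\<^esub>), zero = 0, add = (+)\<rparr>"

text \<open>Bilinearity, balanced over the index set \<open>F\<close> of scalars \<open>r\<close> acting through \<open>\<phi> r\<close> and \<open>\<psi> r\<close>.\<close>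

definition tensor_rels ::
  "'f set \<Rightarrow> ('f \<Rightarrow> 'a) \<Rightarrow> ('f \<Rightarrow> 'b) \<Rightarrow> ('a, 'm) ring_scheme \<Rightarrow> ('b, 'n) ring_scheme \<Rightarrow>
     ('a \<times> 'b \<Rightarrow>\<^sub>0 int) set" where
  "tensor_rels F \<phi> \<psi> A B =
     {frag_of (a \<oplus>\<^bsub>A\<^esub> a', b) - frag_of (a, b) - frag_of (a', b) | a a' b.
        a \<in> carrier A \<and> a' \<in> carrier A \<and> b \<in> carrier B} \<union>
     {frag_of (a, b \<oplus>\<^bsub>B\<^esub> b') - frag_of (a, b) - frag_of (a, b') | a b b'.
        a \<in> carrier A \<and> b \<in> carrier B \<and> b' \<in> carrier B} \<union>
     {frag_of (a \<otimes>\<^bsub>A\<^esub> \<phi> r, b) - frag_of (a, \<psi> r \<otimes>\<^bsub>B\<^esub> b) | a r b.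
        a \<in> carrier A \<and> r \<in> F \<and> b \<in> carrier B}"

definition tensor_ideal ::
  "'f set \<Rightarrow> ('f \<Rightarrow> 'a) \<Rightarrow> ('f \<Rightarrow> 'b) \<Rightarrow> ('a, 'm) ring_scheme \<Rightarrow> ('b, 'n) ring_scheme \<Rightarrow>
     ('a \<times> 'b \<Rightarrow>\<^sub>0 int) set" where
  "tensor_ideal F \<phi> \<psi> A B = Idl\<^bsub>tensor_free A B\<^esub> (tensor_rels F \<phi> \<psi> A B)"

text \<open>
  \<open>A \<otimes>\<^sub>F B\<close> for a commutative ring \<open>F\<close> mapping to the centers of \<open>A\<close> and \<open>B\<close> via \<open>\<phi>\<close> and \<open>\<psi>\<close>.
  As \<open>\<phi> r\<close> and \<open>\<psi> r\<close> are central, the ideal generated by the relations is already the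
  subgroup generated by them. The group acts diagonally, \<open>g(a \<otimes> b) = ga \<otimes> gb\<close>; on a coset this
  is the image of the coset.
\<close>

definition galg_tensor ::
  "'f set \<Rightarrow> ('f \<Rightarrow> 'a) \<Rightarrow> ('f \<Rightarrow> 'b) \<Rightarrow> ('a, 'k, 'g) galg \<Rightarrow> ('b, 'k, 'g) galg \<Rightarrow>
     (('a \<times> 'b \<Rightarrow>\<^sub>0 int) set, 'k, 'g) galg" where
  "galg_tensor F \<phi> \<psi> A B =
     (let I = tensor_ideal F \<phi> \<psi> A B; T = tensor_free A B Quot I in
      \<lparr>carrier = carrier T, mult = mult T, one = one T, zero = zero T, add = add T,
       sclr = (\<lambda>c. I +>\<^bsub>tensor_free A B\<^esub> frag_of (sclr A c, \<one>\<^bsub>B\<^esub>)),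
       act = (\<lambda>g C. frag_extend (\<lambda>(a, b). frag_of (act A g a, act B g b)) ` C)\<rparr>)"


subsection \<open>Splitting fields\<close>

text \<open>A central simple algebra \<open>B\<close> of degree \<open>n\<close> is \<open>G\<close>-split: \<open>B \<cong> M\<^sub>n(k) \<otimes>\<^sub>k Z(B)\<close>.\<close>

definition galg_split ::
  "('g, 'z) monoid_scheme \<Rightarrow> nat \<Rightarrow> ('b, 'k::field, 'g) galg \<Rightarrow> bool" where
  "galg_split G n B \<longleftrightarrow>
     galg_iso G B
       (galg_tensor UNIV (sclr (mat_galg n :: ('k mat, 'k, 'g) galg)) (sclr (galg_center B))
          (mat_galg n) (galg_center B)) \<noteq> {}"

text \<open>
  \<open>L\<close> is a \<open>G\<close>-splitting field of the central simple algebra \<open>A\<close> of degree \<open>n\<close>, where the field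
  extension \<open>L/Z(A)\<close> is given by the embedding \<open>\<iota>\<close>.
\<close>

definition G_splitting_field ::
  "('g, 'z) monoid_scheme \<Rightarrow> nat \<Rightarrow> ('a, 'k::field, 'g) galg \<Rightarrow> ('l, 'k, 'g) galg \<Rightarrow>
     ('a \<Rightarrow> 'l) \<Rightarrow> bool" where
  "G_splitting_field G n A L \<iota> \<longleftrightarrow>
     field L \<and> \<iota> \<in> galg_hom G (galg_center A) L \<and>
     galg_split G n (galg_tensor (carrier (galg_center A)) (\<lambda>z. z) \<iota> A L)"


section \<open>Transcendence degree\<close>

text \<open>
  The monomials in the elements of \<open>S\<close>, indexed by exponent functions \<open>u\<close>, are linearly
  independent over \<open>F\<close>.
\<close>

definition alg_independent :: "('a, 'm) ring_scheme \<Rightarrow> 'a set \<Rightarrow> 'a set \<Rightarrow> bool" where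
  "alg_independent L F S \<longleftrightarrow> S \<subseteq> carrier L \<and>
     (\<forall>(M :: ('a \<Rightarrow>\<^sub>0 nat) set) c. finite M \<longrightarrow>
        (\<forall>u\<in>M. Poly_Mapping.keys u \<subseteq> S \<and> c u \<in> F) \<longrightarrow>
        (\<Oplus>\<^bsub>L\<^esub>u\<in>M. c u \<otimes>\<^bsub>L\<^esub>
           (\<Otimes>\<^bsub>L\<^esub>s\<in>Poly_Mapping.keys u. s [^]\<^bsub>L\<^esub> Poly_Mapping.lookup u s)) = \<zero>\<^bsub>L\<^esub> \<longrightarrow>
        (\<forall>u\<in>M. c u = \<zero>\<^bsub>L\<^esub>))"

definition trdeg :: "('a, 'm) ring_scheme \<Rightarrow> 'a set \<Rightarrow> enat" where
  "trdeg L F = (SUP S\<in>{S. finite S \<and> alg_independent L F S}. enat (card S))"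


section \<open>Varieties\<close>

text \<open>
  A space with functions: a topological space with, for each open \<open>U\<close>, a set of regular functions
  on \<open>U\<close>. The values of a regular function outside \<open>U\<close> are irrelevant.
\<close>

record ('x, 'k) fspace =
  tp :: "'x topology"
  reg :: "'x set \<Rightarrow> ('x \<Rightarrow> 'k) set"

definition space_with_functions :: "('x, 'k::field) fspace \<Rightarrow> bool" where
  "space_with_functions X \<longleftrightarrow>
     (\<forall>U f g. openin (tp X) U \<longrightarrow> f \<in> reg X U \<longrightarrow> (\<forall>x\<in>U. f x = g x) \<longrightarrow> g \<in> reg X U) \<and>
     (\<forall>\<U> f. (\<forall>U\<in>\<U>. openin (tp X) U) \<longrightarrow> (f \<in> reg X (\<Union>\<U>) \<longleftrightarrow> (\<forall>U\<in>\<U>. f \<in> reg X U))) \<and>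
     (\<forall>U c. openin (tp X) U \<longrightarrow> (\<lambda>_. c) \<in> reg X U) \<and>
     (\<forall>U f g. openin (tp X) U \<longrightarrow> f \<in> reg X U \<longrightarrow> g \<in> reg X U \<longrightarrow>
        (\<lambda>x. f x + g x) \<in> reg X U \<and> (\<lambda>x. f x * g x) \<in> reg X U) \<and>
     (\<forall>U f. openin (tp X) U \<longrightarrow> f \<in> reg X U \<longrightarrow>
        openin (tp X) {x \<in> U. f x \<noteq> 0} \<and> (\<lambda>x. inverse (f x)) \<in> reg X {x \<in> U. f x \<noteq> 0})"

definition morphism :: "('x, 'k) fspace \<Rightarrow> ('y, 'k) fspace \<Rightarrow> ('x \<Rightarrow> 'y) \<Rightarrow> bool" where
  "morphism X Y \<phi> \<longleftrightarrow> continuous_map (tp X) (tp Y) \<phi> \<and>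
     (\<forall>V f. openin (tp Y) V \<longrightarrow> f \<in> reg Y V \<longrightarrow>
        (\<lambda>x. f (\<phi> x)) \<in> reg X {x \<in> topspace (tp X). \<phi> x \<in> V})"

definition isomorphic_fspaces :: "('x, 'k) fspace \<Rightarrow> ('y, 'k) fspace \<Rightarrow> bool" where
  "isomorphic_fspaces X Y \<longleftrightarrow> (\<exists>\<phi> \<psi>. morphism X Y \<phi> \<and> morphism Y X \<psi> \<and>
     (\<forall>x\<in>topspace (tp X). \<psi> (\<phi> x) = x) \<and> (\<forall>y\<in>topspace (tp Y). \<phi> (\<psi> y) = y))"

definition open_subspace :: "('x, 'k) fspace \<Rightarrow> 'x set \<Rightarrow> ('x, 'k) fspace" where
  "open_subspace X U = \<lparr>tp = subtopology (tp X) U, reg = reg X\<rparr>"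

text \<open>The functions that are polynomial in the coordinate functions \<open>C\<close>.\<close>

inductive_set poly_functions :: "('x \<Rightarrow> 'k::field) set \<Rightarrow> ('x \<Rightarrow> 'k) set" for C where
  const: "(\<lambda>_. c) \<in> poly_functions C"
| coord: "f \<in> C \<Longrightarrow> f \<in> poly_functions C"
| add: "f \<in> poly_functions C \<Longrightarrow> g \<in> poly_functions C \<Longrightarrow> (\<lambda>x. f x + g x) \<in> poly_functions C"
| mult: "f \<in> poly_functions C \<Longrightarrow> g \<in> poly_functions C \<Longrightarrow> (\<lambda>x. f x * g x) \<in> poly_functions C"

text \<open>
  A locally closed subset \<open>V\<close> of an affine space with coordinate functions \<open>C\<close>, with the Zariski
  topology and the functions that are locally quotients of polynomials.
\<close>

definition zariski_fspace :: "('x \<Rightarrow> 'k::field) set \<Rightarrow> 'x set \<Rightarrow> ('x, 'k) fspace" where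
  "zariski_fspace C V =
     (let T = topology_generated_by {{x \<in> V. p x \<noteq> 0} | p. p \<in> poly_functions C} in
      \<lparr>tp = T,
       reg = (\<lambda>U. {f. \<forall>x\<in>U. \<exists>W p q. openin T W \<and> x \<in> W \<and> W \<subseteq> U \<and>
                p \<in> poly_functions C \<and> q \<in> poly_functions C \<and>
                (\<forall>y\<in>W. q y \<noteq> 0 \<and> f y = p y / q y)})\<rparr>)"

definition vec_coords :: "nat \<Rightarrow> ('k::field vec \<Rightarrow> 'k) set" where
  "vec_coords N = {\<lambda>v. v $ i | i. i < N}"

definition mat_coords :: "nat \<Rightarrow> ('k::field mat \<Rightarrow> 'k) set" where
  "mat_coords m = {\<lambda>a. a $$ (i, j) | i j. i < m \<and> j < m}"

definition affine_variety :: "('x, 'k::field) fspace \<Rightarrow> bool" where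
  "affine_variety X \<longleftrightarrow> (\<exists>N P. P \<subseteq> poly_functions (vec_coords N) \<and>
     isomorphic_fspaces X
       (zariski_fspace (vec_coords N) {v \<in> carrier_vec N. \<forall>p\<in>P. p v = 0}))"

text \<open>
  The product in the category of spaces with functions. The sums \<open>\<Sum>\<^sub>i f\<^sub>i(x) g\<^sub>i(y)\<close> with
  \<open>f\<^sub>i\<close>, \<open>g\<^sub>i\<close> regular have to be regular on \<open>U \<times> V\<close>; their nonvanishing sets are a basis of the
  topology, and every regular function is locally a quotient of two of them.
\<close>

definition product_sums ::
  "('x, 'k::field) fspace \<Rightarrow> ('y, 'k) fspace \<Rightarrow> 'x set \<Rightarrow> 'y set \<Rightarrow> ('x \<times> 'y \<Rightarrow> 'k) set" where
  "product_sums X Y U V = {\<lambda>(x, y). \<Sum>i<r. f i x * g i y | f g (r::nat).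
     \<forall>i<r. f i \<in> reg X U \<and> g i \<in> reg Y V}"

definition product_fspace ::
  "('x, 'k::field) fspace \<Rightarrow> ('y, 'k) fspace \<Rightarrow> ('x \<times> 'y, 'k) fspace" where
  "product_fspace X Y =
     (let T = topology_generated_by {{z \<in> U \<times> V. a z \<noteq> 0} | U V a.
                openin (tp X) U \<and> openin (tp Y) V \<and> a \<in> product_sums X Y U V} in
      \<lparr>tp = T,
       reg = (\<lambda>S. {f. \<forall>z\<in>S. \<exists>W U V a b. openin T W \<and> z \<in> W \<and> W \<subseteq> S \<inter> (U \<times> V) \<and>
                openin (tp X) U \<and> openin (tp Y) V \<and>
                a \<in> product_sums X Y U V \<and> b \<in> product_sums X Y U V \<and>
                (\<forall>w\<in>W. b w \<noteq> 0 \<and> f w = a w / b w)})\<rparr>)"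

definition variety :: "('x, 'k::field) fspace \<Rightarrow> bool" where
  "variety X \<longleftrightarrow> space_with_functions X \<and>
     (\<exists>\<U>. finite \<U> \<and> (\<forall>U\<in>\<U>. openin (tp X) U \<and> affine_variety (open_subspace X U)) \<and>
        \<Union>\<U> = topspace (tp X)) \<and>
     closedin (tp (product_fspace X X)) {(x, x) | x. x \<in> topspace (tp X)}"

definition irreducible_fspace :: "('x, 'k) fspace \<Rightarrow> bool" where
  "irreducible_fspace X \<longleftrightarrow> topspace (tp X) \<noteq> {} \<and>
     (\<forall>U V. openin (tp X) U \<longrightarrow> openin (tp X) V \<longrightarrow> U \<noteq> {} \<longrightarrow> V \<noteq> {} \<longrightarrow> U \<inter> V \<noteq> {})"


section \<open>\<open>GL\<^sub>m\<close>-varieties and their function fields\<close>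

definition GL :: "nat \<Rightarrow> 'k::field mat monoid" where
  "GL m = units_of (ring_mat TYPE('k) m ())"

definition GL_fspace :: "nat \<Rightarrow> ('k::field mat, 'k) fspace" where
  "GL_fspace m = zariski_fspace (mat_coords m) (carrier (GL m))"

definition GL_variety ::
  "nat \<Rightarrow> ('x, 'k::field) fspace \<Rightarrow> ('k mat \<Rightarrow> 'x \<Rightarrow> 'x) \<Rightarrow> bool" where
  "GL_variety m X \<alpha> \<longleftrightarrow> variety X \<and> group_action (GL m) (topspace (tp X)) \<alpha> \<and>
     morphism (product_fspace (GL_fspace m) X) X (\<lambda>(g, x). \<alpha> g x)"

definition rational_rep :: "('x, 'k) fspace \<Rightarrow> ('x set \<times> ('x \<Rightarrow> 'k)) set" where
  "rational_rep X = {(U, f). openin (tp X) U \<and> U \<noteq> {} \<and> f \<in> reg X U}"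

definition rational_eq ::
  "('x, 'k) fspace \<Rightarrow> (('x set \<times> ('x \<Rightarrow> 'k)) \<times> ('x set \<times> ('x \<Rightarrow> 'k))) set" where
  "rational_eq X = {((U, f), (V, g)). (U, f) \<in> rational_rep X \<and> (V, g) \<in> rational_rep X \<and>
     (\<forall>x\<in>U \<inter> V. f x = g x)}"

definition rational_class ::
  "('x, 'k) fspace \<Rightarrow> 'x set \<Rightarrow> ('x \<Rightarrow> 'k) \<Rightarrow> ('x set \<times> ('x \<Rightarrow> 'k)) set" where
  "rational_class X U f = rational_eq X `` {(U, f)}"

text \<open>
  \<open>k(X)\<close> for an irreducible \<open>X\<close>, with the action \<open>(gf)(x) = f(g\<inverse>x)\<close>. The operations are
  given on representatives; the unions are over equal classes.
\<close>

definition function_field ::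
  "nat \<Rightarrow> ('x, 'k::field) fspace \<Rightarrow> ('k mat \<Rightarrow> 'x \<Rightarrow> 'x) \<Rightarrow>
     (('x set \<times> ('x \<Rightarrow> 'k)) set, 'k, 'k mat) galg" where
  "function_field m X \<alpha> =
     \<lparr>carrier = rational_rep X // rational_eq X,
      mult = (\<lambda>C D. \<Union>(U, f)\<in>C. \<Union>(V, g)\<in>D. rational_class X (U \<inter> V) (\<lambda>x. f x * g x)),
      one = rational_class X (topspace (tp X)) (\<lambda>_. 1),
      zero = rational_class X (topspace (tp X)) (\<lambda>_. 0),
      add = (\<lambda>C D. \<Union>(U, f)\<in>C. \<Union>(V, g)\<in>D. rational_class X (U \<inter> V) (\<lambda>x. f x + g x)),
      sclr = (\<lambda>c. rational_class X (topspace (tp X)) (\<lambda>_. c)),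
      act = (\<lambda>g C. \<Union>(U, f)\<in>C. rational_class X (\<alpha> g ` U) (\<lambda>x. f (\<alpha> (inv\<^bsub>GL m\<^esub> g) x)))\<rparr>"


section \<open>The universal division algebra\<close>

text \<open>
  The variable \<open>x\<^sub>i\<^sub>j\<^sup>(\<^sup>h\<^sup>)\<close> is the triple \<open>(h, i, j)\<close>, with all indices starting from \<open>0\<close>.
  The type \<open>'k gfrac\<close> contains variables for all triples; only those with \<open>h < m\<close> and
  \<open>i, j < n\<close> occur in \<open>UD(m,n)\<close>.
\<close>

type_synonym var = "nat \<times> nat \<times> nat"
type_synonym 'k gpoly = "(var \<Rightarrow>\<^sub>0 nat) \<Rightarrow>\<^sub>0 'k"
type_synonym 'k gfrac = "'k gpoly fract"

definition gconst :: "'k::field \<Rightarrow> 'k gfrac" where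
  "gconst c = Fract (Poly_Mapping.single 0 c) 1"

definition gvar :: "var \<Rightarrow> 'k::field gfrac" where
  "gvar v = Fract (Poly_Mapping.single (Poly_Mapping.single v 1) 1) 1"

definition generic_mat :: "nat \<Rightarrow> nat \<Rightarrow> 'k::field gfrac mat" where
  "generic_mat n h = mat n n (\<lambda>(i, j). gvar (h, i, j))"

text \<open>
  The \<open>k\<close>-subalgebra generated by the generic matrices and closed under inversion. Every nonzero
  element of it is invertible, so this is the division subalgebra generated by them.
\<close>

inductive_set UD_carrier :: "nat \<Rightarrow> nat \<Rightarrow> 'k::field gfrac mat set" for m n where
  scalar: "gconst c \<cdot>\<^sub>m 1\<^sub>m n \<in> UD_carrier m n"
| generic: "h < m \<Longrightarrow> generic_mat n h \<in> UD_carrier m n"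
| add: "a \<in> UD_carrier m n \<Longrightarrow> b \<in> UD_carrier m n \<Longrightarrow> a + b \<in> UD_carrier m n"
| mult: "a \<in> UD_carrier m n \<Longrightarrow> b \<in> UD_carrier m n \<Longrightarrow> a * b \<in> UD_carrier m n"
| inverse: "a \<in> UD_carrier m n \<Longrightarrow> b \<in> carrier_mat n n \<Longrightarrow> a * b = 1\<^sub>m n \<Longrightarrow> b * a = 1\<^sub>m n \<Longrightarrow>
    b \<in> UD_carrier m n"

definition poly_subst :: "(var \<Rightarrow> 'k gfrac) \<Rightarrow> 'k::field gpoly \<Rightarrow> 'k gfrac" where
  "poly_subst \<sigma> p = (\<Sum>u\<in>Poly_Mapping.keys p. gconst (Poly_Mapping.lookup p u) *
     (\<Prod>v\<in>Poly_Mapping.keys u. \<sigma> v ^ Poly_Mapping.lookup u v))"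

text \<open>Well defined if \<open>poly_subst \<sigma>\<close> is injective.\<close>

definition rat_subst :: "(var \<Rightarrow> 'k gfrac) \<Rightarrow> 'k::field gfrac \<Rightarrow> 'k gfrac" where
  "rat_subst \<sigma> q =
     (THE r. \<exists>a b. b \<noteq> 0 \<and> q = Fract a b \<and> r = poly_subst \<sigma> a / poly_subst \<sigma> b)"

text \<open>
  \<open>(gf)(x) = f(g\<inverse>x)\<close>, i.e. \<open>x\<^sub>i\<^sub>j\<^sup>(\<^sup>h\<^sup>)\<close> is replaced by the \<open>(i,j)\<close> entry of
  \<open>\<Sum>\<^sub>l (g\<inverse>)\<^sub>h\<^sub>l X\<^sup>(\<^sup>l\<^sup>)\<close>.
\<close>

definition GL_subst :: "nat \<Rightarrow> 'k::field mat \<Rightarrow> var \<Rightarrow> 'k gfrac" where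
  "GL_subst m g = (\<lambda>(h, i, j).
     if h < m then \<Sum>l<m. gconst ((inv\<^bsub>GL m\<^esub> g) $$ (h, l)) * gvar (l, i, j)
     else gvar (h, i, j))"

definition UD :: "nat \<Rightarrow> nat \<Rightarrow> ('k::field gfrac mat, 'k, 'k mat) galg" where
  "UD m n =
     \<lparr>carrier = UD_carrier m n, mult = (*), one = 1\<^sub>m n, zero = 0\<^sub>m n n, add = (+),
      sclr = (\<lambda>c. gconst c \<cdot>\<^sub>m 1\<^sub>m n),
      act = (\<lambda>g. map_mat (rat_subst (GL_subst m g)))\<rparr>"

end

theory Submission
  imports Defs "HOL-Algebra.Embedded_Algebras" "HOL-Algebra.Free_Abelian_Groups" Jordan_Normal_Form.Char_Poly
begin

text \<open>
  Write \<open>G\<close> for \<open>GL\<^sub>m\<close> and \<open>A\<close> for \<open>UD(m,n)\<close>. Everything rests on one observation: since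
  \<open>m \<ge> n\<^sup>2\<close>, the first \<open>n\<^sup>2\<close> generic matrices form a basis of the \<open>n \<times> n\<close> matrices, so the
  \<open>G\<close>-orbit of a point of \<open>(M\<^sub>n(k))\<^sup>m\<close> whose first \<open>n\<^sup>2\<close> matrices are a basis is dense: every
  point has the form \<open>g x\<close> with a square matrix \<open>g\<close> that may be singular (\<open>GL_orbit\<close>), and
  invertible matrices are dense along lines \<open>g + t 1\<close> (\<open>GL_point_dense\<close>).

  For (a), the entries of a \<open>G\<close>-fixed element are \<open>G\<close>-fixed rational functions, hence constant on
  a dense orbit, hence constant (\<open>fixed_fraction_constant\<close>). All elements of \<open>A\<close> are
  \<open>PGL\<^sub>n\<close>-equivariant (\<open>UD_conj_equivariant\<close>); a constant equivariant map is a matrix that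
  commutes with all invertible matrices, so it is scalar (\<open>UD_fixed\<close>).

  For (b), let \<open>L = k(X)\<close> be a splitting field with the embedding \<open>\<iota>\<close> of \<open>Z(A)\<close>. The splitting
  provides \<open>G\<close>-fixed matrix units in \<open>A \<otimes> L\<close> (\<open>matrix_units_of_split\<close>). As the center of
  \<open>A \<otimes> L\<close> is \<open>L\<close> (\<open>commutant_of_tens_left\<close>), the coordinates with respect to them are elements
  of \<open>L\<close>, and \<open>a \<mapsto> a \<otimes> 1\<close> becomes a \<open>G\<close>-equivariant ring homomorphism \<open>\<Lambda>\<close> from \<open>A\<close> to
  \<open>M\<^sub>n(L)\<close> that extends \<open>\<iota>\<close>. The entries \<open>y\<close> of the images of the generic matrices are rational
  functions on \<open>X\<close>; together they are a \<open>G\<close>-equivariant rational map from \<open>X\<close> to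
  \<open>(M\<^sub>n(k))\<^sup>m\<close>. The first \<open>n\<^sup>2\<close> generic matrices are independent over \<open>Z(A)\<close>, so their images are
  a basis over \<open>L\<close> (\<open>independent_imp_spanning\<close>), and the first \<open>n\<^sup>2\<close> matrices of a general
  value of this map form a basis. The closure of the image is \<open>G\<close>-stable, so it contains
  a dense orbit, and no nonzero polynomial vanishes on the image (\<open>\<theta>_injective\<close>): the variables
  \<open>x\<^sub>i\<^sub>j\<^sup>(\<^sup>h\<^sup>)\<close> can be replaced by the elements \<open>y\<close>, which embeds the field of rational
  functions in the matrix entries into \<open>L\<close>, compatibly with \<open>\<iota>\<close> (\<open>corr_entries\<close>).

  It remains to bound below the transcendence degree of that field over \<open>Z(A)\<close>, whose elements are
  \<open>PGL\<^sub>n\<close>-invariant. The \<open>n\<^sup>2 - 1\<close> entries in the first columns of \<open>X\<^sup>(\<^sup>1\<^sup>)\<close>, ..., \<open>X\<^sup>(\<^sup>n\<^sup>)\<close>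
  other than the first entry of the first of them are independent over the invariants
  (\<open>column_vars_independent\<close>): conjugation can give them arbitrary values, at the special
  point where each \<open>X\<^sup>(\<^sup>h\<^sup>)\<close> is a matrix unit in the first column, without any effect on the
  coefficients of a relation.
\<close>

section \<open>Tensor products of rings\<close>

lemma ring_if_same_operations:
  assumes "ring R" "carrier S = carrier R" "mult S = mult R" "one S = one R"
    "\<zero>\<^bsub>S\<^esub> = \<zero>\<^bsub>R\<^esub>" "add S = add R"
  shows "ring S"
proof -
  interpret R: ring R by fact
  show ?thesis
    by (intro ringI abelian_groupI monoidI)
      (auto simp: assms R.m_assoc R.a_assoc R.l_distr R.r_distr R.add.m_ac intro: R.l_neg[OF _] R.a_inv_closed
        intro!: bexI[of _ "\<ominus>\<^bsub>R\<^esub> _"])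
qed

lemma frag_extend_diff_fun:
  fixes f g :: "'i \<Rightarrow> 'z \<Rightarrow>\<^sub>0 int"
  shows "frag_extend (\<lambda>i. f i - g i) p = frag_extend f p - frag_extend g p"
proof -
  have "frag_cmul c (a - b) = frag_cmul c a - frag_cmul c b" for c :: int and a b :: "'z \<Rightarrow>\<^sub>0 int"
    by (rule poly_mapping_eqI) (simp add: lookup_minus right_diff_distrib)
  then show ?thesis
    by (simp add: frag_extend_def sum_subtractf)
qed

locale ring_pair = A: ring A + B: ring B
  for A :: "('a, 'm) ring_scheme" and B :: "('b, 'n) ring_scheme"
begin

abbreviation T where "T \<equiv> tensor_free A B"

lemma free_simps [simp]:
  "carrier T = {p. Poly_Mapping.keys p \<subseteq> carrier A \<times> carrier B}"
  "add T = (+)" "\<zero>\<^bsub>T\<^esub> = 0" "one T = frag_of (\<one>\<^bsub>A\<^esub>, \<one>\<^bsub>B\<^esub>)"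
  by (auto simp: tensor_free_def)

lemma free_mult_of [simp]:
  "frag_of (a, b) \<otimes>\<^bsub>T\<^esub> frag_of (a', b') = frag_of (a \<otimes>\<^bsub>A\<^esub> a', b \<otimes>\<^bsub>B\<^esub> b')"
  by (simp add: tensor_free_def)

lemma free_mult_diff:
  "(p - q) \<otimes>\<^bsub>T\<^esub> r = p \<otimes>\<^bsub>T\<^esub> r - q \<otimes>\<^bsub>T\<^esub> r"
  "r \<otimes>\<^bsub>T\<^esub> (p - q) = r \<otimes>\<^bsub>T\<^esub> p - r \<otimes>\<^bsub>T\<^esub> q"
  by (simp_all add: tensor_free_def frag_extend_diff case_prod_unfold frag_extend_diff_fun)

lemma free_mult_zero [simp]: "0 \<otimes>\<^bsub>T\<^esub> r = 0" "r \<otimes>\<^bsub>T\<^esub> 0 = 0"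
  using free_mult_diff(1)[of 0 0 r] free_mult_diff(2)[of r 0 0] by simp_all

lemma free_mult_add:
  "(p + q) \<otimes>\<^bsub>T\<^esub> r = p \<otimes>\<^bsub>T\<^esub> r + q \<otimes>\<^bsub>T\<^esub> r"
  "r \<otimes>\<^bsub>T\<^esub> (p + q) = r \<otimes>\<^bsub>T\<^esub> p + r \<otimes>\<^bsub>T\<^esub> q"
  using free_mult_diff(1)[of p "- q" r] free_mult_diff(1)[of 0 q r]
    free_mult_diff(2)[of r p "- q"] free_mult_diff(2)[of r 0 q] by simp_all

text \<open>Under differences, the pairs generate the free group.\<close>

lemma free_induct [consumes 1, case_names zero one diff]:
  assumes "p \<in> carrier T" "P 0"
    "\<And>a b. a \<in> carrier A \<Longrightarrow> b \<in> carrier B \<Longrightarrow> P (frag_of (a, b))"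
    "\<And>p q. p \<in> carrier T \<Longrightarrow> q \<in> carrier T \<Longrightarrow> P p \<Longrightarrow> P q \<Longrightarrow> P (p - q)"
  shows "P p"
proof -
  have "Poly_Mapping.keys p \<subseteq> carrier A \<times> carrier B" using assms(1) by simp
  then have "p \<in> carrier T \<and> P p"
  proof (induction rule: frag_induction)
    case (diff a b)
    then show ?case using assms(4)[of a b] keys_diff[of a b] by auto
  qed (use assms in \<open>auto simp: keys_frag_of\<close>)
  then show ?thesis by simp
qed

lemma free_of_closed: "a \<in> carrier A \<Longrightarrow> b \<in> carrier B \<Longrightarrow> frag_of (a, b) \<in> carrier T"
  by (simp add: keys_frag_of)

lemma free_add_closed: "p \<in> carrier T \<Longrightarrow> q \<in> carrier T \<Longrightarrow> p + q \<in> carrier T"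
  using keys_add[of p q] by auto

lemma free_diff_closed: "p \<in> carrier T \<Longrightarrow> q \<in> carrier T \<Longrightarrow> p - q \<in> carrier T"
  using keys_diff[of p q] by auto

lemma free_neg_closed: "p \<in> carrier T \<Longrightarrow> - p \<in> carrier T"
  using free_diff_closed[of 0 p] by simp

lemma free_mult_closed: "p \<in> carrier T \<Longrightarrow> q \<in> carrier T \<Longrightarrow> p \<otimes>\<^bsub>T\<^esub> q \<in> carrier T"
proof (induction p rule: free_induct)
  case (one a b)
  from one(3) show ?case
  proof (induction q rule: free_induct)
    case (one a' b')
    then show ?case unfolding free_mult_of using \<open>a \<in> carrier A\<close> \<open>b \<in> carrier B\<close>
      by (intro free_of_closed) auto
  next
    case (diff p q)
    then show ?case unfolding free_mult_diff by (intro free_diff_closed)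
  qed auto
next
  case (diff p r)
  then show ?case unfolding free_mult_diff by (intro free_diff_closed)
qed auto

lemma free_mult_assoc:
  assumes "p \<in> carrier T" "q \<in> carrier T" "r \<in> carrier T"
  shows "p \<otimes>\<^bsub>T\<^esub> q \<otimes>\<^bsub>T\<^esub> r = p \<otimes>\<^bsub>T\<^esub> (q \<otimes>\<^bsub>T\<^esub> r)"
  using assms(1)
proof (induction p rule: free_induct)
  case (one a b)
  from assms(2) show ?case
  proof (induction q rule: free_induct)
    case (one a' b')
    from assms(3) show ?case
    proof (induction r rule: free_induct)
      case (one a'' b'')
      then show ?case using \<open>a \<in> carrier A\<close> \<open>b \<in> carrier B\<close> \<open>a' \<in> carrier A\<close> \<open>b' \<in> carrier B\<close>
        by (simp add: A.m_assoc B.m_assoc)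
    qed (auto simp: free_mult_diff)
  qed (auto simp: free_mult_diff)
qed (auto simp: free_mult_diff)

lemma free_mult_one:
  assumes "p \<in> carrier T"
  shows "\<one>\<^bsub>T\<^esub> \<otimes>\<^bsub>T\<^esub> p = p" "p \<otimes>\<^bsub>T\<^esub> \<one>\<^bsub>T\<^esub> = p"
  using assms by (induction p rule: free_induct) (auto simp: free_mult_diff)

lemma free_ring: "ring T"
proof (intro ringI abelian_groupI monoidI)
  show "\<exists>y\<in>carrier T. y \<oplus>\<^bsub>T\<^esub> x = \<zero>\<^bsub>T\<^esub>" if "x \<in> carrier T" for x
    using that by (intro bexI[of _ "- x"]) (simp_all only: free_neg_closed, simp_all)
qed (use free_mult_one free_mult_assoc free_mult_closed free_of_closed[of "\<one>\<^bsub>A\<^esub>" "\<one>\<^bsub>B\<^esub>"] free_add_closed in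
    \<open>simp_all add: free_mult_add ac_simps\<close>)

sublocale T: ring T by (rule free_ring)

lemma free_uminus: "p \<in> carrier T \<Longrightarrow> \<ominus>\<^bsub>T\<^esub> p = - p"
  by (rule T.minus_equality) (simp_all only: free_neg_closed, simp_all)

end

text \<open>
  The action is by ring endomorphisms; invertibility is recorded by the one identity
  \<open>g (g\<inverse> a) = a\<close>.
\<close>

definition gring :: "('g, 'z) monoid_scheme \<Rightarrow> ('a, 'k, 'g) galg \<Rightarrow> bool" where
  "gring G A \<longleftrightarrow> ring A \<and> (\<forall>g\<in>carrier G. act A g \<in> ring_hom A A \<and>
     (\<forall>a\<in>carrier A. act A g (act A (inv\<^bsub>G\<^esub> g) a) = a))"

text \<open>
  The two rings are glued along central elements \<open>\<phi> r\<close> and \<open>\<psi> r\<close>. Centrality is what makes the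
  subgroup generated by the relations an ideal.
\<close>

locale tensor_product = ring_pair A B
  for A :: "('a, 'k, 'g) galg" and B :: "('b, 'k, 'g) galg" +
  fixes F :: "'f set" and \<phi> :: "'f \<Rightarrow> 'a" and \<psi> :: "'f \<Rightarrow> 'b"
  assumes \<phi>_closed: "r \<in> F \<Longrightarrow> \<phi> r \<in> carrier A"
    and \<phi>_central: "r \<in> F \<Longrightarrow> a \<in> carrier A \<Longrightarrow> \<phi> r \<otimes>\<^bsub>A\<^esub> a = a \<otimes>\<^bsub>A\<^esub> \<phi> r"
    and \<psi>_closed: "r \<in> F \<Longrightarrow> \<psi> r \<in> carrier B"
    and \<psi>_central: "r \<in> F \<Longrightarrow> b \<in> carrier B \<Longrightarrow> \<psi> r \<otimes>\<^bsub>B\<^esub> b = b \<otimes>\<^bsub>B\<^esub> \<psi> r"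
begin

abbreviation I where "I \<equiv> tensor_ideal F \<phi> \<psi> A B"
abbreviation Q where "Q \<equiv> galg_tensor F \<phi> \<psi> A B"

definition tens :: "'a \<Rightarrow> 'b \<Rightarrow> ('a \<times> 'b \<Rightarrow>\<^sub>0 int) set" where
  "tens a b = I +>\<^bsub>T\<^esub> frag_of (a, b)"

lemma rels_closed: "tensor_rels F \<phi> \<psi> A B \<subseteq> carrier T"
  unfolding tensor_rels_def
  by (intro Un_least subsetI; elim CollectE exE conjE)
    (simp_all only: free_diff_closed free_of_closed A.a_closed B.a_closed A.m_closed B.m_closed
      \<phi>_closed \<psi>_closed)

sublocale I: ideal I T
  unfolding tensor_ideal_def by (rule T.genideal_ideal[OF rels_closed])

text \<open>
  The relations are stable under multiplication by pure tensors on both sides. For the relation that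
  moves \<open>s\<close> across, this is where centrality of \<open>\<phi> s\<close> and \<open>\<psi> s\<close> enters.
\<close>

lemma rel_sandwich:
  assumes r: "r \<in> tensor_rels F \<phi> \<psi> A B"
    and c: "c \<in> carrier A" "d \<in> carrier B" "c' \<in> carrier A" "d' \<in> carrier B"
  shows "frag_of (c, d) \<otimes>\<^bsub>T\<^esub> r \<otimes>\<^bsub>T\<^esub> frag_of (c', d') \<in> tensor_rels F \<phi> \<psi> A B"
proof -
  from r consider
    (l) a a' b where "r = frag_of (a \<oplus>\<^bsub>A\<^esub> a', b) - frag_of (a, b) - frag_of (a', b)"
      "a \<in> carrier A" "a' \<in> carrier A" "b \<in> carrier B"
  | (r) a b b' where "r = frag_of (a, b \<oplus>\<^bsub>B\<^esub> b') - frag_of (a, b) - frag_of (a, b')"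
      "a \<in> carrier A" "b \<in> carrier B" "b' \<in> carrier B"
  | (m) a s b where "r = frag_of (a \<otimes>\<^bsub>A\<^esub> \<phi> s, b) - frag_of (a, \<psi> s \<otimes>\<^bsub>B\<^esub> b)"
      "a \<in> carrier A" "s \<in> F" "b \<in> carrier B"
    unfolding tensor_rels_def by blast
  then show ?thesis
  proof cases
    case l
    have "frag_of (c, d) \<otimes>\<^bsub>T\<^esub> r \<otimes>\<^bsub>T\<^esub> frag_of (c', d') =
      frag_of (c \<otimes>\<^bsub>A\<^esub> a \<otimes>\<^bsub>A\<^esub> c' \<oplus>\<^bsub>A\<^esub> c \<otimes>\<^bsub>A\<^esub> a' \<otimes>\<^bsub>A\<^esub> c', d \<otimes>\<^bsub>B\<^esub> b \<otimes>\<^bsub>B\<^esub> d')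
        - frag_of (c \<otimes>\<^bsub>A\<^esub> a \<otimes>\<^bsub>A\<^esub> c', d \<otimes>\<^bsub>B\<^esub> b \<otimes>\<^bsub>B\<^esub> d')
        - frag_of (c \<otimes>\<^bsub>A\<^esub> a' \<otimes>\<^bsub>A\<^esub> c', d \<otimes>\<^bsub>B\<^esub> b \<otimes>\<^bsub>B\<^esub> d')"
      using l c by (simp add: free_mult_diff A.l_distr A.r_distr)
    moreover have "c \<otimes>\<^bsub>A\<^esub> a \<otimes>\<^bsub>A\<^esub> c' \<in> carrier A" "c \<otimes>\<^bsub>A\<^esub> a' \<otimes>\<^bsub>A\<^esub> c' \<in> carrier A"
      "d \<otimes>\<^bsub>B\<^esub> b \<otimes>\<^bsub>B\<^esub> d' \<in> carrier B" using l c by auto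
    ultimately show ?thesis unfolding tensor_rels_def by blast
  next
    case r
    have "frag_of (c, d) \<otimes>\<^bsub>T\<^esub> r \<otimes>\<^bsub>T\<^esub> frag_of (c', d') =
      frag_of (c \<otimes>\<^bsub>A\<^esub> a \<otimes>\<^bsub>A\<^esub> c', d \<otimes>\<^bsub>B\<^esub> b \<otimes>\<^bsub>B\<^esub> d' \<oplus>\<^bsub>B\<^esub> d \<otimes>\<^bsub>B\<^esub> b' \<otimes>\<^bsub>B\<^esub> d')
        - frag_of (c \<otimes>\<^bsub>A\<^esub> a \<otimes>\<^bsub>A\<^esub> c', d \<otimes>\<^bsub>B\<^esub> b \<otimes>\<^bsub>B\<^esub> d')
        - frag_of (c \<otimes>\<^bsub>A\<^esub> a \<otimes>\<^bsub>A\<^esub> c', d \<otimes>\<^bsub>B\<^esub> b' \<otimes>\<^bsub>B\<^esub> d')"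
      using r c by (simp add: free_mult_diff B.l_distr B.r_distr)
    moreover have "c \<otimes>\<^bsub>A\<^esub> a \<otimes>\<^bsub>A\<^esub> c' \<in> carrier A" "d \<otimes>\<^bsub>B\<^esub> b \<otimes>\<^bsub>B\<^esub> d' \<in> carrier B"
      "d \<otimes>\<^bsub>B\<^esub> b' \<otimes>\<^bsub>B\<^esub> d' \<in> carrier B" using r c by auto
    ultimately show ?thesis unfolding tensor_rels_def by blast
  next
    case m
    have 1: "c \<otimes>\<^bsub>A\<^esub> (a \<otimes>\<^bsub>A\<^esub> \<phi> s) \<otimes>\<^bsub>A\<^esub> c' = c \<otimes>\<^bsub>A\<^esub> a \<otimes>\<^bsub>A\<^esub> c' \<otimes>\<^bsub>A\<^esub> \<phi> s"
      using m c \<phi>_closed by (simp add: A.m_assoc \<phi>_central)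
    have 2: "d \<otimes>\<^bsub>B\<^esub> (\<psi> s \<otimes>\<^bsub>B\<^esub> b) \<otimes>\<^bsub>B\<^esub> d' = \<psi> s \<otimes>\<^bsub>B\<^esub> (d \<otimes>\<^bsub>B\<^esub> b \<otimes>\<^bsub>B\<^esub> d')"
    proof -
      have "d \<otimes>\<^bsub>B\<^esub> (\<psi> s \<otimes>\<^bsub>B\<^esub> b) = \<psi> s \<otimes>\<^bsub>B\<^esub> (d \<otimes>\<^bsub>B\<^esub> b)"
        using m c \<psi>_closed \<psi>_central[of s d] by (simp flip: B.m_assoc)
      then show ?thesis using m c \<psi>_closed by (simp add: B.m_assoc)
    qed
    have "frag_of (c, d) \<otimes>\<^bsub>T\<^esub> r \<otimes>\<^bsub>T\<^esub> frag_of (c', d') =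
      frag_of (c \<otimes>\<^bsub>A\<^esub> a \<otimes>\<^bsub>A\<^esub> c' \<otimes>\<^bsub>A\<^esub> \<phi> s, d \<otimes>\<^bsub>B\<^esub> b \<otimes>\<^bsub>B\<^esub> d')
        - frag_of (c \<otimes>\<^bsub>A\<^esub> a \<otimes>\<^bsub>A\<^esub> c', \<psi> s \<otimes>\<^bsub>B\<^esub> (d \<otimes>\<^bsub>B\<^esub> b \<otimes>\<^bsub>B\<^esub> d'))"
      using m(1) by (simp add: free_mult_diff 1 2)
    moreover have "c \<otimes>\<^bsub>A\<^esub> a \<otimes>\<^bsub>A\<^esub> c' \<in> carrier A" "d \<otimes>\<^bsub>B\<^esub> b \<otimes>\<^bsub>B\<^esub> d' \<in> carrier B"
      using m c by auto
    ultimately show ?thesis using m(3) unfolding tensor_rels_def by blast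
  qed
qed

text \<open>
  The ideal is generated by the relations as an ideal, but additive maps only see the subgroup that
  they generate. The elements \<open>p\<close> for which \<open>h\<close> vanishes on all products \<open>q p q'\<close> form an ideal, and
  it contains the relations because these are stable under such products.
\<close>

lemma additive_map_vanishes_on_ideal:
  fixes V :: "('v, 'w) ring_scheme"
  assumes V: "abelian_group V"
    and closed: "\<And>p. p \<in> carrier T \<Longrightarrow> h p \<in> carrier V"
    and add: "\<And>p q. p \<in> carrier T \<Longrightarrow> q \<in> carrier T \<Longrightarrow> h (p + q) = h p \<oplus>\<^bsub>V\<^esub> h q"
    and rels: "\<And>r. r \<in> tensor_rels F \<phi> \<psi> A B \<Longrightarrow> h r = \<zero>\<^bsub>V\<^esub>"
    and p: "p \<in> I"
  shows "h p = \<zero>\<^bsub>V\<^esub>"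
proof -
  interpret V: abelian_group V by fact
  have zero: "h 0 = \<zero>\<^bsub>V\<^esub>"
    using add[of 0 0] closed[of 0] V.add.l_cancel_one'[of "h 0" "h 0"] by simp
  have neg: "h (- p) = \<ominus>\<^bsub>V\<^esub> h p" if "p \<in> carrier T" for p
    using add[of "- p" p] that free_neg_closed closed zero V.minus_equality[of "h (-p)" "h p"] by simp
  have hdiff: "h (p - q) = h p \<ominus>\<^bsub>V\<^esub> h q" if "p \<in> carrier T" "q \<in> carrier T" for p q
    using add[of p "- q"] that free_neg_closed neg by (simp add: a_minus_def)
  define J where "J = {p \<in> carrier T. \<forall>q\<in>carrier T. \<forall>q'\<in>carrier T. h (q \<otimes>\<^bsub>T\<^esub> p \<otimes>\<^bsub>T\<^esub> q') = \<zero>\<^bsub>V\<^esub>}"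
  have "ideal J T"
  proof (rule idealI[OF free_ring])
    show "subgroup J (add_monoid T)"
    proof (rule T.add.subgroupI)
      show "J \<noteq> {}" unfolding J_def using zero by (auto intro!: exI[of _ 0])
      show "\<ominus>\<^bsub>T\<^esub> a \<in> J" if "a \<in> J" for a
      proof -
        have a: "a \<in> carrier T" using that unfolding J_def by blast
        have "q \<otimes>\<^bsub>T\<^esub> (- a) \<otimes>\<^bsub>T\<^esub> q' = - (q \<otimes>\<^bsub>T\<^esub> a \<otimes>\<^bsub>T\<^esub> q')" for q q'
          using free_mult_diff(2)[of q 0 a] free_mult_diff(1)[of 0 "q \<otimes>\<^bsub>T\<^esub> a" q'] by simp
        then show ?thesis using that a unfolding J_def
          by (simp add: free_uminus neg free_mult_closed free_neg_closed del: free_simps(1))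
      qed
      show "a \<oplus>\<^bsub>T\<^esub> b \<in> J" if "a \<in> J" "b \<in> J" for a b
        using that unfolding J_def
        by (simp add: free_mult_add add free_mult_closed free_add_closed del: free_simps(1))
    qed (auto simp: J_def)
    show "x \<otimes>\<^bsub>T\<^esub> a \<in> J" "a \<otimes>\<^bsub>T\<^esub> x \<in> J" if "a \<in> J" "x \<in> carrier T" for a x
      using that unfolding J_def
      by (auto simp: T.m_assoc simp del: free_simps(1)) (auto simp flip: T.m_assoc simp del: free_simps(1))
  qed
  moreover have "tensor_rels F \<phi> \<psi> A B \<subseteq> J"
  proof
    fix r assume r: "r \<in> tensor_rels F \<phi> \<psi> A B"
    then have rT: "r \<in> carrier T" using rels_closed by blast
    have "h (q \<otimes>\<^bsub>T\<^esub> r \<otimes>\<^bsub>T\<^esub> q') = \<zero>\<^bsub>V\<^esub>" if "q \<in> carrier T" "q' \<in> carrier T" for q q'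
      using that(1)
    proof (induction q rule: free_induct)
      case (one a b)
      from that(2) show ?case
      proof (induction q' rule: free_induct)
        case (one a' b')
        then show ?case using rel_sandwich[OF r] rels \<open>a \<in> carrier A\<close> \<open>b \<in> carrier B\<close> by simp
      next
        case (diff p q)
        then show ?case using \<open>a \<in> carrier A\<close> \<open>b \<in> carrier B\<close> rT
          by (simp add: free_mult_diff free_mult_closed free_of_closed hdiff a_minus_def del: free_simps(1))
      qed (simp add: zero)
    next
      case (diff p q)
      then show ?case using that(2) rT
        by (simp add: free_mult_diff free_mult_closed hdiff a_minus_def del: free_simps(1))
    qed (simp add: zero)
    then show "r \<in> J" using rT unfolding J_def by blast
  qed
  ultimately have "I \<subseteq> J"
    unfolding tensor_ideal_def by (rule T.genideal_minimal)
  then have "p \<in> carrier T" "h (\<one>\<^bsub>T\<^esub> \<otimes>\<^bsub>T\<^esub> p \<otimes>\<^bsub>T\<^esub> \<one>\<^bsub>T\<^esub>) = \<zero>\<^bsub>V\<^esub>"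
    using p unfolding J_def by (blast, blast intro: T.one_closed)
  then show ?thesis by (simp del: free_simps)
qed

lemma Q_simps: "carrier Q = carrier (T Quot I)" "mult Q = mult (T Quot I)" "one Q = one (T Quot I)"
    "\<zero>\<^bsub>Q\<^esub> = \<zero>\<^bsub>T Quot I\<^esub>" "add Q = add (T Quot I)"
    "sclr Q c = tens (sclr A c) \<one>\<^bsub>B\<^esub>"
    "act Q g = (`) (frag_extend (\<lambda>(a, b). frag_of (act A g a, act B g b)))"
  by (auto simp: galg_tensor_def Let_def tens_def)

lemma Q_ring: "ring Q"
  by (rule ring_if_same_operations[OF I.quotient_is_ring]) (simp_all only: Q_simps)

sublocale Q: ring Q by (rule Q_ring)

abbreviation \<pi> where "\<pi> p \<equiv> I +>\<^bsub>T\<^esub> p"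

lemma \<pi>_hom: "\<pi> \<in> ring_hom T Q"
  using I.rcos_ring_hom unfolding ring_hom_def Q_simps by simp

lemma \<pi>_closed: "p \<in> carrier T \<Longrightarrow> \<pi> p \<in> carrier Q"
  using \<pi>_hom by (rule ring_hom_closed)

lemma \<pi>_surj: "x \<in> carrier Q \<Longrightarrow> \<exists>p\<in>carrier T. x = \<pi> p"
  by (auto simp: Q_simps FactRing_def A_RCOSETS_defs a_r_coset_def)

lemma \<pi>_add: "p \<in> carrier T \<Longrightarrow> q \<in> carrier T \<Longrightarrow> \<pi> (p + q) = \<pi> p \<oplus>\<^bsub>Q\<^esub> \<pi> q"
  using ring_hom_add[OF \<pi>_hom, of p q] by simp

lemma \<pi>_mult: "p \<in> carrier T \<Longrightarrow> q \<in> carrier T \<Longrightarrow> \<pi> (p \<otimes>\<^bsub>T\<^esub> q) = \<pi> p \<otimes>\<^bsub>Q\<^esub> \<pi> q"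
  using ring_hom_mult[OF \<pi>_hom, of p q] by simp

lemma \<pi>_eq_zero: "p \<in> carrier T \<Longrightarrow> \<pi> p = \<zero>\<^bsub>Q\<^esub> \<longleftrightarrow> p \<in> I"
  using T.a_coset_join1[of I p] I.a_rcos_const[of p] I.a_subgroup
  by (auto simp: Q_simps FactRing_def simp del: free_simps(1))

lemma \<pi>_diff:
  assumes "p \<in> carrier T" "q \<in> carrier T" shows "\<pi> (p - q) = \<pi> p \<ominus>\<^bsub>Q\<^esub> \<pi> q"
proof -
  have "\<pi> p = \<pi> (p - q) \<oplus>\<^bsub>Q\<^esub> \<pi> q"
    using \<pi>_add[of "p - q" q] assms free_diff_closed by simp
  moreover have "\<pi> (p - q) \<in> carrier Q" "\<pi> q \<in> carrier Q" "\<pi> p \<in> carrier Q"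
    using assms by (intro \<pi>_closed free_diff_closed; simp)+
  ultimately show ?thesis by (simp add: a_minus_def Q.a_assoc Q.r_neg)
qed

lemma \<pi>_eq_iff:
  assumes "p \<in> carrier T" "q \<in> carrier T" shows "\<pi> p = \<pi> q \<longleftrightarrow> p - q \<in> I"
  using \<pi>_diff[OF assms] \<pi>_eq_zero[OF free_diff_closed[OF assms]] \<pi>_closed assms
  by (metis Q.r_right_minus_eq)

lemma tens_closed: "a \<in> carrier A \<Longrightarrow> b \<in> carrier B \<Longrightarrow> tens a b \<in> carrier Q"
  unfolding tens_def by (intro \<pi>_closed free_of_closed)

lemma tens_mult:
  assumes "a \<in> carrier A" "b \<in> carrier B" "a' \<in> carrier A" "b' \<in> carrier B"
  shows "tens a b \<otimes>\<^bsub>Q\<^esub> tens a' b' = tens (a \<otimes>\<^bsub>A\<^esub> a') (b \<otimes>\<^bsub>B\<^esub> b')"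
  unfolding tens_def using assms by (subst \<pi>_mult[symmetric]) (auto simp: keys_frag_of)

lemma tens_one: "\<one>\<^bsub>Q\<^esub> = tens \<one>\<^bsub>A\<^esub> \<one>\<^bsub>B\<^esub>"
  unfolding tens_def using ring_hom_one[OF \<pi>_hom] by simp

lemma rel_in_ideal: "r \<in> tensor_rels F \<phi> \<psi> A B \<Longrightarrow> r \<in> I"
  unfolding tensor_ideal_def using T.genideal_self[OF rels_closed] by blast

lemma tens_add_left:
  assumes "a \<in> carrier A" "a' \<in> carrier A" "b \<in> carrier B"
  shows "tens (a \<oplus>\<^bsub>A\<^esub> a') b = tens a b \<oplus>\<^bsub>Q\<^esub> tens a' b"
proof -
  have "frag_of (a \<oplus>\<^bsub>A\<^esub> a', b) - frag_of (a, b) - frag_of (a', b) \<in> I"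
    by (rule rel_in_ideal) (use assms in \<open>unfold tensor_rels_def, blast\<close>)
  then have "frag_of (a \<oplus>\<^bsub>A\<^esub> a', b) - (frag_of (a, b) + frag_of (a', b)) \<in> I"
    by (simp add: algebra_simps)
  then show ?thesis unfolding tens_def using assms
    by (simp add: \<pi>_eq_iff free_add_closed free_of_closed flip: \<pi>_add del: free_simps(1))
qed

lemma tens_add_right:
  assumes "a \<in> carrier A" "b \<in> carrier B" "b' \<in> carrier B"
  shows "tens a (b \<oplus>\<^bsub>B\<^esub> b') = tens a b \<oplus>\<^bsub>Q\<^esub> tens a b'"
proof -
  have "frag_of (a, b \<oplus>\<^bsub>B\<^esub> b') - frag_of (a, b) - frag_of (a, b') \<in> I"
    by (rule rel_in_ideal) (use assms in \<open>unfold tensor_rels_def, blast\<close>)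
  then have "frag_of (a, b \<oplus>\<^bsub>B\<^esub> b') - (frag_of (a, b) + frag_of (a, b')) \<in> I"
    by (simp add: algebra_simps)
  then show ?thesis unfolding tens_def using assms
    by (simp add: \<pi>_eq_iff free_add_closed free_of_closed flip: \<pi>_add del: free_simps(1))
qed

lemma tens_balanced:
  assumes "a \<in> carrier A" "r \<in> F" "b \<in> carrier B"
  shows "tens (a \<otimes>\<^bsub>A\<^esub> \<phi> r) b = tens a (\<psi> r \<otimes>\<^bsub>B\<^esub> b)"
proof -
  have "frag_of (a \<otimes>\<^bsub>A\<^esub> \<phi> r, b) - frag_of (a, \<psi> r \<otimes>\<^bsub>B\<^esub> b) \<in> I"
    by (rule rel_in_ideal) (use assms in \<open>unfold tensor_rels_def, blast\<close>)
  then show ?thesis unfolding tens_def using assms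
    by (simp add: \<pi>_eq_iff free_of_closed \<phi>_closed \<psi>_closed del: free_simps(1))
qed

lemma tens_zero_left: "b \<in> carrier B \<Longrightarrow> tens \<zero>\<^bsub>A\<^esub> b = \<zero>\<^bsub>Q\<^esub>"
  using tens_add_left[of "\<zero>\<^bsub>A\<^esub>" "\<zero>\<^bsub>A\<^esub>" b] tens_closed[of "\<zero>\<^bsub>A\<^esub>" b] Q.add.l_cancel_one' by fastforce

lemma tens_zero_right: "a \<in> carrier A \<Longrightarrow> tens a \<zero>\<^bsub>B\<^esub> = \<zero>\<^bsub>Q\<^esub>"
  using tens_add_right[of a "\<zero>\<^bsub>B\<^esub>" "\<zero>\<^bsub>B\<^esub>"] tens_closed[of a "\<zero>\<^bsub>B\<^esub>"] Q.add.l_cancel_one' by fastforce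

lemma tens_neg: "a \<in> carrier A \<Longrightarrow> b \<in> carrier B \<Longrightarrow> tens (\<ominus>\<^bsub>A\<^esub> a) b = \<ominus>\<^bsub>Q\<^esub> tens a b"
  by (rule Q.minus_equality[symmetric])
    (auto simp: tens_closed A.l_neg tens_zero_left simp flip: tens_add_left)

text \<open>
  Negatives of pure tensors are pure tensors, so sums suffice. The auxiliary predicate quantifies over
  a summand on the left, as differences in the free group are not built by adding one tensor at a time.
\<close>

lemma tens_induct [consumes 1, case_names zero add]:
  assumes "x \<in> carrier Q" "P \<zero>\<^bsub>Q\<^esub>"
    "\<And>x a b. x \<in> carrier Q \<Longrightarrow> a \<in> carrier A \<Longrightarrow> b \<in> carrier B \<Longrightarrow> P x \<Longrightarrow> P (x \<oplus>\<^bsub>Q\<^esub> tens a b)"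
  shows "P x"
proof -
  define S where "S y \<longleftrightarrow> (\<forall>x\<in>carrier Q. P x \<longrightarrow> P (x \<oplus>\<^bsub>Q\<^esub> y) \<and> P (x \<ominus>\<^bsub>Q\<^esub> y))" for y
  obtain p where p: "p \<in> carrier T" "x = \<pi> p" using \<pi>_surj assms(1) by blast
  have "S (\<pi> p)"
    using p(1)
  proof (induction p rule: free_induct)
    case zero
    then show ?case using \<pi>_eq_zero[of 0] I.zero_closed by (simp add: S_def a_minus_def)
  next
    case (one a b)
    have "x \<ominus>\<^bsub>Q\<^esub> tens a b = x \<oplus>\<^bsub>Q\<^esub> tens (\<ominus>\<^bsub>A\<^esub> a) b" for x
      using one by (simp add: a_minus_def tens_neg)
    then show ?case using one assms(3) unfolding S_def tens_def[symmetric] by simp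
  next
    case (diff p q)
    have c: "\<pi> p \<in> carrier Q" "\<pi> q \<in> carrier Q" using diff \<pi>_closed by auto
    have "x \<oplus>\<^bsub>Q\<^esub> (\<pi> p \<ominus>\<^bsub>Q\<^esub> \<pi> q) = (x \<oplus>\<^bsub>Q\<^esub> \<pi> p) \<ominus>\<^bsub>Q\<^esub> \<pi> q"
      "x \<ominus>\<^bsub>Q\<^esub> (\<pi> p \<ominus>\<^bsub>Q\<^esub> \<pi> q) = (x \<oplus>\<^bsub>Q\<^esub> \<pi> q) \<ominus>\<^bsub>Q\<^esub> \<pi> p" if "x \<in> carrier Q" for x
      using c that by (simp_all add: a_minus_def Q.minus_add Q.add.m_ac)
    then show ?case using diff(3,4) c unfolding \<pi>_diff[OF diff(1,2)] S_def by simp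
  qed
  then have "P (\<zero>\<^bsub>Q\<^esub> \<oplus>\<^bsub>Q\<^esub> x)" using assms(2) p(2) unfolding S_def by blast
  then show ?thesis using assms(1) by simp
qed

text \<open>
  The universal property for balanced biadditive maps: extend to the free group, then use that the
  extension vanishes on the ideal.
\<close>

lemma tens_lift:
  fixes V :: "('v, 'w) ring_scheme"
  assumes V: "abelian_group V"
    and closed: "\<And>a b. a \<in> carrier A \<Longrightarrow> b \<in> carrier B \<Longrightarrow> f a b \<in> carrier V"
    and add_left: "\<And>a a' b. a \<in> carrier A \<Longrightarrow> a' \<in> carrier A \<Longrightarrow> b \<in> carrier B \<Longrightarrow>
      f (a \<oplus>\<^bsub>A\<^esub> a') b = f a b \<oplus>\<^bsub>V\<^esub> f a' b"
    and add_right: "\<And>a b b'. a \<in> carrier A \<Longrightarrow> b \<in> carrier B \<Longrightarrow> b' \<in> carrier B \<Longrightarrow>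
      f a (b \<oplus>\<^bsub>B\<^esub> b') = f a b \<oplus>\<^bsub>V\<^esub> f a b'"
    and balanced: "\<And>a r b. a \<in> carrier A \<Longrightarrow> r \<in> F \<Longrightarrow> b \<in> carrier B \<Longrightarrow>
      f (a \<otimes>\<^bsub>A\<^esub> \<phi> r) b = f a (\<psi> r \<otimes>\<^bsub>B\<^esub> b)"
  obtains \<Phi> where "\<And>x. x \<in> carrier Q \<Longrightarrow> \<Phi> x \<in> carrier V"
    "\<And>x y. x \<in> carrier Q \<Longrightarrow> y \<in> carrier Q \<Longrightarrow> \<Phi> (x \<oplus>\<^bsub>Q\<^esub> y) = \<Phi> x \<oplus>\<^bsub>V\<^esub> \<Phi> y"
    "\<And>a b. a \<in> carrier A \<Longrightarrow> b \<in> carrier B \<Longrightarrow> \<Phi> (tens a b) = f a b"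
proof -
  interpret V: abelian_group V by fact
  have "(\<lambda>(a, b). f a b) ` (carrier A \<times> carrier B) \<subseteq> carrier V"
    using closed by auto
  then obtain h where h: "h \<in> hom (free_Abelian_group (carrier A \<times> carrier B)) (add_monoid V)"
    and h_of: "\<And>x. x \<in> carrier A \<times> carrier B \<Longrightarrow> h (frag_of x) = (\<lambda>(a, b). f a b) x"
  proof (rule V.add.free_Abelian_group_universal)
    fix h assume "h \<in> hom (free_Abelian_group (carrier A \<times> carrier B)) (add_monoid V)"
      "\<And>x. x \<in> carrier A \<times> carrier B \<Longrightarrow> h (frag_of x) = (\<lambda>(a, b). f a b) x"
    then show thesis by (rule that)
  qed
  have h_closed: "h p \<in> carrier V" if "p \<in> carrier T" for p
    using h that by (auto simp: hom_def)
  have h_add: "h (p + q) = h p \<oplus>\<^bsub>V\<^esub> h q" if "p \<in> carrier T" "q \<in> carrier T" for p q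
    using h that by (auto simp: hom_def)
  have h_diff: "h p = z \<oplus>\<^bsub>V\<^esub> h q \<Longrightarrow> h (p - q) = z"
    if "p \<in> carrier T" "q \<in> carrier T" "z \<in> carrier V" for p q z
    using h_add[of "p - q" q] that free_diff_closed h_closed V.add.right_cancel[of "h q" "h (p - q)" z]
    by simp
  have h_zero: "h p = \<zero>\<^bsub>V\<^esub>" if "p \<in> I" for p
  proof (rule additive_map_vanishes_on_ideal[OF V h_closed h_add _ that])
    fix r assume "r \<in> tensor_rels F \<phi> \<psi> A B"
    then consider
      (l) a a' b where "r = frag_of (a \<oplus>\<^bsub>A\<^esub> a', b) - frag_of (a, b) - frag_of (a', b)"
        "a \<in> carrier A" "a' \<in> carrier A" "b \<in> carrier B"
    | (r) a b b' where "r = frag_of (a, b \<oplus>\<^bsub>B\<^esub> b') - frag_of (a, b) - frag_of (a, b')"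
        "a \<in> carrier A" "b \<in> carrier B" "b' \<in> carrier B"
    | (m) a s b where "r = frag_of (a \<otimes>\<^bsub>A\<^esub> \<phi> s, b) - frag_of (a, \<psi> s \<otimes>\<^bsub>B\<^esub> b)"
        "a \<in> carrier A" "s \<in> F" "b \<in> carrier B"
      unfolding tensor_rels_def by blast
    then show "h r = \<zero>\<^bsub>V\<^esub>"
    proof cases
      case l
      then show ?thesis unfolding l(1) using closed
        by (intro h_diff free_diff_closed free_of_closed)
          (auto simp: h_of add_left V.a_comm intro!: free_of_closed)
    next
      case r
      then show ?thesis unfolding r(1) using closed
        by (intro h_diff free_diff_closed free_of_closed)
          (auto simp: h_of add_right V.a_comm intro!: free_of_closed)
    next
      case m
      then show ?thesis unfolding m(1) using closed
        by (intro h_diff free_diff_closed free_of_closed)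
          (auto simp: h_of balanced \<phi>_closed \<psi>_closed intro!: free_of_closed)
    qed
  qed
  define \<Phi> where "\<Phi> x = h (SOME p. p \<in> carrier T \<and> \<pi> p = x)" for x
  have \<Phi>: "\<Phi> (\<pi> p) = h p" if "p \<in> carrier T" for p
  proof -
    define q where "q = (SOME q. q \<in> carrier T \<and> \<pi> q = \<pi> p)"
    have q: "q \<in> carrier T \<and> \<pi> q = \<pi> p"
      unfolding q_def by (rule someI[of _ p]) (use that in simp)
    then have "h (q - p) = \<zero>\<^bsub>V\<^esub>" using \<pi>_eq_iff that h_zero by blast
    then have "h q = h p"
      using h_add[of "q - p" p] q that free_diff_closed h_closed by simp
    then show ?thesis by (simp add: \<Phi>_def q_def)
  qed
  show thesis
  proof
    show "\<Phi> x \<in> carrier V" if "x \<in> carrier Q" for x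
      using \<pi>_surj[OF that] \<Phi> h_closed by auto
    show "\<Phi> (x \<oplus>\<^bsub>Q\<^esub> y) = \<Phi> x \<oplus>\<^bsub>V\<^esub> \<Phi> y" if "x \<in> carrier Q" "y \<in> carrier Q" for x y
    proof -
      obtain p q where "p \<in> carrier T" "x = \<pi> p" "q \<in> carrier T" "y = \<pi> q"
        using \<pi>_surj \<open>x \<in> carrier Q\<close> \<open>y \<in> carrier Q\<close> by metis
      then show ?thesis
        by (simp add: \<Phi> h_add free_add_closed flip: \<pi>_add del: free_simps(1))
    qed
    show "\<Phi> (tens a b) = f a b" if "a \<in> carrier A" "b \<in> carrier B" for a b
      using that unfolding tens_def by (subst \<Phi>) (auto simp: keys_frag_of h_of)
  qed
qed

end

lemma gring_ring: "gring G A \<Longrightarrow> ring A"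
  and gring_hom: "gring G A \<Longrightarrow> g \<in> carrier G \<Longrightarrow> act A g \<in> ring_hom A A"
  and gring_inv: "gring G A \<Longrightarrow> g \<in> carrier G \<Longrightarrow> a \<in> carrier A \<Longrightarrow> act A g (act A (inv\<^bsub>G\<^esub> g) a) = a"
  by (auto simp: gring_def)

locale equivariant_tensor = tensor_product A B F \<phi> \<psi> + G: group G
  for A :: "('a, 'k, 'g) galg" and B :: "('b, 'k, 'g) galg" and F :: "'f set" and \<phi> \<psi>
    and G :: "('g, 'z) monoid_scheme" +
  assumes gA: "gring G A" and gB: "gring G B"
    and act_compatible: "g \<in> carrier G \<Longrightarrow> r \<in> F \<Longrightarrow>
      \<exists>r'\<in>F. \<phi> r' = act A g (\<phi> r) \<and> \<psi> r' = act B g (\<psi> r)"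
begin

lemmas actA = gring_hom[OF gA]
lemmas actB = gring_hom[OF gB]

abbreviation \<sigma> where "\<sigma> g \<equiv> frag_extend (\<lambda>(a, b). frag_of (act A g a, act B g b))"

lemma \<sigma>_closed:
  assumes "g \<in> carrier G" "p \<in> carrier T" shows "\<sigma> g p \<in> carrier T"
  using assms(2)
proof (induction p rule: free_induct)
  case (one a b)
  then show ?case using ring_hom_closed[OF actA[OF assms(1)]] ring_hom_closed[OF actB[OF assms(1)]]
    by (auto simp: keys_frag_of)
next
  case (diff p q)
  then show ?case by (simp add: frag_extend_diff free_diff_closed del: free_simps(1))
qed auto

lemma \<sigma>_mult:
  assumes g: "g \<in> carrier G" and "p \<in> carrier T" "q \<in> carrier T"
  shows "\<sigma> g (p \<otimes>\<^bsub>T\<^esub> q) = \<sigma> g p \<otimes>\<^bsub>T\<^esub> \<sigma> g q"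
  using assms(2)
proof (induction p rule: free_induct)
  case (one a b)
  from assms(3) show ?case
  proof (induction q rule: free_induct)
    case (one a' b')
    then show ?case using \<open>a \<in> carrier A\<close> \<open>b \<in> carrier B\<close>
      by (simp add: ring_hom_mult[OF actA[OF g]] ring_hom_mult[OF actB[OF g]])
  qed (simp_all add: free_mult_diff frag_extend_diff)
qed (simp_all add: free_mult_diff frag_extend_diff)

lemma \<sigma>_inv:
  assumes "g \<in> carrier G" "p \<in> carrier T" shows "\<sigma> g (\<sigma> (inv\<^bsub>G\<^esub> g) p) = p"
  using assms(2)
  by (induction p rule: free_induct)
    (simp_all add: assms(1) frag_extend_diff gring_inv[OF gA] gring_inv[OF gB])

text \<open>
  The action maps relations to relations, since \<open>r'\<close> in \<open>act_compatible\<close> is again admissible.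
\<close>

lemma \<sigma>_ideal_subset:
  assumes g: "g \<in> carrier G" and p: "p \<in> I" shows "\<sigma> g p \<in> I"
proof -
  have "\<pi> (\<sigma> g p) = \<zero>\<^bsub>Q\<^esub>"
  proof (rule additive_map_vanishes_on_ideal[where V = Q and h = "\<lambda>p. \<pi> (\<sigma> g p)"])
    show "abelian_group Q" by unfold_locales
    show "\<pi> (\<sigma> g (p + q)) = \<pi> (\<sigma> g p) \<oplus>\<^bsub>Q\<^esub> \<pi> (\<sigma> g q)" if "p \<in> carrier T" "q \<in> carrier T" for p q
      using that g \<sigma>_closed by (simp add: frag_extend_add \<pi>_add del: free_simps(1))
    show "\<pi> (\<sigma> g r) = \<zero>\<^bsub>Q\<^esub>" if r: "r \<in> tensor_rels F \<phi> \<psi> A B" for r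
    proof -
      note hom = ring_hom_add[OF actA[OF g]] ring_hom_add[OF actB[OF g]]
        ring_hom_mult[OF actA[OF g]] ring_hom_mult[OF actB[OF g]]
      note cl = ring_hom_closed[OF actA[OF g]] ring_hom_closed[OF actB[OF g]]
      from r consider
        (l) a a' b where "r = frag_of (a \<oplus>\<^bsub>A\<^esub> a', b) - frag_of (a, b) - frag_of (a', b)"
          "a \<in> carrier A" "a' \<in> carrier A" "b \<in> carrier B"
      | (r) a b b' where "r = frag_of (a, b \<oplus>\<^bsub>B\<^esub> b') - frag_of (a, b) - frag_of (a, b')"
          "a \<in> carrier A" "b \<in> carrier B" "b' \<in> carrier B"
      | (m) a s b where "r = frag_of (a \<otimes>\<^bsub>A\<^esub> \<phi> s, b) - frag_of (a, \<psi> s \<otimes>\<^bsub>B\<^esub> b)"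
          "a \<in> carrier A" "s \<in> F" "b \<in> carrier B"
        unfolding tensor_rels_def by blast
      then have "\<sigma> g r \<in> tensor_rels F \<phi> \<psi> A B"
      proof cases
        case l
        then have "\<sigma> g r = frag_of (act A g a \<oplus>\<^bsub>A\<^esub> act A g a', act B g b)
            - frag_of (act A g a, act B g b) - frag_of (act A g a', act B g b)"
          by (simp add: frag_extend_diff hom)
        then show ?thesis using cl l(2-) unfolding tensor_rels_def by blast
      next
        case r
        then have "\<sigma> g r = frag_of (act A g a, act B g b \<oplus>\<^bsub>B\<^esub> act B g b')
            - frag_of (act A g a, act B g b) - frag_of (act A g a, act B g b')"
          by (simp add: frag_extend_diff hom)
        then show ?thesis using cl r(2-) unfolding tensor_rels_def by blast
      next
        case m
        obtain s' where s': "s' \<in> F" "\<phi> s' = act A g (\<phi> s)" "\<psi> s' = act B g (\<psi> s)"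
          using act_compatible[OF g m(3)] by blast
        have "\<sigma> g r = frag_of (act A g a \<otimes>\<^bsub>A\<^esub> \<phi> s', act B g b)
            - frag_of (act A g a, \<psi> s' \<otimes>\<^bsub>B\<^esub> act B g b)"
          using m \<phi>_closed \<psi>_closed by (simp add: frag_extend_diff hom s')
        then show ?thesis using cl m(2-) s'(1) unfolding tensor_rels_def by blast
      qed
      then show ?thesis using rel_in_ideal rels_closed \<pi>_eq_zero by blast
    qed
  qed (use p g \<sigma>_closed \<pi>_closed in auto)
  then show ?thesis using p I.a_Hcarr \<sigma>_closed[OF g] \<pi>_eq_zero by blast
qed

lemma \<sigma>_ideal: "g \<in> carrier G \<Longrightarrow> \<sigma> g ` I = I"
proof (intro equalityI subsetI)
  fix p assume "g \<in> carrier G" "p \<in> I"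
  then show "p \<in> \<sigma> g ` I"
    using \<sigma>_inv[of g p] \<sigma>_ideal_subset[of "inv\<^bsub>G\<^esub> g" p] I.a_Hcarr[of p]
    by (intro image_eqI[of _ _ "\<sigma> (inv\<^bsub>G\<^esub> g) p"]) auto
qed (use \<sigma>_ideal_subset in auto)

lemma act_\<pi>:
  assumes g: "g \<in> carrier G" and p: "p \<in> carrier T"
  shows "act Q g (\<pi> p) = \<pi> (\<sigma> g p)"
proof -
  have "act Q g (\<pi> p) = (\<lambda>h. h + \<sigma> g p) ` (\<sigma> g ` I)"
    by (force simp: Q_simps a_r_coset_def r_coset_def frag_extend_add)
  then show ?thesis unfolding \<sigma>_ideal[OF g] by (auto simp: a_r_coset_def r_coset_def)
qed

lemma act_tens:
  "g \<in> carrier G \<Longrightarrow> a \<in> carrier A \<Longrightarrow> b \<in> carrier B \<Longrightarrow>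
    act Q g (tens a b) = tens (act A g a) (act B g b)"
  unfolding tens_def by (subst act_\<pi>) (simp_all add: keys_frag_of)

theorem tensor_gring: "gring G Q"
  unfolding gring_def
proof (intro conjI ballI)
  show "ring Q" by (rule Q_ring)
  fix g assume g: "g \<in> carrier G"
  show "act Q g \<in> ring_hom Q Q"
  proof (rule ring_hom_memI)
    fix x y assume "x \<in> carrier Q" "y \<in> carrier Q"
    then obtain p q where p: "p \<in> carrier T" "x = \<pi> p" and q: "q \<in> carrier T" "y = \<pi> q"
      using \<pi>_surj by metis
    show "act Q g x \<in> carrier Q" using p g by (simp add: act_\<pi> \<pi>_closed \<sigma>_closed del: free_simps(1))
    show "act Q g (x \<otimes>\<^bsub>Q\<^esub> y) = act Q g x \<otimes>\<^bsub>Q\<^esub> act Q g y"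
      using p q g by (simp add: act_\<pi> \<sigma>_closed free_mult_closed \<sigma>_mult flip: \<pi>_mult del: free_simps(1))
    show "act Q g (x \<oplus>\<^bsub>Q\<^esub> y) = act Q g x \<oplus>\<^bsub>Q\<^esub> act Q g y"
      using p q g by (simp add: act_\<pi> \<sigma>_closed free_add_closed frag_extend_add flip: \<pi>_add del: free_simps(1))
  next
    show "act Q g \<one>\<^bsub>Q\<^esub> = \<one>\<^bsub>Q\<^esub>"
      using g unfolding tens_one by (simp add: act_tens ring_hom_one[OF actA] ring_hom_one[OF actB])
  qed
  fix x assume "x \<in> carrier Q"
  then obtain p where p: "p \<in> carrier T" "x = \<pi> p" using \<pi>_surj by blast
  then show "act Q g (act Q (inv\<^bsub>G\<^esub> g) x) = x"
    using g by (simp add: act_\<pi> \<sigma>_closed \<sigma>_inv del: free_simps(1))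
qed

end

section \<open>The center of a scalar extension\<close>

lemma additive_map_finsum:
  fixes R :: "('r, 's) ring_scheme" and V :: "('v, 'w) ring_scheme"
  assumes R: "abelian_group R" and V: "abelian_group V"
    and closed: "\<And>x. x \<in> carrier R \<Longrightarrow> \<Phi> x \<in> carrier V"
    and add: "\<And>x y. x \<in> carrier R \<Longrightarrow> y \<in> carrier R \<Longrightarrow> \<Phi> (x \<oplus>\<^bsub>R\<^esub> y) = \<Phi> x \<oplus>\<^bsub>V\<^esub> \<Phi> y"
    and f: "f \<in> J \<rightarrow> carrier R"
  shows "\<Phi> (\<Oplus>\<^bsub>R\<^esub>j\<in>J. f j) = (\<Oplus>\<^bsub>V\<^esub>j\<in>J. \<Phi> (f j))"
proof -
  interpret R: abelian_group R by fact
  interpret V: abelian_group V by fact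
  have zero: "\<Phi> \<zero>\<^bsub>R\<^esub> = \<zero>\<^bsub>V\<^esub>"
    using add[of "\<zero>\<^bsub>R\<^esub>" "\<zero>\<^bsub>R\<^esub>"] closed[of "\<zero>\<^bsub>R\<^esub>"] V.add.l_cancel_one'[of "\<Phi> \<zero>\<^bsub>R\<^esub>" "\<Phi> \<zero>\<^bsub>R\<^esub>"] by simp
  show ?thesis
  proof (cases "finite J")
    case True
    then show ?thesis using f
    proof (induction J rule: finite_induct)
      case (insert j J)
      then show ?case
        by (subst R.finsum_insert; (subst V.finsum_insert)?) (auto simp: add closed Pi_iff)
    qed (simp add: zero)
  qed (simp add: zero)
qed

text \<open>
  \<open>A \<otimes> L\<close> for a field \<open>L\<close> over the center of \<open>A\<close>. Nonzero central
  elements of \<open>A\<close> have central inverses, so \<open>L\<close> is a vector space over the center.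
\<close>

locale scalar_extension = equivariant_tensor A L "carrier (galg_center A)" "\<lambda>z. z" \<iota> G + L: field L
  for A :: "('a, 'k, 'g) galg" and L :: "('l, 'k, 'g) galg" and \<iota> and G :: "('g, 'z) monoid_scheme" +
  assumes \<iota>_hom: "\<iota> \<in> ring_hom (galg_center A) L"
    and center_inverse: "z \<in> carrier (galg_center A) \<Longrightarrow> z \<noteq> \<zero>\<^bsub>A\<^esub> \<Longrightarrow>
      \<exists>z'\<in>carrier (galg_center A). z' \<otimes>\<^bsub>A\<^esub> z = \<one>\<^bsub>A\<^esub>"
begin

abbreviation Z where "Z \<equiv> carrier (galg_center A)"

lemma Z_iff: "z \<in> Z \<longleftrightarrow> z \<in> carrier A \<and> (\<forall>a\<in>carrier A. z \<otimes>\<^bsub>A\<^esub> a = a \<otimes>\<^bsub>A\<^esub> z)"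
  by (simp add: galg_center_def)

lemma Z_carrier: "z \<in> Z \<Longrightarrow> z \<in> carrier A"
  by (simp add: Z_iff)

lemma Z_add: "z \<in> Z \<Longrightarrow> z' \<in> Z \<Longrightarrow> z \<oplus>\<^bsub>A\<^esub> z' \<in> Z"
  by (auto simp: Z_iff A.l_distr A.r_distr)

lemma Z_mult: "z \<in> Z \<Longrightarrow> z' \<in> Z \<Longrightarrow> z \<otimes>\<^bsub>A\<^esub> z' \<in> Z"
  unfolding Z_iff by (metis A.m_assoc A.m_closed)

lemma Z_neg: "z \<in> Z \<Longrightarrow> \<ominus>\<^bsub>A\<^esub> z \<in> Z"
  by (auto simp: Z_iff A.l_minus A.r_minus)

lemma Z_one: "\<one>\<^bsub>A\<^esub> \<in> Z" and Z_zero: "\<zero>\<^bsub>A\<^esub> \<in> Z"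
  by (auto simp: Z_iff)

lemma \<iota>_closed: "z \<in> Z \<Longrightarrow> \<iota> z \<in> carrier L"
  using ring_hom_closed[OF \<iota>_hom] .

lemma center_operations:
  "add (galg_center A) = add A" "mult (galg_center A) = mult A" "one (galg_center A) = one A"
  by (simp_all add: galg_center_def)

lemma \<iota>_add: "z \<in> Z \<Longrightarrow> z' \<in> Z \<Longrightarrow> \<iota> (z \<oplus>\<^bsub>A\<^esub> z') = \<iota> z \<oplus>\<^bsub>L\<^esub> \<iota> z'"
  using ring_hom_add[OF \<iota>_hom, of z z'] unfolding center_operations .

lemma \<iota>_mult: "z \<in> Z \<Longrightarrow> z' \<in> Z \<Longrightarrow> \<iota> (z \<otimes>\<^bsub>A\<^esub> z') = \<iota> z \<otimes>\<^bsub>L\<^esub> \<iota> z'"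
  using ring_hom_mult[OF \<iota>_hom, of z z'] unfolding center_operations .

lemma \<iota>_one: "\<iota> \<one>\<^bsub>A\<^esub> = \<one>\<^bsub>L\<^esub>"
  using ring_hom_one[OF \<iota>_hom] unfolding center_operations .

lemma \<iota>_zero: "\<iota> \<zero>\<^bsub>A\<^esub> = \<zero>\<^bsub>L\<^esub>"
  using \<iota>_add[OF Z_zero Z_zero] \<iota>_closed[OF Z_zero] by simp

lemma \<iota>_neg: "z \<in> Z \<Longrightarrow> \<iota> (\<ominus>\<^bsub>A\<^esub> z) = \<ominus>\<^bsub>L\<^esub> \<iota> z"
  using \<iota>_add[of "\<ominus>\<^bsub>A\<^esub> z" z] Z_neg Z_carrier \<iota>_closed \<iota>_zero
  by (intro B.minus_equality[symmetric]) (auto simp: A.l_neg)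

definition subspace :: "'l set \<Rightarrow> bool" where
  "subspace W \<longleftrightarrow> W \<subseteq> carrier L \<and> \<zero>\<^bsub>L\<^esub> \<in> W \<and> (\<forall>x\<in>W. \<forall>y\<in>W. x \<oplus>\<^bsub>L\<^esub> y \<in> W) \<and>
     (\<forall>z\<in>Z. \<forall>x\<in>W. \<iota> z \<otimes>\<^bsub>L\<^esub> x \<in> W)"

lemma subspace_neg: "subspace W \<Longrightarrow> x \<in> W \<Longrightarrow> \<ominus>\<^bsub>L\<^esub> x \<in> W"
proof -
  assume W: "subspace W" "x \<in> W"
  then have "\<iota> (\<ominus>\<^bsub>A\<^esub> \<one>\<^bsub>A\<^esub>) \<otimes>\<^bsub>L\<^esub> x \<in> W" using Z_neg[OF Z_one] by (simp add: subspace_def)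
  moreover have "x \<in> carrier L" using W by (auto simp: subspace_def)
  ultimately show ?thesis by (simp add: \<iota>_neg Z_one \<iota>_one B.l_minus)
qed

definition functional :: "('l \<Rightarrow> 'a) \<Rightarrow> bool" where
  "functional f \<longleftrightarrow> (\<forall>l\<in>carrier L. f l \<in> Z) \<and>
     (\<forall>l\<in>carrier L. \<forall>l'\<in>carrier L. f (l \<oplus>\<^bsub>L\<^esub> l') = f l \<oplus>\<^bsub>A\<^esub> f l') \<and>
     (\<forall>z\<in>Z. \<forall>l\<in>carrier L. f (\<iota> z \<otimes>\<^bsub>L\<^esub> l) = z \<otimes>\<^bsub>A\<^esub> f l)"

text \<open>
  \<open>L\<close> is a vector space over \<open>Z(A)\<close>, possibly of infinite dimension, so Zorn's lemma gives a subspace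
  \<open>W\<close> that contains \<open>V0\<close> and is maximal among those without \<open>l0\<close>. Maximality forces
  \<open>L = Z l0 \<oplus> W\<close>, and the functional is the coefficient of \<open>l0\<close>.
\<close>

lemma functional_separating:
  assumes V0: "subspace V0" and l0: "l0 \<in> carrier L" "l0 \<notin> V0"
  obtains f where "functional f" "f l0 = \<one>\<^bsub>A\<^esub>" "\<And>l. l \<in> V0 \<Longrightarrow> f l = \<zero>\<^bsub>A\<^esub>"
proof -
  define \<A> where "\<A> = {W. subspace W \<and> V0 \<subseteq> W \<and> l0 \<notin> W}"
  have "\<exists>M\<in>\<A>. \<forall>X\<in>\<A>. M \<subseteq> X \<longrightarrow> X = M"
  proof (rule subset_Zorn_nonempty)
    show "\<A> \<noteq> {}" using V0 l0 by (auto simp: \<A>_def)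
    fix \<C> assume C: "\<C> \<noteq> {}" "subset.chain \<A> \<C>"
    have sub: "\<C> \<subseteq> \<A>" and lin: "\<And>X Y. X \<in> \<C> \<Longrightarrow> Y \<in> \<C> \<Longrightarrow> X \<subseteq> Y \<or> Y \<subseteq> X"
      using C(2) by (auto simp: subset_chain_def)
    have "subspace (\<Union>\<C>)"
      unfolding subspace_def
    proof (intro conjI ballI)
      show "\<Union>\<C> \<subseteq> carrier L" using sub by (auto simp: \<A>_def subspace_def)
      show "\<zero>\<^bsub>L\<^esub> \<in> \<Union>\<C>" using C(1) sub by (auto simp: \<A>_def subspace_def)
      fix x y assume "x \<in> \<Union>\<C>" "y \<in> \<Union>\<C>"
      then obtain X where "X \<in> \<C>" "x \<in> X" "y \<in> X" using lin by blast
      then show "x \<oplus>\<^bsub>L\<^esub> y \<in> \<Union>\<C>" using sub unfolding \<A>_def subspace_def by blast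
    next
      fix z x assume "z \<in> Z" "x \<in> \<Union>\<C>"
      then show "\<iota> z \<otimes>\<^bsub>L\<^esub> x \<in> \<Union>\<C>" using sub unfolding \<A>_def subspace_def by blast
    qed
    moreover have "V0 \<subseteq> \<Union>\<C>" "l0 \<notin> \<Union>\<C>" using C(1) sub unfolding \<A>_def by blast+
    ultimately show "\<Union>\<C> \<in> \<A>" unfolding \<A>_def by blast
  qed
  then obtain W where W: "subspace W" "V0 \<subseteq> W" "l0 \<notin> W"
    and max: "\<And>X. subspace X \<Longrightarrow> W \<subseteq> X \<Longrightarrow> l0 \<notin> X \<Longrightarrow> X = W"
    unfolding \<A>_def by auto
  have W_closed: "x \<in> W \<Longrightarrow> x \<in> carrier L" for x using W(1) by (auto simp: subspace_def)
  have W_add: "x \<in> W \<Longrightarrow> y \<in> W \<Longrightarrow> x \<oplus>\<^bsub>L\<^esub> y \<in> W" for x y using W(1) by (auto simp: subspace_def)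
  have W_scale: "z \<in> Z \<Longrightarrow> x \<in> W \<Longrightarrow> \<iota> z \<otimes>\<^bsub>L\<^esub> x \<in> W" for x z using W(1) by (auto simp: subspace_def)
  have W_zero: "\<zero>\<^bsub>L\<^esub> \<in> W" using W(1) by (auto simp: subspace_def)
  have cancel: "z = \<zero>\<^bsub>A\<^esub>" if "z \<in> Z" "\<iota> z \<otimes>\<^bsub>L\<^esub> l \<in> W" "l \<in> carrier L" "l \<notin> W" for z l
  proof (rule ccontr)
    assume "z \<noteq> \<zero>\<^bsub>A\<^esub>"
    then have "\<exists>z'\<in>Z. z' \<otimes>\<^bsub>A\<^esub> z = \<one>\<^bsub>A\<^esub>" using center_inverse that(1) by blast
    then obtain z' where z': "z' \<in> Z" "z' \<otimes>\<^bsub>A\<^esub> z = \<one>\<^bsub>A\<^esub>" by blast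
    have "\<iota> z' \<otimes>\<^bsub>L\<^esub> (\<iota> z \<otimes>\<^bsub>L\<^esub> l) = l"
      using that z' by (simp add: \<iota>_closed \<iota>_one flip: B.m_assoc \<iota>_mult)
    then show False using W_scale[OF z'(1) that(2)] that(4) by simp
  qed
  have ex: "\<exists>z\<in>Z. \<exists>w\<in>W. l = \<iota> z \<otimes>\<^bsub>L\<^esub> l0 \<oplus>\<^bsub>L\<^esub> w" if l: "l \<in> carrier L" for l
  proof (cases "l \<in> W")
    case True
    then show ?thesis using l l0(1) Z_zero
      by (intro bexI[of _ "\<zero>\<^bsub>A\<^esub>"] bexI[of _ l]) (auto simp: \<iota>_zero)
  next
    case False
    define X where "X = {\<iota> z \<otimes>\<^bsub>L\<^esub> l \<oplus>\<^bsub>L\<^esub> w | z w. z \<in> Z \<and> w \<in> W}"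
    have "subspace X"
      unfolding subspace_def
    proof (intro conjI ballI)
      show "X \<subseteq> carrier L" using W_closed l \<iota>_closed by (auto simp: X_def)
      show "\<zero>\<^bsub>L\<^esub> \<in> X" unfolding X_def using W_zero Z_zero l
        by (intro CollectI exI[of _ "\<zero>\<^bsub>A\<^esub>"] exI[of _ "\<zero>\<^bsub>L\<^esub>"]) (auto simp: \<iota>_zero)
      fix x y assume "x \<in> X" "y \<in> X"
      then obtain z w z' w' where *: "x = \<iota> z \<otimes>\<^bsub>L\<^esub> l \<oplus>\<^bsub>L\<^esub> w" "z \<in> Z" "w \<in> W"
        "y = \<iota> z' \<otimes>\<^bsub>L\<^esub> l \<oplus>\<^bsub>L\<^esub> w'" "z' \<in> Z" "w' \<in> W" unfolding X_def by blast
      have "x \<oplus>\<^bsub>L\<^esub> y = \<iota> (z \<oplus>\<^bsub>A\<^esub> z') \<otimes>\<^bsub>L\<^esub> l \<oplus>\<^bsub>L\<^esub> (w \<oplus>\<^bsub>L\<^esub> w')"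
        using * l W_closed \<iota>_closed by (simp add: \<iota>_add B.l_distr B.add.m_ac)
      then show "x \<oplus>\<^bsub>L\<^esub> y \<in> X" using * Z_add W_add unfolding X_def by blast
    next
      fix c x assume c: "c \<in> Z" "x \<in> X"
      then obtain z w where *: "x = \<iota> z \<otimes>\<^bsub>L\<^esub> l \<oplus>\<^bsub>L\<^esub> w" "z \<in> Z" "w \<in> W" unfolding X_def by blast
      have "\<iota> c \<otimes>\<^bsub>L\<^esub> x = \<iota> (c \<otimes>\<^bsub>A\<^esub> z) \<otimes>\<^bsub>L\<^esub> l \<oplus>\<^bsub>L\<^esub> (\<iota> c \<otimes>\<^bsub>L\<^esub> w)"
        using * c l W_closed \<iota>_closed by (simp add: \<iota>_mult B.r_distr B.m_assoc)
      then show "\<iota> c \<otimes>\<^bsub>L\<^esub> x \<in> X" using * c Z_mult W_scale unfolding X_def by blast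
    qed
    moreover have "W \<subseteq> X"
      unfolding X_def using l W_closed Z_zero by (force simp: \<iota>_zero)
    moreover have "l \<in> X"
      unfolding X_def using l Z_one W_zero
      by (intro CollectI exI[of _ "\<one>\<^bsub>A\<^esub>"] exI[of _ "\<zero>\<^bsub>L\<^esub>"]) (auto simp: \<iota>_one)
    ultimately have "l0 \<in> X" using max False by blast
    then obtain z w where zw: "l0 = \<iota> z \<otimes>\<^bsub>L\<^esub> l \<oplus>\<^bsub>L\<^esub> w" "z \<in> Z" "w \<in> W" unfolding X_def by blast
    have "z \<noteq> \<zero>\<^bsub>A\<^esub>"
      using zw W(3) l W_closed by (auto simp: \<iota>_zero)
    then obtain z' where z': "z' \<in> Z" "z' \<otimes>\<^bsub>A\<^esub> z = \<one>\<^bsub>A\<^esub>" using center_inverse zw by blast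
    have "\<iota> z' \<otimes>\<^bsub>L\<^esub> l0 = \<iota> (z' \<otimes>\<^bsub>A\<^esub> z) \<otimes>\<^bsub>L\<^esub> l \<oplus>\<^bsub>L\<^esub> \<iota> z' \<otimes>\<^bsub>L\<^esub> w"
      using zw z'(1) l W_closed \<iota>_closed by (simp add: \<iota>_mult B.r_distr B.m_assoc)
    then have "l = \<iota> z' \<otimes>\<^bsub>L\<^esub> l0 \<oplus>\<^bsub>L\<^esub> \<ominus>\<^bsub>L\<^esub> (\<iota> z' \<otimes>\<^bsub>L\<^esub> w)"
      using z' l W_closed[OF zw(3)] \<iota>_closed by (simp add: \<iota>_one B.a_assoc B.r_neg)
    then show ?thesis using z'(1) subspace_neg[OF W(1) W_scale[OF z'(1) zw(3)]] by blast
  qed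
  \<comment> \<open>The coefficient of \<open>l0\<close>; it is unique by \<open>cancel\<close>.\<close>
  define f where "f l = (SOME z. z \<in> Z \<and> (\<exists>w\<in>W. l = \<iota> z \<otimes>\<^bsub>L\<^esub> l0 \<oplus>\<^bsub>L\<^esub> w))" for l
  have f_eq: "f (\<iota> z \<otimes>\<^bsub>L\<^esub> l0 \<oplus>\<^bsub>L\<^esub> w) = z" if "z \<in> Z" "w \<in> W" for z w
  proof -
    have "f (\<iota> z \<otimes>\<^bsub>L\<^esub> l0 \<oplus>\<^bsub>L\<^esub> w) \<in> Z \<and> (\<exists>w'\<in>W. \<iota> z \<otimes>\<^bsub>L\<^esub> l0 \<oplus>\<^bsub>L\<^esub> w = \<iota> (f (\<iota> z \<otimes>\<^bsub>L\<^esub> l0 \<oplus>\<^bsub>L\<^esub> w)) \<otimes>\<^bsub>L\<^esub> l0 \<oplus>\<^bsub>L\<^esub> w')"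
      unfolding f_def by (rule someI[of _ z]) (use that in blast)
    then obtain z' w' where z': "f (\<iota> z \<otimes>\<^bsub>L\<^esub> l0 \<oplus>\<^bsub>L\<^esub> w) = z'" "z' \<in> Z" "w' \<in> W"
      "\<iota> z \<otimes>\<^bsub>L\<^esub> l0 \<oplus>\<^bsub>L\<^esub> w = \<iota> z' \<otimes>\<^bsub>L\<^esub> l0 \<oplus>\<^bsub>L\<^esub> w'" by blast
    have c: "w \<in> carrier L" "w' \<in> carrier L" "\<iota> z \<in> carrier L" "\<iota> z' \<in> carrier L"
      using that z' W_closed \<iota>_closed by auto
    have "\<iota> (z' \<oplus>\<^bsub>A\<^esub> \<ominus>\<^bsub>A\<^esub> z) \<otimes>\<^bsub>L\<^esub> l0 = (\<iota> z' \<otimes>\<^bsub>L\<^esub> l0 \<oplus>\<^bsub>L\<^esub> w') \<oplus>\<^bsub>L\<^esub> (\<ominus>\<^bsub>L\<^esub> w' \<oplus>\<^bsub>L\<^esub> \<ominus>\<^bsub>L\<^esub> (\<iota> z \<otimes>\<^bsub>L\<^esub> l0))"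
      using c l0(1) z'(2) that(1)
      by (simp add: \<iota>_add \<iota>_neg Z_neg B.l_distr B.l_minus B.a_assoc B.r_neg2)
    also have "\<dots> = w \<oplus>\<^bsub>L\<^esub> \<ominus>\<^bsub>L\<^esub> w'"
      unfolding z'(4)[symmetric] using c l0(1) by (simp add: B.add.m_ac B.r_neg B.r_neg1 B.r_neg2)
    finally have "\<iota> (z' \<oplus>\<^bsub>A\<^esub> \<ominus>\<^bsub>A\<^esub> z) \<otimes>\<^bsub>L\<^esub> l0 \<in> W"
      using that(2) z'(3) W_add subspace_neg[OF W(1)] by simp
    then have "z' \<oplus>\<^bsub>A\<^esub> \<ominus>\<^bsub>A\<^esub> z = \<zero>\<^bsub>A\<^esub>"
      using cancel Z_add Z_neg z'(2) that(1) l0(1) W(3) by blast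
    then show ?thesis using z'(1,2) that(1) Z_carrier A.r_right_minus_eq[of z' z] by (simp add: a_minus_def)
  qed
  show thesis
  proof
    show "functional f"
      unfolding functional_def
    proof (intro conjI ballI)
      fix l assume l: "l \<in> carrier L"
      obtain z w where zw: "z \<in> Z" "w \<in> W" "l = \<iota> z \<otimes>\<^bsub>L\<^esub> l0 \<oplus>\<^bsub>L\<^esub> w" using ex[OF l] by blast
      then show "f l \<in> Z" using f_eq by simp
      { fix l' assume l': "l' \<in> carrier L"
        obtain z' w' where zw': "z' \<in> Z" "w' \<in> W" "l' = \<iota> z' \<otimes>\<^bsub>L\<^esub> l0 \<oplus>\<^bsub>L\<^esub> w'" using ex[OF l'] by blast
        have "l \<oplus>\<^bsub>L\<^esub> l' = \<iota> (z \<oplus>\<^bsub>A\<^esub> z') \<otimes>\<^bsub>L\<^esub> l0 \<oplus>\<^bsub>L\<^esub> (w \<oplus>\<^bsub>L\<^esub> w')"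
          using zw zw' l0(1) W_closed \<iota>_closed by (simp add: \<iota>_add B.l_distr B.add.m_ac)
        then show "f (l \<oplus>\<^bsub>L\<^esub> l') = f l \<oplus>\<^bsub>A\<^esub> f l'"
          using f_eq zw zw' Z_add W_add by simp }
      fix c assume c: "c \<in> Z"
      have "\<iota> c \<otimes>\<^bsub>L\<^esub> l = \<iota> (c \<otimes>\<^bsub>A\<^esub> z) \<otimes>\<^bsub>L\<^esub> l0 \<oplus>\<^bsub>L\<^esub> (\<iota> c \<otimes>\<^bsub>L\<^esub> w)"
        using zw c l0(1) W_closed \<iota>_closed by (simp add: \<iota>_mult B.r_distr B.m_assoc)
      then show "f (\<iota> c \<otimes>\<^bsub>L\<^esub> l) = c \<otimes>\<^bsub>A\<^esub> f l"
        using f_eq zw c Z_mult W_scale by simp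
    qed
    show "f l0 = \<one>\<^bsub>A\<^esub>" using f_eq[OF Z_one W_zero] l0(1) by (simp add: \<iota>_one)
    show "f l = \<zero>\<^bsub>A\<^esub>" if "l \<in> V0" for l
      using f_eq[OF Z_zero, of l] that W(2) W_closed l0(1) by (auto simp: \<iota>_zero)
  qed
qed

text \<open>
  \<open>\<Phi>\<close> is \<open>id \<otimes> f\<close>, a map of \<open>A\<close>-bimodules from \<open>A \<otimes> L\<close> to \<open>A\<close>. It takes the place of a choice of a basis of \<open>L\<close>.
\<close>

definition lifts :: "('l \<Rightarrow> 'a) \<Rightarrow> (('a \<times> 'l \<Rightarrow>\<^sub>0 int) set \<Rightarrow> 'a) \<Rightarrow> bool" where
  "lifts f \<Phi> \<longleftrightarrow> (\<forall>x\<in>carrier Q. \<Phi> x \<in> carrier A) \<and>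
     (\<forall>x\<in>carrier Q. \<forall>y\<in>carrier Q. \<Phi> (x \<oplus>\<^bsub>Q\<^esub> y) = \<Phi> x \<oplus>\<^bsub>A\<^esub> \<Phi> y) \<and>
     (\<forall>a\<in>carrier A. \<forall>l\<in>carrier L. \<Phi> (tens a l) = a \<otimes>\<^bsub>A\<^esub> f l) \<and>
     (\<forall>c\<in>carrier A. \<forall>x\<in>carrier Q. \<Phi> (tens c \<one>\<^bsub>L\<^esub> \<otimes>\<^bsub>Q\<^esub> x) = c \<otimes>\<^bsub>A\<^esub> \<Phi> x \<and>
        \<Phi> (x \<otimes>\<^bsub>Q\<^esub> tens c \<one>\<^bsub>L\<^esub>) = \<Phi> x \<otimes>\<^bsub>A\<^esub> c)"

lemma functional_lift:
  assumes f: "functional f"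
  shows "\<exists>\<Phi>. lifts f \<Phi>"
proof -
  have fZ: "f l \<in> Z" if "l \<in> carrier L" for l using f that by (simp add: functional_def)
  note fA = Z_carrier[OF fZ]
  have "abelian_group A" by unfold_locales
  then obtain \<Phi> where closed: "\<And>x. x \<in> carrier Q \<Longrightarrow> \<Phi> x \<in> carrier A"
    and add: "\<And>x y. x \<in> carrier Q \<Longrightarrow> y \<in> carrier Q \<Longrightarrow> \<Phi> (x \<oplus>\<^bsub>Q\<^esub> y) = \<Phi> x \<oplus>\<^bsub>A\<^esub> \<Phi> y"
    and tens: "\<And>a l. a \<in> carrier A \<Longrightarrow> l \<in> carrier L \<Longrightarrow> \<Phi> (tens a l) = a \<otimes>\<^bsub>A\<^esub> f l"
  proof (rule tens_lift[where f = "\<lambda>a l. a \<otimes>\<^bsub>A\<^esub> f l"])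
    show "a \<otimes>\<^bsub>A\<^esub> r \<otimes>\<^bsub>A\<^esub> f b = a \<otimes>\<^bsub>A\<^esub> f (\<iota> r \<otimes>\<^bsub>L\<^esub> b)" if "a \<in> carrier A" "r \<in> Z" "b \<in> carrier L" for a r b
      using that f fA Z_carrier by (simp add: functional_def A.m_assoc)
  qed (use f fA in \<open>auto simp: functional_def A.l_distr A.r_distr\<close>)
  have zero: "\<Phi> \<zero>\<^bsub>Q\<^esub> = \<zero>\<^bsub>A\<^esub>"
    using add[of "\<zero>\<^bsub>Q\<^esub>" "\<zero>\<^bsub>Q\<^esub>"] closed[of "\<zero>\<^bsub>Q\<^esub>"] by simp
  have "\<Phi> (tens c \<one>\<^bsub>L\<^esub> \<otimes>\<^bsub>Q\<^esub> x) = c \<otimes>\<^bsub>A\<^esub> \<Phi> x"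
    if c: "c \<in> carrier A" and x: "x \<in> carrier Q" for c x
    using x by (induction x rule: tens_induct)
      (simp_all add: c zero tens_closed Q.r_distr add tens_mult tens closed fA A.r_distr A.m_assoc)
  moreover have "\<Phi> (x \<otimes>\<^bsub>Q\<^esub> tens c \<one>\<^bsub>L\<^esub>) = \<Phi> x \<otimes>\<^bsub>A\<^esub> c"
    if c: "c \<in> carrier A" and x: "x \<in> carrier Q" for c x
  proof -
    have comm: "a \<otimes>\<^bsub>A\<^esub> c \<otimes>\<^bsub>A\<^esub> f l = a \<otimes>\<^bsub>A\<^esub> f l \<otimes>\<^bsub>A\<^esub> c" if "a \<in> carrier A" "l \<in> carrier L" for a l
      using that c fZ[of l] by (simp add: Z_iff A.m_assoc)
    show ?thesis
      using x by (induction x rule: tens_induct)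
        (simp_all add: c zero tens_closed Q.l_distr add tens_mult tens closed fA A.l_distr comm)
  qed
  ultimately show ?thesis using closed add tens unfolding lifts_def
    by (intro exI[of _ \<Phi>] conjI ballI) simp_all
qed

text \<open>
  If some \<open>l h\<close> were nonzero, a functional with value \<open>1\<close> there would turn the vanishing sum into a
  nontrivial relation over the center.
\<close>

lemma tens_independent:
  assumes J: "finite J" and x: "x \<in> J \<rightarrow> carrier A" and l: "l \<in> J \<rightarrow> carrier L"
    and indep: "\<And>c. c \<in> J \<rightarrow> Z \<Longrightarrow> (\<Oplus>\<^bsub>A\<^esub>h\<in>J. x h \<otimes>\<^bsub>A\<^esub> c h) = \<zero>\<^bsub>A\<^esub> \<Longrightarrow> \<forall>h\<in>J. c h = \<zero>\<^bsub>A\<^esub>"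
    and zero: "(\<Oplus>\<^bsub>Q\<^esub>h\<in>J. tens (x h) (l h)) = \<zero>\<^bsub>Q\<^esub>" and h: "h \<in> J"
  shows "l h = \<zero>\<^bsub>L\<^esub>"
proof (rule ccontr)
  assume "l h \<noteq> \<zero>\<^bsub>L\<^esub>"
  moreover have "subspace {\<zero>\<^bsub>L\<^esub>}" by (auto simp: subspace_def \<iota>_closed)
  ultimately obtain f where f: "functional f" "f (l h) = \<one>\<^bsub>A\<^esub>"
    using functional_separating[of "{\<zero>\<^bsub>L\<^esub>}" "l h"] l h by blast
  obtain \<Phi> where \<Phi>: "lifts f \<Phi>" using functional_lift[OF f(1)] by blast
  have closed: "\<And>x. x \<in> carrier Q \<Longrightarrow> \<Phi> x \<in> carrier A"
    and add: "\<And>x y. x \<in> carrier Q \<Longrightarrow> y \<in> carrier Q \<Longrightarrow> \<Phi> (x \<oplus>\<^bsub>Q\<^esub> y) = \<Phi> x \<oplus>\<^bsub>A\<^esub> \<Phi> y"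
    and tens: "\<And>a l. a \<in> carrier A \<Longrightarrow> l \<in> carrier L \<Longrightarrow> \<Phi> (tens a l) = a \<otimes>\<^bsub>A\<^esub> f l"
    using \<Phi> unfolding lifts_def by blast+
  have fZ: "f (l h) \<in> Z" if "h \<in> J" for h using f(1) l that by (auto simp: functional_def)
  have "\<Phi> (\<Oplus>\<^bsub>Q\<^esub>h\<in>J. tens (x h) (l h)) = (\<Oplus>\<^bsub>A\<^esub>h\<in>J. \<Phi> (tens (x h) (l h)))"
    using x l tens_closed
    by (intro additive_map_finsum[OF Q.abelian_group_axioms A.abelian_group_axioms closed add]) (auto simp: Pi_iff)
  also have "\<dots> = (\<Oplus>\<^bsub>A\<^esub>h\<in>J. x h \<otimes>\<^bsub>A\<^esub> f (l h))"
    using x l Z_carrier[OF fZ] by (intro A.finsum_cong') (auto simp: tens Pi_iff)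
  moreover have "\<Phi> \<zero>\<^bsub>Q\<^esub> = \<zero>\<^bsub>A\<^esub>"
    using add[of "\<zero>\<^bsub>Q\<^esub>" "\<zero>\<^bsub>Q\<^esub>"] closed[of "\<zero>\<^bsub>Q\<^esub>"] by simp
  ultimately have "(\<Oplus>\<^bsub>A\<^esub>h\<in>J. x h \<otimes>\<^bsub>A\<^esub> f (l h)) = \<zero>\<^bsub>A\<^esub>" using zero by simp
  then have "\<forall>h\<in>J. f (l h) = \<zero>\<^bsub>A\<^esub>" using fZ by (intro indep[of "\<lambda>h. f (l h)"]) blast+
  then have "\<one>\<^bsub>A\<^esub> = \<zero>\<^bsub>A\<^esub>" using f(2) h by simp
  then show False using \<iota>_one \<iota>_zero L.one_not_zero by simp
qed

lemma tens_one_inj: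
  assumes "l \<in> carrier L" "l' \<in> carrier L" "tens \<one>\<^bsub>A\<^esub> l = tens \<one>\<^bsub>A\<^esub> l'"
  shows "l = l'"
proof -
  have "tens \<one>\<^bsub>A\<^esub> (l \<oplus>\<^bsub>L\<^esub> \<ominus>\<^bsub>L\<^esub> l') = tens \<one>\<^bsub>A\<^esub> (l' \<oplus>\<^bsub>L\<^esub> \<ominus>\<^bsub>L\<^esub> l')"
    using assms by (simp add: tens_add_right del: B.r_neg)
  then have z: "tens \<one>\<^bsub>A\<^esub> (l \<oplus>\<^bsub>L\<^esub> \<ominus>\<^bsub>L\<^esub> l') = \<zero>\<^bsub>Q\<^esub>"
    using assms tens_zero_right[of "\<one>\<^bsub>A\<^esub>"] by (simp add: B.r_neg)
  have "l \<oplus>\<^bsub>L\<^esub> \<ominus>\<^bsub>L\<^esub> l' = \<zero>\<^bsub>L\<^esub>"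
    by (rule tens_independent[of "{0::nat}" "\<lambda>_. \<one>\<^bsub>A\<^esub>" "\<lambda>_. l \<oplus>\<^bsub>L\<^esub> \<ominus>\<^bsub>L\<^esub> l'" 0])
      (use assms z tens_closed in \<open>auto simp: Z_carrier\<close>)
  then show ?thesis using assms B.r_right_minus_eq[of l l'] by (simp add: a_minus_def)
qed

lemma tens_sum_representation:
  assumes "x \<in> carrier Q"
  shows "\<exists>(J :: nat set) a l. finite J \<and> a \<in> J \<rightarrow> carrier A \<and> l \<in> J \<rightarrow> carrier L \<and>
    x = (\<Oplus>\<^bsub>Q\<^esub>j\<in>J. tens (a j) (l j))"
  using assms
proof (induction x rule: tens_induct)
  case zero
  show ?case by (intro exI[of _ "{}"]) auto
next
  case (add x a' l')
  then obtain J :: "nat set" and a l where J: "finite J" "a \<in> J \<rightarrow> carrier A" "l \<in> J \<rightarrow> carrier L"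
    "x = (\<Oplus>\<^bsub>Q\<^esub>j\<in>J. tens (a j) (l j))" by blast
  obtain i where i: "i \<notin> J" using J(1) ex_new_if_finite infinite_UNIV_nat by blast
  have "(\<Oplus>\<^bsub>Q\<^esub>j\<in>insert i J. tens ((a(i := a')) j) ((l(i := l')) j)) =
     tens a' l' \<oplus>\<^bsub>Q\<^esub> (\<Oplus>\<^bsub>Q\<^esub>j\<in>J. tens ((a(i := a')) j) ((l(i := l')) j))"
    using J i add tens_closed by (subst Q.finsum_insert) (auto simp: Pi_iff)
  also have "(\<Oplus>\<^bsub>Q\<^esub>j\<in>J. tens ((a(i := a')) j) ((l(i := l')) j)) = x"
    unfolding J(4) using J i tens_closed by (intro Q.finsum_cong') (auto simp: Pi_iff)
  finally have "x \<oplus>\<^bsub>Q\<^esub> tens a' l' = (\<Oplus>\<^bsub>Q\<^esub>j\<in>insert i J. tens ((a(i := a')) j) ((l(i := l')) j))"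
    using add tens_closed by (simp add: Q.a_comm)
  then show ?case using J add
    by (intro exI[of _ "insert i J"] exI[of _ "a(i := a')"] exI[of _ "l(i := l')"]) (auto simp: Pi_iff)
qed

text \<open>
  Write \<open>x = \<Sum> a\<^sub>j \<otimes> l\<^sub>j\<close> with the least possible number of terms. Then no \<open>l\<^sub>i\<close> is a combination
  of the others over \<open>Z(A)\<close>, so a functional singles out \<open>l\<^sub>i\<close>. Its lift is a bimodule map that takes
  \<open>x\<close> to \<open>a\<^sub>i\<close>; as \<open>x\<close> commutes with \<open>A\<close>, every \<open>a\<^sub>i\<close> is central and can be moved across.
\<close>

theorem commutant_of_tens_left:
  assumes x: "x \<in> carrier Q"
    and comm: "\<And>a. a \<in> carrier A \<Longrightarrow> tens a \<one>\<^bsub>L\<^esub> \<otimes>\<^bsub>Q\<^esub> x = x \<otimes>\<^bsub>Q\<^esub> tens a \<one>\<^bsub>L\<^esub>"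
  shows "\<exists>l\<in>carrier L. x = tens \<one>\<^bsub>A\<^esub> l"
proof -
  define rep where "rep J a l \<longleftrightarrow> finite J \<and> a \<in> J \<rightarrow> carrier A \<and> l \<in> J \<rightarrow> carrier L \<and>
    x = (\<Oplus>\<^bsub>Q\<^esub>j\<in>J. tens (a j) (l j))" for J :: "nat set" and a l
  define P where "P r \<longleftrightarrow> (\<exists>J a l. rep J a l \<and> card J = r)" for r
  have "\<exists>r. P r" using tens_sum_representation[OF x] unfolding P_def rep_def by blast
  then have "P (LEAST r. P r)" by (rule LeastI_ex)
  then obtain J a l where J: "rep J a l" and card: "card J = (LEAST r. P r)" unfolding P_def by blast
  have min: "card J \<le> card J'" if "rep J' a' l'" for J' a' l'
    unfolding card using that by (intro Least_le) (auto simp: P_def)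
  have J_fin: "finite J" and a: "a \<in> J \<rightarrow> carrier A" and l: "l \<in> J \<rightarrow> carrier L"
    and x_eq: "x = (\<Oplus>\<^bsub>Q\<^esub>j\<in>J. tens (a j) (l j))" using J by (auto simp: rep_def)
  have aZ: "a i \<in> Z" if i: "i \<in> J" for i
  proof -
    define J' where "J' = J - {i}"
    have J': "finite J'" "J' \<subseteq> J" "i \<notin> J'" "J = insert i J'" using J_fin i by (auto simp: J'_def)
    define comb where "comb c = (\<Oplus>\<^bsub>L\<^esub>j\<in>J'. \<iota> (c j) \<otimes>\<^bsub>L\<^esub> l j)" for c
    define V where "V = {comb c | c. c \<in> J' \<rightarrow> Z}"
    have term_closed: "\<iota> (c j) \<otimes>\<^bsub>L\<^esub> l j \<in> carrier L" if "c \<in> J' \<rightarrow> Z" "j \<in> J'" for c j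
      using that l J'(2) \<iota>_closed by (auto simp: Pi_iff subset_iff)
    have V: "subspace V"
      unfolding subspace_def
    proof (intro conjI ballI)
      show "V \<subseteq> carrier L" unfolding V_def comb_def using term_closed by (auto intro!: B.finsum_closed)
      have "comb (\<lambda>_. \<zero>\<^bsub>A\<^esub>) = (\<Oplus>\<^bsub>L\<^esub>j\<in>J'. \<zero>\<^bsub>L\<^esub>)"
        unfolding comb_def using l J' by (intro B.finsum_cong') (auto simp: \<iota>_zero Pi_iff subset_iff)
      then have "comb (\<lambda>_. \<zero>\<^bsub>A\<^esub>) = \<zero>\<^bsub>L\<^esub>" by simp
      then show "\<zero>\<^bsub>L\<^esub> \<in> V" unfolding V_def using Z_zero by (intro CollectI exI[of _ "\<lambda>_. \<zero>\<^bsub>A\<^esub>"]) auto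
      fix u v assume "u \<in> V" "v \<in> V"
      then obtain c d where c: "u = comb c" "c \<in> J' \<rightarrow> Z" and d: "v = comb d" "d \<in> J' \<rightarrow> Z"
        unfolding V_def by blast
      have "u \<oplus>\<^bsub>L\<^esub> v = (\<Oplus>\<^bsub>L\<^esub>j\<in>J'. \<iota> (c j) \<otimes>\<^bsub>L\<^esub> l j \<oplus>\<^bsub>L\<^esub> \<iota> (d j) \<otimes>\<^bsub>L\<^esub> l j)"
        unfolding c(1) d(1) comb_def using term_closed c d by (intro B.finsum_addf[symmetric]) auto
      also have "\<dots> = comb (\<lambda>j. c j \<oplus>\<^bsub>A\<^esub> d j)"
        unfolding comb_def using c d l J' by (intro B.finsum_cong') (auto simp: \<iota>_add B.l_distr \<iota>_closed Pi_iff Z_add subset_iff)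
      finally show "u \<oplus>\<^bsub>L\<^esub> v \<in> V" unfolding V_def using c d Z_add by (intro CollectI exI[of _ "\<lambda>j. c j \<oplus>\<^bsub>A\<^esub> d j"]) auto
    next
      fix z u assume z: "z \<in> Z" and "u \<in> V"
      then obtain c where c: "u = comb c" "c \<in> J' \<rightarrow> Z" unfolding V_def by blast
      have "\<iota> z \<otimes>\<^bsub>L\<^esub> u = (\<Oplus>\<^bsub>L\<^esub>j\<in>J'. \<iota> z \<otimes>\<^bsub>L\<^esub> (\<iota> (c j) \<otimes>\<^bsub>L\<^esub> l j))"
        unfolding c(1) comb_def using term_closed c z \<iota>_closed J'(1) by (intro B.finsum_rdistr) auto
      also have "\<dots> = comb (\<lambda>j. z \<otimes>\<^bsub>A\<^esub> c j)"
        unfolding comb_def using c z l J' by (intro B.finsum_cong') (auto simp: \<iota>_mult B.m_assoc \<iota>_closed Pi_iff Z_mult subset_iff)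
      finally show "\<iota> z \<otimes>\<^bsub>L\<^esub> u \<in> V" unfolding V_def using c z Z_mult by (intro CollectI exI[of _ "\<lambda>j. z \<otimes>\<^bsub>A\<^esub> c j"]) auto
    qed
    have lV: "l j \<in> V" if j: "j \<in> J'" for j
    proof -
      have "comb (\<lambda>j'. if j' = j then \<one>\<^bsub>A\<^esub> else \<zero>\<^bsub>A\<^esub>) = (\<Oplus>\<^bsub>L\<^esub>j'\<in>J'. if j = j' then l j' else \<zero>\<^bsub>L\<^esub>)"
        unfolding comb_def using l J' by (intro B.finsum_cong') (auto simp: \<iota>_zero \<iota>_one Pi_iff subset_iff)
      also have "\<dots> = l j" using B.finsum_singleton[OF j J'(1), of l] l J'(2) by auto
      finally show ?thesis unfolding V_def using Z_zero Z_one
        by (intro CollectI exI[of _ "\<lambda>j'. if j' = j then \<one>\<^bsub>A\<^esub> else \<zero>\<^bsub>A\<^esub>"]) auto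
    qed
    have "l i \<notin> V"
    proof
      assume "l i \<in> V"
      then obtain c where c: "l i = comb c" "c \<in> J' \<rightarrow> Z" unfolding V_def by blast
      have ai: "a i \<in> carrier A" using a i by auto
      have "x = tens (a i) (l i) \<oplus>\<^bsub>Q\<^esub> (\<Oplus>\<^bsub>Q\<^esub>j\<in>J'. tens (a j) (l j))"
        unfolding x_eq J'(4) using J' a l tens_closed i by (subst Q.finsum_insert) (auto simp: Pi_iff)
      also have "tens (a i) (l i) = (\<Oplus>\<^bsub>Q\<^esub>j\<in>J'. tens (a i) (\<iota> (c j) \<otimes>\<^bsub>L\<^esub> l j))"
        unfolding c(1) comb_def using ai term_closed c(2)
        by (intro additive_map_finsum[OF B.abelian_group_axioms Q.abelian_group_axioms] tens_closed tens_add_right) auto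
      also have "\<dots> = (\<Oplus>\<^bsub>Q\<^esub>j\<in>J'. tens (a i \<otimes>\<^bsub>A\<^esub> c j) (l j))"
        using ai c(2) l J'(2) Z_carrier
        by (intro Q.finsum_cong') (auto simp: tens_balanced \<iota>_closed Pi_iff subset_iff intro!: tens_closed)
      also have "\<dots> \<oplus>\<^bsub>Q\<^esub> (\<Oplus>\<^bsub>Q\<^esub>j\<in>J'. tens (a j) (l j)) =
          (\<Oplus>\<^bsub>Q\<^esub>j\<in>J'. tens (a i \<otimes>\<^bsub>A\<^esub> c j) (l j) \<oplus>\<^bsub>Q\<^esub> tens (a j) (l j))"
        using ai a c(2) l J'(2) Z_carrier
        by (intro Q.finsum_addf[symmetric]) (auto simp: Pi_iff subset_iff intro!: tens_closed)
      also have "\<dots> = (\<Oplus>\<^bsub>Q\<^esub>j\<in>J'. tens (a i \<otimes>\<^bsub>A\<^esub> c j \<oplus>\<^bsub>A\<^esub> a j) (l j))"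
        using ai a c(2) l J'(2) Z_carrier
        by (intro Q.finsum_cong') (auto simp: tens_add_left Pi_iff subset_iff intro!: tens_closed)
      finally have "rep J' (\<lambda>j. a i \<otimes>\<^bsub>A\<^esub> c j \<oplus>\<^bsub>A\<^esub> a j) l"
        unfolding rep_def using J' ai a c(2) l Z_carrier by (auto simp: Pi_iff)
      then show False using min[of J'] J' J_fin by simp
    qed
    then obtain f where f: "functional f" "f (l i) = \<one>\<^bsub>A\<^esub>" "\<And>v. v \<in> V \<Longrightarrow> f v = \<zero>\<^bsub>A\<^esub>"
      using functional_separating[OF V, of "l i"] l i by blast
    obtain \<Phi> where \<Phi>: "lifts f \<Phi>" using functional_lift[OF f(1)] by blast
    have closed: "\<And>x. x \<in> carrier Q \<Longrightarrow> \<Phi> x \<in> carrier A"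
      and add: "\<And>x y. x \<in> carrier Q \<Longrightarrow> y \<in> carrier Q \<Longrightarrow> \<Phi> (x \<oplus>\<^bsub>Q\<^esub> y) = \<Phi> x \<oplus>\<^bsub>A\<^esub> \<Phi> y"
      and tens: "\<And>a l. a \<in> carrier A \<Longrightarrow> l \<in> carrier L \<Longrightarrow> \<Phi> (tens a l) = a \<otimes>\<^bsub>A\<^esub> f l"
      and left: "\<And>c x. c \<in> carrier A \<Longrightarrow> x \<in> carrier Q \<Longrightarrow> \<Phi> (tens c \<one>\<^bsub>L\<^esub> \<otimes>\<^bsub>Q\<^esub> x) = c \<otimes>\<^bsub>A\<^esub> \<Phi> x"
      and right: "\<And>c x. c \<in> carrier A \<Longrightarrow> x \<in> carrier Q \<Longrightarrow> \<Phi> (x \<otimes>\<^bsub>Q\<^esub> tens c \<one>\<^bsub>L\<^esub>) = \<Phi> x \<otimes>\<^bsub>A\<^esub> c"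
      using \<Phi> unfolding lifts_def by blast+
    have "\<Phi> x = (\<Oplus>\<^bsub>A\<^esub>j\<in>J. \<Phi> (tens (a j) (l j)))"
      unfolding x_eq using a l tens_closed
      by (intro additive_map_finsum[OF Q.abelian_group_axioms A.abelian_group_axioms closed add]) (auto simp: Pi_iff)
    also have "\<dots> = (\<Oplus>\<^bsub>A\<^esub>j\<in>J. if i = j then a j else \<zero>\<^bsub>A\<^esub>)"
    proof (intro A.finsum_cong')
      fix j assume j: "j \<in> J"
      then have "a j \<in> carrier A" "l j \<in> carrier L" using a l by auto
      moreover have "f (l j) = \<zero>\<^bsub>A\<^esub>" if "i \<noteq> j" using f(3)[OF lV[of j]] that j J'(4) by blast
      ultimately show "\<Phi> (tens (a j) (l j)) = (if i = j then a j else \<zero>\<^bsub>A\<^esub>)"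
        using f(2) by (cases "i = j") (simp_all add: tens)
    qed (use a in auto)
    also have "\<dots> = a i" using A.finsum_singleton[OF i J_fin, of a] a by auto
    finally have "\<Phi> x = a i" .
    then have "c \<otimes>\<^bsub>A\<^esub> a i = a i \<otimes>\<^bsub>A\<^esub> c" if "c \<in> carrier A" for c
      using left[OF that x] right[OF that x] comm[OF that] by simp
    then show ?thesis using a i by (auto simp: Z_iff)
  qed
  have "x = (\<Oplus>\<^bsub>Q\<^esub>j\<in>J. tens \<one>\<^bsub>A\<^esub> (\<iota> (a j) \<otimes>\<^bsub>L\<^esub> l j))"
    unfolding x_eq
  proof (intro Q.finsum_cong')
    fix j assume j: "j \<in> J"
    have "tens (\<one>\<^bsub>A\<^esub> \<otimes>\<^bsub>A\<^esub> a j) (l j) = tens \<one>\<^bsub>A\<^esub> (\<iota> (a j) \<otimes>\<^bsub>L\<^esub> l j)"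
      by (rule tens_balanced) (use aZ j l in auto)
    then show "tens (a j) (l j) = tens \<one>\<^bsub>A\<^esub> (\<iota> (a j) \<otimes>\<^bsub>L\<^esub> l j)" using Z_carrier[OF aZ[OF j]] by simp
  qed (use aZ l \<iota>_closed in \<open>auto intro!: tens_closed\<close>)
  also have "\<dots> = tens \<one>\<^bsub>A\<^esub> (\<Oplus>\<^bsub>L\<^esub>j\<in>J. \<iota> (a j) \<otimes>\<^bsub>L\<^esub> l j)"
    using aZ l \<iota>_closed
    by (intro additive_map_finsum[OF B.abelian_group_axioms Q.abelian_group_axioms, symmetric] tens_closed tens_add_right)
      (auto simp: Pi_iff)
  finally show ?thesis using aZ l \<iota>_closed by (intro bexI) (auto intro!: B.finsum_closed)
qed

end

section \<open>Matrix units in a split algebra\<close>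

lemma mat_galg_ring: "ring (mat_galg n :: ('k::field mat, 'k, 'g) galg)"
  by (rule ring_if_same_operations[OF ring_mat[of n "()"]])
    (simp_all add: mat_galg_def ring_mat_def)

lemma mat_galg_gring: "gring G (mat_galg n :: ('k::field mat, 'k, 'g) galg)"
  unfolding gring_def using mat_galg_ring
  by (auto simp: mat_galg_def intro!: ring_hom_memI)

lemma galg_centerI:
  "z \<in> carrier B \<Longrightarrow> (\<And>b. b \<in> carrier B \<Longrightarrow> z \<otimes>\<^bsub>B\<^esub> b = b \<otimes>\<^bsub>B\<^esub> z) \<Longrightarrow> z \<in> carrier (galg_center B)"
  by (simp add: galg_center_def)

lemma galg_center_gring:
  assumes G: "group G" and B: "gring G B"
  shows "gring G (galg_center B)"
proof -
  interpret G: group G by fact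
  interpret B: ring B using gring_ring[OF B] .
  have ops: "add (galg_center B) = add B" "mult (galg_center B) = mult B" "one (galg_center B) = one B"
    "\<zero>\<^bsub>galg_center B\<^esub> = \<zero>\<^bsub>B\<^esub>" "act (galg_center B) = act B"
    by (simp_all add: galg_center_def)
  have mem: "z \<in> carrier (galg_center B) \<longleftrightarrow> z \<in> carrier B \<and> (\<forall>a\<in>carrier B. z \<otimes>\<^bsub>B\<^esub> a = a \<otimes>\<^bsub>B\<^esub> z)" for z
    by (simp add: galg_center_def)
  have m_closed: "x \<otimes>\<^bsub>B\<^esub> y \<in> carrier (galg_center B)"
    if "x \<in> carrier (galg_center B)" "y \<in> carrier (galg_center B)" for x y
    using that unfolding mem by (metis B.m_assoc B.m_closed)
  have a_closed: "x \<oplus>\<^bsub>B\<^esub> y \<in> carrier (galg_center B)"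
    if "x \<in> carrier (galg_center B)" "y \<in> carrier (galg_center B)" for x y
    using that unfolding mem by (auto simp: B.l_distr B.r_distr)
  have memB: "x \<in> carrier B" if "x \<in> carrier (galg_center B)" for x using that by (simp add: mem)
  have "\<zero>\<^bsub>B\<^esub> \<in> carrier (galg_center B)" "\<one>\<^bsub>B\<^esub> \<in> carrier (galg_center B)" by (simp_all add: mem)
  note cl = this a_closed m_closed
  have "ring (galg_center B)"
  proof (intro ringI abelian_groupI monoidI, unfold ops)
    show "\<exists>y\<in>carrier (galg_center B). y \<oplus>\<^bsub>B\<^esub> x = \<zero>\<^bsub>B\<^esub>" if "x \<in> carrier (galg_center B)" for x
      using that by (intro bexI[of _ "\<ominus>\<^bsub>B\<^esub> x"]) (auto simp: mem B.l_minus B.r_minus B.l_neg)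
  qed (simp_all only: cl, simp_all add: memB B.m_assoc B.add.m_ac B.l_distr B.r_distr)
  moreover have "act B g \<in> ring_hom (galg_center B) (galg_center B)"
    and "z \<in> carrier (galg_center B) \<Longrightarrow> act B g (act B (inv\<^bsub>G\<^esub> g) z) = z" if g: "g \<in> carrier G" for g z
  proof -
    note hom = gring_hom[OF B g] and hom' = gring_hom[OF B G.inv_closed[OF g]]
    show "act B g (act B (inv\<^bsub>G\<^esub> g) z) = z" if "z \<in> carrier (galg_center B)"
      using that gring_inv[OF B g] mem by blast
    show "act B g \<in> ring_hom (galg_center B) (galg_center B)"
    proof (rule ring_hom_memI, unfold ops)
      fix x assume x: "x \<in> carrier (galg_center B)"
      then have xB: "x \<in> carrier B" by (simp add: mem)
      show "act B g x \<in> carrier (galg_center B)"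
        unfolding mem
      proof (intro conjI ballI)
        fix a assume a: "a \<in> carrier B"
        let ?a = "act B (inv\<^bsub>G\<^esub> g) a"
        have a': "?a \<in> carrier B" using ring_hom_closed[OF hom' a] .
        then have "x \<otimes>\<^bsub>B\<^esub> ?a = ?a \<otimes>\<^bsub>B\<^esub> x" using x mem by blast
        then have "act B g x \<otimes>\<^bsub>B\<^esub> act B g ?a = act B g ?a \<otimes>\<^bsub>B\<^esub> act B g x"
          using ring_hom_mult[OF hom xB a'] ring_hom_mult[OF hom a' xB] by simp
        then show "act B g x \<otimes>\<^bsub>B\<^esub> a = a \<otimes>\<^bsub>B\<^esub> act B g x" using gring_inv[OF B g a] by simp
      qed (rule ring_hom_closed[OF hom xB])
      fix y assume "y \<in> carrier (galg_center B)"
      then have yB: "y \<in> carrier B" by (simp add: mem)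
      show "act B g (x \<otimes>\<^bsub>B\<^esub> y) = act B g x \<otimes>\<^bsub>B\<^esub> act B g y" "act B g (x \<oplus>\<^bsub>B\<^esub> y) = act B g x \<oplus>\<^bsub>B\<^esub> act B g y"
        using ring_hom_mult[OF hom xB yB] ring_hom_add[OF hom xB yB] .
    qed (rule ring_hom_one[OF hom])
  qed
  ultimately show ?thesis unfolding gring_def ops by blast
qed

definition unit_mat :: "nat \<Rightarrow> nat \<Rightarrow> nat \<Rightarrow> 'k::field mat" where
  "unit_mat n i j = mat n n (\<lambda>(a, b). if a = i \<and> b = j then 1 else 0)"

lemma unit_mat_closed: "unit_mat n i j \<in> carrier_mat n n"
  by (simp add: unit_mat_def)

text \<open>
  Products with matrix units extract an entry; the matrix units of a split algebra inherit this
  property in the form \<open>e 0 i b e j 0 = d e 0 0\<close> with \<open>d\<close> central.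
\<close>

lemma unit_mat_sandwich:
  assumes "a \<in> carrier_mat n n" "i < n" "j < n" "k < n" "l < n"
  shows "unit_mat n k i * a * unit_mat n j l = (a $$ (i, j)) \<cdot>\<^sub>m unit_mat n k l"
proof (rule eq_matI)
  fix p q assume "p < dim_row ((a $$ (i, j)) \<cdot>\<^sub>m unit_mat n k l)" "q < dim_col ((a $$ (i, j)) \<cdot>\<^sub>m unit_mat n k l)"
  then have pq: "p < n" "q < n" by (auto simp: unit_mat_def)
  have 1: "(unit_mat n k i * a) $$ (p, r) = (if p = k then a $$ (i, r) else 0)" if "r < n" for r
  proof -
    have "(unit_mat n k i * a) $$ (p, r) = (\<Sum>s<n. (if p = k \<and> s = i then 1 else 0) * a $$ (s, r))"
      using assms pq that by (simp add: unit_mat_def scalar_prod_def lessThan_atLeast0)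
    also have "\<dots> = (\<Sum>s<n. if s = i then (if p = k then a $$ (i, r) else 0) else 0)"
      by (rule sum.cong) auto
    finally show ?thesis using assms by simp
  qed
  have "(unit_mat n k i * a * unit_mat n j l) $$ (p, q) =
      (\<Sum>r<n. (unit_mat n k i * a) $$ (p, r) * (if r = j \<and> q = l then 1 else 0))"
    using assms pq by (simp add: unit_mat_def scalar_prod_def lessThan_atLeast0 del: index_mult_mat(1)) 
      (simp add: scalar_prod_def unit_mat_def lessThan_atLeast0)
  also have "\<dots> = (\<Sum>r<n. if r = j then (if p = k \<and> q = l then a $$ (i, j) else 0) else 0)"
    by (rule sum.cong) (auto simp: 1)
  finally show "(unit_mat n k i * a * unit_mat n j l) $$ (p, q) = ((a $$ (i, j)) \<cdot>\<^sub>m unit_mat n k l) $$ (p, q)"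
    using assms pq by (simp add: unit_mat_def)
qed (use assms in \<open>auto simp: unit_mat_def\<close>)

lemma unit_mat_mult:
  assumes "i < n" "j < n" "k < n" "l < n"
  shows "unit_mat n i j * unit_mat n k l = (if j = k then unit_mat n i l else (0\<^sub>m n n :: 'k::field mat))"
proof -
  have "unit_mat n i j * unit_mat n k l = unit_mat n i j * 1\<^sub>m n * (unit_mat n k l :: 'k mat)"
    by (simp only: right_mult_one_mat[OF unit_mat_closed])
  also have "\<dots> = (1\<^sub>m n $$ (j, k)) \<cdot>\<^sub>m unit_mat n i l"
    by (rule unit_mat_sandwich) (use assms in auto)
  finally show ?thesis using assms by (auto simp: unit_mat_def intro!: eq_matI)
qed

lemma finsum_matrices:
  assumes R: "ring R" and sub: "carrier R \<subseteq> carrier_mat n n" and ops: "add R = (+)" "\<zero>\<^bsub>R\<^esub> = (0\<^sub>m n n :: 'f::comm_ring_1 mat)"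
    and "finite J" "f \<in> J \<rightarrow> carrier R"
  shows "(\<Oplus>\<^bsub>R\<^esub>j\<in>J. f j) = mat n n (\<lambda>p. \<Sum>j\<in>J. f j $$ p)"
proof -
  interpret ring R by fact
  show ?thesis using assms(5,6)
  proof (induction J rule: finite_induct)
    case empty
    show ?case unfolding finsum_empty ops by (auto intro!: eq_matI)
  next
    case (insert j J)
    have "(\<Oplus>\<^bsub>R\<^esub>j\<in>insert j J. f j) = f j \<oplus>\<^bsub>R\<^esub> (\<Oplus>\<^bsub>R\<^esub>j\<in>J. f j)"
      using insert by (intro finsum_insert) auto
    also have "\<dots> = f j + mat n n (\<lambda>p. \<Sum>j\<in>J. f j $$ p)"
      using insert by (simp add: ops)
    also have "\<dots> = mat n n (\<lambda>p. \<Sum>j\<in>insert j J. f j $$ p)"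
      using insert sub by (intro eq_matI) auto
    finally show ?case .
  qed
qed

lemma finsum_mat_galg:
  assumes "finite J" "f \<in> J \<rightarrow> carrier_mat n n"
  shows "(\<Oplus>\<^bsub>mat_galg n :: ('k::field mat, 'k, 'g) galg\<^esub>j\<in>J. f j) = mat n n (\<lambda>p. \<Sum>j\<in>J. f j $$ p)"
  using assms by (intro finsum_matrices[OF mat_galg_ring]) (simp_all add: mat_galg_def)

lemma sum_unit_mat:
  "(\<Oplus>\<^bsub>mat_galg n :: ('k::field mat, 'k, 'g) galg\<^esub>i\<in>{..<n}. unit_mat n i i) = 1\<^sub>m n"
proof -
  have "(\<Sum>k<n. unit_mat n k k $$ (i, j)) = (if i = j then 1 else (0 :: 'k))" if "i < n" "j < n" for i j
  proof -
    have "(\<Sum>k<n. unit_mat n k k $$ (i, j)) = (\<Sum>k<n. if k = i then if i = j then 1 else 0 else (0 :: 'k))"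
      by (rule sum.cong) (use that in \<open>auto simp: unit_mat_def\<close>)
    then show ?thesis using that by simp
  qed
  then show ?thesis
    by (subst finsum_mat_galg) (auto simp: unit_mat_closed intro!: eq_matI)
qed

text \<open>
  \<open>G\<close>-fixed matrix units. The last property of the entries says that the corners \<open>e 0 i b e j 0\<close>
  are central multiples of \<open>e 0 0\<close>: this is all that is kept from the tensor product decomposition,
  and it is what defines coordinates.
\<close>

definition is_matrix_units :: "('g, 'z) monoid_scheme \<Rightarrow> nat \<Rightarrow> ('b, 'k, 'g) galg \<Rightarrow> (nat \<Rightarrow> nat \<Rightarrow> 'b) \<Rightarrow> bool" where
  "is_matrix_units G n B e \<longleftrightarrow>
     (\<forall>i<n. \<forall>j<n. e i j \<in> carrier B \<and> (\<forall>g\<in>carrier G. act B g (e i j) = e i j) \<and>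
        (\<forall>k<n. \<forall>l<n. e i j \<otimes>\<^bsub>B\<^esub> e k l = (if j = k then e i l else \<zero>\<^bsub>B\<^esub>)) \<and>
        (\<forall>b\<in>carrier B. \<exists>d\<in>carrier (galg_center B).
            e 0 i \<otimes>\<^bsub>B\<^esub> b \<otimes>\<^bsub>B\<^esub> e j 0 = d \<otimes>\<^bsub>B\<^esub> e 0 0)) \<and>
     (\<Oplus>\<^bsub>B\<^esub>i\<in>{..<n}. e i i) = \<one>\<^bsub>B\<^esub>"

text \<open>
  The units \<open>E\<^sub>i\<^sub>j \<otimes> 1\<close> of \<open>M\<^sub>n(k) \<otimes> Z(B)\<close> are fixed because the action on \<open>M\<^sub>n(k)\<close> is trivial.
  They are carried back to \<open>B\<close> by the inverse of the splitting isomorphism.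
\<close>

theorem matrix_units_of_split:
  fixes B :: "('b, 'k::field, 'g) galg" and G :: "('g, 'z) monoid_scheme"
  assumes G: "group G" and gB: "gring G B"
    and sclr: "\<And>c. sclr B c \<in> carrier (galg_center B)"
    and sclr_fixed: "\<And>g c. g \<in> carrier G \<Longrightarrow> act B g (sclr B c) = sclr B c"
    and n: "n \<ge> 1" and split: "galg_split G n B"
  shows "\<exists>e. is_matrix_units G n B e"
proof -
  let ?M = "mat_galg n :: ('k mat, 'k, 'g) galg" and ?Z = "galg_center B"
  have M: "carrier ?M = carrier_mat n n" "mult ?M = (*)" "one ?M = 1\<^sub>m n" "act ?M g = (\<lambda>a. a)"
    for g by (simp_all add: mat_galg_def)
  have sclr_M: "sclr ?M c = c \<cdot>\<^sub>m 1\<^sub>m n" for c by (simp add: mat_galg_def)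
  have Z: "mult ?Z = mult B" "one ?Z = one B" "act ?Z = act B" "add ?Z = add B"
    by (simp_all add: galg_center_def)
  have sclr_Z: "sclr ?Z = sclr B" by (simp add: galg_center_def)
  have Z_mem: "z \<in> carrier ?Z \<longleftrightarrow> z \<in> carrier B \<and> (\<forall>a\<in>carrier B. z \<otimes>\<^bsub>B\<^esub> a = a \<otimes>\<^bsub>B\<^esub> z)" for z
    by (simp add: galg_center_def)
  interpret B: ring B using gring_ring[OF gB] .
  interpret C: equivariant_tensor ?M ?Z "UNIV :: 'k set" "sclr ?M" "sclr ?Z" G
  proof (intro equivariant_tensor.intro tensor_product.intro ring_pair.intro)
    show "ring ?M" by (rule mat_galg_ring)
    show "ring ?Z" by (rule gring_ring[OF galg_center_gring[OF G gB]])
    show "group G" by fact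
    show "tensor_product_axioms ?M ?Z UNIV (sclr ?M) (sclr ?Z)"
    proof
      fix c :: 'k and a assume "a \<in> carrier ?M"
      then have a: "a \<in> carrier_mat n n" by (simp add: M)
      show "sclr ?M c \<otimes>\<^bsub>?M\<^esub> a = a \<otimes>\<^bsub>?M\<^esub> sclr ?M c"
        using mult_smult_assoc_mat[of "1\<^sub>m n" n n a n c] mult_smult_distrib[of a n n "1\<^sub>m n" n c] a by (simp add: M sclr_M)
    next
      fix c b assume "b \<in> carrier ?Z"
      then show "sclr ?Z c \<otimes>\<^bsub>?Z\<^esub> b = b \<otimes>\<^bsub>?Z\<^esub> sclr ?Z c" unfolding Z sclr_Z using sclr[of c] Z_mem by blast
    qed (use sclr in \<open>auto simp: M Z sclr_M sclr_Z\<close>)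
    show "equivariant_tensor_axioms ?M ?Z UNIV (sclr ?M) (sclr ?Z) G"
    proof
      fix g and r :: 'k assume "g \<in> carrier G"
      then show "\<exists>r'\<in>UNIV. sclr ?M r' = act ?M g (sclr ?M r) \<and> sclr ?Z r' = act ?Z g (sclr ?Z r)"
        using sclr_fixed by (intro bexI[of _ r]) (auto simp: M Z sclr_M sclr_Z)
    qed (use mat_galg_gring galg_center_gring[OF G gB] in auto)
  qed
  let ?C = "C.Q"
  obtain \<psi> where \<psi>: "\<psi> \<in> galg_hom G B ?C" and bij: "bij_betw \<psi> (carrier B) (carrier ?C)"
    using split unfolding galg_split_def galg_iso_def by blast
  have hom: "\<psi> \<in> ring_hom B ?C" and equi: "\<And>g a. g \<in> carrier G \<Longrightarrow> a \<in> carrier B \<Longrightarrow> \<psi> (act B g a) = act ?C g (\<psi> a)"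
    using \<psi> unfolding galg_hom_def by auto
  have inj: "x = y" if "\<psi> x = \<psi> y" "x \<in> carrier B" "y \<in> carrier B" for x y
    using bij that by (auto simp: bij_betw_def inj_on_def)
  define \<chi> where "\<chi> = inv_into (carrier B) \<psi>"
  have \<chi>: "\<chi> c \<in> carrier B" "\<psi> (\<chi> c) = c" if "c \<in> carrier ?C" for c
    unfolding \<chi>_def using that bij_betw_inv_into_right[OF bij] bij_betwE[OF bij_betw_inv_into[OF bij]] by simp_all
  note hom_simps = ring_hom_mult[OF hom] ring_hom_add[OF hom] ring_hom_one[OF hom] ring_hom_closed[OF hom]
  have one_Z: "\<one>\<^bsub>?Z\<^esub> \<in> carrier ?Z" by (rule C.B.one_closed)
  define E where "E i j = C.tens (unit_mat n i j) \<one>\<^bsub>?Z\<^esub>" for i j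
  have E_closed: "E i j \<in> carrier ?C" for i j
    unfolding E_def by (rule C.tens_closed) (auto simp: M unit_mat_closed)
  have \<psi>_zero: "\<psi> \<zero>\<^bsub>B\<^esub> = \<zero>\<^bsub>?C\<^esub>"
    using ring_hom_zero[OF hom B.ring_axioms C.Q_ring] .
  have E_mult: "E i j \<otimes>\<^bsub>?C\<^esub> E k l = (if j = k then E i l else \<zero>\<^bsub>?C\<^esub>)"
    if "i < n" "j < n" "k < n" "l < n" for i j k l
  proof -
    have "E i j \<otimes>\<^bsub>?C\<^esub> E k l = C.tens (unit_mat n i j * unit_mat n k l) \<one>\<^bsub>?Z\<^esub>"
      unfolding E_def by (subst C.tens_mult) (auto simp: M unit_mat_closed)
    also have "\<dots> = (if j = k then E i l else \<zero>\<^bsub>?C\<^esub>)"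
      using that C.tens_zero_left[OF one_Z] by (simp add: unit_mat_mult E_def) (simp add: mat_galg_def)
    finally show ?thesis .
  qed
  have E_fixed: "act ?C g (E i j) = E i j" if "g \<in> carrier G" for g i j
    unfolding E_def using that
    by (subst C.act_tens) (auto simp: M unit_mat_closed ring_hom_one[OF C.actB])
  have E_sum: "(\<Oplus>\<^bsub>?C\<^esub>i\<in>{..<n}. E i i) = \<one>\<^bsub>?C\<^esub>"
  proof -
    have "(\<Oplus>\<^bsub>?C\<^esub>i\<in>{..<n}. E i i) = C.tens (\<Oplus>\<^bsub>?M\<^esub>i\<in>{..<n}. unit_mat n i i) \<one>\<^bsub>?Z\<^esub>"
      unfolding E_def
      by (intro additive_map_finsum[OF C.A.abelian_group_axioms C.Q.abelian_group_axioms, symmetric]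
          C.tens_closed C.tens_add_left one_Z) (auto simp: M unit_mat_closed)
    then show ?thesis by (simp add: sum_unit_mat C.tens_one M)
  qed
  have E_sandwich: "\<exists>z\<in>carrier ?Z. E 0 i \<otimes>\<^bsub>?C\<^esub> c \<otimes>\<^bsub>?C\<^esub> E j 0 = C.tens (1\<^sub>m n) z \<otimes>\<^bsub>?C\<^esub> E 0 0"
    if c: "c \<in> carrier ?C" and ij: "i < n" "j < n" for c i j
    using c
  proof (induction c rule: C.tens_induct)
    case zero
    have "C.tens (1\<^sub>m n) \<zero>\<^bsub>?Z\<^esub> = \<zero>\<^bsub>?C\<^esub>" by (rule C.tens_zero_right) (simp add: M)
    then show ?case using E_closed by (intro bexI[of _ "\<zero>\<^bsub>?Z\<^esub>"]) auto
  next
    case (add x a b)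
    then obtain z where z: "z \<in> carrier ?Z" "E 0 i \<otimes>\<^bsub>?C\<^esub> x \<otimes>\<^bsub>?C\<^esub> E j 0 = C.tens (1\<^sub>m n) z \<otimes>\<^bsub>?C\<^esub> E 0 0"
      by blast
    have a: "a \<in> carrier_mat n n" using add by (simp add: M)
    let ?s = "sclr ?Z (a $$ (i, j))"
    have s: "?s \<in> carrier ?Z" using sclr by (simp add: sclr_Z)
    have "E 0 i \<otimes>\<^bsub>?C\<^esub> C.tens a b \<otimes>\<^bsub>?C\<^esub> E j 0 = C.tens (unit_mat n 0 i * a * unit_mat n j 0) b"
      unfolding E_def using add a
      by (simp add: C.tens_mult M unit_mat_closed mult_carrier_mat[OF unit_mat_closed])
    also have "unit_mat n 0 i * a * unit_mat n j 0 = unit_mat n 0 0 \<otimes>\<^bsub>?M\<^esub> sclr ?M (a $$ (i, j))"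
    proof -
      have "unit_mat n 0 i * a * unit_mat n j 0 = a $$ (i, j) \<cdot>\<^sub>m unit_mat n 0 0"
        by (rule unit_mat_sandwich) (use a ij n in auto)
      moreover have "unit_mat n 0 0 * (c \<cdot>\<^sub>m 1\<^sub>m n) = c \<cdot>\<^sub>m unit_mat n 0 0" for c :: 'k
        using mult_smult_distrib[OF unit_mat_closed one_carrier_mat] right_mult_one_mat[OF unit_mat_closed] by metis
      ultimately show ?thesis by (simp add: M sclr_M)
    qed
    also have "C.tens \<dots> b = C.tens (unit_mat n 0 0) (?s \<otimes>\<^bsub>?Z\<^esub> b)"
      by (rule C.tens_balanced) (use add unit_mat_closed in \<open>auto simp: M\<close>)
    also have "\<dots> = C.tens (1\<^sub>m n) (?s \<otimes>\<^bsub>?Z\<^esub> b) \<otimes>\<^bsub>?C\<^esub> E 0 0"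
      unfolding E_def using s add by (subst C.tens_mult) (simp_all add: M unit_mat_closed left_mult_one_mat[OF unit_mat_closed])
    finally have *: "E 0 i \<otimes>\<^bsub>?C\<^esub> C.tens a b \<otimes>\<^bsub>?C\<^esub> E j 0 = C.tens (1\<^sub>m n) (?s \<otimes>\<^bsub>?Z\<^esub> b) \<otimes>\<^bsub>?C\<^esub> E 0 0" .
    have cl: "C.tens a b \<in> carrier ?C" "C.tens (1\<^sub>m n) z \<in> carrier ?C" "C.tens (1\<^sub>m n) (?s \<otimes>\<^bsub>?Z\<^esub> b) \<in> carrier ?C"
      using add z s by (auto intro!: C.tens_closed simp: M)
    have "E 0 i \<otimes>\<^bsub>?C\<^esub> (x \<oplus>\<^bsub>?C\<^esub> C.tens a b) \<otimes>\<^bsub>?C\<^esub> E j 0 = C.tens (1\<^sub>m n) (z \<oplus>\<^bsub>?Z\<^esub> ?s \<otimes>\<^bsub>?Z\<^esub> b) \<otimes>\<^bsub>?C\<^esub> E 0 0"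
      using add z s * cl E_closed
      by (simp add: C.tens_add_right M C.Q.l_distr C.Q.r_distr)
    then show ?case using z s add by (intro bexI[of _ "z \<oplus>\<^bsub>?Z\<^esub> ?s \<otimes>\<^bsub>?Z\<^esub> b"]) auto
  qed
  have central: "C.tens (1\<^sub>m n) z \<otimes>\<^bsub>?C\<^esub> c = c \<otimes>\<^bsub>?C\<^esub> C.tens (1\<^sub>m n) z"
    if z: "z \<in> carrier ?Z" and c: "c \<in> carrier ?C" for z c
    using c
  proof (induction c rule: C.tens_induct)
    case zero
    have "C.tens (1\<^sub>m n) z \<in> carrier ?C" by (rule C.tens_closed) (use z in \<open>simp_all add: M\<close>)
    then show ?case by simp
  next
    case (add x a b)
    have cl: "C.tens (1\<^sub>m n) z \<in> carrier ?C" "C.tens a b \<in> carrier ?C"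
      by (rule C.tens_closed; use z add in \<open>simp_all add: M\<close>)+
    have "z \<otimes>\<^bsub>B\<^esub> b = b \<otimes>\<^bsub>B\<^esub> z" using z add(3) Z_mem by blast
    then have "C.tens (1\<^sub>m n) z \<otimes>\<^bsub>?C\<^esub> C.tens a b = C.tens a b \<otimes>\<^bsub>?C\<^esub> C.tens (1\<^sub>m n) z"
      using z add by (simp add: C.tens_mult M Z)
    then show ?case using cl add by (simp add: C.Q.l_distr C.Q.r_distr)
  qed
  define e where "e i j = \<chi> (E i j)" for i j
  have e: "e i j \<in> carrier B" "\<psi> (e i j) = E i j" for i j
    unfolding e_def using \<chi> E_closed by auto
  have "is_matrix_units G n B e"
    unfolding is_matrix_units_def
  proof (intro conjI allI impI ballI)
    fix i j assume ij: "i < n" "j < n"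
    show "e i j \<in> carrier B" by (rule e)
    show "act B g (e i j) = e i j" if "g \<in> carrier G" for g
      using that e E_fixed equi ring_hom_closed[OF gring_hom[OF gB that] e(1)] by (intro inj) simp_all
    show "e i j \<otimes>\<^bsub>B\<^esub> e k l = (if j = k then e i l else \<zero>\<^bsub>B\<^esub>)" if "k < n" "l < n" for k l
      using ij that e by (intro inj) (simp_all add: hom_simps E_mult \<psi>_zero)
    fix b assume b: "b \<in> carrier B"
    from E_sandwich[OF ring_hom_closed[OF hom b] ij] obtain z where z: "z \<in> carrier ?Z"
      "E 0 i \<otimes>\<^bsub>?C\<^esub> \<psi> b \<otimes>\<^bsub>?C\<^esub> E j 0 = C.tens (1\<^sub>m n) z \<otimes>\<^bsub>?C\<^esub> E 0 0"
      by (rule bexE)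
    let ?d = "\<chi> (C.tens (1\<^sub>m n) z)"
    have t: "C.tens (1\<^sub>m n) z \<in> carrier ?C" by (rule C.tens_closed) (use z in \<open>simp_all add: M\<close>)
    show "\<exists>d\<in>carrier ?Z. e 0 i \<otimes>\<^bsub>B\<^esub> b \<otimes>\<^bsub>B\<^esub> e j 0 = d \<otimes>\<^bsub>B\<^esub> e 0 0"
    proof
      show "e 0 i \<otimes>\<^bsub>B\<^esub> b \<otimes>\<^bsub>B\<^esub> e j 0 = ?d \<otimes>\<^bsub>B\<^esub> e 0 0"
        using e b z \<chi>[OF t] by (intro inj) (simp_all add: hom_simps)
      have "?d \<otimes>\<^bsub>B\<^esub> a = a \<otimes>\<^bsub>B\<^esub> ?d" if "a \<in> carrier B" for a
        using that \<chi>[OF t] central[OF z(1), of "\<psi> a"] by (intro inj) (simp_all add: hom_simps)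
      then show "?d \<in> carrier ?Z" unfolding Z_mem using \<chi>[OF t] by blast
    qed
  next
    have "\<psi> (\<Oplus>\<^bsub>B\<^esub>i\<in>{..<n}. e i i) = (\<Oplus>\<^bsub>?C\<^esub>i\<in>{..<n}. \<psi> (e i i))"
      by (intro additive_map_finsum[OF B.abelian_group_axioms C.Q.abelian_group_axioms]) (auto simp: hom_simps e)
    then show "(\<Oplus>\<^bsub>B\<^esub>i\<in>{..<n}. e i i) = \<one>\<^bsub>B\<^esub>"
      using e E_sum by (intro inj) (auto simp: hom_simps intro!: B.finsum_closed)
  qed
  then show ?thesis by blast
qed

section \<open>Coordinates in a split scalar extension\<close>

lemma pair_index:
  fixes i j n :: nat
  assumes "i < n" "j < n"
  shows "i * n + j < n * n" "(i * n + j) div n = i" "(i * n + j) mod n = j"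
proof -
  have "i * n + j < Suc i * n" "Suc i * n \<le> n * n" using assms by (simp, intro mult_le_mono1, simp)
  then show "i * n + j < n * n" by (rule less_le_trans)
qed (use assms in simp_all)

lemma pair_index_iff:
  fixes e i j n :: nat
  assumes "e < n * n" "i < n" "j < n"
  shows "e = i * n + j \<longleftrightarrow> e div n = i \<and> e mod n = j"
  using pair_index[OF assms(2,3)] div_mod_decomp[of e n] by auto

context scalar_extension
begin

abbreviation scal where "scal l \<equiv> tens \<one>\<^bsub>A\<^esub> l"

lemma scal_closed: "l \<in> carrier L \<Longrightarrow> scal l \<in> carrier Q"
  by (rule tens_closed) auto

lemma scal_hom: "scal \<in> ring_hom L Q"
  by (rule ring_hom_memI) (auto simp: scal_closed tens_mult tens_add_right tens_one)

lemma scal_central: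
  assumes "l \<in> carrier L" "x \<in> carrier Q"
  shows "scal l \<otimes>\<^bsub>Q\<^esub> x = x \<otimes>\<^bsub>Q\<^esub> scal l"
  using assms(2)
proof (induction x rule: tens_induct)
  case (add x a b)
  have "scal l \<otimes>\<^bsub>Q\<^esub> tens a b = tens a b \<otimes>\<^bsub>Q\<^esub> scal l"
    using add assms(1) by (simp add: tens_mult L.m_comm)
  then show ?case using add assms(1) by (simp add: Q.l_distr Q.r_distr scal_closed tens_closed)
qed (simp add: assms scal_closed)

end

locale split_extension = scalar_extension A L \<iota> G
  for A :: "('a, 'k, 'g) galg" and L :: "('l, 'k, 'g) galg" and \<iota> and G :: "('g, 'z) monoid_scheme" +
  fixes n :: nat and e :: "nat \<Rightarrow> nat \<Rightarrow> ('a \<times> 'l \<Rightarrow>\<^sub>0 int) set"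
  assumes units: "is_matrix_units G n Q e" and n: "n \<ge> 1"
begin

lemma e_closed: "i < n \<Longrightarrow> j < n \<Longrightarrow> e i j \<in> carrier Q"
  and e_fixed: "i < n \<Longrightarrow> j < n \<Longrightarrow> g \<in> carrier G \<Longrightarrow> act Q g (e i j) = e i j"
  and e_mult: "i < n \<Longrightarrow> j < n \<Longrightarrow> k < n \<Longrightarrow> l < n \<Longrightarrow>
    e i j \<otimes>\<^bsub>Q\<^esub> e k l = (if j = k then e i l else \<zero>\<^bsub>Q\<^esub>)"
  and e_sum: "(\<Oplus>\<^bsub>Q\<^esub>i\<in>{..<n}. e i i) = \<one>\<^bsub>Q\<^esub>"
  using units unfolding is_matrix_units_def by blast+

lemma zero_less_n: "0 < n" using n by simp

text \<open>
  The commutant of \<open>A \<otimes> 1\<close> alone is already \<open>1 \<otimes> L\<close>.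
\<close>

lemma center_eq: "carrier (galg_center Q) = scal ` carrier L"
proof (intro equalityI subsetI)
  fix x assume "x \<in> carrier (galg_center Q)"
  then have x: "x \<in> carrier Q" and comm: "\<And>y. y \<in> carrier Q \<Longrightarrow> x \<otimes>\<^bsub>Q\<^esub> y = y \<otimes>\<^bsub>Q\<^esub> x"
    by (auto simp: galg_center_def)
  show "x \<in> scal ` carrier L"
    using commutant_of_tens_left[OF x comm[symmetric]] tens_closed by blast
next
  fix x assume "x \<in> scal ` carrier L"
  then show "x \<in> carrier (galg_center Q)"
    using scal_closed scal_central unfolding galg_center_def by auto
qed

lemma sum_zero: "(\<And>i. i < n \<Longrightarrow> f i = \<zero>\<^bsub>Q\<^esub>) \<Longrightarrow> (\<Oplus>\<^bsub>Q\<^esub>i\<in>{..<n}. f i) = \<zero>\<^bsub>Q\<^esub>"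
  using Q.finsum_cong'[of "{..<n}" "{..<n}" "\<lambda>_. \<zero>\<^bsub>Q\<^esub>" f] by simp

lemma eq_zero_if_corner_zero:
  assumes x: "x \<in> carrier Q"
    and zero: "\<And>i j. i < n \<Longrightarrow> j < n \<Longrightarrow> e 0 i \<otimes>\<^bsub>Q\<^esub> x \<otimes>\<^bsub>Q\<^esub> e j 0 = \<zero>\<^bsub>Q\<^esub>"
  shows "x = \<zero>\<^bsub>Q\<^esub>"
proof -
  have corner: "e i i \<otimes>\<^bsub>Q\<^esub> x \<otimes>\<^bsub>Q\<^esub> e j j = \<zero>\<^bsub>Q\<^esub>" if "i < n" "j < n" for i j
  proof -
    have c: "e i 0 \<in> carrier Q" "e 0 i \<in> carrier Q" "e j 0 \<in> carrier Q" "e 0 j \<in> carrier Q"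
      using that zero_less_n e_closed by auto
    have "e i i \<otimes>\<^bsub>Q\<^esub> x \<otimes>\<^bsub>Q\<^esub> e j j = (e i 0 \<otimes>\<^bsub>Q\<^esub> e 0 i) \<otimes>\<^bsub>Q\<^esub> x \<otimes>\<^bsub>Q\<^esub> (e j 0 \<otimes>\<^bsub>Q\<^esub> e 0 j)"
      using that zero_less_n by (simp add: e_mult)
    also have "\<dots> = e i 0 \<otimes>\<^bsub>Q\<^esub> (e 0 i \<otimes>\<^bsub>Q\<^esub> x \<otimes>\<^bsub>Q\<^esub> e j 0) \<otimes>\<^bsub>Q\<^esub> e 0 j"
      using c x by (simp add: Q.m_assoc)
    finally show ?thesis using zero[OF that] c by simp
  qed
  have left: "e i i \<otimes>\<^bsub>Q\<^esub> x = \<zero>\<^bsub>Q\<^esub>" if i: "i < n" for i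
  proof -
    have "e i i \<otimes>\<^bsub>Q\<^esub> x = e i i \<otimes>\<^bsub>Q\<^esub> x \<otimes>\<^bsub>Q\<^esub> (\<Oplus>\<^bsub>Q\<^esub>j\<in>{..<n}. e j j)"
      using i x e_closed by (simp add: e_sum)
    also have "\<dots> = (\<Oplus>\<^bsub>Q\<^esub>j\<in>{..<n}. e i i \<otimes>\<^bsub>Q\<^esub> x \<otimes>\<^bsub>Q\<^esub> e j j)"
      using i x e_closed by (intro Q.finsum_rdistr) auto
    also have "\<dots> = \<zero>\<^bsub>Q\<^esub>" using corner i by (intro sum_zero)
    finally show ?thesis .
  qed
  have "x = (\<Oplus>\<^bsub>Q\<^esub>i\<in>{..<n}. e i i) \<otimes>\<^bsub>Q\<^esub> x" using x by (simp add: e_sum)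
  also have "\<dots> = (\<Oplus>\<^bsub>Q\<^esub>i\<in>{..<n}. e i i \<otimes>\<^bsub>Q\<^esub> x)"
    using x e_closed by (intro Q.finsum_ldistr) auto
  also have "\<dots> = \<zero>\<^bsub>Q\<^esub>" using left by (intro sum_zero)
  finally show ?thesis .
qed

text \<open>
  The scalar is recovered from its corner: \<open>l = \<Sum>\<^sub>i e i 0 (l e 0 0) e 0 i\<close>.
\<close>

lemma scal_corner_inj:
  assumes l: "l \<in> carrier L" "l' \<in> carrier L" and eq: "scal l \<otimes>\<^bsub>Q\<^esub> e 0 0 = scal l' \<otimes>\<^bsub>Q\<^esub> e 0 0"
  shows "l = l'"
proof -
  have expand: "scal l = (\<Oplus>\<^bsub>Q\<^esub>i\<in>{..<n}. e i 0 \<otimes>\<^bsub>Q\<^esub> (scal l \<otimes>\<^bsub>Q\<^esub> e 0 0) \<otimes>\<^bsub>Q\<^esub> e 0 i)" if l: "l \<in> carrier L" for l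
  proof -
    have "scal l = scal l \<otimes>\<^bsub>Q\<^esub> (\<Oplus>\<^bsub>Q\<^esub>i\<in>{..<n}. e i i)" using l scal_closed by (simp add: e_sum)
    also have "\<dots> = (\<Oplus>\<^bsub>Q\<^esub>i\<in>{..<n}. scal l \<otimes>\<^bsub>Q\<^esub> e i i)"
      using l scal_closed e_closed by (intro Q.finsum_rdistr) auto
    also have "\<dots> = (\<Oplus>\<^bsub>Q\<^esub>i\<in>{..<n}. e i 0 \<otimes>\<^bsub>Q\<^esub> (scal l \<otimes>\<^bsub>Q\<^esub> e 0 0) \<otimes>\<^bsub>Q\<^esub> e 0 i)"
    proof (rule Q.finsum_cong')
      show "scal l \<otimes>\<^bsub>Q\<^esub> e i i = e i 0 \<otimes>\<^bsub>Q\<^esub> (scal l \<otimes>\<^bsub>Q\<^esub> e 0 0) \<otimes>\<^bsub>Q\<^esub> e 0 i" if "i \<in> {..<n}" for i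
      proof -
        have i: "i < n" using that by simp
        have c: "e i 0 \<in> carrier Q" "e 0 i \<in> carrier Q" "e 0 0 \<in> carrier Q" "scal l \<in> carrier Q"
          using i zero_less_n e_closed scal_closed l by auto
        have "e i 0 \<otimes>\<^bsub>Q\<^esub> (scal l \<otimes>\<^bsub>Q\<^esub> e 0 0) \<otimes>\<^bsub>Q\<^esub> e 0 i = (e i 0 \<otimes>\<^bsub>Q\<^esub> scal l) \<otimes>\<^bsub>Q\<^esub> (e 0 0 \<otimes>\<^bsub>Q\<^esub> e 0 i)"
          using c by (simp add: Q.m_assoc)
        also have "\<dots> = scal l \<otimes>\<^bsub>Q\<^esub> (e i 0 \<otimes>\<^bsub>Q\<^esub> (e 0 0 \<otimes>\<^bsub>Q\<^esub> e 0 i))"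
          using c l by (simp add: scal_central[symmetric] Q.m_assoc)
        also have "\<dots> = scal l \<otimes>\<^bsub>Q\<^esub> e i i" using i zero_less_n by (simp add: e_mult)
        finally show ?thesis by simp
      qed
    qed (use l zero_less_n e_closed scal_closed in auto)
    finally show ?thesis .
  qed
  have "scal l = scal l'" using expand[OF l(1)] expand[OF l(2)] eq by simp
  then show ?thesis using tens_one_inj l by simp
qed

text \<open>
  The \<open>(i, j)\<close> entry of \<open>x\<close> with respect to the matrix units, read off in the corner of
  \<open>e 0 0\<close>.
\<close>

definition coord :: "('a \<times> 'l \<Rightarrow>\<^sub>0 int) set \<Rightarrow> nat \<Rightarrow> nat \<Rightarrow> 'l" where
  "coord x i j = (SOME l. l \<in> carrier L \<and> e 0 i \<otimes>\<^bsub>Q\<^esub> x \<otimes>\<^bsub>Q\<^esub> e j 0 = scal l \<otimes>\<^bsub>Q\<^esub> e 0 0)"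

lemma coord:
  assumes "x \<in> carrier Q" "i < n" "j < n"
  shows "coord x i j \<in> carrier L" "e 0 i \<otimes>\<^bsub>Q\<^esub> x \<otimes>\<^bsub>Q\<^esub> e j 0 = scal (coord x i j) \<otimes>\<^bsub>Q\<^esub> e 0 0"
proof -
  have "\<exists>d\<in>carrier (galg_center Q). e 0 i \<otimes>\<^bsub>Q\<^esub> x \<otimes>\<^bsub>Q\<^esub> e j 0 = d \<otimes>\<^bsub>Q\<^esub> e 0 0"
    using units assms unfolding is_matrix_units_def by blast
  then have "\<exists>l. l \<in> carrier L \<and> e 0 i \<otimes>\<^bsub>Q\<^esub> x \<otimes>\<^bsub>Q\<^esub> e j 0 = scal l \<otimes>\<^bsub>Q\<^esub> e 0 0"
    unfolding center_eq by blast
  from someI_ex[OF this] show "coord x i j \<in> carrier L"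
    "e 0 i \<otimes>\<^bsub>Q\<^esub> x \<otimes>\<^bsub>Q\<^esub> e j 0 = scal (coord x i j) \<otimes>\<^bsub>Q\<^esub> e 0 0" unfolding coord_def by blast+
qed

lemma coord_eqI:
  assumes "x \<in> carrier Q" "i < n" "j < n" "l \<in> carrier L"
    "e 0 i \<otimes>\<^bsub>Q\<^esub> x \<otimes>\<^bsub>Q\<^esub> e j 0 = scal l \<otimes>\<^bsub>Q\<^esub> e 0 0"
  shows "coord x i j = l"
  using coord[OF assms(1-3)] assms(4,5) scal_corner_inj by simp

lemma coord_add:
  assumes "x \<in> carrier Q" "y \<in> carrier Q" "i < n" "j < n"
  shows "coord (x \<oplus>\<^bsub>Q\<^esub> y) i j = coord x i j \<oplus>\<^bsub>L\<^esub> coord y i j"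
  using assms zero_less_n coord[OF assms(1,3,4)] coord[OF assms(2,3,4)]
  by (intro coord_eqI) (auto simp: Q.l_distr Q.r_distr e_closed tens_add_right scal_closed)

lemma coord_scal:
  assumes "l \<in> carrier L" "x \<in> carrier Q" "i < n" "j < n"
  shows "coord (scal l \<otimes>\<^bsub>Q\<^esub> x) i j = l \<otimes>\<^bsub>L\<^esub> coord x i j"
proof (rule coord_eqI)
  have c: "e 0 i \<in> carrier Q" "e j 0 \<in> carrier Q" "e 0 0 \<in> carrier Q" "scal l \<in> carrier Q"
    using assms zero_less_n e_closed scal_closed by auto
  have "e 0 i \<otimes>\<^bsub>Q\<^esub> (scal l \<otimes>\<^bsub>Q\<^esub> x) \<otimes>\<^bsub>Q\<^esub> e j 0 = scal l \<otimes>\<^bsub>Q\<^esub> (e 0 i \<otimes>\<^bsub>Q\<^esub> x \<otimes>\<^bsub>Q\<^esub> e j 0)"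
  proof -
    have "e 0 i \<otimes>\<^bsub>Q\<^esub> (scal l \<otimes>\<^bsub>Q\<^esub> x) = scal l \<otimes>\<^bsub>Q\<^esub> (e 0 i \<otimes>\<^bsub>Q\<^esub> x)"
      using scal_central[OF assms(1) c(1)] c assms by (metis Q.m_assoc)
    then show ?thesis using c assms by (simp add: Q.m_assoc)
  qed
  also have "\<dots> = scal (l \<otimes>\<^bsub>L\<^esub> coord x i j) \<otimes>\<^bsub>Q\<^esub> e 0 0"
    using coord[OF assms(2-4)] c assms(1)
    by (simp add: ring_hom_mult[OF scal_hom] scal_closed Q.m_assoc)
  finally show "e 0 i \<otimes>\<^bsub>Q\<^esub> (scal l \<otimes>\<^bsub>Q\<^esub> x) \<otimes>\<^bsub>Q\<^esub> e j 0 = scal (l \<otimes>\<^bsub>L\<^esub> coord x i j) \<otimes>\<^bsub>Q\<^esub> e 0 0" .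
qed (use assms coord scal_closed in auto)

lemma coord_e:
  assumes "i < n" "j < n" "a < n" "b < n"
  shows "coord (e a b) i j = (if i = a \<and> j = b then \<one>\<^bsub>L\<^esub> else \<zero>\<^bsub>L\<^esub>)"
proof (rule coord_eqI)
  have "scal \<zero>\<^bsub>L\<^esub> = \<zero>\<^bsub>Q\<^esub>" "scal \<one>\<^bsub>L\<^esub> = \<one>\<^bsub>Q\<^esub>" by (simp_all add: tens_zero_right tens_one)
  then show "e 0 i \<otimes>\<^bsub>Q\<^esub> e a b \<otimes>\<^bsub>Q\<^esub> e j 0 = scal (if i = a \<and> j = b then \<one>\<^bsub>L\<^esub> else \<zero>\<^bsub>L\<^esub>) \<otimes>\<^bsub>Q\<^esub> e 0 0"
    using assms zero_less_n e_closed by (simp add: e_mult)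
qed (use assms e_closed in auto)

lemma coord_one:
  assumes "i < n" "j < n"
  shows "coord \<one>\<^bsub>Q\<^esub> i j = (if i = j then \<one>\<^bsub>L\<^esub> else \<zero>\<^bsub>L\<^esub>)"
proof (rule coord_eqI)
  have "scal \<zero>\<^bsub>L\<^esub> = \<zero>\<^bsub>Q\<^esub>" "scal \<one>\<^bsub>L\<^esub> = \<one>\<^bsub>Q\<^esub>" by (simp_all add: tens_zero_right tens_one)
  then show "e 0 i \<otimes>\<^bsub>Q\<^esub> \<one>\<^bsub>Q\<^esub> \<otimes>\<^bsub>Q\<^esub> e j 0 = scal (if i = j then \<one>\<^bsub>L\<^esub> else \<zero>\<^bsub>L\<^esub>) \<otimes>\<^bsub>Q\<^esub> e 0 0"
    using assms zero_less_n e_closed by (simp add: e_mult)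
qed (use assms in auto)

lemma coord_mult:
  assumes x: "x \<in> carrier Q" and y: "y \<in> carrier Q" and ij: "i < n" "j < n"
  shows "coord (x \<otimes>\<^bsub>Q\<^esub> y) i j = (\<Oplus>\<^bsub>L\<^esub>l\<in>{..<n}. coord x i l \<otimes>\<^bsub>L\<^esub> coord y l j)"
proof (rule coord_eqI)
  have c: "e 0 i \<in> carrier Q" "e j 0 \<in> carrier Q" "e 0 0 \<in> carrier Q"
    using ij zero_less_n e_closed by auto
  have summand: "e 0 i \<otimes>\<^bsub>Q\<^esub> x \<otimes>\<^bsub>Q\<^esub> e l l \<otimes>\<^bsub>Q\<^esub> (y \<otimes>\<^bsub>Q\<^esub> e j 0) = scal (coord x i l \<otimes>\<^bsub>L\<^esub> coord y l j) \<otimes>\<^bsub>Q\<^esub> e 0 0"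
    if l: "l < n" for l
  proof -
    let ?s = "scal (coord x i l)" and ?t = "scal (coord y l j)"
    have cl: "e l 0 \<in> carrier Q" "e 0 l \<in> carrier Q" "?s \<in> carrier Q" "?t \<in> carrier Q"
      using l ij x y zero_less_n e_closed coord scal_closed by auto
    have "e 0 i \<otimes>\<^bsub>Q\<^esub> x \<otimes>\<^bsub>Q\<^esub> e l l \<otimes>\<^bsub>Q\<^esub> (y \<otimes>\<^bsub>Q\<^esub> e j 0)
        = e 0 i \<otimes>\<^bsub>Q\<^esub> x \<otimes>\<^bsub>Q\<^esub> (e l 0 \<otimes>\<^bsub>Q\<^esub> e 0 l) \<otimes>\<^bsub>Q\<^esub> (y \<otimes>\<^bsub>Q\<^esub> e j 0)"
      using l zero_less_n by (simp add: e_mult)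
    also have "\<dots> = (e 0 i \<otimes>\<^bsub>Q\<^esub> x \<otimes>\<^bsub>Q\<^esub> e l 0) \<otimes>\<^bsub>Q\<^esub> (e 0 l \<otimes>\<^bsub>Q\<^esub> y \<otimes>\<^bsub>Q\<^esub> e j 0)"
      using c cl x y by (simp add: Q.m_assoc)
    also have "\<dots> = (?s \<otimes>\<^bsub>Q\<^esub> e 0 0) \<otimes>\<^bsub>Q\<^esub> (?t \<otimes>\<^bsub>Q\<^esub> e 0 0)"
      using coord(2)[OF x ij(1) l] coord(2)[OF y l ij(2)] by simp
    also have "\<dots> = ?s \<otimes>\<^bsub>Q\<^esub> (e 0 0 \<otimes>\<^bsub>Q\<^esub> ?t) \<otimes>\<^bsub>Q\<^esub> e 0 0" using c cl by (simp add: Q.m_assoc)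
    also have "e 0 0 \<otimes>\<^bsub>Q\<^esub> ?t = ?t \<otimes>\<^bsub>Q\<^esub> e 0 0" using c coord(1)[OF y l ij(2)] by (simp add: scal_central)
    also have "?s \<otimes>\<^bsub>Q\<^esub> (?t \<otimes>\<^bsub>Q\<^esub> e 0 0) \<otimes>\<^bsub>Q\<^esub> e 0 0 = ?s \<otimes>\<^bsub>Q\<^esub> ?t \<otimes>\<^bsub>Q\<^esub> (e 0 0 \<otimes>\<^bsub>Q\<^esub> e 0 0)"
      using c cl by (simp add: Q.m_assoc)
    also have "\<dots> = scal (coord x i l \<otimes>\<^bsub>L\<^esub> coord y l j) \<otimes>\<^bsub>Q\<^esub> e 0 0"
      using zero_less_n coord(1)[OF x ij(1) l] coord(1)[OF y l ij(2)]
      by (simp add: e_mult ring_hom_mult[OF scal_hom])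
    finally show ?thesis .
  qed
  have t_closed: "coord x i l \<otimes>\<^bsub>L\<^esub> coord y l j \<in> carrier L" if "l < n" for l
    using coord(1)[OF x ij(1) that] coord(1)[OF y that ij(2)] by simp
  have "e 0 i \<otimes>\<^bsub>Q\<^esub> (x \<otimes>\<^bsub>Q\<^esub> y) \<otimes>\<^bsub>Q\<^esub> e j 0 = e 0 i \<otimes>\<^bsub>Q\<^esub> x \<otimes>\<^bsub>Q\<^esub> (\<Oplus>\<^bsub>Q\<^esub>l\<in>{..<n}. e l l) \<otimes>\<^bsub>Q\<^esub> (y \<otimes>\<^bsub>Q\<^esub> e j 0)"
    using c x y by (simp add: e_sum Q.m_assoc)
  also have "\<dots> = (\<Oplus>\<^bsub>Q\<^esub>l\<in>{..<n}. e 0 i \<otimes>\<^bsub>Q\<^esub> x \<otimes>\<^bsub>Q\<^esub> e l l \<otimes>\<^bsub>Q\<^esub> (y \<otimes>\<^bsub>Q\<^esub> e j 0))"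
    using c x y e_closed by (simp add: Q.finsum_rdistr Q.finsum_ldistr Pi_iff)
  also have "\<dots> = (\<Oplus>\<^bsub>Q\<^esub>l\<in>{..<n}. scal (coord x i l \<otimes>\<^bsub>L\<^esub> coord y l j) \<otimes>\<^bsub>Q\<^esub> e 0 0)"
    using c by (intro Q.finsum_cong') (auto simp: summand intro!: Q.m_closed scal_closed t_closed)
  also have "\<dots> = (\<Oplus>\<^bsub>Q\<^esub>l\<in>{..<n}. scal (coord x i l \<otimes>\<^bsub>L\<^esub> coord y l j)) \<otimes>\<^bsub>Q\<^esub> e 0 0"
    using c by (intro Q.finsum_ldistr[symmetric]) (auto intro!: scal_closed t_closed)
  also have "(\<Oplus>\<^bsub>Q\<^esub>l\<in>{..<n}. scal (coord x i l \<otimes>\<^bsub>L\<^esub> coord y l j)) = scal (\<Oplus>\<^bsub>L\<^esub>l\<in>{..<n}. coord x i l \<otimes>\<^bsub>L\<^esub> coord y l j)"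
    by (intro additive_map_finsum[OF B.abelian_group_axioms Q.abelian_group_axioms, symmetric] scal_closed tens_add_right)
      (auto intro!: t_closed)
  finally show "e 0 i \<otimes>\<^bsub>Q\<^esub> (x \<otimes>\<^bsub>Q\<^esub> y) \<otimes>\<^bsub>Q\<^esub> e j 0 =
      scal (\<Oplus>\<^bsub>L\<^esub>l\<in>{..<n}. coord x i l \<otimes>\<^bsub>L\<^esub> coord y l j) \<otimes>\<^bsub>Q\<^esub> e 0 0" .
  show "(\<Oplus>\<^bsub>L\<^esub>l\<in>{..<n}. coord x i l \<otimes>\<^bsub>L\<^esub> coord y l j) \<in> carrier L"
    by (intro B.finsum_closed) (auto intro!: t_closed)
qed (use x y ij in auto)

text \<open>The coordinates are equivariant because the matrix units are fixed.\<close>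

lemma coord_act:
  assumes g: "g \<in> carrier G" and x: "x \<in> carrier Q" and ij: "i < n" "j < n"
  shows "coord (act Q g x) i j = act L g (coord x i j)"
proof (rule coord_eqI)
  note hom = gring_hom[OF tensor_gring g]
  have l: "coord x i j \<in> carrier L" using coord(1)[OF x ij] .
  have c: "e 0 i \<in> carrier Q" "e j 0 \<in> carrier Q" "e 0 0 \<in> carrier Q"
    using ij zero_less_n e_closed by auto
  have "e 0 i \<otimes>\<^bsub>Q\<^esub> act Q g x \<otimes>\<^bsub>Q\<^esub> e j 0 = act Q g (e 0 i \<otimes>\<^bsub>Q\<^esub> x \<otimes>\<^bsub>Q\<^esub> e j 0)"
    using c x g ij zero_less_n by (simp add: ring_hom_mult[OF hom] e_fixed)
  also have "\<dots> = act Q g (scal (coord x i j)) \<otimes>\<^bsub>Q\<^esub> e 0 0"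
    using coord(2)[OF x ij] c l g zero_less_n by (simp add: ring_hom_mult[OF hom] scal_closed e_fixed)
  also have "act Q g (scal (coord x i j)) = scal (act L g (coord x i j))"
    using g l by (simp add: act_tens ring_hom_one[OF actA])
  finally show "e 0 i \<otimes>\<^bsub>Q\<^esub> act Q g x \<otimes>\<^bsub>Q\<^esub> e j 0 = scal (act L g (coord x i j)) \<otimes>\<^bsub>Q\<^esub> e 0 0" .
  show "act L g (coord x i j) \<in> carrier L" using ring_hom_closed[OF actB[OF g] l] .
  show "act Q g x \<in> carrier Q" using ring_hom_closed[OF hom x] .
qed (use ij in auto)

lemma coord_inj:
  assumes x: "x \<in> carrier Q" and zero: "\<And>i j. i < n \<Longrightarrow> j < n \<Longrightarrow> coord x i j = \<zero>\<^bsub>L\<^esub>"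
  shows "x = \<zero>\<^bsub>Q\<^esub>"
proof (rule eq_zero_if_corner_zero[OF x])
  fix i j assume "i < n" "j < n"
  then show "e 0 i \<otimes>\<^bsub>Q\<^esub> x \<otimes>\<^bsub>Q\<^esub> e j 0 = \<zero>\<^bsub>Q\<^esub>"
    using coord(2)[OF x] zero zero_less_n e_closed by (simp add: tens_zero_right)
qed

lemma coord_finsum:
  assumes "f \<in> J \<rightarrow> carrier Q" "i < n" "j < n"
  shows "coord (\<Oplus>\<^bsub>Q\<^esub>h\<in>J. f h) i j = (\<Oplus>\<^bsub>L\<^esub>h\<in>J. coord (f h) i j)"
  using assms
  by (intro additive_map_finsum[OF Q.abelian_group_axioms B.abelian_group_axioms]) (auto simp: coord coord_add)

lemma combine_eq_finsum:
  assumes "\<And>h. h < N \<Longrightarrow> k h \<in> carrier Q" "\<And>h. h < N \<Longrightarrow> u h \<in> carrier Q"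
  shows "Q.combine (map k [0..<N]) (map u [0..<N]) = (\<Oplus>\<^bsub>Q\<^esub>h\<in>{..<N}. k h \<otimes>\<^bsub>Q\<^esub> u h)"
  using assms
proof (induction N)
  case (Suc N)
  have "Q.combine (map k [0..<Suc N]) (map u [0..<Suc N]) =
      Q.combine (map k [0..<N]) (map u [0..<N]) \<oplus>\<^bsub>Q\<^esub> Q.combine [k N] [u N]"
    using Q.combine_append[of "map k [0..<N]" "map u [0..<N]" "[k N]" "[u N]"] Suc.prems
    by (simp add: image_subset_iff)
  also have "Q.combine (map k [0..<N]) (map u [0..<N]) = (\<Oplus>\<^bsub>Q\<^esub>h\<in>{..<N}. k h \<otimes>\<^bsub>Q\<^esub> u h)"
    by (rule Suc.IH) (use Suc.prems in simp_all)
  also have "Q.combine [k N] [u N] = k N \<otimes>\<^bsub>Q\<^esub> u N" using Suc.prems by simp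
  also have "(\<Oplus>\<^bsub>Q\<^esub>h\<in>{..<N}. k h \<otimes>\<^bsub>Q\<^esub> u h) \<oplus>\<^bsub>Q\<^esub> k N \<otimes>\<^bsub>Q\<^esub> u N = k N \<otimes>\<^bsub>Q\<^esub> u N \<oplus>\<^bsub>Q\<^esub> (\<Oplus>\<^bsub>Q\<^esub>h\<in>{..<N}. k h \<otimes>\<^bsub>Q\<^esub> u h)"
    by (rule Q.a_comm) (use Suc.prems in \<open>simp_all add: Q.finsum_closed Pi_iff\<close>)
  also have "\<dots> = (\<Oplus>\<^bsub>Q\<^esub>h\<in>{..<Suc N}. k h \<otimes>\<^bsub>Q\<^esub> u h)"
    unfolding lessThan_Suc
    by (rule Q.finsum_insert[symmetric]) (use Suc.prems in \<open>simp_all add: Pi_iff\<close>)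
  finally show ?case .
qed simp

lemma scal_subfield: "subfield (scal ` carrier L) Q"
proof -
  interpret h: ring_hom_ring L Q scal
    by (rule ring_hom_ringI2[OF B.ring_axioms Q_ring scal_hom])
  have "\<one>\<^bsub>Q\<^esub> \<noteq> \<zero>\<^bsub>Q\<^esub>"
  proof
    assume "\<one>\<^bsub>Q\<^esub> = \<zero>\<^bsub>Q\<^esub>"
    then have "scal \<one>\<^bsub>L\<^esub> = scal \<zero>\<^bsub>L\<^esub>"
      unfolding tens_one[symmetric] tens_zero_right[OF A.one_closed] .
    then show False using tens_one_inj L.one_not_zero by blast
  qed
  then show ?thesis using h.img_is_subfield(2)[OF L.carrier_is_subfield] by blast
qed

lemma Ks_eq_map: "set Ks \<subseteq> scal ` carrier L \<Longrightarrow> length Ks = N \<Longrightarrow>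
  \<exists>k. (\<forall>h<N. k h \<in> carrier L) \<and> Ks = map (\<lambda>h. scal (k h)) [0..<N]"
proof -
  assume Ks: "set Ks \<subseteq> scal ` carrier L" "length Ks = N"
  then have "\<forall>h<N. \<exists>l. l \<in> carrier L \<and> Ks ! h = scal l" by (metis (no_types, lifting) image_iff nth_mem subsetD)
  then obtain k where "\<forall>h<N. k h \<in> carrier L \<and> Ks ! h = scal (k h)" by metis
  then show ?thesis using Ks(2) by (intro exI[of _ k]) (auto intro!: nth_equalityI)
qed

lemma independentI:
  assumes u: "\<And>h. h < N \<Longrightarrow> u h \<in> carrier Q"
    and indep: "\<And>k h. (\<And>h. h < N \<Longrightarrow> k h \<in> carrier L) \<Longrightarrow>
      (\<Oplus>\<^bsub>Q\<^esub>h\<in>{..<N}. scal (k h) \<otimes>\<^bsub>Q\<^esub> u h) = \<zero>\<^bsub>Q\<^esub> \<Longrightarrow> h < N \<Longrightarrow> k h = \<zero>\<^bsub>L\<^esub>"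
  shows "Q.independent (scal ` carrier L) (map u [0..<N])"
proof (rule Q.trivial_combine_imp_independent[OF scal_subfield])
  show "set (map u [0..<N]) \<subseteq> carrier Q" using u by auto
  fix Ks assume Ks: "set Ks \<subseteq> scal ` carrier L" "Q.combine Ks (map u [0..<N]) = \<zero>\<^bsub>Q\<^esub>"
  have Ks_carrier: "set Ks \<subseteq> carrier Q" using Ks(1) scal_closed by auto
  have us: "set (map u [0..<N]) \<subseteq> carrier Q" using u by auto
  from Q.combine_normalize[OF Ks_carrier us refl] obtain Ks' where
    Ks': "set (take (length (map u [0..<N])) Ks) \<subseteq> set Ks'" 
    "set Ks' \<subseteq> set (take (length (map u [0..<N])) Ks) \<union> {\<zero>\<^bsub>Q\<^esub>}"
    "length Ks' = length (map u [0..<N])"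
    "Q.combine Ks (map u [0..<N]) = Q.combine Ks' (map u [0..<N])" by metis
  have "\<zero>\<^bsub>Q\<^esub> \<in> scal ` carrier L"
    unfolding tens_zero_right[OF A.one_closed, symmetric] by (rule imageI) simp
  then have "set Ks' \<subseteq> scal ` carrier L" using Ks' Ks(1) set_take_subset[of _ Ks] by blast
  then obtain k where k: "\<forall>h<N. k h \<in> carrier L" "Ks' = map (\<lambda>h. scal (k h)) [0..<N]"
    using Ks_eq_map[of Ks' N] Ks'(3) by auto
  have "(\<Oplus>\<^bsub>Q\<^esub>h\<in>{..<N}. scal (k h) \<otimes>\<^bsub>Q\<^esub> u h) = \<zero>\<^bsub>Q\<^esub>"
    using combine_eq_finsum[of N "\<lambda>h. scal (k h)" u] k u Ks(2) Ks'(4) scal_closed by simp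
  then have "\<forall>h<N. k h = \<zero>\<^bsub>L\<^esub>" using indep k(1) by blast
  then have "set Ks' \<subseteq> {\<zero>\<^bsub>Q\<^esub>}" unfolding k(2) by (auto simp: tens_zero_right)
  then show "set (take (length (map u [0..<N])) Ks) \<subseteq> {\<zero>\<^bsub>Q\<^esub>}" using Ks'(1) by blast
qed

text \<open>
  The matrix units in row-major order; a pair \<open>(i, j)\<close> has the index \<open>i n + j\<close>.
\<close>

definition unit_list :: "nat \<Rightarrow> ('a \<times> 'l \<Rightarrow>\<^sub>0 int) set" where
  "unit_list h = e (h div n) (h mod n)"

lemma idx:
  assumes "h < n * n" shows "h div n < n" "h mod n < n"
  using assms zero_less_n by (auto simp: less_mult_imp_div_less)

lemma unit_list_closed: "h < n * n \<Longrightarrow> unit_list h \<in> carrier Q"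
  unfolding unit_list_def using idx e_closed by blast

lemma coord_combination:
  assumes k: "\<And>h. h < n * n \<Longrightarrow> k h \<in> carrier L" and h: "h < n * n"
  shows "coord (\<Oplus>\<^bsub>Q\<^esub>h\<in>{..<n*n}. scal (k h) \<otimes>\<^bsub>Q\<^esub> unit_list h) (h div n) (h mod n) = k h"
proof -
  have "coord (\<Oplus>\<^bsub>Q\<^esub>h\<in>{..<n*n}. scal (k h) \<otimes>\<^bsub>Q\<^esub> unit_list h) (h div n) (h mod n) =
    (\<Oplus>\<^bsub>L\<^esub>h'\<in>{..<n*n}. coord (scal (k h') \<otimes>\<^bsub>Q\<^esub> unit_list h') (h div n) (h mod n))"
    using idx[OF h] unit_list_closed k scal_closed by (intro coord_finsum) auto
  also have "\<dots> = (\<Oplus>\<^bsub>L\<^esub>h'\<in>{..<n*n}. if h = h' then k h' else \<zero>\<^bsub>L\<^esub>)"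
  proof (rule B.finsum_cong')
    fix h' assume "h' \<in> {..<n*n}"
    then have h': "h' < n * n" by simp
    have "coord (unit_list h') (h div n) (h mod n) = (if h = h' then \<one>\<^bsub>L\<^esub> else \<zero>\<^bsub>L\<^esub>)"
      unfolding unit_list_def using idx[OF h] idx[OF h'] by (auto simp: coord_e) (metis div_mod_decomp)+
    then show "coord (scal (k h') \<otimes>\<^bsub>Q\<^esub> unit_list h') (h div n) (h mod n) = (if h = h' then k h' else \<zero>\<^bsub>L\<^esub>)"
      using k[OF h'] unit_list_closed[OF h'] idx[OF h] by (simp add: coord_scal)
  qed (use k in auto)
  also have "\<dots> = k h" using h k by (subst B.finsum_singleton) auto
  finally show ?thesis .
qed

lemma coord_eq_imp_eq:
  assumes x: "x \<in> carrier Q" and y: "y \<in> carrier Q"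
    and eq: "\<And>i j. i < n \<Longrightarrow> j < n \<Longrightarrow> coord x i j = coord y i j"
  shows "x = y"
proof -
  have "coord (x \<oplus>\<^bsub>Q\<^esub> scal (\<ominus>\<^bsub>L\<^esub> \<one>\<^bsub>L\<^esub>) \<otimes>\<^bsub>Q\<^esub> y) i j = \<zero>\<^bsub>L\<^esub>" if ij: "i < n" "j < n" for i j
    using eq[OF ij] ij x y coord(1)[OF x ij]
    by (simp add: coord_add coord_scal scal_closed B.l_minus B.r_neg)
  then have "x \<oplus>\<^bsub>Q\<^esub> scal (\<ominus>\<^bsub>L\<^esub> \<one>\<^bsub>L\<^esub>) \<otimes>\<^bsub>Q\<^esub> y = \<zero>\<^bsub>Q\<^esub>"
    using x y scal_closed by (intro coord_inj) auto
  moreover have "scal (\<ominus>\<^bsub>L\<^esub> \<one>\<^bsub>L\<^esub>) = \<ominus>\<^bsub>Q\<^esub> \<one>\<^bsub>Q\<^esub>"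
    by (rule Q.minus_equality[symmetric])
      (auto simp: tens_one B.l_neg tens_zero_right scal_closed simp flip: tens_add_right)
  ultimately show ?thesis using x y Q.r_right_minus_eq[of x y] by (simp add: a_minus_def Q.l_minus)
qed

lemma combination_closed:
  "(\<And>h. h < n * n \<Longrightarrow> k h \<in> carrier L) \<Longrightarrow> (\<Oplus>\<^bsub>Q\<^esub>h\<in>{..<n*n}. scal (k h) \<otimes>\<^bsub>Q\<^esub> unit_list h) \<in> carrier Q"
  using unit_list_closed scal_closed by (intro Q.finsum_closed) auto

lemma coord_surj:
  assumes "\<And>i j. i < n \<Longrightarrow> j < n \<Longrightarrow> l i j \<in> carrier L"
  shows "\<exists>x\<in>carrier Q. \<forall>i<n. \<forall>j<n. coord x i j = l i j"
proof (intro bexI allI impI)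
  let ?k = "\<lambda>h. l (h div n) (h mod n)"
  have k: "?k h \<in> carrier L" if "h < n * n" for h using assms idx[OF that] by blast
  show "(\<Oplus>\<^bsub>Q\<^esub>h\<in>{..<n*n}. scal (?k h) \<otimes>\<^bsub>Q\<^esub> unit_list h) \<in> carrier Q" by (rule combination_closed[OF k])
  show "coord (\<Oplus>\<^bsub>Q\<^esub>h\<in>{..<n*n}. scal (?k h) \<otimes>\<^bsub>Q\<^esub> unit_list h) i j = l i j" if "i < n" "j < n" for i j
    using coord_combination[of ?k "i * n + j", OF k] pair_index[OF that] by simp
qed

lemma dimension_Q: "Q.dimension (n * n) (scal ` carrier L) (carrier Q)"
proof -
  have indep: "Q.independent (scal ` carrier L) (map unit_list [0..<n*n])"
  proof (rule independentI[OF unit_list_closed])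
    fix k h assume k: "\<And>h. h < n * n \<Longrightarrow> k h \<in> carrier L"
      and zero: "(\<Oplus>\<^bsub>Q\<^esub>h\<in>{..<n*n}. scal (k h) \<otimes>\<^bsub>Q\<^esub> unit_list h) = \<zero>\<^bsub>Q\<^esub>" and h: "h < n * n"
    have "coord \<zero>\<^bsub>Q\<^esub> (h div n) (h mod n) = \<zero>\<^bsub>L\<^esub>"
      using idx[OF h] zero_less_n e_closed by (intro coord_eqI) (auto simp: tens_zero_right)
    then show "k h = \<zero>\<^bsub>L\<^esub>" using coord_combination[of k h] k h zero by metis
  qed auto
  have "Q.Span (scal ` carrier L) (map unit_list [0..<n*n]) = carrier Q"
  proof (intro equalityI subsetI)
    show "x \<in> carrier Q" if "x \<in> Q.Span (scal ` carrier L) (map unit_list [0..<n*n])" for x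
      using that Q.Span_in_carrier[of "scal ` carrier L" "map unit_list [0..<n*n]"] unit_list_closed scal_closed by fastforce
    fix x assume x: "x \<in> carrier Q"
    define k where "k h = coord x (h div n) (h mod n)" for h
    have k: "k h \<in> carrier L" if "h < n * n" for h unfolding k_def using coord(1)[OF x] idx[OF that] by blast
    let ?y = "\<Oplus>\<^bsub>Q\<^esub>h\<in>{..<n*n}. scal (k h) \<otimes>\<^bsub>Q\<^esub> unit_list h"
    have y: "?y \<in> carrier Q" by (rule combination_closed[OF k])
    have "x = ?y"
    proof (rule coord_eq_imp_eq[OF x y])
      fix i j assume ij: "i < n" "j < n"
      show "coord x i j = coord ?y i j"
        using coord_combination[of k "i * n + j", OF k] pair_index[OF ij] unfolding k_def by simp
    qed
    also have "\<dots> = Q.combine (map (\<lambda>h. scal (k h)) [0..<n*n]) (map unit_list [0..<n*n])"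
      using k unit_list_closed scal_closed by (intro combine_eq_finsum[symmetric]) auto
    finally have "x = Q.combine (map (\<lambda>h. scal (k h)) [0..<n*n]) (map unit_list [0..<n*n])" .
    moreover have "set (map unit_list [0..<n*n]) \<subseteq> carrier Q" using unit_list_closed by auto
    moreover have "set (map (\<lambda>h. scal (k h)) [0..<n*n]) \<subseteq> scal ` carrier L" using k by auto
    ultimately show "x \<in> Q.Span (scal ` carrier L) (map unit_list [0..<n*n])"
      unfolding Q.Span_eq_combine_set[OF scal_subfield \<open>set (map unit_list [0..<n*n]) \<subseteq> carrier Q\<close>]
      by (intro CollectI exI conjI)
  qed
  then show ?thesis using Q.dimensionI[OF scal_subfield indep] by simp
qed

text \<open>
  Elements of \<open>A\<close> that are independent over the center stay independent over \<open>L\<close>, so \<open>n\<^sup>2\<close> of them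
  are a basis of \<open>A \<otimes> L\<close>. The coefficients of the matrix unit \<open>e a b\<close> in this basis are row \<open>(a, b)\<close> of
  a left inverse of the coordinate matrix of the \<open>x h\<close>.
\<close>

theorem independent_imp_spanning:
  assumes x: "\<And>h. h < n * n \<Longrightarrow> x h \<in> carrier A"
    and indep: "\<And>c. (\<And>h. h < n * n \<Longrightarrow> c h \<in> Z) \<Longrightarrow> (\<Oplus>\<^bsub>A\<^esub>h\<in>{..<n*n}. x h \<otimes>\<^bsub>A\<^esub> c h) = \<zero>\<^bsub>A\<^esub> \<Longrightarrow>
      \<forall>h<n*n. c h = \<zero>\<^bsub>A\<^esub>"
    and ab: "a < n" "b < n"
  shows "\<exists>w. (\<forall>h<n*n. w h \<in> carrier L) \<and> (\<forall>i<n. \<forall>j<n.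
    (\<Oplus>\<^bsub>L\<^esub>h\<in>{..<n*n}. w h \<otimes>\<^bsub>L\<^esub> coord (tens (x h) \<one>\<^bsub>L\<^esub>) i j) = (if i = a \<and> j = b then \<one>\<^bsub>L\<^esub> else \<zero>\<^bsub>L\<^esub>))"
proof -
  define u where "u h = tens (x h) \<one>\<^bsub>L\<^esub>" for h
  have u: "u h \<in> carrier Q" if "h < n * n" for h unfolding u_def using x[OF that] by (intro tens_closed) auto
  have ku: "scal k \<otimes>\<^bsub>Q\<^esub> u h = tens (x h) k" if "h < n * n" "k \<in> carrier L" for h k
    unfolding u_def using x that by (simp add: tens_mult)
  have us: "set (map u [0..<n*n]) \<subseteq> carrier Q" using u by auto
  have ind: "Q.independent (scal ` carrier L) (map u [0..<n*n])"
  proof (rule independentI[OF u])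
    fix k h assume k: "\<And>h. h < n * n \<Longrightarrow> k h \<in> carrier L"
      and zero: "(\<Oplus>\<^bsub>Q\<^esub>h\<in>{..<n*n}. scal (k h) \<otimes>\<^bsub>Q\<^esub> u h) = \<zero>\<^bsub>Q\<^esub>" and h: "h < n * n"
    have "(\<Oplus>\<^bsub>Q\<^esub>h\<in>{..<n*n}. tens (x h) (k h)) = (\<Oplus>\<^bsub>Q\<^esub>h\<in>{..<n*n}. scal (k h) \<otimes>\<^bsub>Q\<^esub> u h)"
      using k u scal_closed by (intro Q.finsum_cong') (auto simp: ku)
    moreover have "\<forall>h\<in>{..<n*n}. c h = \<zero>\<^bsub>A\<^esub>"
      if "c \<in> {..<n*n} \<rightarrow> Z" "(\<Oplus>\<^bsub>A\<^esub>h\<in>{..<n*n}. x h \<otimes>\<^bsub>A\<^esub> c h) = \<zero>\<^bsub>A\<^esub>" for c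
    proof -
      have "\<forall>h<n*n. c h = \<zero>\<^bsub>A\<^esub>" by (rule indep) (use that in auto)
      then show ?thesis by simp
    qed
    ultimately show "k h = \<zero>\<^bsub>L\<^esub>"
      using zero x k h by (intro tens_independent[of "{..<n*n}" x k h]) simp_all
  qed auto
  from Q.complete_base[OF scal_subfield dimension_Q ind us] obtain Vs where
    Vs: "length (Vs @ map u [0..<n*n]) = n * n" "Q.Span (scal ` carrier L) (Vs @ map u [0..<n*n]) = carrier Q"
    by blast
  then have "Vs = []" by simp
  then have "e a b \<in> Q.Span (scal ` carrier L) (map u [0..<n*n])" using Vs(2) e_closed[OF ab] by simp
  then obtain Ks where Ks: "e a b = Q.combine Ks (map u [0..<n*n])"
    "length Ks = length (map u [0..<n*n])" "set Ks \<subseteq> scal ` carrier L"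
    unfolding Q.Span_eq_combine_set_length_version[OF scal_subfield us]
    by (elim CollectE exE conjE) (rule that)
  obtain w where w: "\<forall>h<n*n. w h \<in> carrier L" "Ks = map (\<lambda>h. scal (w h)) [0..<n*n]"
    using Ks_eq_map[OF Ks(3), of "n * n"] Ks(2) by auto
  have eq: "e a b = (\<Oplus>\<^bsub>Q\<^esub>h\<in>{..<n*n}. scal (w h) \<otimes>\<^bsub>Q\<^esub> u h)"
    unfolding Ks(1) w(2) using w(1) u scal_closed by (intro combine_eq_finsum) auto
  have "(\<Oplus>\<^bsub>L\<^esub>h\<in>{..<n*n}. w h \<otimes>\<^bsub>L\<^esub> coord (u h) i j) = (if i = a \<and> j = b then \<one>\<^bsub>L\<^esub> else \<zero>\<^bsub>L\<^esub>)"
    if ij: "i < n" "j < n" for i j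
  proof -
    have "(if i = a \<and> j = b then \<one>\<^bsub>L\<^esub> else \<zero>\<^bsub>L\<^esub>) = coord (e a b) i j" using ij ab by (simp add: coord_e)
    also have "\<dots> = (\<Oplus>\<^bsub>L\<^esub>h\<in>{..<n*n}. coord (scal (w h) \<otimes>\<^bsub>Q\<^esub> u h) i j)"
      unfolding eq using ij w(1) u scal_closed by (intro coord_finsum) auto
    also have "\<dots> = (\<Oplus>\<^bsub>L\<^esub>h\<in>{..<n*n}. w h \<otimes>\<^bsub>L\<^esub> coord (u h) i j)"
      using ij w(1) u by (intro B.finsum_cong') (auto simp: coord_scal coord)
    finally show ?thesis by simp
  qed
  then show ?thesis using w(1) unfolding u_def by blast
qed

end

section \<open>Evaluation of polynomials\<close>

abbreviation pconst :: "'k::field \<Rightarrow> 'k gpoly" where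
  "pconst c \<equiv> Poly_Mapping.single 0 c"

abbreviation pvar :: "var \<Rightarrow> 'k::field gpoly" where
  "pvar v \<equiv> Poly_Mapping.single (Poly_Mapping.single v (Suc 0)) 1"

definition monomial :: "(var \<Rightarrow> 'c::comm_ring_1) \<Rightarrow> (var \<Rightarrow>\<^sub>0 nat) \<Rightarrow> 'c" where
  "monomial \<sigma> u = (\<Prod>v\<in>Poly_Mapping.keys u. \<sigma> v ^ Poly_Mapping.lookup u v)"

text \<open>
  Evaluation of a polynomial at \<open>\<sigma>\<close>, with coefficients mapped by \<open>c\<close>. Points, substitutions by
  polynomials and substitutions by fractions are the cases \<open>c = id\<close>, \<open>pconst\<close> and \<open>gconst\<close>.
\<close>

definition gev :: "('k::field \<Rightarrow> 'c::comm_ring_1) \<Rightarrow> (var \<Rightarrow> 'c) \<Rightarrow> 'k gpoly \<Rightarrow> 'c" where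
  "gev c \<sigma> p = (\<Sum>u\<in>Poly_Mapping.keys p. c (Poly_Mapping.lookup p u) * monomial \<sigma> u)"

lemma monomial_superset:
  assumes "finite S" "Poly_Mapping.keys u \<subseteq> S"
  shows "monomial \<sigma> u = (\<Prod>v\<in>S. \<sigma> v ^ Poly_Mapping.lookup u v)"
  unfolding monomial_def using assms
  by (intro prod.mono_neutral_left) (auto simp: in_keys_iff)

lemma monomial_add: "monomial \<sigma> (u + u') = monomial \<sigma> u * monomial \<sigma> u'"
proof -
  let ?S = "Poly_Mapping.keys u \<union> Poly_Mapping.keys u'"
  have "monomial \<sigma> (u + u') = (\<Prod>v\<in>?S. \<sigma> v ^ Poly_Mapping.lookup (u + u') v)"
    using keys_add[of u u'] by (intro monomial_superset) auto
  then show ?thesis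
    by (simp add: monomial_superset[of ?S u] monomial_superset[of ?S u'] lookup_add power_add prod.distrib)
qed

lemma monomial_zero [simp]: "monomial \<sigma> 0 = 1"
  by (simp add: monomial_def)

lemma monomial_single [simp]: "monomial \<sigma> (Poly_Mapping.single v (Suc 0)) = \<sigma> v"
  by (simp add: monomial_def)

lemma sum_single_keys:
  "p = (\<Sum>u\<in>Poly_Mapping.keys p. Poly_Mapping.single u (Poly_Mapping.lookup p u))" (is "_ = ?r")
proof (rule poly_mapping_eqI)
  fix k
  have "Poly_Mapping.lookup ?r k = (\<Sum>u\<in>Poly_Mapping.keys p. if u = k then Poly_Mapping.lookup p k else 0)"
    unfolding lookup_sum by (rule sum.cong) (auto simp: lookup_single when_def)
  then show "Poly_Mapping.lookup p k = Poly_Mapping.lookup ?r k"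
    by (simp add: in_keys_iff)
qed

locale evaluation = comm_ring_hom c for c :: "'k::field \<Rightarrow> 'c::comm_ring_1"
begin

lemma gev_superset:
  assumes "finite S" "Poly_Mapping.keys p \<subseteq> S"
  shows "gev c \<sigma> p = (\<Sum>u\<in>S. c (Poly_Mapping.lookup p u) * monomial \<sigma> u)"
  unfolding gev_def using assms
  by (intro sum.mono_neutral_left) (auto simp: in_keys_iff)

lemma gev_add: "gev c \<sigma> (p + q) = gev c \<sigma> p + gev c \<sigma> q"
proof -
  let ?S = "Poly_Mapping.keys p \<union> Poly_Mapping.keys q"
  have "gev c \<sigma> (p + q) = (\<Sum>u\<in>?S. c (Poly_Mapping.lookup (p + q) u) * monomial \<sigma> u)"
    using keys_add[of p q] by (intro gev_superset) auto
  then show ?thesis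
    by (simp add: gev_superset[of ?S p] gev_superset[of ?S q] lookup_add hom_add distrib_right sum.distrib)
qed

lemma gev_zero [simp]: "gev c \<sigma> 0 = 0"
  by (simp add: gev_def)

lemma gev_sum: "gev c \<sigma> (\<Sum>i\<in>J. f i) = (\<Sum>i\<in>J. gev c \<sigma> (f i))"
  by (induction J rule: infinite_finite_induct) (simp_all add: gev_add)

lemma gev_single: "gev c \<sigma> (Poly_Mapping.single u a) = c a * monomial \<sigma> u"
  by (cases "a = 0") (simp_all add: gev_def)

lemma gev_mult: "gev c \<sigma> (p * q) = gev c \<sigma> p * gev c \<sigma> q"
proof -
  let ?s = "\<lambda>p u. Poly_Mapping.single u (Poly_Mapping.lookup p u)"
  have "gev c \<sigma> ((\<Sum>u\<in>Poly_Mapping.keys p. ?s p u) * (\<Sum>u\<in>Poly_Mapping.keys q. ?s q u)) =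
    gev c \<sigma> (\<Sum>u\<in>Poly_Mapping.keys p. ?s p u) * gev c \<sigma> (\<Sum>u\<in>Poly_Mapping.keys q. ?s q u)"
    unfolding sum_product gev_sum mult_single gev_single
    by (simp add: monomial_add hom_mult ac_simps)
  then show ?thesis using sum_single_keys[of p] sum_single_keys[of q] by simp
qed

lemma gev_hom: "comm_ring_hom (gev c \<sigma>)"
proof
  show "gev c \<sigma> 1 = 1" using gev_single[of \<sigma> 0 1] by simp
qed (simp_all add: gev_add gev_mult)

lemma gev_const [simp]: "gev c \<sigma> (pconst a) = c a"
  by (simp add: gev_single)

lemma gev_var [simp]: "gev c \<sigma> (pvar v) = \<sigma> v"
  by (simp add: gev_single)

lemma hom_gev:
  assumes "comm_ring_hom h"
  shows "h (gev c \<sigma> p) = gev (\<lambda>a. h (c a)) (\<lambda>v. h (\<sigma> v)) p"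
proof -
  interpret h: comm_ring_hom h by fact
  show ?thesis unfolding gev_def monomial_def by (simp add: h.hom_sum h.hom_mult h.hom_prod h.hom_power)
qed

end

lemma gev_cong:
  assumes "\<And>v u. u \<in> Poly_Mapping.keys p \<Longrightarrow> v \<in> Poly_Mapping.keys u \<Longrightarrow> \<sigma> v = \<tau> v"
  shows "gev c \<sigma> p = gev c \<tau> p"
  unfolding gev_def monomial_def using assms by (intro sum.cong arg_cong2[of _ _ _ _ "(*)"] prod.cong) auto

lemma evaluation_id: "evaluation (\<lambda>a. a)"
  by unfold_locales simp_all

lemma evaluation_pconst: "evaluation pconst"
  by unfold_locales (simp_all add: single_add mult_single flip: single_one)

interpretation E_const: evaluation "pconst :: 'k::field \<Rightarrow> 'k gpoly" by (rule evaluation_pconst)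

abbreviation peval :: "(var \<Rightarrow> 'k::field) \<Rightarrow> 'k gpoly \<Rightarrow> 'k" where
  "peval \<equiv> gev (\<lambda>a. a)"

abbreviation psub :: "(var \<Rightarrow> 'k::field gpoly) \<Rightarrow> 'k gpoly \<Rightarrow> 'k gpoly" where
  "psub \<equiv> gev pconst"

lemmas peval_hom = evaluation.gev_hom[OF evaluation_id]

lemma peval_const [simp]: "peval x (pconst a) = a"
  by (rule evaluation.gev_const[OF evaluation_id])

lemma peval_var [simp]: "peval x (pvar v) = x v"
  by (rule evaluation.gev_var[OF evaluation_id])

lemma peval_psub: "peval x (psub \<tau> p) = peval (\<lambda>v. peval x (\<tau> v)) p"
  by (subst E_const.hom_gev[OF peval_hom]) simp

interpretation peval: comm_ring_hom "peval x" for x :: "var \<Rightarrow> 'k::field" by (rule peval_hom)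

text \<open>
  The point with value \<open>2\<close> at a variable with different exponents and \<open>1\<close> elsewhere separates them; in
  characteristic \<open>0\<close> the powers of \<open>2\<close> are distinct.
\<close>

lemma distinct_monomials:
  assumes "u \<noteq> u'"
  shows "\<exists>z :: var \<Rightarrow> 'k::field_char_0. monomial z u \<noteq> monomial z u'"
proof -
  have "\<exists>v. Poly_Mapping.lookup u v \<noteq> Poly_Mapping.lookup u' v"
    using assms poly_mapping_eqI[of u u'] by blast
  then obtain v where v: "Poly_Mapping.lookup u v \<noteq> Poly_Mapping.lookup u' v" by blast
  define z :: "var \<Rightarrow> 'k" where "z w = (if w = v then 2 else 1)" for w
  have "monomial z w = 2 ^ Poly_Mapping.lookup w v" for w
  proof -
    have "monomial z w = (\<Prod>a\<in>insert v (Poly_Mapping.keys w). z a ^ Poly_Mapping.lookup w a)"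
      by (rule monomial_superset) auto
    also have "\<dots> = (\<Prod>a\<in>insert v (Poly_Mapping.keys w). if a = v then 2 ^ Poly_Mapping.lookup w v else 1)"
      by (rule prod.cong[OF refl]) (simp add: z_def)
    finally show ?thesis by simp
  qed
  moreover have "(2 :: 'k) ^ a \<noteq> 2 ^ b" if "a \<noteq> b" for a b :: nat
  proof -
    have "(2 :: nat) ^ a \<noteq> 2 ^ b" using that by simp
    then have "(of_nat (2 ^ a) :: 'k) \<noteq> of_nat (2 ^ b)" unfolding of_nat_eq_iff .
    then show ?thesis by simp
  qed
  ultimately show ?thesis using v by (intro exI[of _ z]) simp
qed

lemma monomial_pointwise_mult: "monomial (\<lambda>v. x v * z v) u = monomial x u * monomial z u"
  by (simp add: monomial_def power_mult_distrib prod.distrib)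

text \<open>
  Artin's argument for the independence of characters: monomials are multiplicative functions of the
  point, so scaling a relation by \<open>z\<close> and subtracting a multiple eliminates one of them.
\<close>

lemma monomials_independent:
  fixes c :: "(var \<Rightarrow>\<^sub>0 nat) \<Rightarrow> 'k::field_char_0"
  assumes "finite M" and "\<And>x. (\<Sum>u\<in>M. c u * monomial x u) = 0"
  shows "\<forall>u\<in>M. c u = 0"
  using assms
proof (induction M arbitrary: c rule: finite_induct)
  case (insert u0 M)
  have M: "c u = 0" if u: "u \<in> M" for u
  proof -
    have "u \<noteq> u0" using u insert.hyps(2) by blast
    then obtain z :: "var \<Rightarrow> 'k" where z: "monomial z u \<noteq> monomial z u0" using distinct_monomials by blast
    have "(\<Sum>w\<in>M. (c w * (monomial z w - monomial z u0)) * monomial x w) = 0" for x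
    proof -
      have "(\<Sum>w\<in>insert u0 M. c w * monomial (\<lambda>v. x v * z v) w) - monomial z u0 * (\<Sum>w\<in>insert u0 M. c w * monomial x w) = 0"
        by (simp only: insert.prems mult_zero_right diff_zero)
      then have "(\<Sum>w\<in>insert u0 M. (c w * (monomial z w - monomial z u0)) * monomial x w) = 0"
        unfolding monomial_pointwise_mult sum_distrib_left sum_subtractf[symmetric]
        by (simp add: algebra_simps)
      then show ?thesis using insert.hyps by simp
    qed
    then have "\<forall>w\<in>M. c w * (monomial z w - monomial z u0) = 0" by (rule insert.IH)
    then show ?thesis using u z by auto
  qed
  moreover have "c u0 = 0"
  proof -
    have "(\<Sum>u\<in>insert u0 M. c u * monomial (\<lambda>_. 1) u) = 0" by (rule insert.prems)
    moreover have "(\<Sum>u\<in>M. c u * monomial (\<lambda>_. 1) u) = 0" using M by (intro sum.neutral) auto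
    ultimately show ?thesis using insert.hyps by (simp add: monomial_def)
  qed
  ultimately show ?case by simp
qed simp

lemma poly_eq_zero_if_peval_zero:
  fixes p :: "'k::field_char_0 gpoly"
  assumes "\<And>x. peval x p = 0"
  shows "p = 0"
proof -
  have "\<forall>u\<in>Poly_Mapping.keys p. Poly_Mapping.lookup p u = 0"
    using assms unfolding gev_def by (intro monomials_independent) auto
  then have "Poly_Mapping.lookup p u = 0" for u by (cases "u \<in> Poly_Mapping.keys p") (auto simp: in_keys_iff)
  then show ?thesis by (intro poly_mapping_eqI) simp
qed

text \<open>
  A polynomial may be tested off the zero set of a nonzero \<open>q\<close>, as \<open>p q\<close> vanishes everywhere.
\<close>

lemma peval_zero_product:
  fixes p q :: "'k::field_char_0 gpoly"
  assumes "\<And>x. peval x q \<noteq> 0 \<Longrightarrow> peval x p = 0" "q \<noteq> 0"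
  shows "p = 0"
proof -
  have "p * q = 0"
    using assms(1) by (intro poly_eq_zero_if_peval_zero) (auto simp: peval.hom_mult)
  then show ?thesis using assms(2) by simp
qed

subsection \<open>Restriction to lines\<close>

lemma peval_line:
  fixes p :: "'k::field gpoly"
  shows "\<exists>P :: 'k poly. \<forall>t. peval (\<lambda>v. a v + t * b v) p = poly P t"
proof -
  have E: "evaluation (\<lambda>c :: 'k. [:c:])"
    by unfold_locales (simp_all add: one_pCons)
  interpret E: evaluation "\<lambda>c :: 'k. [:c:]" by (rule E)
  have "comm_ring_hom (\<lambda>P. poly P t)" for t :: 'k by unfold_locales simp_all
  then have "poly (gev (\<lambda>c. [:c:]) (\<lambda>v. [:a v, b v:]) p) t = peval (\<lambda>v. a v + t * b v) p" for t
    by (subst E.hom_gev) simp_all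
  then show ?thesis by (intro exI allI) (rule sym)
qed

lemma poly_eq_zero_if_cofinite:
  fixes P :: "'k::field_char_0 poly"
  assumes "finite S" "\<And>t. t \<notin> S \<Longrightarrow> poly P t = 0"
  shows "P = 0"
proof (rule ccontr)
  assume "P \<noteq> 0"
  then have "finite {t. poly P t = 0}" by (rule poly_roots_finite)
  then have "finite (S \<union> {t. poly P t = 0})" using assms(1) by simp
  moreover have "S \<union> {t. poly P t = 0} = UNIV" using assms(2) by auto
  ultimately show False using infinite_UNIV_char_0 by metis
qed

text \<open>
  The exceptional \<open>t\<close> are the negatives of eigenvalues. Thus every matrix is a limit, along a line, of
  invertible matrices.
\<close>

lemma finite_det_shift_zero:
  fixes M :: "'k::field mat"
  assumes M: "M \<in> carrier_mat n n"
  shows "finite {t. det (M + t \<cdot>\<^sub>m 1\<^sub>m n) = 0}"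
proof -
  have "char_poly M \<noteq> 0" using degree_monic_char_poly[OF M] by auto
  then have "finite (uminus ` {t. poly (char_poly M) t = 0})" using poly_roots_finite by blast
  moreover have "{t. det (M + t \<cdot>\<^sub>m 1\<^sub>m n) = 0} \<subseteq> uminus ` {t. poly (char_poly M) t = 0}"
  proof
    fix t assume "t \<in> {t. det (M + t \<cdot>\<^sub>m 1\<^sub>m n) = 0}"
    then have "eigenvalue M (- t)" using M by (simp add: eigenvalue_det[OF M] char_matrix_def)
    then show "t \<in> uminus ` {t. poly (char_poly M) t = 0}"
      using eigenvalue_root_char_poly[OF M] by (intro image_eqI[of _ _ "- t"]) auto
  qed
  ultimately show ?thesis by (rule finite_subset[rotated])
qed

subsection \<open>Fractions and substitutions\<close>

abbreviation to_frac :: "'k::field gpoly \<Rightarrow> 'k gfrac" where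
  "to_frac p \<equiv> Fract p 1"

lemma to_frac_hom: "comm_ring_hom (to_frac :: 'k::field gpoly \<Rightarrow> 'k gfrac)"
  by unfold_locales (simp_all add: Zero_fract_def One_fract_def)

lemma to_frac_zero: "to_frac 0 = 0" and to_frac_one: "to_frac 1 = 1"
  by (simp_all add: Zero_fract_def One_fract_def)

lemma to_frac_add: "to_frac (p + q) = to_frac p + to_frac q"
  and to_frac_mult: "to_frac (p * q) = to_frac p * to_frac q"
  by simp_all

lemma to_frac_eq_iff [simp]: "to_frac p = to_frac q \<longleftrightarrow> p = q"
  by (simp add: eq_fract)

lemma to_frac_eq_zero [simp]: "to_frac p = 0 \<longleftrightarrow> p = 0"
  using to_frac_eq_iff[of p 0] by (simp add: Zero_fract_def)

lemma gconst_to_frac: "gconst c = to_frac (pconst c)"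
  by (simp add: gconst_def)

lemma gvar_to_frac: "gvar v = to_frac (pvar v)"
  by (simp add: gvar_def)

lemma evaluation_gconst: "evaluation gconst"
  unfolding gconst_to_frac by unfold_locales
    (simp_all add: E_const.hom_add E_const.hom_mult E_const.hom_one E_const.hom_zero to_frac_zero to_frac_one)

interpretation E_gconst: evaluation "gconst :: 'k::field \<Rightarrow> 'k gfrac" by (rule evaluation_gconst)

lemma poly_subst_eq: "poly_subst \<sigma> = gev gconst \<sigma>"
  by (rule ext) (simp add: poly_subst_def gev_def monomial_def)

lemma poly_subst_to_frac: "poly_subst (\<lambda>v. to_frac (\<tau> v)) p = to_frac (psub \<tau> p)"
  unfolding poly_subst_eq E_const.hom_gev[OF to_frac_hom] gconst_to_frac[abs_def] ..

lemma poly_subst_gvar: "poly_subst gvar p = to_frac p"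
proof -
  have "psub pvar p = p"
  proof -
    have "psub pvar p = (\<Sum>u\<in>Poly_Mapping.keys p. Poly_Mapping.single u (Poly_Mapping.lookup p u))"
    proof -
      have "monomial (pvar :: var \<Rightarrow> 'a gpoly) u = Poly_Mapping.single u 1" for u
      proof -
        have *: "(pvar v :: 'a gpoly) ^ k = Poly_Mapping.single (Poly_Mapping.single v k) 1" for v k
        proof (induction k)
          case (Suc k)
          have "Poly_Mapping.single v (Suc 0) + Poly_Mapping.single v k = Poly_Mapping.single v (Suc k)"
            by (simp flip: single_add)
          then show ?case by (simp only: power_Suc Suc.IH mult_single mult_1)
        qed simp
        have "(\<Prod>v\<in>S. Poly_Mapping.single (Poly_Mapping.single v (Poly_Mapping.lookup u v)) (1 :: 'a)) =
          Poly_Mapping.single (\<Sum>v\<in>S. Poly_Mapping.single v (Poly_Mapping.lookup u v)) 1" for S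
          by (induction S rule: infinite_finite_induct) (simp_all add: mult_single)
        then show ?thesis unfolding monomial_def * using sum_single_keys[of u] by simp
      qed
      then show ?thesis unfolding gev_def by (simp add: mult_single)
    qed
    then show ?thesis using sum_single_keys[of p] by simp
  qed
  then show ?thesis using poly_subst_to_frac[of pvar p] unfolding gvar_to_frac[abs_def] by simp
qed

text \<open>Injectivity on polynomials keeps denominators nonzero, which makes \<open>rat_subst\<close> well defined.\<close>

locale injective_substitution =
  fixes \<sigma> :: "var \<Rightarrow> 'k::field gfrac"
  assumes inj: "poly_subst \<sigma> p = 0 \<Longrightarrow> p = 0"
begin

interpretation s: comm_ring_hom "poly_subst \<sigma>"
  unfolding poly_subst_eq by (rule E_gconst.gev_hom)

lemma rat_subst_Fract:
  assumes "q \<noteq> 0"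
  shows "rat_subst \<sigma> (Fract p q) = poly_subst \<sigma> p / poly_subst \<sigma> q"
  unfolding rat_subst_def
proof (rule the_equality)
  show "\<exists>a b. b \<noteq> 0 \<and> Fract p q = Fract a b \<and> poly_subst \<sigma> p / poly_subst \<sigma> q = poly_subst \<sigma> a / poly_subst \<sigma> b"
    using assms by blast
  fix r assume "\<exists>a b. b \<noteq> 0 \<and> Fract p q = Fract a b \<and> r = poly_subst \<sigma> a / poly_subst \<sigma> b"
  then obtain a b where ab: "b \<noteq> 0" "Fract p q = Fract a b" "r = poly_subst \<sigma> a / poly_subst \<sigma> b" by blast
  have "p * b = a * q" using ab assms by (simp add: eq_fract)
  then have "poly_subst \<sigma> p * poly_subst \<sigma> b = poly_subst \<sigma> a * poly_subst \<sigma> q"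
    by (simp flip: s.hom_mult)
  moreover have "poly_subst \<sigma> b \<noteq> 0" "poly_subst \<sigma> q \<noteq> 0" using inj ab assms by auto
  ultimately show "r = poly_subst \<sigma> p / poly_subst \<sigma> q" unfolding ab(3) by (simp add: frac_eq_eq)
qed

lemma rat_subst_to_frac: "rat_subst \<sigma> (to_frac p) = poly_subst \<sigma> p"
  by (simp add: rat_subst_Fract)

lemma rat_subst_gconst: "rat_subst \<sigma> (gconst c) = gconst c"
  unfolding gconst_to_frac rat_subst_to_frac by (simp add: poly_subst_eq gconst_to_frac)

lemma rat_subst_gvar: "rat_subst \<sigma> (gvar v) = \<sigma> v"
  unfolding gvar_to_frac rat_subst_to_frac by (simp add: poly_subst_eq)

lemma rat_subst_hom: "field_hom (rat_subst \<sigma>)"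
proof
  show "rat_subst \<sigma> 1 = 1"
    using rat_subst_to_frac[of 1] by (simp add: One_fract_def)
  show "rat_subst \<sigma> 0 = 0"
    using rat_subst_to_frac[of 0] by (simp add: Zero_fract_def)
  fix x y :: "'k gfrac"
  obtain a b where x: "x = Fract a b" "b \<noteq> 0" by (cases x) auto
  obtain c d where y: "y = Fract c d" "d \<noteq> 0" by (cases y) auto
  have nz: "poly_subst \<sigma> b \<noteq> 0" "poly_subst \<sigma> d \<noteq> 0" using inj x y by auto
  show "rat_subst \<sigma> (x + y) = rat_subst \<sigma> x + rat_subst \<sigma> y"
    unfolding x y using x(2) y(2) nz
    by (simp add: rat_subst_Fract s.hom_add s.hom_mult add_frac_eq)
  show "rat_subst \<sigma> (x * y) = rat_subst \<sigma> x * rat_subst \<sigma> y"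
    unfolding x y using x(2) y(2) nz by (simp add: rat_subst_Fract s.hom_mult)
qed

end

lemma gev_gconst_hom:
  fixes h :: "'k::field gfrac \<Rightarrow> 'k gfrac"
  assumes "comm_ring_hom h" "\<And>c. h (gconst c) = gconst c"
  shows "h (poly_subst \<sigma> p) = poly_subst (\<lambda>v. h (\<sigma> v)) p"
  unfolding poly_subst_eq using E_gconst.hom_gev[OF assms(1)] assms(2) by simp

text \<open>A substitution by polynomials that is onto on points is injective on polynomials.\<close>

lemma injective_substitutionI:
  fixes \<tau> :: "var \<Rightarrow> 'k::field_char_0 gpoly"
  assumes "\<And>y. \<exists>x. \<forall>v. peval x (\<tau> v) = y v"
  shows "injective_substitution (\<lambda>v. to_frac (\<tau> v))"
proof
  fix p :: "'k gpoly" assume "poly_subst (\<lambda>v. to_frac (\<tau> v)) p = 0"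
  then have 0: "psub \<tau> p = 0" by (simp add: poly_subst_to_frac)
  have "peval y p = 0" for y
  proof -
    obtain x where "\<forall>v. peval x (\<tau> v) = y v" using assms by blast
    then have "(\<lambda>v. peval x (\<tau> v)) = y" by blast
    then have "peval x (psub \<tau> p) = peval y p" unfolding peval_psub by simp
    then show ?thesis using 0 by simp
  qed
  then show "p = 0" by (rule poly_eq_zero_if_peval_zero)
qed

subsection \<open>Polynomials in a set of variables\<close>

definition polys_in :: "var set \<Rightarrow> 'k::field gpoly set" where
  "polys_in V = {p. \<forall>u\<in>Poly_Mapping.keys p. Poly_Mapping.keys u \<subseteq> V}"

lemma peval_cong: "p \<in> polys_in V \<Longrightarrow> (\<And>v. v \<in> V \<Longrightarrow> x v = y v) \<Longrightarrow> peval x p = peval y p"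
  by (rule gev_cong, unfold polys_in_def, blast)

lemma polys_in_const: "pconst c \<in> polys_in V"
  by (cases "c = 0") (auto simp: polys_in_def)

lemma polys_in_one: "1 \<in> polys_in V"
  using polys_in_const[of 1 V] by simp

lemma polys_in_var: "v \<in> V \<Longrightarrow> pvar v \<in> polys_in V"
  by (auto simp: polys_in_def)

lemma polys_in_add: "p \<in> polys_in V \<Longrightarrow> q \<in> polys_in V \<Longrightarrow> p + q \<in> polys_in V"
  using keys_add[of p q] unfolding polys_in_def by blast

lemma polys_in_mult: "p \<in> polys_in V \<Longrightarrow> q \<in> polys_in V \<Longrightarrow> p * q \<in> polys_in V"
  using keys_mult[of p q] keys_add unfolding polys_in_def by (fastforce dest!: subsetD)

definition fracs_in :: "var set \<Rightarrow> 'k::field gfrac set" where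
  "fracs_in V = {Fract p q | p q. p \<in> polys_in V \<and> q \<in> polys_in V \<and> q \<noteq> 0}"

lemma fracs_in_const: "gconst c \<in> fracs_in V"
  unfolding fracs_in_def gconst_def using polys_in_const[of c V] polys_in_one[of V] by fastforce

lemma fracs_in_zero: "0 \<in> fracs_in V" and fracs_in_one: "1 \<in> fracs_in V"
  using fracs_in_const[of 0 V] fracs_in_const[of 1 V] by (simp_all add: E_gconst.hom_zero E_gconst.hom_one)

lemma fracs_in_var: "v \<in> V \<Longrightarrow> gvar v \<in> fracs_in V"
  unfolding fracs_in_def gvar_to_frac using polys_in_var[of v V] polys_in_one[of V] by fastforce

lemma fracs_in_add: "x \<in> fracs_in V \<Longrightarrow> y \<in> fracs_in V \<Longrightarrow> x + y \<in> fracs_in V"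
proof -
  assume "x \<in> fracs_in V" "y \<in> fracs_in V"
  then obtain p q p' q' where *: "x = Fract p q" "y = Fract p' q'" "p \<in> polys_in V" "q \<in> polys_in V" "q \<noteq> 0"
    "p' \<in> polys_in V" "q' \<in> polys_in V" "q' \<noteq> 0" unfolding fracs_in_def by blast
  then have "x + y = Fract (p * q' + p' * q) (q * q')" by simp
  then show ?thesis using * polys_in_add polys_in_mult unfolding fracs_in_def
    by (metis (mono_tags, lifting) mem_Collect_eq no_zero_divisors)
qed

lemma fracs_in_mult: "x \<in> fracs_in V \<Longrightarrow> y \<in> fracs_in V \<Longrightarrow> x * y \<in> fracs_in V"
proof -
  assume "x \<in> fracs_in V" "y \<in> fracs_in V"
  then obtain p q p' q' where *: "x = Fract p q" "y = Fract p' q'" "p \<in> polys_in V" "q \<in> polys_in V" "q \<noteq> 0"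
    "p' \<in> polys_in V" "q' \<in> polys_in V" "q' \<noteq> 0" unfolding fracs_in_def by blast
  then have "x * y = Fract (p * p') (q * q')" by simp
  then show ?thesis using * polys_in_mult unfolding fracs_in_def
    by (metis (mono_tags, lifting) mem_Collect_eq no_zero_divisors)
qed

lemma fracs_in_inverse: "x \<in> fracs_in V \<Longrightarrow> inverse x \<in> fracs_in V"
proof -
  assume "x \<in> fracs_in V"
  then obtain p q where *: "x = Fract p q" "p \<in> polys_in V" "q \<in> polys_in V" "q \<noteq> 0"
    unfolding fracs_in_def by blast
  show ?thesis
  proof (cases "p = 0")
    case True
    then have "inverse x = 0" using * by (simp add: Zero_fract_def eq_fract)
    then show ?thesis using fracs_in_zero by simp
  next
    case False
    then show ?thesis using * unfolding fracs_in_def by auto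
  qed
qed

lemma fracs_in_uminus: "x \<in> fracs_in V \<Longrightarrow> - x \<in> fracs_in V"
  using fracs_in_mult[OF fracs_in_const[of "-1"], of x V] by (simp add: E_gconst.hom_uminus E_gconst.hom_one)

lemma fracs_in_sum: "(\<And>i. i \<in> J \<Longrightarrow> f i \<in> fracs_in V) \<Longrightarrow> (\<Sum>i\<in>J. f i) \<in> fracs_in V"
  by (induction J rule: infinite_finite_induct) (auto simp: fracs_in_zero fracs_in_add)

lemma fracs_in_prod: "(\<And>i. i \<in> J \<Longrightarrow> f i \<in> fracs_in V) \<Longrightarrow> (\<Prod>i\<in>J. f i) \<in> fracs_in V"
  by (induction J rule: infinite_finite_induct) (auto simp: fracs_in_one fracs_in_mult)

lemma fracs_in_det:
  assumes "M \<in> carrier_mat n n" "\<And>i j. i < n \<Longrightarrow> j < n \<Longrightarrow> M $$ (i, j) \<in> fracs_in V"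
  shows "det M \<in> fracs_in V"
  unfolding det_def'[OF assms(1)]
proof (intro fracs_in_sum fracs_in_mult fracs_in_prod assms(2))
  fix p i assume "p \<in> {p. p permutes {0..<n}}" "i \<in> {0..<n}"
  then show "i < n" "p i < n" using permutes_in_image[of p "{0..<n}" i] by auto
qed (auto simp: sign_def fracs_in_one fracs_in_uminus)

text \<open>By the formula for the inverse in terms of cofactors.\<close>

lemma fracs_in_inverse_matrix:
  assumes M: "M \<in> carrier_mat n n" and N: "N \<in> carrier_mat n n" and inv: "N * M = 1\<^sub>m n"
    and entries: "\<And>i j. i < n \<Longrightarrow> j < n \<Longrightarrow> M $$ (i, j) \<in> fracs_in V"
    and ij: "i < n" "j < n"
  shows "N $$ (i, j) \<in> fracs_in V"
proof -
  have "det N * det M = 1" using inv det_mult[OF N M] by simp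
  then have nz: "det M \<noteq> 0" by auto
  have "N * (M * adj_mat M) = (N * M) * adj_mat M"
    using M N adj_mat(1)[OF M] by simp
  then have "det M \<cdot>\<^sub>m N = adj_mat M"
    using M N adj_mat[OF M] inv mult_smult_distrib[OF N one_carrier_mat, of "det M"] by simp
  then have "det M * N $$ (i, j) = adj_mat M $$ (i, j)" using N ij by (metis carrier_matD index_smult_mat(1))
  then have "N $$ (i, j) = inverse (det M) * cofactor M j i"
    using nz M ij by (simp add: adj_mat_def field_simps)
  moreover have "cofactor M j i \<in> fracs_in V"
    unfolding cofactor_def
  proof (intro fracs_in_mult)
    show "(- 1) ^ (j + i) \<in> fracs_in V"
      using fracs_in_one[of V] fracs_in_uminus[OF fracs_in_one, of V] by (cases "even (j + i)") auto
    show "det (mat_delete M j i) \<in> fracs_in V"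
      using M ij entries
      by (intro fracs_in_det[of _ "n - 1"]) (auto simp: mat_delete_def)
  qed
  ultimately show ?thesis using fracs_in_mult fracs_in_inverse fracs_in_det[OF M entries] by metis
qed

section \<open>The universal division algebra as a ring\<close>

lemma to_frac_sum: "to_frac (\<Sum>i\<in>J. f i) = (\<Sum>i\<in>J. to_frac (f i))"
proof (induction J rule: infinite_finite_induct)
  case (insert x F)
  show ?case unfolding sum.insert[OF insert.hyps] to_frac_add insert.IH ..
qed (simp_all add: to_frac_zero)

lemma mat_mult_entry:
  assumes "A \<in> carrier_mat n n" "B \<in> carrier_mat n n" "i < n" "j < n"
  shows "(A * B) $$ (i, j) = (\<Sum>k<n. A $$ (i, k) * B $$ (k, j))"
  using assms by (simp add: scalar_prod_def lessThan_atLeast0)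

lemma mat_mult3_entry:
  fixes P Y P' :: "'f::comm_ring_1 mat"
  assumes "P \<in> carrier_mat n n" "Y \<in> carrier_mat n n" "P' \<in> carrier_mat n n" "i < n" "j < n"
  shows "(P * Y * P') $$ (i, j) = (\<Sum>a<n. \<Sum>b<n. P $$ (i, a) * P' $$ (b, j) * Y $$ (a, b))"
proof -
  have "(P * Y * P') $$ (i, j) = (\<Sum>b<n. (\<Sum>a<n. P $$ (i, a) * Y $$ (a, b)) * P' $$ (b, j))"
    unfolding mat_mult_entry[OF mult_carrier_mat[OF assms(1,2)] assms(3-5)]
    by (rule sum.cong[OF refl]) (use assms in \<open>simp add: mat_mult_entry[OF assms(1,2)] del: index_mult_mat(1)\<close>)
  also have "\<dots> = (\<Sum>b<n. \<Sum>a<n. P $$ (i, a) * P' $$ (b, j) * Y $$ (a, b))"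
    by (simp add: sum_distrib_right sum_distrib_left ac_simps)
  finally show ?thesis by (subst sum.swap)
qed

lemma inverse_matrix_exists:
  fixes M :: "'f::field mat"
  assumes M: "M \<in> carrier_mat n n" and det: "det M \<noteq> 0"
  obtains N where "N \<in> carrier_mat n n" "M * N = 1\<^sub>m n" "N * M = 1\<^sub>m n"
  using det_non_zero_imp_unit[OF M det, of "()"] unfolding Units_def ring_mat_def by auto

definition gvars :: "nat \<Rightarrow> nat \<Rightarrow> var set" where
  "gvars m n = {(h, i, j) | h i j. h < m \<and> i < n \<and> j < n}"

lemma UD_closed: "a \<in> UD_carrier m n \<Longrightarrow> a \<in> carrier_mat n n"
  by (induction rule: UD_carrier.induct) (auto simp: generic_mat_def)

text \<open>
  The elements of \<open>UD(m,n)\<close> involve the variables of the \<open>m\<close> generic matrices only, although the type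
  of fractions has infinitely many variables.
\<close>

lemma UD_entries:
  "a \<in> UD_carrier m n \<Longrightarrow> i < n \<Longrightarrow> j < n \<Longrightarrow> a $$ (i, j) \<in> fracs_in (gvars m n)"
proof (induction arbitrary: i j rule: UD_carrier.induct)
  case (scalar c)
  then show ?case by (auto simp: fracs_in_const fracs_in_zero)
next
  case (generic h)
  then show ?case by (auto simp: generic_mat_def gvars_def intro!: fracs_in_var)
next
  case (add a b)
  then show ?case using UD_closed[OF add(1)] UD_closed[OF add(2)] by (simp add: fracs_in_add)
next
  case (mult a b)
  then show ?case unfolding mat_mult_entry[OF UD_closed[OF mult(1)] UD_closed[OF mult(2)] mult(5,6)]
    by (intro fracs_in_sum fracs_in_mult) auto
next
  case (inverse a b)
  show ?case
    by (rule fracs_in_inverse_matrix[OF UD_closed[OF inverse(1)] inverse(2,4) inverse(5) inverse(6,7)])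
qed

lemma UD_simps: "carrier (UD m n) = UD_carrier m n" "mult (UD m n) = (*)" "one (UD m n) = 1\<^sub>m n"
  "\<zero>\<^bsub>UD m n\<^esub> = 0\<^sub>m n n" "add (UD m n) = (+)" "sclr (UD m n) c = gconst c \<cdot>\<^sub>m 1\<^sub>m n"
  "act (UD m n) g = map_mat (rat_subst (GL_subst m g))"
  by (simp_all add: UD_def)

lemma UD_one: "(1\<^sub>m n :: 'k::field gfrac mat) \<in> UD_carrier m n"
proof -
  have "gconst 1 \<cdot>\<^sub>m 1\<^sub>m n = (1\<^sub>m n :: 'k gfrac mat)" by (intro eq_matI) (auto simp: E_gconst.hom_one)
  then show "(1\<^sub>m n :: 'k gfrac mat) \<in> UD_carrier m n" using UD_carrier.scalar[of "1 :: 'k" n m] by (simp only:)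
qed

lemma UD_zero: "(0\<^sub>m n n :: 'k::field gfrac mat) \<in> UD_carrier m n"
proof -
  have "gconst 0 \<cdot>\<^sub>m 1\<^sub>m n = (0\<^sub>m n n :: 'k gfrac mat)" by (intro eq_matI) (auto simp: E_gconst.hom_zero)
  then show "(0\<^sub>m n n :: 'k gfrac mat) \<in> UD_carrier m n" using UD_carrier.scalar[of "0 :: 'k" n m] by (simp only:)
qed

lemma UD_smult: "a \<in> UD_carrier m n \<Longrightarrow> gconst c \<cdot>\<^sub>m a \<in> UD_carrier m n"
proof -
  assume a: "a \<in> UD_carrier m n"
  have "(gconst c \<cdot>\<^sub>m 1\<^sub>m n) * a = gconst c \<cdot>\<^sub>m a"
    using mult_smult_assoc_mat[OF one_carrier_mat UD_closed[OF a]] left_mult_one_mat[OF UD_closed[OF a]] by simp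
  then show ?thesis using UD_carrier.mult[OF UD_carrier.scalar a, of c] by simp
qed

lemma UD_ring: "ring (UD m n :: ('k::field gfrac mat, 'k, 'k mat) galg)"
proof (intro ringI abelian_groupI monoidI, unfold UD_simps)
  show "x + y + z = x + (y + z)" if "x \<in> UD_carrier m n" "y \<in> UD_carrier m n" "z \<in> UD_carrier m n"
    for x y z :: "'k gfrac mat"
    using assoc_add_mat[OF UD_closed[OF that(1)] UD_closed[OF that(2)] UD_closed[OF that(3)]] .
  show "x + y = y + x" if "x \<in> UD_carrier m n" "y \<in> UD_carrier m n" for x y :: "'k gfrac mat"
    using comm_add_mat[OF UD_closed[OF that(1)] UD_closed[OF that(2)]] .
  show "\<exists>y\<in>UD_carrier m n. y + x = 0\<^sub>m n n" if x: "x \<in> UD_carrier m n" for x :: "'k gfrac mat"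
  proof
    show "gconst (- 1) \<cdot>\<^sub>m x \<in> UD_carrier m n" by (rule UD_smult[OF x])
    show "gconst (- 1) \<cdot>\<^sub>m x + x = 0\<^sub>m n n" using UD_closed[OF x]
      by (intro eq_matI) (auto simp: E_gconst.hom_uminus E_gconst.hom_one)
  qed
qed (simp_all add: UD_one UD_zero UD_carrier.add UD_carrier.mult UD_closed[of _ m n] add_mult_distrib_mat[of _ n n _ _ n]
    mult_add_distrib_mat[of _ n n _ n] assoc_mult_mat[of _ n n _ n _ n]
    left_mult_one_mat[of _ n n] right_mult_one_mat[of _ n n])

subsection \<open>The generic matrices form a basis of the matrix algebra\<close>

text \<open>
  The \<open>n\<^sup>2 \<times> n\<^sup>2\<close> matrix whose rows are the first \<open>n\<^sup>2\<close> generic matrices, written as vectors. It is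
  invertible, which says that these matrices form a basis.
\<close>

definition gen_poly_mat :: "nat \<Rightarrow> 'k::field gpoly mat" where
  "gen_poly_mat n = mat (n * n) (n * n) (\<lambda>(h, e). pvar (h, e div n, e mod n))"

definition point_mat :: "nat \<Rightarrow> (var \<Rightarrow> 'k::field) \<Rightarrow> 'k mat" where
  "point_mat n x = mat (n * n) (n * n) (\<lambda>(h, e). x (h, e div n, e mod n))"

lemma peval_det_gen: "peval x (det (gen_poly_mat n)) = det (point_mat n x)"
proof -
  have "map_mat (peval x) (gen_poly_mat n) = point_mat n x"
    by (auto simp: gen_poly_mat_def point_mat_def)
  then show ?thesis using peval.hom_det[of x "gen_poly_mat n"] by simp
qed

text \<open>
  At the point where the generic matrices become the matrix units, the determinant is \<open>1\<close>.
\<close>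

lemma det_gen_nonzero: "det (gen_poly_mat n) \<noteq> (0 :: 'k::field gpoly)"
proof
  assume "det (gen_poly_mat n) = (0 :: 'k gpoly)"
  then have "det (point_mat n x) = (0 :: 'k)" for x using peval_det_gen[of x n] by simp
  moreover have "point_mat n (\<lambda>(h, i, j). if h = i * n + j then 1 else 0) = (1\<^sub>m (n * n) :: 'k mat)"
    by (auto simp: point_mat_def intro!: eq_matI)
  ultimately show False by (metis det_one zero_neq_one)
qed

lemma gen_inverse:
  "\<exists>W. (\<forall>e<n*n. \<forall>i<n. \<forall>j<n.
      (\<Sum>h<n*n. W $$ (e, h) * gvar (h, i, j)) = (if e = i * n + j then 1 else (0 :: 'k::field gfrac))) \<and>
    (\<forall>h<n*n. \<forall>h'<n*n.
      (\<Sum>e<n*n. gvar (h, e div n, e mod n) * W $$ (e, h')) = (if h = h' then 1 else (0 :: 'k gfrac)))"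
proof -
  let ?X = "map_mat to_frac (gen_poly_mat n) :: 'k gfrac mat"
  have X: "?X \<in> carrier_mat (n * n) (n * n)" by (simp add: gen_poly_mat_def)
  have X_entry: "?X $$ (h, e) = gvar (h, e div n, e mod n)" if "h < n * n" "e < n * n" for h e
    using that by (simp add: gen_poly_mat_def gvar_to_frac)
  have "det ?X = to_frac (det (gen_poly_mat n))" by (rule comm_ring_hom.hom_det[OF to_frac_hom])
  then have "det ?X \<noteq> 0" using det_gen_nonzero by simp
  then obtain W where W: "W \<in> carrier_mat (n * n) (n * n)" "?X * W = 1\<^sub>m (n * n)" "W * ?X = 1\<^sub>m (n * n)"
    by (rule inverse_matrix_exists[OF X])
  show ?thesis
  proof (intro exI[of _ W] conjI allI impI)
    fix e i j assume e: "e < n * n" "i < n" "j < n"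
    note ij = pair_index[OF e(2,3)]
    have "(\<Sum>h<n*n. W $$ (e, h) * gvar (h, i, j)) = (W * ?X) $$ (e, i * n + j)"
      unfolding mat_mult_entry[OF W(1) X e(1) ij(1)] using ij by (intro sum.cong) (auto simp: X_entry)
    then show "(\<Sum>h<n*n. W $$ (e, h) * gvar (h, i, j)) = (if e = i * n + j then 1 else 0)"
      using W(3) e ij by simp
  next
    fix h h' assume h: "h < n * n" "h' < n * n"
    have "(\<Sum>e<n*n. gvar (h, e div n, e mod n) * W $$ (e, h')) = (?X * W) $$ (h, h')"
      unfolding mat_mult_entry[OF X W(1) h] using h by (intro sum.cong) (auto simp: X_entry)
    then show "(\<Sum>e<n*n. gvar (h, e div n, e mod n) * W $$ (e, h')) = (if h = h' then 1 else 0)"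
      using W(2) h by simp
  qed
qed

text \<open>
  The inverse \<open>W\<close> expresses every matrix unit by generic matrices, so \<open>z\<close> commutes with the matrix units.
\<close>

lemma commutes_with_generic_imp_scalar:
  fixes z :: "'k::field gfrac mat"
  assumes z: "z \<in> carrier_mat n n" and n: "n \<ge> 1"
    and comm: "\<And>h. h < n * n \<Longrightarrow> z * generic_mat n h = generic_mat n h * z"
  shows "z = z $$ (0, 0) \<cdot>\<^sub>m 1\<^sub>m n"
proof -
  obtain W where "\<forall>e<n*n. \<forall>i<n. \<forall>j<n.
      (\<Sum>h<n*n. W $$ (e, h) * gvar (h, i, j)) = (if e = i * n + j then 1 else (0 :: 'k gfrac))"
    using gen_inverse[of n] by blast
  then have W: "(\<Sum>h<n*n. W $$ (e, h) * gvar (h, i, j)) = (if e = i * n + j then 1 else (0 :: 'k gfrac))"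
    if "e < n * n" "i < n" "j < n" for e i j using that by blast
  have entry: "(if b = j then z $$ (i, a) else 0) = (if i = a then z $$ (b, j) else 0)"
    if lt: "i < n" "j < n" "a < n" "b < n" for i j a b
  proof -
    let ?e = "a * n + b"
    have e: "?e < n * n" using pair_index(1)[of a n b] lt by simp
    have e_iff: "?e = c * n + d \<longleftrightarrow> a = c \<and> b = d" if "c < n" "d < n" for c d
      using pair_index(2,3)[of a n b] pair_index_iff[OF e that] lt by simp
    have g: "generic_mat n h \<in> carrier_mat n n" for h by (simp add: generic_mat_def)
    have zg: "(z * generic_mat n h) $$ (i, j) = (\<Sum>c<n. z $$ (i, c) * gvar (h, c, j))"
      and gz: "(generic_mat n h * z) $$ (i, j) = (\<Sum>c<n. z $$ (c, j) * gvar (h, i, c))" for h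
      unfolding mat_mult_entry[OF z g lt(1,2)] mat_mult_entry[OF g z lt(1,2)]
      by (rule sum.cong[OF refl]; use lt in \<open>simp add: generic_mat_def\<close>)+
    have "(\<Sum>h<n*n. W $$ (?e, h) * (z * generic_mat n h) $$ (i, j)) =
        (\<Sum>c<n. z $$ (i, c) * (\<Sum>h<n*n. W $$ (?e, h) * gvar (h, c, j)))"
      unfolding zg sum_distrib_left by (subst sum.swap) (simp add: ac_simps)
    also have "\<dots> = (\<Sum>c<n. if c = a then (if b = j then z $$ (i, a) else 0) else 0)"
      using lt by (intro sum.cong) (auto simp: W[OF e] e_iff)
    finally have 1: "(\<Sum>h<n*n. W $$ (?e, h) * (z * generic_mat n h) $$ (i, j)) = (if b = j then z $$ (i, a) else 0)"
      using lt by simp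
    have "(\<Sum>h<n*n. W $$ (?e, h) * (generic_mat n h * z) $$ (i, j)) =
        (\<Sum>c<n. z $$ (c, j) * (\<Sum>h<n*n. W $$ (?e, h) * gvar (h, i, c)))"
      unfolding gz sum_distrib_left by (subst sum.swap) (simp add: ac_simps)
    also have "\<dots> = (\<Sum>c<n. if c = b then (if i = a then z $$ (b, j) else 0) else 0)"
      using lt by (intro sum.cong) (auto simp: W[OF e] e_iff)
    finally have 2: "(\<Sum>h<n*n. W $$ (?e, h) * (generic_mat n h * z) $$ (i, j)) = (if i = a then z $$ (b, j) else 0)"
      using lt by simp
    show ?thesis using 1 2 comm by simp
  qed
  show ?thesis
  proof (rule eq_matI)
    fix i j assume "i < dim_row (z $$ (0, 0) \<cdot>\<^sub>m 1\<^sub>m n)" "j < dim_col (z $$ (0, 0) \<cdot>\<^sub>m 1\<^sub>m n)"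
    then show "z $$ (i, j) = (z $$ (0, 0) \<cdot>\<^sub>m 1\<^sub>m n) $$ (i, j)"
      using entry[of i 0 j 0] n by (cases "i = j") simp_all
  qed (use z in auto)
qed

lemma UD_center:
  assumes n: "n \<ge> 1" and m: "m \<ge> n * n" and z: "z \<in> carrier (galg_center (UD m n))"
  shows "z = z $$ (0, 0) \<cdot>\<^sub>m 1\<^sub>m n"
proof (rule commutes_with_generic_imp_scalar[OF _ n])
  have zUD: "z \<in> UD_carrier m n" and comm: "\<And>a. a \<in> UD_carrier m n \<Longrightarrow> z * a = a * z"
    using z by (auto simp: galg_center_def UD_simps)
  show "z \<in> carrier_mat n n" by (rule UD_closed[OF zUD])
  show "z * generic_mat n h = generic_mat n h * z" if "h < n * n" for h
    using that m by (intro comm UD_carrier.generic) simp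
qed

lemma UD_center_inverse:
  assumes n: "n \<ge> 1" and m: "m \<ge> n * n" and z: "z \<in> carrier (galg_center (UD m n))" "z \<noteq> \<zero>\<^bsub>UD m n\<^esub>"
  shows "\<exists>z'\<in>carrier (galg_center (UD m n)). z' \<otimes>\<^bsub>UD m n\<^esub> z = \<one>\<^bsub>UD m n\<^esub>"
proof -
  have zUD: "z \<in> UD_carrier m n" using z by (simp add: galg_center_def UD_simps)
  obtain \<zeta> where \<zeta>: "z = \<zeta> \<cdot>\<^sub>m 1\<^sub>m n" using UD_center[OF n m z(1)] by blast
  have "\<zeta> \<noteq> 0"
  proof
    assume "\<zeta> = 0"
    then have "z = 0\<^sub>m n n" unfolding \<zeta> by auto
    then show False using z(2) by (simp add: UD_simps)
  qed
  let ?z = "inverse \<zeta> \<cdot>\<^sub>m 1\<^sub>m n"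
  have zz: "?z * z = 1\<^sub>m n" "z * ?z = 1\<^sub>m n" unfolding \<zeta> using \<open>\<zeta> \<noteq> 0\<close>
    by (auto simp: mult_smult_distrib[of _ n n _ n] mult_smult_assoc_mat[of _ n n _ n])
  have "?z \<in> UD_carrier m n" by (rule UD_carrier.inverse[OF zUD _ zz(2,1)]) simp
  moreover have "?z * a = a * ?z" if "a \<in> UD_carrier m n" for a
    using UD_closed[OF that] mult_smult_distrib[of a n n "1\<^sub>m n" n "inverse \<zeta>"]
      mult_smult_assoc_mat[of "1\<^sub>m n" n n a n "inverse \<zeta>"] by simp
  ultimately show ?thesis using zz by (intro bexI[of _ ?z]) (auto simp: UD_simps galg_center_def)
qed

lemma UD_generic_independent:
  fixes c :: "nat \<Rightarrow> 'k::field gfrac mat"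
  assumes n: "n \<ge> 1" and m: "m \<ge> n * n"
    and c: "\<And>h. h < n * n \<Longrightarrow> c h \<in> carrier (galg_center (UD m n))"
    and zero: "(\<Oplus>\<^bsub>UD m n\<^esub>h\<in>{..<n*n}. generic_mat n h \<otimes>\<^bsub>UD m n\<^esub> c h) = \<zero>\<^bsub>UD m n\<^esub>"
    and h: "h < n * n"
  shows "c h = \<zero>\<^bsub>UD m n\<^esub>"
proof -
  obtain W where "\<forall>h<n*n. \<forall>h'<n*n.
      (\<Sum>e<n*n. gvar (h, e div n, e mod n) * W $$ (e, h')) = (if h = h' then 1 else (0 :: 'k gfrac))"
    using gen_inverse[of n] by blast
  then have W: "(\<Sum>e<n*n. gvar (h, e div n, e mod n) * W $$ (e, h')) = (if h = h' then 1 else (0 :: 'k gfrac))"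
    if "h < n * n" "h' < n * n" for h h' using that by blast
  define \<zeta> where "\<zeta> h = c h $$ (0, 0)" for h
  have c_eq: "c h = \<zeta> h \<cdot>\<^sub>m 1\<^sub>m n" if "h < n * n" for h
    unfolding \<zeta>_def using UD_center[OF n m c[OF that]] .
  have prod: "generic_mat n h * c h = \<zeta> h \<cdot>\<^sub>m generic_mat n h" if "h < n * n" for h
    unfolding c_eq[OF that] by (simp add: mult_smult_distrib[of _ n n _ n] generic_mat_def)
  have "generic_mat n h * c h \<in> UD_carrier m n" if "h < n * n" for h
    using that m c[OF that] by (intro UD_carrier.mult UD_carrier.generic) (auto simp: galg_center_def UD_simps)
  then have "(\<Oplus>\<^bsub>UD m n\<^esub>h\<in>{..<n*n}. generic_mat n h \<otimes>\<^bsub>UD m n\<^esub> c h) =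
      mat n n (\<lambda>p. \<Sum>h\<in>{..<n*n}. (generic_mat n h * c h) $$ p)"
    using UD_closed by (subst finsum_matrices[OF UD_ring]) (auto simp: UD_simps)
  then have entries: "(\<Sum>h<n*n. \<zeta> h * gvar (h, i, j)) = 0" if ij: "i < n" "j < n" for i j
  proof -
    have "(\<Sum>h<n*n. \<zeta> h * gvar (h, i, j)) = (\<Sum>h\<in>{..<n*n}. (generic_mat n h * c h) $$ (i, j))"
      using ij by (intro sum.cong) (auto simp: prod, simp add: generic_mat_def)
    also have "\<dots> = (\<Oplus>\<^bsub>UD m n\<^esub>h\<in>{..<n*n}. generic_mat n h \<otimes>\<^bsub>UD m n\<^esub> c h) $$ (i, j)"
      unfolding \<open>_ = mat n n _\<close> using ij by simp
    also have "\<dots> = 0" unfolding zero using ij by (simp add: UD_simps(4))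
    finally show ?thesis .
  qed
  have "\<zeta> h = (\<Sum>h'<n*n. \<zeta> h' * (\<Sum>e<n*n. gvar (h', e div n, e mod n) * W $$ (e, h)))"
  proof -
    have "(\<Sum>h'<n*n. \<zeta> h' * (\<Sum>e<n*n. gvar (h', e div n, e mod n) * W $$ (e, h))) = (\<Sum>h'<n*n. if h' = h then \<zeta> h else 0)"
      using h by (intro sum.cong) (auto simp: W)
    then show ?thesis using h by simp
  qed
  also have "\<dots> = (\<Sum>e<n*n. (\<Sum>h'<n*n. \<zeta> h' * gvar (h', e div n, e mod n)) * W $$ (e, h))"
    unfolding sum_distrib_left sum_distrib_right by (subst sum.swap) (simp add: ac_simps)
  also have "\<dots> = 0"
    using n by (intro sum.neutral ballI) (subst entries, auto simp: less_mult_imp_div_less)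
  finally show ?thesis unfolding c_eq[OF h] UD_simps by auto
qed

subsection \<open>Conjugation\<close>

text \<open>
  Simultaneous conjugation \<open>X\<^sup>(\<^sup>h\<^sup>) \<mapsto> T X\<^sup>(\<^sup>h\<^sup>) T'\<close>, where \<open>T'\<close> is the inverse of \<open>T\<close>, as a
  substitution. Variables that do not belong to \<open>n \<times> n\<close> matrices are kept, which makes it
  bijective on points.
\<close>

definition conj_poly :: "nat \<Rightarrow> 'k::field mat \<Rightarrow> 'k mat \<Rightarrow> var \<Rightarrow> 'k gpoly" where
  "conj_poly n T T' = (\<lambda>(h, i, j). if i < n \<and> j < n
     then \<Sum>a<n. \<Sum>b<n. pconst (T $$ (i, a) * T' $$ (b, j)) * pvar (h, a, b) else pvar (h, i, j))"

definition conj_point :: "nat \<Rightarrow> 'k::field mat \<Rightarrow> 'k mat \<Rightarrow> (var \<Rightarrow> 'k) \<Rightarrow> var \<Rightarrow> 'k" where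
  "conj_point n T T' x = (\<lambda>(h, i, j). if i < n \<and> j < n
     then \<Sum>a<n. \<Sum>b<n. T $$ (i, a) * T' $$ (b, j) * x (h, a, b) else x (h, i, j))"

lemma peval_conj_poly: "peval x (conj_poly n T T' v) = conj_point n T T' x v"
  by (cases v) (simp add: conj_poly_def conj_point_def peval.hom_sum peval.hom_mult)

lemma conj_point_inverse:
  assumes T: "T \<in> carrier_mat n n" "T' \<in> carrier_mat n n" "T * T' = 1\<^sub>m n" "T' * T = 1\<^sub>m n"
  shows "conj_point n T T' (conj_point n T' T x) = x"
proof
  fix v :: var
  obtain h i j where v: "v = (h, i, j)" by (cases v)
  show "conj_point n T T' (conj_point n T' T x) v = x v"
  proof (cases "i < n \<and> j < n")
    case True
    define X where "X = mat n n (\<lambda>(i, j). x (h, i, j))"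
    have X: "X \<in> carrier_mat n n" by (simp add: X_def)
    have Y: "T' * X * T \<in> carrier_mat n n" using T X by simp
    have inner: "conj_point n T' T x (h, a, b) = (T' * X * T) $$ (a, b)" if "a < n" "b < n" for a b
      unfolding mat_mult3_entry[OF T(2) X T(1) that] using that by (simp add: conj_point_def X_def)
    have "conj_point n T T' (conj_point n T' T x) v = (T * (T' * X * T) * T') $$ (i, j)"
      unfolding mat_mult3_entry[OF T(1) Y T(2) True[THEN conjunct1] True[THEN conjunct2]]
      using True by (simp add: v conj_point_def[of n T T'] inner del: index_mult_mat(1) cong: sum.cong_simp)
    also have "T * (T' * X * T) * T' = (T * T') * X * (T * T')"
      using T(1,2) X by (simp add: assoc_mult_mat[of _ n n _ n _ n])
    also have "\<dots> $$ (i, j) = x v" using True X unfolding T(3) by (simp add: v X_def)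
    finally show ?thesis .
  qed (auto simp: v conj_point_def)
qed

lemma conj_injective:
  fixes T :: "'k::field_char_0 mat"
  assumes T: "T \<in> carrier_mat n n" "T' \<in> carrier_mat n n" "T * T' = 1\<^sub>m n" "T' * T = 1\<^sub>m n"
  shows "injective_substitution (\<lambda>v. to_frac (conj_poly n T T' v))"
proof (rule injective_substitutionI)
  fix y :: "var \<Rightarrow> 'k"
  show "\<exists>x. \<forall>v. peval x (conj_poly n T T' v) = y v"
    unfolding peval_conj_poly using conj_point_inverse[OF T] by metis
qed

text \<open>
  The generic matrices are equivariant by construction, and equivariance is preserved by the ring
  operations and by inverses.
\<close>

lemma UD_conj_equivariant:
  fixes T :: "'k::field_char_0 mat"
  assumes T: "T \<in> carrier_mat n n" "T' \<in> carrier_mat n n" "T * T' = 1\<^sub>m n" "T' * T = 1\<^sub>m n"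
    and a: "a \<in> UD_carrier m n"
  shows "map_mat (rat_subst (\<lambda>v. to_frac (conj_poly n T T' v))) a = map_mat gconst T * a * map_mat gconst T'"
proof -
  let ?\<sigma> = "\<lambda>v. to_frac (conj_poly n T T' v)"
  interpret inj: injective_substitution ?\<sigma> by (rule conj_injective[OF T])
  interpret r: field_hom "rat_subst ?\<sigma>" by (rule inj.rat_subst_hom)
  let ?r = "map_mat (rat_subst ?\<sigma>)" and ?T = "map_mat gconst T" and ?T' = "map_mat gconst T'"
  have cT: "?T \<in> carrier_mat n n" "?T' \<in> carrier_mat n n" using T by auto
  have TT: "?T * ?T' = 1\<^sub>m n" "?T' * ?T = 1\<^sub>m n"
    using E_gconst.mat_hom_mult[OF T(1,2)] E_gconst.mat_hom_mult[OF T(2,1)] T(3,4) by (simp_all add: E_gconst.mat_hom_one)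
  show ?thesis using a
  proof (induction rule: UD_carrier.induct)
    case (scalar c)
    have "?r (gconst c \<cdot>\<^sub>m 1\<^sub>m n) = gconst c \<cdot>\<^sub>m 1\<^sub>m n"
      by (intro eq_matI) (auto simp: inj.rat_subst_gconst)
    moreover have "?T * (gconst c \<cdot>\<^sub>m 1\<^sub>m n) * ?T' = gconst c \<cdot>\<^sub>m (?T * ?T')"
      using cT by (simp add: mult_smult_distrib[of _ n n _ n] mult_smult_assoc_mat[of _ n n _ n])
    ultimately show ?case using TT by simp
  next
    case (generic h)
    show ?case
    proof (rule eq_matI)
      fix i j assume "i < dim_row (?T * generic_mat n h * ?T')" "j < dim_col (?T * generic_mat n h * ?T')"
      then have ij: "i < n" "j < n" using T by auto
      have g: "generic_mat n h \<in> carrier_mat n n" by (simp add: generic_mat_def)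
      have "?r (generic_mat n h) $$ (i, j) = to_frac (conj_poly n T T' (h, i, j))"
        using ij by (simp add: generic_mat_def inj.rat_subst_gvar)
      also have "\<dots> = (\<Sum>a<n. \<Sum>b<n. gconst (T $$ (i, a)) * gconst (T' $$ (b, j)) * gvar (h, a, b))"
        using ij by (simp add: conj_poly_def to_frac_sum gvar_to_frac gconst_to_frac mult_single)
      also have "\<dots> = (?T * generic_mat n h * ?T') $$ (i, j)"
        unfolding mat_mult3_entry[OF cT(1) g cT(2) ij]
        by (intro sum.cong refl) (use ij T in \<open>simp add: generic_mat_def\<close>)
      finally show "?r (generic_mat n h) $$ (i, j) = (?T * generic_mat n h * ?T') $$ (i, j)" .
    qed (use T in \<open>auto simp: generic_mat_def\<close>)
  next
    case (add a b)
    note c = UD_closed[OF add(1)] UD_closed[OF add(2)]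
    have "?r (a + b) = ?r a + ?r b" using c by (intro eq_matI) (auto simp: r.hom_add)
    also have "\<dots> = ?T * (a + b) * ?T'"
      using c cT by (simp add: add.IH mult_add_distrib_mat[of _ n n _ n] add_mult_distrib_mat[of _ n n _ _ n])
    finally show ?case .
  next
    case (mult a b)
    note c = UD_closed[OF mult(1)] UD_closed[OF mult(2)]
    have "?r (a * b) = ?r a * ?r b" by (rule r.mat_hom_mult[OF c])
    also have "\<dots> = ?T * a * (?T' * ?T) * (b * ?T')"
      using c cT by (simp only: mult.IH) (simp add: assoc_mult_mat[of _ n n _ n _ n])
    also have "\<dots> = ?T * (a * b) * ?T'"
      unfolding TT using c cT by (simp add: assoc_mult_mat[of _ n n _ n _ n])
    finally show ?case .
  next
    case (inverse a b)
    note c = UD_closed[OF inverse(1)] inverse(2)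
    have "?r b * ?r a = 1\<^sub>m n"
      using r.mat_hom_mult[OF c(2,1)] inverse(4) by (simp add: r.mat_hom_one)
    moreover have "?r a * (?T * b * ?T') = 1\<^sub>m n"
    proof -
      have "?r a * (?T * b * ?T') = ?T * a * (?T' * ?T) * (b * ?T')"
        using c cT by (simp only: inverse.IH) (simp add: assoc_mult_mat[of _ n n _ n _ n])
      also have "\<dots> = ?T * (a * b) * ?T'"
        unfolding TT using c cT by (simp add: assoc_mult_mat[of _ n n _ n _ n])
      finally show ?thesis using inverse(3) cT TT by simp
    qed
    moreover have "?r b * (?r a * (?T * b * ?T')) = (?r b * ?r a) * (?T * b * ?T')"
      using c cT by (simp add: assoc_mult_mat[of _ n n _ n _ n])
    ultimately show ?case using c cT by simp
  qed
qed

subsection \<open>The action of the general linear group\<close>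

lemma GL_group: "group (GL m)"
proof -
  interpret ring "ring_mat TYPE('a::field) m ()" by (rule ring_mat)
  show "group (GL m :: 'a mat monoid)" unfolding GL_def by (rule units_group)
qed

lemma GL_simps: "mult (GL m) = (*)" "one (GL m) = 1\<^sub>m m"
  by (simp_all add: GL_def units_of_def ring_mat_def)

lemma GL_mem: "g \<in> carrier (GL m) \<longleftrightarrow> g \<in> carrier_mat m m \<and> (\<exists>g'\<in>carrier_mat m m. g' * g = 1\<^sub>m m \<and> g * g' = 1\<^sub>m m)"
  by (auto simp: GL_def units_of_def Units_def ring_mat_def)

lemma GL_det: "g \<in> carrier_mat m m \<Longrightarrow> det g \<noteq> 0 \<Longrightarrow> g \<in> carrier (GL m)"
  using inverse_matrix_exists unfolding GL_mem by metis

lemma GL_inv: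
  assumes "g \<in> carrier (GL m)"
  shows "inv\<^bsub>GL m\<^esub> g \<in> carrier_mat m m" "inv\<^bsub>GL m\<^esub> g * g = 1\<^sub>m m" "g * inv\<^bsub>GL m\<^esub> g = 1\<^sub>m m"
    "inv\<^bsub>GL m\<^esub> g \<in> carrier (GL m)" "inv\<^bsub>GL m\<^esub> (inv\<^bsub>GL m\<^esub> g) = g"
proof -
  interpret group "GL m" by (rule GL_group)
  show "inv\<^bsub>GL m\<^esub> g \<in> carrier (GL m)" "inv\<^bsub>GL m\<^esub> (inv\<^bsub>GL m\<^esub> g) = g" using assms by auto
  then show "inv\<^bsub>GL m\<^esub> g \<in> carrier_mat m m" unfolding GL_mem by blast
  show "inv\<^bsub>GL m\<^esub> g * g = 1\<^sub>m m" "g * inv\<^bsub>GL m\<^esub> g = 1\<^sub>m m"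
    using l_inv[OF assms] r_inv[OF assms] by (simp_all add: GL_simps)
qed

definition GL_poly :: "nat \<Rightarrow> 'k::field mat \<Rightarrow> var \<Rightarrow> 'k gpoly" where
  "GL_poly m g = (\<lambda>(h, i, j). if h < m then \<Sum>l<m. pconst (g $$ (h, l)) * pvar (l, i, j) else pvar (h, i, j))"

definition GL_point :: "nat \<Rightarrow> 'k::field mat \<Rightarrow> (var \<Rightarrow> 'k) \<Rightarrow> var \<Rightarrow> 'k" where
  "GL_point m g x = (\<lambda>(h, i, j). if h < m then \<Sum>l<m. g $$ (h, l) * x (l, i, j) else x (h, i, j))"

lemma peval_GL_poly: "peval x (GL_poly m g v) = GL_point m g x v"
  by (cases v) (simp add: GL_poly_def GL_point_def peval.hom_sum peval.hom_mult)

lemma GL_point_mult: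
  assumes "g \<in> carrier_mat m m" "g' \<in> carrier_mat m m"
  shows "GL_point m g (GL_point m g' x) = GL_point m (g * g') x"
proof
  fix v :: var
  obtain h i j where v: "v = (h, i, j)" by (cases v)
  show "GL_point m g (GL_point m g' x) v = GL_point m (g * g') x v"
  proof (cases "h < m")
    case True
    have "(\<Sum>l<m. g $$ (h, l) * (\<Sum>k<m. g' $$ (l, k) * x (k, i, j))) = (\<Sum>k<m. (\<Sum>l<m. g $$ (h, l) * g' $$ (l, k)) * x (k, i, j))"
      unfolding sum_distrib_left sum_distrib_right by (subst sum.swap) (simp add: ac_simps)
    then show ?thesis using True by (simp add: v GL_point_def mat_mult_entry[OF assms] del: index_mult_mat(1) cong: sum.cong_simp)
  qed (simp add: v GL_point_def)
qed

lemma GL_point_one: "GL_point m (1\<^sub>m m) x = x"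
proof
  fix v :: var
  obtain h i j where v: "v = (h, i, j)" by (cases v)
  have "(\<Sum>l<m. (1\<^sub>m m :: 'a mat) $$ (h, l) * x (l, i, j)) = (\<Sum>l<m. if l = h then x (h, i, j) else 0)" if "h < m"
    using that by (intro sum.cong) auto
  then show "GL_point m (1\<^sub>m m) x v = x v" by (simp add: v GL_point_def)
qed

lemma GL_subst_eq: "GL_subst m g = (\<lambda>v. to_frac (GL_poly m (inv\<^bsub>GL m\<^esub> g) v))"
proof
  fix v :: var
  obtain h i j where v: "v = (h, i, j)" by (cases v)
  show "GL_subst m g v = to_frac (GL_poly m (inv\<^bsub>GL m\<^esub> g) v)"
    by (simp add: v GL_subst_def GL_poly_def gvar_to_frac gconst_to_frac to_frac_sum)
qed

lemma GL_injective:
  fixes g :: "'k::field_char_0 mat"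
  assumes g: "g \<in> carrier (GL m)"
  shows "injective_substitution (GL_subst m g)"
  unfolding GL_subst_eq
proof (rule injective_substitutionI)
  fix y :: "var \<Rightarrow> 'k"
  have "g \<in> carrier_mat m m" using g GL_mem by blast
  then have "\<forall>v. peval (GL_point m g y) (GL_poly m (inv\<^bsub>GL m\<^esub> g) v) = y v"
    unfolding peval_GL_poly using GL_inv[OF g] by (simp add: GL_point_mult GL_point_one)
  then show "\<exists>x. \<forall>v. peval x (GL_poly m (inv\<^bsub>GL m\<^esub> g) v) = y v" by blast
qed

lemma hom_fixing_variables:
  fixes h :: "'k::field gfrac \<Rightarrow> 'k gfrac"
  assumes h: "field_hom h" and c: "\<And>c. h (gconst c) = gconst c" and v: "\<And>v. h (gvar v) = gvar v"
  shows "h r = r"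
proof -
  interpret h: field_hom h by fact
  have pol: "h (to_frac p) = to_frac p" for p
    using gev_gconst_hom[OF h.comm_ring_hom_axioms c, of gvar p] by (simp add: v poly_subst_gvar)
  obtain p q where r: "r = Fract p q" "q \<noteq> 0" by (cases r) auto
  have "r * to_frac q = to_frac p" using r by (simp add: eq_fract)
  then have "h r * to_frac q = to_frac p" using h.hom_mult[of r "to_frac q"] pol by metis
  then have "h r * to_frac q = r * to_frac q" using \<open>r * to_frac q = to_frac p\<close> by simp
  then show ?thesis using r(2) by simp
qed

text \<open>Both sides are field homomorphisms that agree on constants and variables.\<close>

lemma GL_subst_compose:
  fixes g :: "'k::field_char_0 mat"
  assumes g: "g \<in> carrier (GL m)"
  shows "rat_subst (GL_subst m g) (rat_subst (GL_subst m (inv\<^bsub>GL m\<^esub> g)) r) = r"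
proof (rule hom_fixing_variables[where h = "\<lambda>r. rat_subst (GL_subst m g) (rat_subst (GL_subst m (inv\<^bsub>GL m\<^esub> g)) r)"])
  let ?g = "inv\<^bsub>GL m\<^esub> g"
  interpret a: injective_substitution "GL_subst m g" by (rule GL_injective[OF g])
  interpret b: injective_substitution "GL_subst m ?g" by (rule GL_injective[OF GL_inv(4)[OF g]])
  interpret ra: field_hom "rat_subst (GL_subst m g)" by (rule a.rat_subst_hom)
  interpret rb: field_hom "rat_subst (GL_subst m ?g)" by (rule b.rat_subst_hom)
  show "field_hom (\<lambda>r. rat_subst (GL_subst m g) (rat_subst (GL_subst m ?g) r))"
    by unfold_locales (simp_all add: ra.hom_add rb.hom_add ra.hom_mult rb.hom_mult)
  show "rat_subst (GL_subst m g) (rat_subst (GL_subst m ?g) (gconst c)) = gconst c" for c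
    by (simp add: a.rat_subst_gconst b.rat_subst_gconst)
  have gm: "g \<in> carrier_mat m m" using g GL_mem by blast
  fix v :: var
  obtain h i j where v: "v = (h, i, j)" by (cases v)
  show "rat_subst (GL_subst m g) (rat_subst (GL_subst m ?g) (gvar v)) = gvar v"
  proof (cases "h < m")
    case True
    have "rat_subst (GL_subst m g) (GL_subst m ?g v) = (\<Sum>l<m. gconst (g $$ (h, l)) * GL_subst m g (l, i, j))"
      using True by (simp add: v GL_subst_def[of m ?g] GL_inv(5)[OF g] ra.hom_sum ra.hom_mult a.rat_subst_gconst a.rat_subst_gvar)
    also have "\<dots> = (\<Sum>l<m. \<Sum>k<m. gconst (g $$ (h, l) * ?g $$ (l, k)) * gvar (k, i, j))"
      by (intro sum.cong) (auto simp: GL_subst_def sum_distrib_left E_gconst.hom_mult ac_simps)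
    also have "\<dots> = (\<Sum>k<m. gconst ((g * ?g) $$ (h, k)) * gvar (k, i, j))"
      using True by (subst sum.swap) (simp add: mat_mult_entry[OF gm GL_inv(1)[OF g]] E_gconst.hom_sum sum_distrib_right del: index_mult_mat(1) cong: sum.cong_simp)
    also have "\<dots> = (\<Sum>k<m. if k = h then gvar (h, i, j) else 0)"
      unfolding GL_inv(3)[OF g] using True by (intro sum.cong) (auto simp: E_gconst.hom_one E_gconst.hom_zero)
    finally show ?thesis using True by (simp add: v b.rat_subst_gvar)
  next
    case False
    then have "GL_subst m g' v = gvar v" for g' :: "'k mat" by (simp add: v GL_subst_def)
    then show ?thesis by (simp add: a.rat_subst_gvar b.rat_subst_gvar)
  qed
qed

lemma UD_act_generic:
  fixes g :: "'k::field_char_0 mat"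
  assumes g: "g \<in> carrier (GL m)" and h: "h < m"
  shows "act (UD m n) g (generic_mat n h) = mat n n (\<lambda>p. \<Sum>l<m. gconst ((inv\<^bsub>GL m\<^esub> g) $$ (h, l)) * generic_mat n l $$ p)"
proof -
  interpret a: injective_substitution "GL_subst m g" by (rule GL_injective[OF g])
  show ?thesis using h
    by (intro eq_matI) (simp_all add: UD_simps generic_mat_def a.rat_subst_gvar, simp add: GL_subst_def)
qed

lemma UD_combination:
  fixes a :: "'i \<Rightarrow> 'k::field gfrac mat"
  assumes "\<And>l. l \<in> S \<Longrightarrow> a l \<in> UD_carrier m n" "finite S"
  shows "mat n n (\<lambda>p. \<Sum>l\<in>S. gconst (c l) * a l $$ p) \<in> UD_carrier m n"
  using assms(2,1)
proof (induction S rule: finite_induct)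
  case empty
  have "mat n n (\<lambda>p. 0) = (0\<^sub>m n n :: 'k gfrac mat)" by auto
  then show ?case using UD_zero[where 'k = 'k] by (simp only: sum.empty)
next
  case (insert l S)
  have "mat n n (\<lambda>p. \<Sum>l\<in>insert l S. gconst (c l) * a l $$ p) =
      gconst (c l) \<cdot>\<^sub>m a l + mat n n (\<lambda>p. \<Sum>l\<in>S. gconst (c l) * a l $$ p)"
    using insert.hyps UD_closed[OF insert.prems[of l]] by (intro eq_matI) auto
  then show ?case using insert by (simp add: UD_carrier.add UD_smult)
qed

lemma UD_act_closed:
  fixes g :: "'k::field_char_0 mat"
  assumes g: "g \<in> carrier (GL m)" and a: "a \<in> UD_carrier m n"
  shows "act (UD m n) g a \<in> UD_carrier m n"
  using a
proof (induction rule: UD_carrier.induct)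
  interpret a: injective_substitution "GL_subst m g" by (rule GL_injective[OF g])
  interpret r: field_hom "rat_subst (GL_subst m g)" by (rule a.rat_subst_hom)
  case (scalar c)
  have "act (UD m n) g (gconst c \<cdot>\<^sub>m 1\<^sub>m n) = gconst c \<cdot>\<^sub>m 1\<^sub>m n"
    by (intro eq_matI) (auto simp: UD_simps a.rat_subst_gconst)
  then show ?case by (simp add: UD_carrier.scalar)
next
  case (generic h)
  show ?case unfolding UD_act_generic[OF g generic] by (intro UD_combination UD_carrier.generic) auto
next
  interpret a: injective_substitution "GL_subst m g" by (rule GL_injective[OF g])
  interpret r: field_hom "rat_subst (GL_subst m g)" by (rule a.rat_subst_hom)
  case (add a b)
  have "act (UD m n) g (a + b) = act (UD m n) g a + act (UD m n) g b"
    using UD_closed[OF add(1)] UD_closed[OF add(2)] by (intro eq_matI) (auto simp: UD_simps r.hom_add)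
  then show ?case using add by (simp add: UD_carrier.add)
next
  interpret a: injective_substitution "GL_subst m g" by (rule GL_injective[OF g])
  interpret r: field_hom "rat_subst (GL_subst m g)" by (rule a.rat_subst_hom)
  case (mult a b)
  have "act (UD m n) g (a * b) = act (UD m n) g a * act (UD m n) g b"
    by (simp add: UD_simps r.mat_hom_mult[OF UD_closed[OF mult(1)] UD_closed[OF mult(2)]])
  then show ?case using mult by (simp add: UD_carrier.mult)
next
  interpret a: injective_substitution "GL_subst m g" by (rule GL_injective[OF g])
  interpret r: field_hom "rat_subst (GL_subst m g)" by (rule a.rat_subst_hom)
  case (inverse a b)
  note c = UD_closed[OF inverse(1)] inverse(2)
  show ?case
  proof (rule UD_carrier.inverse[OF inverse.IH])
    show "act (UD m n) g b \<in> carrier_mat n n" using c by (simp add: UD_simps)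
    show "act (UD m n) g a * act (UD m n) g b = 1\<^sub>m n"
      unfolding UD_simps r.mat_hom_mult[OF c, symmetric] inverse(3) by (rule r.mat_hom_one)
    show "act (UD m n) g b * act (UD m n) g a = 1\<^sub>m n"
      unfolding UD_simps r.mat_hom_mult[OF c(2,1), symmetric] inverse(4) by (rule r.mat_hom_one)
  qed
qed

lemma UD_gring: "gring (GL m) (UD m n :: ('k::field_char_0 gfrac mat, 'k, 'k mat) galg)"
  unfolding gring_def
proof (intro conjI ballI UD_ring)
  fix g :: "'k mat" assume g: "g \<in> carrier (GL m)"
  interpret a: injective_substitution "GL_subst m g" by (rule GL_injective[OF g])
  interpret r: field_hom "rat_subst (GL_subst m g)" by (rule a.rat_subst_hom)
  show "act (UD m n) g \<in> ring_hom (UD m n) (UD m n)"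
  proof (rule ring_hom_memI)
    fix x y :: "'k gfrac mat" assume "x \<in> carrier (UD m n)" "y \<in> carrier (UD m n)"
    then have xy: "x \<in> UD_carrier m n" "y \<in> UD_carrier m n" by (simp_all add: UD_simps)
    show "act (UD m n) g x \<in> carrier (UD m n)" using UD_act_closed[OF g xy(1)] by (simp add: UD_simps(1))
    show "act (UD m n) g (x \<otimes>\<^bsub>UD m n\<^esub> y) = act (UD m n) g x \<otimes>\<^bsub>UD m n\<^esub> act (UD m n) g y"
      by (simp add: UD_simps r.mat_hom_mult[OF UD_closed[OF xy(1)] UD_closed[OF xy(2)]])
    show "act (UD m n) g (x \<oplus>\<^bsub>UD m n\<^esub> y) = act (UD m n) g x \<oplus>\<^bsub>UD m n\<^esub> act (UD m n) g y"
      unfolding UD_simps using UD_closed[OF xy(1)] UD_closed[OF xy(2)] by (intro eq_matI) (auto simp: r.hom_add)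
  qed (simp add: UD_simps r.mat_hom_one)
  show "act (UD m n) g (act (UD m n) (inv\<^bsub>GL m\<^esub> g) x) = x" if "x \<in> carrier (UD m n)" for x :: "'k gfrac mat"
    unfolding UD_simps by (intro eq_matI) (auto simp: GL_subst_compose[OF g])
qed

section \<open>Fixed elements\<close>

text \<open>
  Restrict \<open>p\<close> to the line \<open>g + t 1\<close>: a polynomial in \<open>t\<close> that vanishes whenever \<open>g + t 1\<close> is
  invertible, that is, for all but finitely many \<open>t\<close>.
\<close>

lemma GL_point_dense:
  fixes p :: "'k::field_char_0 gpoly"
  assumes zero: "\<And>g. g \<in> carrier (GL m) \<Longrightarrow> peval (GL_point m g x) p = 0"
    and g: "g \<in> carrier_mat m m"
  shows "peval (GL_point m g x) p = 0"
proof -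
  define b where "b = (\<lambda>(h, i, j). if h < m then x (h, i, j) else 0)"
  let ?g = "\<lambda>t. g + t \<cdot>\<^sub>m 1\<^sub>m m"
  have line: "GL_point m (?g t) x = (\<lambda>v. GL_point m g x v + t * b v)" for t
  proof
    fix v :: var
    obtain h i j where v: "v = (h, i, j)" by (cases v)
    show "GL_point m (?g t) x v = GL_point m g x v + t * b v"
    proof (cases "h < m")
      case True
      have "(\<Sum>l<m. ?g t $$ (h, l) * x (l, i, j)) = (\<Sum>l<m. g $$ (h, l) * x (l, i, j) + (if l = h then t * x (h, i, j) else 0))"
        using True g by (intro sum.cong) (auto simp: algebra_simps)
      then show ?thesis using True by (simp add: v GL_point_def b_def sum.distrib)
    qed (simp add: v GL_point_def b_def)
  qed
  obtain P where P: "\<forall>t. peval (\<lambda>v. GL_point m g x v + t * b v) p = poly P t"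
    using peval_line by blast
  have "poly P t = 0" if "t \<notin> {t. det (?g t) = 0}" for t
  proof -
    have "?g t \<in> carrier (GL m)" using that g by (intro GL_det) auto
    from zero[OF this] show ?thesis unfolding line using P by simp
  qed
  then have "P = 0" by (rule poly_eq_zero_if_cofinite[OF finite_det_shift_zero[OF g]])
  then have "peval (\<lambda>v. GL_point m g x v + 0 * b v) p = 0" using P by (metis poly_0)
  then show ?thesis by simp
qed

text \<open>
  The hypothesis says that the first \<open>n\<^sup>2\<close> matrices of \<open>x\<close> have a left inverse \<open>w\<close>, so that the matrix
  units are combinations of them. Hence every matrix is, and the coefficients for the \<open>h\<close>-th matrix of
  \<open>y\<close> form row \<open>h\<close> of \<open>g\<close>; its remaining columns are \<open>0\<close>.
\<close>

lemma GL_orbit: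
  fixes x y :: "var \<Rightarrow> 'k::field"
  assumes m: "n * n \<le> m"
    and w: "\<And>e i j. e < n * n \<Longrightarrow> i < n \<Longrightarrow> j < n \<Longrightarrow>
      (\<Sum>l<n*n. w e l * x (l, i, j)) = (if e = i * n + j then 1 else 0)"
  shows "\<exists>g\<in>carrier_mat m m. \<forall>v\<in>gvars m n. GL_point m g x v = y v"
proof
  define g where "g = mat m m (\<lambda>(h, l). if l < n * n then \<Sum>e<n*n. y (h, e div n, e mod n) * w e l else 0)"
  show "g \<in> carrier_mat m m" by (simp add: g_def)
  show "\<forall>v\<in>gvars m n. GL_point m g x v = y v"
  proof
    fix v assume "v \<in> gvars m n"
    then obtain h i j where v: "v = (h, i, j)" "h < m" "i < n" "j < n" unfolding gvars_def by blast
    have ij: "i * n + j < n * n" "(i * n + j) div n = i" "(i * n + j) mod n = j"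
      using pair_index[of i n j] v by auto
    have "GL_point m g x v = (\<Sum>l<m. if l < n * n then (\<Sum>e<n*n. y (h, e div n, e mod n) * w e l) * x (l, i, j) else 0)"
      using v(2) unfolding v(1) GL_point_def by (simp add: g_def if_distrib[of "\<lambda>c. c * _"] cong: sum.cong_simp if_cong)
    also have "\<dots> = (\<Sum>l<n*n. (\<Sum>e<n*n. y (h, e div n, e mod n) * w e l) * x (l, i, j))"
      using m by (intro sum.mono_neutral_cong_right) auto
    also have "\<dots> = (\<Sum>e<n*n. y (h, e div n, e mod n) * (\<Sum>l<n*n. w e l * x (l, i, j)))"
      unfolding sum_distrib_left sum_distrib_right by (subst sum.swap) (simp add: ac_simps)
    also have "\<dots> = (\<Sum>e<n*n. if e = i * n + j then y (h, i, j) else 0)"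
      using v ij by (intro sum.cong) (auto simp: w)
    also have "\<dots> = y v" using ij v by simp
    finally show "GL_point m g x v = y v" .
  qed
qed

lemma pconst_eq_zero: "pconst c = 0 \<longleftrightarrow> c = 0"
  by (metis lookup_single_eq lookup_zero single_zero)

text \<open>
  If \<open>p / q\<close> is fixed, then \<open>p(g x) q(x) = p(x) q(g x)\<close>. Fix a point \<open>x\<close> with dense orbit and
  \<open>q(x) \<noteq> 0\<close>; then the polynomial \<open>p q(x) - p(x) q\<close> vanishes on the orbit of \<open>x\<close>, so it is \<open>0\<close>.
\<close>

lemma fixed_fraction_constant:
  fixes r :: "'k::field_char_0 gfrac"
  assumes m: "n * n \<le> m" and r: "r \<in> fracs_in (gvars m n)"
    and fixed: "\<And>g. g \<in> carrier (GL m) \<Longrightarrow> rat_subst (GL_subst m g) r = r"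
  shows "\<exists>c. r = gconst c"
proof -
  obtain p q where pq: "r = Fract p q" "p \<in> polys_in (gvars m n)" "q \<in> polys_in (gvars m n)" "q \<noteq> 0"
    using r unfolding fracs_in_def by blast
  have ratio: "peval (GL_point m g x) p * peval x q = peval x p * peval (GL_point m g x) q"
    if g: "g \<in> carrier (GL m)" for g x
  proof -
    let ?h = "inv\<^bsub>GL m\<^esub> g" and ?s = "psub (GL_poly m g)"
    have h: "?h \<in> carrier (GL m)" by (rule GL_inv(4)[OF g])
    interpret s: injective_substitution "GL_subst m ?h" by (rule GL_injective[OF h])
    have subst: "poly_subst (GL_subst m ?h) f = to_frac (?s f)" for f
      unfolding GL_subst_eq GL_inv(5)[OF g] by (rule poly_subst_to_frac)
    have "?s q \<noteq> 0" using s.inj[of q] pq(4) subst[of q] by auto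
    moreover have "to_frac (?s p) / to_frac (?s q) = Fract p q"
      using fixed[OF h] unfolding pq(1) s.rat_subst_Fract[OF pq(4)] subst .
    ultimately have "?s p * q = p * ?s q" using pq(4) by (simp add: eq_fract)
    then have "peval x (?s p * q) = peval x (p * ?s q)" by simp
    then show ?thesis by (simp add: peval.hom_mult peval_psub peval_GL_poly)
  qed
  have "q * det (gen_poly_mat n) \<noteq> 0" using pq(4) det_gen_nonzero by simp
  then obtain x where "peval x (q * det (gen_poly_mat n)) \<noteq> 0" using poly_eq_zero_if_peval_zero by blast
  then have x: "peval x q \<noteq> 0" "det (point_mat n x) \<noteq> 0" by (auto simp: peval.hom_mult peval_det_gen)
  have pm: "point_mat n x \<in> carrier_mat (n * n) (n * n)" by (simp add: point_mat_def)
  obtain N where N: "N \<in> carrier_mat (n * n) (n * n)" "N * point_mat n x = 1\<^sub>m (n * n)"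
    using inverse_matrix_exists[OF pm x(2)] by blast
  have w: "(\<Sum>l<n*n. N $$ (e, l) * x (l, i, j)) = (if e = i * n + j then 1 else 0)"
    if "e < n * n" "i < n" "j < n" for e i j
  proof -
    note ij = pair_index[OF that(2,3)]
    have "(\<Sum>l<n*n. N $$ (e, l) * x (l, i, j)) = (N * point_mat n x) $$ (e, i * n + j)"
      unfolding mat_mult_entry[OF N(1) pm that(1) ij(1)]
      using ij by (intro sum.cong) (auto simp: point_mat_def)
    then show ?thesis unfolding N(2) using that(1) ij(1) by simp
  qed
  define s where "s = p * pconst (peval x q) + pconst (- peval x p) * q"
  have s_in: "s \<in> polys_in (gvars m n)"
    unfolding s_def using pq by (intro polys_in_add polys_in_mult polys_in_const)
  have "peval (GL_point m g x) s = 0" if "g \<in> carrier (GL m)" for g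
    using ratio[OF that, of x] by (simp add: s_def peval.hom_add peval.hom_mult)
  then have s_zero: "peval (GL_point m g x) s = 0" if "g \<in> carrier_mat m m" for g
    using that by (rule GL_point_dense)
  have "peval y s = 0" for y
  proof -
    obtain g where g: "g \<in> carrier_mat m m" "\<forall>v\<in>gvars m n. GL_point m g x v = y v"
      using GL_orbit[OF m w, where y = y] by blast
    have "peval y s = peval (GL_point m g x) s"
      by (rule peval_cong[OF s_in]) (use g in simp)
    then show ?thesis using s_zero[OF g(1)] by simp
  qed
  then have "s = 0" by (rule poly_eq_zero_if_peval_zero)
  then have "p * pconst (peval x q) = pconst (peval x p) * q"
    by (simp add: s_def single_uminus add_eq_0_iff2)
  then have "r * gconst (peval x q) = gconst (peval x p)"
    using pq(4) by (simp add: pq(1) gconst_def eq_fract)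
  moreover have "gconst (peval x q) \<noteq> (0 :: 'k gfrac)" using x(1) by (simp add: gconst_to_frac pconst_eq_zero)
  ultimately have "r = gconst (peval x p) / gconst (peval x q)" by (simp add: eq_divide_eq)
  also have "\<dots> = gconst (peval x p / peval x q)"
    using x(1) by (simp add: gconst_to_frac pconst_eq_zero eq_fract mult_single)
  finally show ?thesis by blast
qed

text \<open>
  Every matrix is the difference of an invertible and a scalar one, so \<open>F\<close> commutes with all matrices,
  in particular with the matrix units.
\<close>

lemma commutes_with_invertible_imp_scalar:
  fixes F :: "'k::field_char_0 mat"
  assumes F: "F \<in> carrier_mat n n"
    and comm: "\<And>T T'. T \<in> carrier_mat n n \<Longrightarrow> T' \<in> carrier_mat n n \<Longrightarrow> T * T' = 1\<^sub>m n \<Longrightarrow> T' * T = 1\<^sub>m n \<Longrightarrow>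
      F * T = T * F"
  shows "F = F $$ (0, 0) \<cdot>\<^sub>m 1\<^sub>m n"
proof -
  have all: "F * M = M * F" if M: "M \<in> carrier_mat n n" for M
  proof -
    have "\<exists>t. t \<notin> {t. det (M + t \<cdot>\<^sub>m 1\<^sub>m n) = 0}"
      using finite_det_shift_zero[OF M] infinite_UNIV_char_0[where 'a = 'k] ex_new_if_finite by blast
    then obtain t where t: "det (M + t \<cdot>\<^sub>m 1\<^sub>m n) \<noteq> 0" by blast
    have MT: "M + t \<cdot>\<^sub>m 1\<^sub>m n \<in> carrier_mat n n" using M by simp
    obtain N where "N \<in> carrier_mat n n" "(M + t \<cdot>\<^sub>m 1\<^sub>m n) * N = 1\<^sub>m n" "N * (M + t \<cdot>\<^sub>m 1\<^sub>m n) = 1\<^sub>m n"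
      by (rule inverse_matrix_exists[OF MT t])
    then have "F * (M + t \<cdot>\<^sub>m 1\<^sub>m n) = (M + t \<cdot>\<^sub>m 1\<^sub>m n) * F" using comm MT by blast
    moreover have "F * (t \<cdot>\<^sub>m 1\<^sub>m n) = t \<cdot>\<^sub>m F" "(t \<cdot>\<^sub>m 1\<^sub>m n) * F = t \<cdot>\<^sub>m F"
      using mult_smult_distrib[OF F one_carrier_mat, of t] mult_smult_assoc_mat[OF one_carrier_mat F, of t] F by simp_all
    ultimately have eq: "F * M + t \<cdot>\<^sub>m F = M * F + t \<cdot>\<^sub>m F"
      using F M by (simp add: mult_add_distrib_mat[of _ n n _ n] add_mult_distrib_mat[of _ n n _ _ n])
    show ?thesis
    proof (rule eq_matI)
      fix i j assume ij: "i < dim_row (M * F)" "j < dim_col (M * F)"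
      have "(F * M + t \<cdot>\<^sub>m F) $$ (i, j) = (M * F + t \<cdot>\<^sub>m F) $$ (i, j)" using eq by simp
      then show "(F * M) $$ (i, j) = (M * F) $$ (i, j)" using ij F M by (simp del: index_mult_mat(1))
    qed (use F M in auto)
  qed
  have entry: "(if b = j then F $$ (i, a) else 0) = (if i = a then F $$ (b, j) else 0)"
    if lt: "i < n" "j < n" "a < n" "b < n" for i j a b
  proof -
    let ?E = "unit_mat n a b :: 'k mat"
    have E: "?E \<in> carrier_mat n n" by (rule unit_mat_closed)
    have "(F * ?E) $$ (i, j) = (\<Sum>c<n. if c = a then (if b = j then F $$ (i, a) else 0) else 0)"
      unfolding mat_mult_entry[OF F E lt(1,2)] using lt by (intro sum.cong) (auto simp: unit_mat_def)
    moreover have "(?E * F) $$ (i, j) = (\<Sum>c<n. if c = b then (if i = a then F $$ (b, j) else 0) else 0)"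
      unfolding mat_mult_entry[OF E F lt(1,2)] using lt by (intro sum.cong) (auto simp: unit_mat_def)
    ultimately show ?thesis using all[OF E] lt by simp
  qed
  show ?thesis
  proof (rule eq_matI)
    fix i j assume "i < dim_row (F $$ (0, 0) \<cdot>\<^sub>m 1\<^sub>m n)" "j < dim_col (F $$ (0, 0) \<cdot>\<^sub>m 1\<^sub>m n)"
    then show "F $$ (i, j) = (F $$ (0, 0) \<cdot>\<^sub>m 1\<^sub>m n) $$ (i, j)"
      using entry[of i 0 j 0] by (cases "i = j") auto
  qed (use F in auto)
qed

theorem UD_fixed:
  assumes m: "n * n \<le> m"
  shows "galg_fixed (GL m) (UD m n :: ('k::field_char_0 gfrac mat, 'k, 'k mat) galg) = range (sclr (UD m n))"
proof (intro equalityI subsetI)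
  fix a :: "'k gfrac mat" assume "a \<in> range (sclr (UD m n))"
  then obtain c where a: "a = gconst c \<cdot>\<^sub>m 1\<^sub>m n" by (auto simp: UD_simps)
  have "act (UD m n) g a = a" if "g \<in> carrier (GL m)" for g :: "'k mat"
  proof -
    interpret a: injective_substitution "GL_subst m g" by (rule GL_injective[OF that])
    interpret r: field_hom "rat_subst (GL_subst m g)" by (rule a.rat_subst_hom)
    show ?thesis unfolding a by (intro eq_matI) (auto simp: UD_simps a.rat_subst_gconst)
  qed
  then show "a \<in> galg_fixed (GL m) (UD m n)"
    unfolding galg_fixed_def a by (auto simp: UD_simps(1) UD_carrier.scalar)
next
  fix a :: "'k gfrac mat" assume "a \<in> galg_fixed (GL m) (UD m n)"
  then have aUD: "a \<in> UD_carrier m n" and fixed: "\<And>g. g \<in> carrier (GL m) \<Longrightarrow> act (UD m n) g a = a"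
    by (auto simp: galg_fixed_def UD_simps(1))
  have ac: "a \<in> carrier_mat n n" by (rule UD_closed[OF aUD])
  have "\<exists>c. a $$ (i, j) = gconst c" if "i < n" "j < n" for i j
  proof (rule fixed_fraction_constant[OF m UD_entries[OF aUD that]])
    fix g :: "'k mat" assume "g \<in> carrier (GL m)"
    then have "act (UD m n) g a $$ (i, j) = a $$ (i, j)" using fixed by simp
    then show "rat_subst (GL_subst m g) (a $$ (i, j)) = a $$ (i, j)" using that ac by (simp add: UD_simps)
  qed
  then obtain c where c: "\<And>i j. i < n \<Longrightarrow> j < n \<Longrightarrow> a $$ (i, j) = gconst (c i j)" by metis
  define F where "F = mat n n (\<lambda>(i, j). c i j)"
  have F: "F \<in> carrier_mat n n" by (simp add: F_def)
  have aF: "a = map_mat gconst F" using ac by (intro eq_matI) (auto simp: F_def c)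
  have gconst_inj: "gconst s = gconst t \<longleftrightarrow> s = t" for s t :: 'k
    unfolding gconst_to_frac to_frac_eq_iff by (metis lookup_single_eq)
  have "F * T = T * F"
    if T: "T \<in> carrier_mat n n" "T' \<in> carrier_mat n n" "T * T' = 1\<^sub>m n" "T' * T = 1\<^sub>m n" for T T' :: "'k mat"
  proof -
    interpret inj: injective_substitution "\<lambda>v. to_frac (conj_poly n T T' v)" by (rule conj_injective[OF T])
    have "map_mat (rat_subst (\<lambda>v. to_frac (conj_poly n T T' v))) a = a"
      unfolding aF by (intro eq_matI) (auto simp: inj.rat_subst_gconst)
    then have "map_mat gconst F = map_mat gconst T * map_mat gconst F * map_mat gconst T'"
      using UD_conj_equivariant[OF T aUD] aF by simp
    also have "\<dots> = map_mat gconst (T * F * T')"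
      using T F by (simp add: E_gconst.mat_hom_mult[of _ n n _ n])
    finally have "map_mat gconst F = map_mat gconst (T * F * T')" .
    then have eq: "map_mat gconst F $$ (i, j) = map_mat gconst (T * F * T') $$ (i, j)" for i j by simp
    have "F = T * F * T'"
    proof (rule eq_matI)
      fix i j assume "i < dim_row (T * F * T')" "j < dim_col (T * F * T')"
      then show "F $$ (i, j) = (T * F * T') $$ (i, j)"
        using eq[of i j] T F by (simp add: gconst_inj del: index_mult_mat(1))
    qed (use T F in auto)
    then have "F * T = T * F * T' * T" by (rule arg_cong[of _ _ "\<lambda>A. A * T"])
    also have "\<dots> = (T * F) * (T' * T)"
      by (rule assoc_mult_mat[OF mult_carrier_mat[OF T(1) F] T(2,1)])
    also have "\<dots> = T * F" unfolding T(4) by (rule right_mult_one_mat[OF mult_carrier_mat[OF T(1) F]])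
    finally show ?thesis .
  qed
  then have "F = F $$ (0, 0) \<cdot>\<^sub>m 1\<^sub>m n" by (rule commutes_with_invertible_imp_scalar[OF F])
  then have "a = map_mat gconst (F $$ (0, 0) \<cdot>\<^sub>m 1\<^sub>m n)" using aF by simp
  also have "\<dots> = gconst (F $$ (0, 0)) \<cdot>\<^sub>m 1\<^sub>m n"
    by (intro eq_matI) (auto simp: E_gconst.hom_mult E_gconst.hom_zero)
  finally show "a \<in> range (sclr (UD m n))" by (auto simp: UD_simps)
qed

section \<open>Matrix entries that are independent over the center\<close>

lemma common_denominator:
  fixes \<zeta> :: "'u \<Rightarrow> 'k::field gfrac"
  assumes "finite M"
  shows "\<exists>P q. q \<noteq> 0 \<and> (\<forall>u\<in>M. \<zeta> u = Fract (P u) q)"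
  using assms
proof (induction M rule: finite_induct)
  case empty
  show ?case by (intro exI[of _ "\<lambda>_. 0"] exI[of _ 1]) simp
next
  case (insert u M)
  then obtain P q where P: "q \<noteq> 0" "\<forall>u\<in>M. \<zeta> u = Fract (P u) q" by blast
  obtain p' q' where u: "\<zeta> u = Fract p' q'" "q' \<noteq> 0" by (cases "\<zeta> u") auto
  have "\<zeta> w = Fract (if w = u then p' * q else P w * q') (q * q')" if "w \<in> insert u M" for w
    using P u that by (auto simp: eq_fract)
  then show ?case using P(1) u(2)
    by (intro exI[of _ "\<lambda>w. if w = u then p' * q else P w * q'"] exI[of _ "q * q'"]) simp
qed

text \<open>The leading term at \<open>0\<close> of a nonzero family of polynomials in one variable.\<close>

lemma divide_out_power:
  fixes A :: "'u \<Rightarrow> 'k::field poly"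
  assumes "u \<in> M" "A u \<noteq> 0"
  shows "\<exists>r D. (\<forall>w\<in>M. A w = [:0, 1:] ^ r * D w) \<and> (\<exists>w\<in>M. poly (D w) 0 \<noteq> 0)"
  using assms(2)
proof (induction "degree (A u)" arbitrary: A rule: less_induct)
  case less
  show ?case
  proof (cases "\<exists>w\<in>M. poly (A w) 0 \<noteq> 0")
    case True
    then show ?thesis by (intro exI[of _ 0] exI[of _ A]) simp
  next
    case False
    then have "\<forall>w\<in>M. \<exists>B. A w = [:0, 1:] * B"
      by (auto simp: poly_eq_0_iff_dvd dvd_def)
    then obtain B where B: "\<forall>w\<in>M. A w = [:0, 1:] * B w" by metis
    have "B u \<noteq> 0" using B assms(1) less.prems by auto
    then have "degree (B u) < degree (A u)" using B assms(1) by simp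
    from less.hyps[of B, OF this \<open>B u \<noteq> 0\<close>] obtain r D where
      "\<forall>w\<in>M. B w = [:0, 1:] ^ r * D w" "\<exists>w\<in>M. poly (D w) 0 \<noteq> 0" by blast
    then show ?thesis using B by (intro exI[of _ "Suc r"] exI[of _ D]) (auto simp: ac_simps)
  qed
qed

text \<open>
  The variables in the first columns of the first \<open>n\<close> generic matrices, except for the corner of the
  first one. There are \<open>n\<^sup>2 - 1\<close> of them, the dimension of \<open>PGL\<^sub>n\<close>.
\<close>

definition column_vars :: "nat \<Rightarrow> var set" where
  "column_vars n = {(i, a, 0) | i a. i < n \<and> a < n \<and> (i, a) \<noteq> (0, 0)}"

text \<open>
  Conjugation depends on \<open>T\<close> up to a scalar, so one entry of \<open>T\<close> is not free. The entry at \<open>(0, 0)\<close> is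
  chosen such that \<open>det T\<close> equals its cofactor; then the \<open>(0, 0)\<close> entry of the inverse is \<open>1\<close>.
\<close>

lemma matrix_with_prescribed_entries:
  fixes Z :: "nat \<Rightarrow> nat \<Rightarrow> 'k::field"
  assumes n: "n \<ge> 1" and det: "det (mat (n - 1) (n - 1) (\<lambda>(a, i). Z (Suc a) (Suc i))) \<noteq> 0"
  shows "\<exists>T T'. T \<in> carrier_mat n n \<and> T' \<in> carrier_mat n n \<and> T * T' = 1\<^sub>m n \<and> T' * T = 1\<^sub>m n \<and>
    T' $$ (0, 0) = 1 \<and> (\<forall>a<n. \<forall>i<n. (a, i) \<noteq> (0, 0) \<longrightarrow> T $$ (a, i) = Z a i)"
proof -
  define Tm where "Tm s = mat n n (\<lambda>(a, i). if a = 0 \<and> i = 0 then s else Z a i)" for s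
  have Tm: "Tm s \<in> carrier_mat n n" for s by (simp add: Tm_def)
  define C where "C j = cofactor (Tm 0) 0 j" for j
  have cof: "cofactor (Tm s) 0 j = C j" if "j < n" for s j
  proof -
    have "mat_delete (Tm s) 0 j = mat_delete (Tm 0) 0 j"
      unfolding mat_delete_def Tm_def using that by (intro eq_matI) auto
    then show ?thesis by (simp add: C_def cofactor_def)
  qed
  have "mat_delete (Tm 0) 0 0 = mat (n - 1) (n - 1) (\<lambda>(a, i). Z (Suc a) (Suc i))"
    unfolding mat_delete_def Tm_def by (intro eq_matI) auto
  then have C0: "C 0 \<noteq> 0" using det by (simp add: C_def cofactor_def)
  \<comment> \<open>The solution of \<open>det T = C 0\<close>, which is linear in \<open>s\<close> by expansion along the first row.\<close>
  define s where "s = (C 0 - (\<Sum>j\<in>{..<n} - {0}. Z 0 j * C j)) / C 0"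
  define T where "T = Tm s"
  have T: "T \<in> carrier_mat n n" by (simp add: T_def Tm)
  have "det T = (\<Sum>j<n. T $$ (0, j) * C j)"
    using laplace_expansion_row[OF T, of 0] n cof by (simp add: T_def)
  also have "\<dots> = T $$ (0, 0) * C 0 + (\<Sum>j\<in>{..<n} - {0}. T $$ (0, j) * C j)"
    using n by (subst sum.remove[of _ 0]) auto
  also have "(\<Sum>j\<in>{..<n} - {0}. T $$ (0, j) * C j) = (\<Sum>j\<in>{..<n} - {0}. Z 0 j * C j)"
    using n by (intro sum.cong) (auto simp: T_def Tm_def)
  also have "T $$ (0, 0) = s" using n by (simp add: T_def Tm_def)
  finally have det_T: "det T = C 0" using C0 by (simp add: s_def)
  define T' where "T' = inverse (C 0) \<cdot>\<^sub>m adj_mat T"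
  note adj = adj_mat[OF T]
  have one: "inverse (C 0) \<cdot>\<^sub>m (C 0 \<cdot>\<^sub>m 1\<^sub>m n) = 1\<^sub>m n" using C0 by (intro eq_matI) auto
  have "T * T' = 1\<^sub>m n" "T' * T = 1\<^sub>m n"
    unfolding T'_def mult_smult_distrib[OF T adj(1)] mult_smult_assoc_mat[OF adj(1) T] adj(2,3) det_T one by simp_all
  moreover have "T' $$ (0, 0) = 1"
    using n T C0 cof[of 0 s] by (simp add: T'_def adj_mat_def T_def[symmetric])
  moreover have "\<forall>a<n. \<forall>i<n. (a, i) \<noteq> (0, 0) \<longrightarrow> T $$ (a, i) = Z a i"
    by (auto simp: T_def Tm_def)
  ultimately show ?thesis using T adj(1) by (intro exI[of _ T] exI[of _ T']) (simp add: T'_def)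
qed

text \<open>
  The point whose \<open>h\<close>-th matrix, for \<open>h < n\<close>, is the matrix unit \<open>E\<^sub>h\<^sub>0\<close>. The first columns of its conjugates are
  multiples of the columns of \<open>T\<close>.
\<close>

definition column_point :: "var \<Rightarrow> 'k::field" where
  "column_point = (\<lambda>(h, a, b). if a = h \<and> b = 0 then 1 else 0)"

lemma conj_column_point:
  assumes "i < n" "a < n" "T \<in> carrier_mat n n" "T' \<in> carrier_mat n n"
  shows "conj_point n T T' column_point (i, a, 0) = T $$ (a, i) * T' $$ (0, 0)"
proof -
  have "conj_point n T T' column_point (i, a, 0) = (\<Sum>c<n. \<Sum>b<n. T $$ (a, c) * T' $$ (b, 0) * column_point (i, c, b))"
    using assms by (simp add: conj_point_def)
  also have "\<dots> = (\<Sum>c<n. \<Sum>b<n. if b = 0 then (if c = i then T $$ (a, i) * T' $$ (0, 0) else 0) else 0)"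
    by (intro sum.cong refl) (auto simp: column_point_def)
  finally have "conj_point n T T' column_point (i, a, 0) =
    (\<Sum>c<n. \<Sum>b<n. if b = 0 then (if c = i then T $$ (a, i) * T' $$ (0, 0) else 0) else 0)" .
  then show ?thesis using assms by simp
qed

lemma conj_point_line:
  "conj_point n T T' (\<lambda>v. a v + t * b v) = (\<lambda>v. conj_point n T T' a v + t * conj_point n T T' b v)"
  by (rule ext) (auto simp: conj_point_def algebra_simps sum.distrib sum_distrib_left split: prod.split)

lemma peval_monomial_pvar: "peval x (monomial pvar u) = monomial x u"
  by (simp add: monomial_def peval.hom_prod peval.hom_power)

lemma monomial_gvar: "monomial gvar u = to_frac (monomial pvar u)"
proof -
  have pow: "to_frac (p ^ k) = to_frac p ^ k" for p :: "'a gpoly" and k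
  proof (induction k)
    case (Suc k)
    show ?case unfolding power_Suc to_frac_mult Suc.IH ..
  qed (simp add: One_fract_def)
  have "to_frac (\<Prod>v\<in>S. f v) = (\<Prod>v\<in>S. to_frac (f v))" for S and f :: "var \<Rightarrow> 'a gpoly"
  proof (induction S rule: infinite_finite_induct)
    case (insert x F)
    show ?case unfolding prod.insert[OF insert.hyps] to_frac_mult insert.IH ..
  qed (simp_all add: One_fract_def)
  then show ?thesis by (simp add: monomial_def gvar_to_frac pow)
qed

text \<open>
  Central elements are equivariant and scalar, so as functions they are invariant. The denominators are
  cleared to have an identity at every point.
\<close>

lemma UD_scalar_conj_invariant:
  fixes \<zeta> :: "'k::field_char_0 gfrac"
  assumes n: "n \<ge> 1" and z: "\<zeta> \<cdot>\<^sub>m 1\<^sub>m n \<in> UD_carrier m n" and \<zeta>: "\<zeta> = Fract p q" "q \<noteq> 0"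
    and T: "T \<in> carrier_mat n n" "T' \<in> carrier_mat n n" "T * T' = 1\<^sub>m n" "T' * T = 1\<^sub>m n"
  shows "peval (conj_point n T T' x) p * peval x q = peval x p * peval (conj_point n T T' x) q"
proof -
  let ?\<sigma> = "\<lambda>v. to_frac (conj_poly n T T' v)" and ?s = "psub (conj_poly n T T')"
  interpret inj: injective_substitution ?\<sigma> by (rule conj_injective[OF T])
  have "map_mat (rat_subst ?\<sigma>) (\<zeta> \<cdot>\<^sub>m 1\<^sub>m n) = map_mat gconst T * (\<zeta> \<cdot>\<^sub>m 1\<^sub>m n) * map_mat gconst T'"
    by (rule UD_conj_equivariant[OF T z])
  also have "\<dots> = \<zeta> \<cdot>\<^sub>m (map_mat gconst T * map_mat gconst T')"
    using T mult_smult_distrib[of "map_mat gconst T" n n "1\<^sub>m n" n \<zeta>]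
      mult_smult_assoc_mat[of "map_mat gconst T" n n "map_mat gconst T'" n \<zeta>] by simp
  also have "map_mat gconst T * map_mat gconst T' = 1\<^sub>m n"
    unfolding E_gconst.mat_hom_mult[OF T(1,2), symmetric] T(3) by (rule E_gconst.mat_hom_one)
  finally have "map_mat (rat_subst ?\<sigma>) (\<zeta> \<cdot>\<^sub>m 1\<^sub>m n) $$ (0, 0) = (\<zeta> \<cdot>\<^sub>m 1\<^sub>m n) $$ (0, 0)" by simp
  then have "rat_subst ?\<sigma> \<zeta> = \<zeta>" using n by simp
  then have eq: "to_frac (?s p) / to_frac (?s q) = Fract p q"
    unfolding \<zeta>(1) inj.rat_subst_Fract[OF \<zeta>(2)] poly_subst_to_frac .
  have "?s q \<noteq> 0" using inj.inj[of q] \<zeta>(2) by (auto simp: poly_subst_to_frac)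
  then have "?s p * q = p * ?s q" using eq \<zeta>(2) by (simp add: eq_fract)
  then have "peval x (?s p * q) = peval x (p * ?s q)" by simp
  then show ?thesis by (simp add: peval.hom_mult peval_psub peval_conj_poly)
qed

text \<open>
  In a relation \<open>\<Sum> \<zeta>\<^sub>u x\<^sup>u = 0\<close> with invariant coefficients, conjugation by \<open>T\<close> changes only the
  monomials: \<open>\<Sum> \<zeta>\<^sub>u(x) (T x T\<inverse>)\<^sup>u = 0\<close>. At \<open>x = column_point\<close> the variables of \<open>T x T\<inverse>\<close> would take
  arbitrary values, and all \<open>\<zeta>\<^sub>u(x)\<close> would have to vanish. The coefficients may well be undefined or all
  \<open>0\<close> at this point. Therefore they are restricted to a line from this point to one where some
  coefficient is nonzero, and replaced by their leading terms at the special point.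
\<close>

theorem column_vars_independent:
  fixes \<zeta> :: "(var \<Rightarrow>\<^sub>0 nat) \<Rightarrow> 'k::field_char_0 gfrac"
  assumes n: "n \<ge> 1" and M: "finite M"
    and vars: "\<And>u. u \<in> M \<Longrightarrow> Poly_Mapping.keys u \<subseteq> column_vars n"
    and UD: "\<And>u. u \<in> M \<Longrightarrow> \<zeta> u \<cdot>\<^sub>m 1\<^sub>m n \<in> UD_carrier m n"
    and zero: "(\<Sum>u\<in>M. \<zeta> u * monomial gvar u) = 0"
  shows "\<forall>u\<in>M. \<zeta> u = 0"
proof (rule ccontr)
  assume "\<not> (\<forall>u\<in>M. \<zeta> u = 0)"
  then obtain u0 where u0: "u0 \<in> M" "\<zeta> u0 \<noteq> 0" by blast
  obtain P q where q: "q \<noteq> 0" and P: "\<And>u. u \<in> M \<Longrightarrow> \<zeta> u = Fract (P u) q"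
    using common_denominator[OF M, of \<zeta>] by blast
  have "P u0 \<noteq> 0" using u0 P[OF u0(1)] by (auto simp: fract_collapse)
  then obtain x1 where x1: "peval x1 (P u0) \<noteq> 0" using poly_eq_zero_if_peval_zero by blast
  have rel: "(\<Sum>u\<in>M. P u * monomial pvar u) = 0"
  proof -
    have "to_frac (\<Sum>u\<in>M. P u * monomial pvar u) = to_frac q * (\<Sum>u\<in>M. \<zeta> u * monomial gvar u)"
      unfolding to_frac_sum sum_distrib_left
    proof (rule sum.cong[OF refl])
      fix u assume "u \<in> M"
      then show "to_frac (P u * monomial pvar u) = to_frac q * (\<zeta> u * monomial gvar u)"
        using q by (simp add: P monomial_gvar eq_fract)
    qed
    then show ?thesis using zero by simp
  qed
  have twisted: "(\<Sum>u\<in>M. peval x (P u) * monomial (conj_point n T T' x) u) = 0"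
    if T: "T \<in> carrier_mat n n" "T' \<in> carrier_mat n n" "T * T' = 1\<^sub>m n" "T' * T = 1\<^sub>m n" for T T' x
  proof -
    let ?s = "psub (conj_poly n T T')"
    define H where "H = (\<Sum>u\<in>M. P u * ?s (monomial pvar u))"
    have H: "peval x H = (\<Sum>u\<in>M. peval x (P u) * monomial (conj_point n T T' x) u)" for x
      by (simp add: H_def peval.hom_sum peval.hom_mult peval_psub peval_conj_poly peval_monomial_pvar)
    interpret inj: injective_substitution "\<lambda>v. to_frac (conj_poly n T T' v)" by (rule conj_injective[OF T])
    have "?s q \<noteq> 0" using inj.inj[of q] q by (auto simp: poly_subst_to_frac)
    moreover have "peval x H = 0" if nz: "peval x (?s q) \<noteq> 0" for x
    proof -
      let ?y = "conj_point n T T' x"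
      have "peval ?y q * peval x H = (\<Sum>u\<in>M. (peval x (P u) * peval ?y q) * monomial ?y u)"
        unfolding H sum_distrib_left by (simp add: ac_simps)
      also have "\<dots> = (\<Sum>u\<in>M. (peval ?y (P u) * peval x q) * monomial ?y u)"
        by (rule sum.cong[OF refl]) (simp add: UD_scalar_conj_invariant[OF n UD P q T])
      also have "\<dots> = peval x q * peval ?y (\<Sum>u\<in>M. P u * monomial pvar u)"
        by (simp add: peval.hom_sum peval.hom_mult peval_monomial_pvar sum_distrib_left ac_simps)
      also have "\<dots> = 0" unfolding rel by simp
      finally show ?thesis using nz by (simp add: peval_psub peval_conj_poly)
    qed
    ultimately have "H = 0" using peval_zero_product by blast
    then show ?thesis using H[of x] by simp
  qed
  \<comment> \<open>The line from \<open>column_point\<close> at \<open>t = 0\<close> to \<open>x1\<close> at \<open>t = 1\<close>.\<close>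
  define d where "d v = x1 v - column_point v" for v
  let ?x = "\<lambda>t v. column_point v + t * d v"
  have "\<forall>u. \<exists>A. \<forall>t. peval (?x t) (P u) = poly A t" using peval_line by blast
  then obtain A where A: "\<And>u t. peval (?x t) (P u) = poly (A u) t" by metis
  have "?x 1 = x1" by (rule ext) (simp add: d_def)
  then have "poly (A u0) 1 \<noteq> 0" using x1 A[of 1 u0] by simp
  then have "A u0 \<noteq> 0" by auto
  from divide_out_power[of u0 M A, OF u0(1) this] obtain r D where
    D: "\<And>u. u \<in> M \<Longrightarrow> A u = [:0, 1:] ^ r * D u" and D0: "\<exists>u\<in>M. poly (D u) 0 \<noteq> 0" by blast
  have leading: "(\<Sum>u\<in>M. poly (D u) 0 * monomial (conj_point n T T' column_point) u) = 0"
    if T: "T \<in> carrier_mat n n" "T' \<in> carrier_mat n n" "T * T' = 1\<^sub>m n" "T' * T = 1\<^sub>m n" for T T'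
  proof -
    have "\<forall>u. \<exists>B. \<forall>t. monomial (conj_point n T T' (?x t)) u = poly B t"
    proof
      fix u
      show "\<exists>B. \<forall>t. monomial (conj_point n T T' (?x t)) u = poly B t"
        unfolding conj_point_line peval_monomial_pvar[symmetric, of _ u] by (rule peval_line)
    qed
    then obtain B where B: "\<And>u t. monomial (conj_point n T T' (?x t)) u = poly (B u) t" by metis
    have "poly (\<Sum>u\<in>M. A u * B u) t = 0" for t
      using twisted[OF T, of "?x t"] by (simp add: poly_sum A B)
    then have "(\<Sum>u\<in>M. A u * B u) = 0" by (intro poly_eq_zero_if_cofinite[of "{}"]) auto
    moreover have "(\<Sum>u\<in>M. A u * B u) = [:0, 1:] ^ r * (\<Sum>u\<in>M. D u * B u)"
      unfolding sum_distrib_left by (rule sum.cong[OF refl]) (simp add: D ac_simps)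
    ultimately have "(\<Sum>u\<in>M. D u * B u) = 0" by simp
    then have "poly (\<Sum>u\<in>M. D u * B u) 0 = 0" by simp
    then show ?thesis using B[of 0] by (simp add: poly_sum)
  qed
  \<comment> \<open>The relation between the leading terms, which has constant coefficients. It holds at every point \<open>z\<close>
     whose column variables are realized by some \<open>T\<close>, that is, off the zero set of a minor.\<close>
  define G where "G = (\<Sum>u\<in>M. pconst (poly (D u) 0) * monomial pvar u)"
  have G: "peval z G = (\<Sum>u\<in>M. poly (D u) 0 * monomial z u)" for z
    by (simp add: G_def peval.hom_sum peval.hom_mult peval_monomial_pvar)
  let ?minor = "\<lambda>z. mat (n - 1) (n - 1) (\<lambda>(a, i). z (Suc i, Suc a, 0)) :: 'k mat"
  have generic: "peval z G = 0" if "det (?minor z) \<noteq> 0" for z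
  proof -
    obtain T T' where T: "T \<in> carrier_mat n n" "T' \<in> carrier_mat n n" "T * T' = 1\<^sub>m n" "T' * T = 1\<^sub>m n"
      and T00: "T' $$ (0, 0) = 1"
      and entries: "\<And>a i. a < n \<Longrightarrow> i < n \<Longrightarrow> (a, i) \<noteq> (0, 0) \<Longrightarrow> T $$ (a, i) = z (i, a, 0)"
      using matrix_with_prescribed_entries[OF n, of "\<lambda>a i. z (i, a, 0)"] \<open>det (?minor z) \<noteq> 0\<close> by metis
    have "conj_point n T T' column_point v = z v" if "v \<in> column_vars n" for v
      using that conj_column_point[OF _ _ T(1,2)] T00 entries by (auto simp: column_vars_def)
    then have "monomial z u = monomial (conj_point n T T' column_point) u" if "u \<in> M" for u
      unfolding monomial_def using vars[OF that] by (intro prod.cong) (auto simp: subset_iff)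
    then show ?thesis unfolding G using leading[OF T] by simp
  qed
  have "peval z G = 0" for z
  proof -
    \<comment> \<open>In direction \<open>b\<close> the minor becomes a shift by \<open>t 1\<close>.\<close>
    define b :: "var \<Rightarrow> 'k" where "b = (\<lambda>(i, a, j). if i = a then 1 else 0)"
    obtain B where B: "\<forall>t. peval (\<lambda>v. z v + t * b v) G = poly B t" using peval_line by blast
    have minor: "?minor (\<lambda>v. z v + t * b v) = ?minor z + t \<cdot>\<^sub>m 1\<^sub>m (n - 1)" for t
      by (intro eq_matI) (auto simp: b_def)
    have "poly B t = 0" if "t \<notin> {t. det (?minor z + t \<cdot>\<^sub>m 1\<^sub>m (n - 1)) = 0}" for t
      using generic[of "\<lambda>v. z v + t * b v"] that B unfolding minor by simp
    moreover have "finite {t. det (?minor z + t \<cdot>\<^sub>m 1\<^sub>m (n - 1)) = 0}"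
      by (rule finite_det_shift_zero) (rule mat_carrier)
    ultimately have "B = 0" using poly_eq_zero_if_cofinite by blast
    then have "peval (\<lambda>v. z v + 0 * b v) G = 0" using B by (metis poly_0)
    then show ?thesis by simp
  qed
  then have "\<forall>u\<in>M. poly (D u) 0 = 0" unfolding G by (intro monomials_independent[OF M]) simp
  then show False using D0 by blast
qed

section \<open>The function field of an irreducible space\<close>

locale irreducible_space =
  fixes X :: "('x, 'k::field) fspace"
  assumes swf: "space_with_functions X" and irr: "irreducible_fspace X"
begin

lemmas swf_parts = swf[unfolded space_with_functions_def]

lemma reg_cong: "openin (tp X) U \<Longrightarrow> f \<in> reg X U \<Longrightarrow> (\<And>x. x \<in> U \<Longrightarrow> f x = g x) \<Longrightarrow> g \<in> reg X U"
  using swf_parts[THEN conjunct1, rule_format, of U f g] by simp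

lemma reg_Union: "(\<And>U. U \<in> \<U> \<Longrightarrow> openin (tp X) U) \<Longrightarrow> f \<in> reg X (\<Union>\<U>) \<longleftrightarrow> (\<forall>U\<in>\<U>. f \<in> reg X U)"
  using swf_parts[THEN conjunct2, THEN conjunct1, rule_format, of \<U> f] by simp

lemma reg_const: "openin (tp X) U \<Longrightarrow> (\<lambda>_. c) \<in> reg X U"
  using swf_parts[THEN conjunct2, THEN conjunct2, THEN conjunct1, rule_format, of U c] by simp

lemma reg_add: "openin (tp X) U \<Longrightarrow> f \<in> reg X U \<Longrightarrow> g \<in> reg X U \<Longrightarrow> (\<lambda>x. f x + g x) \<in> reg X U"
  and reg_mult: "openin (tp X) U \<Longrightarrow> f \<in> reg X U \<Longrightarrow> g \<in> reg X U \<Longrightarrow> (\<lambda>x. f x * g x) \<in> reg X U"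
  using swf_parts[THEN conjunct2, THEN conjunct2, THEN conjunct2, THEN conjunct1, rule_format, of U f g] by simp_all

lemma reg_nonzero_open: "openin (tp X) U \<Longrightarrow> f \<in> reg X U \<Longrightarrow> openin (tp X) {x \<in> U. f x \<noteq> 0}"
  and reg_inverse: "openin (tp X) U \<Longrightarrow> f \<in> reg X U \<Longrightarrow> (\<lambda>x. inverse (f x)) \<in> reg X {x \<in> U. f x \<noteq> 0}"
  using swf_parts[THEN conjunct2, THEN conjunct2, THEN conjunct2, THEN conjunct2, rule_format, of U f] by simp_all

lemma reg_restrict:
  assumes "openin (tp X) U" "openin (tp X) V" "V \<subseteq> U" "f \<in> reg X U"
  shows "f \<in> reg X V"
proof -
  have "\<Union>{U, V} = U" using assms(3) by auto
  then show ?thesis using reg_Union[of "{U, V}" f] assms by auto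
qed

lemma reg_sum: "openin (tp X) U \<Longrightarrow> (\<And>i. i \<in> J \<Longrightarrow> f i \<in> reg X U) \<Longrightarrow> (\<lambda>x. \<Sum>i\<in>J. f i x) \<in> reg X U"
  by (induction J rule: infinite_finite_induct) (auto simp: reg_const reg_add)

lemma reg_prod: "openin (tp X) U \<Longrightarrow> (\<And>i. i \<in> J \<Longrightarrow> f i \<in> reg X U) \<Longrightarrow> (\<lambda>x. \<Prod>i\<in>J. f i x) \<in> reg X U"
  by (induction J rule: infinite_finite_induct) (auto simp: reg_const reg_mult)

lemma reg_power: "openin (tp X) U \<Longrightarrow> f \<in> reg X U \<Longrightarrow> (\<lambda>x. f x ^ (k::nat)) \<in> reg X U"
  by (induction k) (auto simp: reg_const reg_mult)

lemma reg_peval: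
  assumes U: "openin (tp X) U" and p: "p \<in> polys_in V" and Y: "\<And>v. v \<in> V \<Longrightarrow> Y v \<in> reg X U"
  shows "(\<lambda>x. peval (\<lambda>v. Y v x) p) \<in> reg X U"
  unfolding gev_def monomial_def
  by (intro reg_sum reg_mult reg_const reg_prod reg_power U Y) (use p in \<open>unfold polys_in_def, blast\<close>)

lemma open_intersect: "openin (tp X) U \<Longrightarrow> openin (tp X) V \<Longrightarrow> U \<noteq> {} \<Longrightarrow> V \<noteq> {} \<Longrightarrow> U \<inter> V \<noteq> {}"
  using irr unfolding irreducible_fspace_def by blast

text \<open>Two regular functions that agree on a nonempty open set agree, as their difference vanishes there.\<close>

lemma reg_identity:
  assumes U: "openin (tp X) U" and W: "openin (tp X) W" "W \<noteq> {}"
    and fg: "f \<in> reg X U" "g \<in> reg X U" and eq: "\<And>x. x \<in> W \<inter> U \<Longrightarrow> f x = g x" and x: "x \<in> U"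
  shows "f x = g x"
proof (rule ccontr)
  assume "f x \<noteq> g x"
  let ?d = "\<lambda>x. f x + (- 1) * g x"
  have "?d \<in> reg X U" by (intro reg_add reg_mult reg_const U fg)
  then have "openin (tp X) {x \<in> U. ?d x \<noteq> 0}" by (rule reg_nonzero_open[OF U])
  moreover have "{x \<in> U. ?d x \<noteq> 0} \<noteq> {}" using x \<open>f x \<noteq> g x\<close> by auto
  ultimately have "{x \<in> U. ?d x \<noteq> 0} \<inter> W \<noteq> {}" using open_intersect W by blast
  then show False using eq by auto
qed

definition dom :: "'x set \<Rightarrow> bool" where
  "dom U \<longleftrightarrow> openin (tp X) U \<and> U \<noteq> {}"

lemma dom_open: "dom U \<Longrightarrow> openin (tp X) U"
  by (simp add: dom_def)

lemma dom_Int: "dom U \<Longrightarrow> dom V \<Longrightarrow> dom (U \<inter> V)"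
  using open_intersect[of U V] by (auto simp: dom_def)

lemma dom_topspace: "dom (topspace (tp X))"
  using irr by (simp add: dom_def irreducible_fspace_def)

abbreviation RC where "RC U f \<equiv> rational_class X U f"

lemma rep_iff: "(U, f) \<in> rational_rep X \<longleftrightarrow> dom U \<and> f \<in> reg X U"
  by (auto simp: rational_rep_def dom_def)

lemma RC_mem: "(V, g) \<in> RC U f \<longleftrightarrow> dom U \<and> f \<in> reg X U \<and> dom V \<and> g \<in> reg X V \<and> (\<forall>x\<in>U \<inter> V. f x = g x)"
  by (auto simp: rational_class_def rational_eq_def rep_iff)

text \<open>
  Transitivity is the identity principle: the middle function is defined on an open set that meets
  every other one.
\<close>

lemma rational_equiv: "equiv (rational_rep X) (rational_eq X)"
proof (rule equivI)
  show "refl_on (rational_rep X) (rational_eq X)" by (auto simp: refl_on_def rational_eq_def)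
  show "rational_eq X \<subseteq> rational_rep X \<times> rational_rep X" by (auto simp: rational_eq_def)
  show "sym (rational_eq X)" by (auto simp: sym_def rational_eq_def)
  show "trans (rational_eq X)"
  proof (rule transI, clarify)
    fix U f V g W h assume 1: "((U, f), V, g) \<in> rational_eq X" and 2: "((V, g), W, h) \<in> rational_eq X"
    then have d: "dom U" "dom V" "dom W" and r: "f \<in> reg X U" "h \<in> reg X W"
      by (auto simp: rational_eq_def rep_iff)
    have UW: "openin (tp X) (U \<inter> W)" using d dom_Int dom_open by blast
    have "f x = h x" if "x \<in> U \<inter> W" for x
    proof (rule reg_identity[OF UW _ _ _ _ _ that, of V])
      show "openin (tp X) V" "V \<noteq> {}" using d by (auto simp: dom_def)
      show "f \<in> reg X (U \<inter> W)" "h \<in> reg X (U \<inter> W)"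
        using reg_restrict[OF dom_open[OF d(1)] UW _ r(1)] reg_restrict[OF dom_open[OF d(3)] UW _ r(2)] by auto
      show "f x = h x" if "x \<in> V \<inter> (U \<inter> W)" for x
        using that 1 2 by (auto simp: rational_eq_def)
    qed
    then show "((U, f), W, h) \<in> rational_eq X" using d r by (auto simp: rational_eq_def rep_iff)
  qed
qed

lemma RC_eq_iff:
  assumes "dom U" "f \<in> reg X U" "dom V" "g \<in> reg X V"
  shows "RC U f = RC V g \<longleftrightarrow> (\<forall>x\<in>U \<inter> V. f x = g x)"
proof -
  have "RC U f = RC V g \<longleftrightarrow> ((U, f), (V, g)) \<in> rational_eq X"
    unfolding rational_class_def using assms by (intro eq_equiv_class_iff[OF rational_equiv]) (auto simp: rep_iff)
  then show ?thesis using assms by (auto simp: rational_eq_def rep_iff)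
qed

lemma RC_eqI:
  assumes "dom U" "f \<in> reg X U" "dom V" "g \<in> reg X V" "\<And>x. x \<in> U \<Longrightarrow> x \<in> V \<Longrightarrow> f x = g x"
  shows "RC U f = RC V g"
  using RC_eq_iff[OF assms(1-4)] assms(5) by blast

lemma binary_operation:
  assumes U: "dom U" "f \<in> reg X U" and V: "dom V" "g \<in> reg X V"
    and op: "\<And>U f g. openin (tp X) U \<Longrightarrow> f \<in> reg X U \<Longrightarrow> g \<in> reg X U \<Longrightarrow> (\<lambda>x. b (f x) (g x)) \<in> reg X U"
  shows "(\<Union>(U, f)\<in>RC U f. \<Union>(V, g)\<in>RC V g. RC (U \<inter> V) (\<lambda>x. b (f x) (g x))) = RC (U \<inter> V) (\<lambda>x. b (f x) (g x))"
proof -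
  have closed: "(\<lambda>x. b (f x) (g x)) \<in> reg X (U \<inter> V)" if "dom U" "f \<in> reg X U" "dom V" "g \<in> reg X V" for U f V g
  proof -
    have UV: "openin (tp X) (U \<inter> V)" using that dom_Int dom_open by blast
    show ?thesis
      using op[OF UV reg_restrict[OF dom_open[OF that(1)] UV _ that(2)] reg_restrict[OF dom_open[OF that(3)] UV _ that(4)]] by auto
  qed
  have eq: "RC (U' \<inter> V') (\<lambda>x. b (f' x) (g' x)) = RC (U \<inter> V) (\<lambda>x. b (f x) (g x))"
    if "(U', f') \<in> RC U f" "(V', g') \<in> RC V g" for U' f' V' g'
  proof (rule RC_eqI)
    show "dom (U' \<inter> V')" "dom (U \<inter> V)" using that U V dom_Int by (auto simp: RC_mem)
    show "(\<lambda>x. b (f' x) (g' x)) \<in> reg X (U' \<inter> V')" "(\<lambda>x. b (f x) (g x)) \<in> reg X (U \<inter> V)"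
      using that U V by (auto simp: RC_mem intro!: closed)
    show "b (f' x) (g' x) = b (f x) (g x)" if "x \<in> U' \<inter> V'" "x \<in> U \<inter> V" for x
      using that \<open>(U', f') \<in> RC U f\<close> \<open>(V', g') \<in> RC V g\<close> by (auto simp: RC_mem)
  qed
  have "(U, f) \<in> RC U f" "(V, g) \<in> RC V g" using U V by (auto simp: RC_mem)
  then show ?thesis using eq by (intro equalityI subsetI) fast+
qed

end

locale GL_function_field = irreducible_space X
  for X :: "('x, 'k::field) fspace" +
  fixes m :: nat and \<alpha> :: "'k mat \<Rightarrow> 'x \<Rightarrow> 'x"
  assumes GLv: "GL_variety m X \<alpha>" and field_L: "field (function_field m X \<alpha>)"
begin

abbreviation L where "L \<equiv> function_field m X \<alpha>"

sublocale L: field L by (rule field_L)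

lemma carrier_L: "C \<in> carrier L \<longleftrightarrow> (\<exists>U f. dom U \<and> f \<in> reg X U \<and> C = RC U f)"
proof -
  have "C \<in> carrier L \<longleftrightarrow> C \<in> rational_rep X // rational_eq X" by (simp add: function_field_def)
  also have "\<dots> \<longleftrightarrow> (\<exists>U f. dom U \<and> f \<in> reg X U \<and> C = RC U f)"
    unfolding quotient_def rational_class_def by (auto simp: rep_iff) blast
  finally show ?thesis .
qed

lemma RC_closed: "dom U \<Longrightarrow> f \<in> reg X U \<Longrightarrow> RC U f \<in> carrier L"
  unfolding carrier_L by blast

lemma L_add: "dom U \<Longrightarrow> f \<in> reg X U \<Longrightarrow> dom V \<Longrightarrow> g \<in> reg X V \<Longrightarrow>
    RC U f \<oplus>\<^bsub>L\<^esub> RC V g = RC (U \<inter> V) (\<lambda>x. f x + g x)"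
  using binary_operation[of U f V g "(+)"] reg_add by (simp add: function_field_def)

lemma L_mult: "dom U \<Longrightarrow> f \<in> reg X U \<Longrightarrow> dom V \<Longrightarrow> g \<in> reg X V \<Longrightarrow>
    RC U f \<otimes>\<^bsub>L\<^esub> RC V g = RC (U \<inter> V) (\<lambda>x. f x * g x)"
  using binary_operation[of U f V g "(*)"] reg_mult by (simp add: function_field_def)

lemma RC_const: "dom U \<Longrightarrow> dom V \<Longrightarrow> RC U (\<lambda>_. c) = RC V (\<lambda>_. c)"
  by (rule RC_eqI) (auto simp: reg_const dom_open)

lemma L_consts: "dom U \<Longrightarrow> \<one>\<^bsub>L\<^esub> = RC U (\<lambda>_. 1)" "dom U \<Longrightarrow> \<zero>\<^bsub>L\<^esub> = RC U (\<lambda>_. 0)" "dom U \<Longrightarrow> sclr L c = RC U (\<lambda>_. c)"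
  using RC_const[OF dom_topspace] by (auto simp: function_field_def)

lemma RC_restrict: "dom U \<Longrightarrow> f \<in> reg X U \<Longrightarrow> dom V \<Longrightarrow> V \<subseteq> U \<Longrightarrow> RC U f = RC V f"
  by (rule RC_eqI) (auto intro: reg_restrict[OF dom_open dom_open])

lemma RC_add: "dom U \<Longrightarrow> f \<in> reg X U \<Longrightarrow> g \<in> reg X U \<Longrightarrow> RC U f \<oplus>\<^bsub>L\<^esub> RC U g = RC U (\<lambda>x. f x + g x)"
  using L_add[of U f U g] by simp

lemma RC_mult: "dom U \<Longrightarrow> f \<in> reg X U \<Longrightarrow> g \<in> reg X U \<Longrightarrow> RC U f \<otimes>\<^bsub>L\<^esub> RC U g = RC U (\<lambda>x. f x * g x)"
  using L_mult[of U f U g] by simp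

lemma RC_sum:
  assumes U: "dom U" and "finite J" "\<And>j. j \<in> J \<Longrightarrow> f j \<in> reg X U"
  shows "(\<Oplus>\<^bsub>L\<^esub>j\<in>J. RC U (f j)) = RC U (\<lambda>x. \<Sum>j\<in>J. f j x)"
  using assms(2,3)
proof (induction J rule: finite_induct)
  case empty
  then show ?case by (simp add: L_consts(2)[OF U])
next
  case (insert j J)
  then show ?case
    using U by (subst L.finsum_insert) (auto simp: RC_closed RC_add reg_sum dom_open)
qed

text \<open>
  Finitely many rational functions are regular on a common nonempty open set, by irreducibility.
\<close>

lemma common_domain:
  assumes "finite S" "S \<subseteq> carrier L"
  shows "\<exists>U F. dom U \<and> (\<forall>s\<in>S. F s \<in> reg X U \<and> s = RC U (F s))"
  using assms
proof (induction S rule: finite_induct)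
  case empty
  show ?case using dom_topspace by blast
next
  case (insert s S)
  then obtain U F where U: "dom U" "\<forall>s\<in>S. F s \<in> reg X U \<and> s = RC U (F s)" by auto
  obtain V f where V: "dom V" "f \<in> reg X V" "s = RC V f" using insert.prems carrier_L by auto
  have UV: "dom (U \<inter> V)" using dom_Int U V by blast
  have "(F(s := f)) t \<in> reg X (U \<inter> V) \<and> t = RC (U \<inter> V) ((F(s := f)) t)" if "t \<in> insert s S" for t
  proof (cases "t = s")
    case True
    then show ?thesis using V UV reg_restrict[OF dom_open dom_open, of V "U \<inter> V" f] RC_restrict[of V f "U \<inter> V"] by simp
  next
    case False
    then have "F t \<in> reg X U" "t = RC U (F t)" using that U(2) by auto
    then show ?thesis
      using False U(1) UV reg_restrict[OF dom_open dom_open, of U "U \<inter> V" "F t"] RC_restrict[of U "F t" "U \<inter> V"] by simp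
  qed
  then show ?case using UV by blast
qed

subsection \<open>The group action\<close>

lemma ga: "group_action (GL m) (topspace (tp X)) \<alpha>"
  using GLv by (simp add: GL_variety_def)

interpretation ga: group_action "GL m" "topspace (tp X)" \<alpha> by (rule ga)

lemma \<alpha>_closed: "g \<in> carrier (GL m) \<Longrightarrow> x \<in> topspace (tp X) \<Longrightarrow> \<alpha> g x \<in> topspace (tp X)"
  using ga.element_image by blast

lemma \<alpha>_inv: "g \<in> carrier (GL m) \<Longrightarrow> x \<in> topspace (tp X) \<Longrightarrow> \<alpha> (inv\<^bsub>GL m\<^esub> g) (\<alpha> g x) = x"
  using ga.orbit_sym_aux by blast

lemma \<alpha>_inv': "g \<in> carrier (GL m) \<Longrightarrow> x \<in> topspace (tp X) \<Longrightarrow> \<alpha> g (\<alpha> (inv\<^bsub>GL m\<^esub> g) x) = x"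
  using \<alpha>_inv[of "inv\<^bsub>GL m\<^esub> g" x] GL_inv(4,5)[of g m] by simp

abbreviation P where "P \<equiv> product_fspace (GL_fspace m) X"

lemma GL_topspace: "topspace (tp (GL_fspace m :: ('k mat, 'k) fspace)) = carrier (GL m)"
proof -
  have "{x \<in> carrier (GL m). p x \<noteq> 0} \<subseteq> carrier (GL m)" for p :: "'k mat \<Rightarrow> 'k" by blast
  moreover have "carrier (GL m) \<in> {{x \<in> carrier (GL m). p x \<noteq> 0} | p. p \<in> poly_functions (mat_coords m :: ('k mat \<Rightarrow> 'k) set)}"
    using poly_functions.const[of 1 "mat_coords m :: ('k mat \<Rightarrow> 'k) set"] by (intro CollectI exI[of _ "\<lambda>_. 1"]) auto
  ultimately show ?thesis
    by (simp add: GL_fspace_def zariski_fspace_def Let_def topology_generated_by_topspace) blast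
qed

lemma product_sums_slice:
  assumes "a \<in> product_sums (GL_fspace m) X U V" "openin (tp X) V"
  shows "(\<lambda>x. a (g, x)) \<in> reg X V"
proof -
  obtain f h and r :: nat where a: "a = (\<lambda>(x, y). \<Sum>i<r. f i x * h i y)"
    "\<forall>i<r. f i \<in> reg (GL_fspace m) U \<and> h i \<in> reg X V"
    using assms(1) unfolding product_sums_def by blast
  show ?thesis unfolding a(1) prod.case
    by (intro reg_sum reg_mult reg_const assms(2)) (use a(2) in auto)
qed

text \<open>
  The topology of the product is finer than the product topology. Slices at \<open>g\<close> are still open: the basic
  open set of \<open>\<Sum>\<^sub>i f\<^sub>i(g) h\<^sub>i(x)\<close> becomes the nonvanishing set of a regular function on \<open>X\<close>.
\<close>

lemma slice_open:
  assumes "openin (tp P) S"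
  shows "openin (tp X) {x \<in> topspace (tp X). (g, x) \<in> S}"
proof -
  let ?B = "{{z \<in> U \<times> V. a z \<noteq> 0} | U V a. openin (tp (GL_fspace m)) U \<and> openin (tp X) V \<and> a \<in> product_sums (GL_fspace m) X U V}"
  have "generate_topology_on ?B S"
    using assms unfolding product_fspace_def Let_def by (simp add: openin_topology_generated_by_iff)
  then show ?thesis
  proof (induction rule: generate_topology_on.induct)
    case (Int S S')
    have "{x \<in> topspace (tp X). (g, x) \<in> S \<inter> S'} = {x \<in> topspace (tp X). (g, x) \<in> S} \<inter> {x \<in> topspace (tp X). (g, x) \<in> S'}" by auto
    then show ?case using openin_Int[OF Int.IH] by simp
  next
    case (UN K)
    have "{x \<in> topspace (tp X). (g, x) \<in> \<Union>K} = (\<Union>S\<in>K. {x \<in> topspace (tp X). (g, x) \<in> S})" by auto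
    then show ?case using UN by auto
  next
    case (Basis S)
    then obtain U V a where S: "S = {z \<in> U \<times> V. a z \<noteq> 0}" "openin (tp X) V" "a \<in> product_sums (GL_fspace m) X U V" by blast
    show ?case
    proof (cases "g \<in> U")
      case True
      have "{x \<in> topspace (tp X). (g, x) \<in> S} = {x \<in> V. a (g, x) \<noteq> 0}"
        using True S openin_subset by auto
      then show ?thesis using reg_nonzero_open[OF S(2) product_sums_slice[OF S(3,2)]] by simp
    qed (simp add: S(1))
  qed simp
qed

lemma in_product_topspace:
  assumes "g \<in> carrier (GL m)" "x \<in> topspace (tp X)"
  shows "(g, x) \<in> topspace (tp P)"
proof -
  let ?U = "topspace (tp (GL_fspace m :: ('k mat, 'k) fspace))" and ?V = "topspace (tp X)"
  have reg_GL: "f \<in> reg (GL_fspace m :: ('k mat, 'k) fspace) U \<longleftrightarrow> (\<forall>x\<in>U. \<exists>W p q.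
      openin (tp (GL_fspace m)) W \<and> x \<in> W \<and> W \<subseteq> U \<and> p \<in> poly_functions (mat_coords m) \<and>
      q \<in> poly_functions (mat_coords m) \<and> (\<forall>y\<in>W. q y \<noteq> 0 \<and> f y = p y / q y))" for f U
    by (simp add: GL_fspace_def zariski_fspace_def Let_def)
  have "(\<lambda>_. 1) \<in> reg (GL_fspace m :: ('k mat, 'k) fspace) ?U"
    unfolding reg_GL
    by (intro ballI exI[of _ ?U] exI[of _ "\<lambda>_. 1"] conjI poly_functions.const openin_topspace) auto
  then have "(\<lambda>(x, y). \<Sum>i<1::nat. (\<lambda>_. 1) x * (\<lambda>_. 1) y) \<in> product_sums (GL_fspace m) X ?U ?V"
    unfolding product_sums_def using reg_const[of ?V 1] by (intro CollectI exI[of _ "\<lambda>_ _. 1"] exI[of _ 1]) auto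
  then have "\<exists>a \<in> product_sums (GL_fspace m) X ?U ?V. \<forall>z. a z = 1" by (intro bexI) auto
  then obtain a where a: "a \<in> product_sums (GL_fspace m) X ?U ?V" "\<And>z. a z = 1" by blast
  have "{z \<in> ?U \<times> ?V. a z \<noteq> 0} \<in> {{z \<in> U \<times> V. a z \<noteq> 0} | U V a. openin (tp (GL_fspace m)) U \<and> openin (tp X) V \<and> a \<in> product_sums (GL_fspace m) X U V}"
    using a by blast
  moreover have "(g, x) \<in> {z \<in> ?U \<times> ?V. a z \<noteq> 0}" using assms a(2) GL_topspace by simp
  ultimately show ?thesis
    unfolding product_fspace_def Let_def by (simp add: topology_generated_by_topspace) blast
qed

lemma \<alpha>_preimage_open:
  assumes g: "g \<in> carrier (GL m)" and U: "openin (tp X) U"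
  shows "openin (tp X) {x \<in> topspace (tp X). \<alpha> g x \<in> U}"
proof -
  have "continuous_map (tp P) (tp X) (\<lambda>(g, x). \<alpha> g x)"
    using GLv by (simp add: GL_variety_def morphism_def)
  then have "openin (tp P) {z \<in> topspace (tp P). (\<lambda>(g, x). \<alpha> g x) z \<in> U}"
    using U by (simp add: continuous_map_def)
  from slice_open[OF this, of g]
  have "openin (tp X) {x \<in> topspace (tp X). (g, x) \<in> {z \<in> topspace (tp P). (\<lambda>(g, x). \<alpha> g x) z \<in> U}}" .
  also have "{x \<in> topspace (tp X). (g, x) \<in> {z \<in> topspace (tp P). (\<lambda>(g, x). \<alpha> g x) z \<in> U}} =
      {x \<in> topspace (tp X). \<alpha> g x \<in> U}" using in_product_topspace[OF g] by auto
  finally show ?thesis .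
qed

text \<open>
  A regular function on the product is locally a quotient of sums of products; with \<open>g\<close> held fixed, these
  are regular on \<open>X\<close>, and regularity is local.
\<close>

lemma \<alpha>_regular:
  assumes g: "g \<in> carrier (GL m)" and U: "openin (tp X) U" and f: "f \<in> reg X U"
  shows "(\<lambda>x. f (\<alpha> g x)) \<in> reg X {x \<in> topspace (tp X). \<alpha> g x \<in> U}"
proof -
  let ?S = "{z \<in> topspace (tp P). (\<lambda>(g, x). \<alpha> g x) z \<in> U}" and ?D = "{x \<in> topspace (tp X). \<alpha> g x \<in> U}"
  have reg_P: "h \<in> reg P S \<longleftrightarrow> (\<forall>z\<in>S. \<exists>W U V a b. openin (tp P) W \<and> z \<in> W \<and> W \<subseteq> S \<inter> (U \<times> V) \<and>
      openin (tp (GL_fspace m)) U \<and> openin (tp X) V \<and>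
      a \<in> product_sums (GL_fspace m) X U V \<and> b \<in> product_sums (GL_fspace m) X U V \<and>
      (\<forall>w\<in>W. b w \<noteq> 0 \<and> h w = a w / b w))" for h S
    by (simp add: product_fspace_def Let_def)
  have "(\<lambda>z. f ((\<lambda>(g, x). \<alpha> g x) z)) \<in> reg P ?S"
    using GLv U f unfolding GL_variety_def morphism_def by blast
  then have loc: "\<exists>W U V a b. openin (tp P) W \<and> z \<in> W \<and> W \<subseteq> ?S \<inter> (U \<times> V) \<and>
      openin (tp (GL_fspace m)) U \<and> openin (tp X) V \<and>
      a \<in> product_sums (GL_fspace m) X U V \<and> b \<in> product_sums (GL_fspace m) X U V \<and>
      (\<forall>w\<in>W. b w \<noteq> 0 \<and> f ((\<lambda>(g, x). \<alpha> g x) w) = a w / b w)" if "z \<in> ?S" for z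
    using that unfolding reg_P by (rule bspec)
  define \<W> where "\<W> = {W. openin (tp X) W \<and> W \<subseteq> ?D \<and> (\<lambda>x. f (\<alpha> g x)) \<in> reg X W}"
  have "?D \<subseteq> \<Union>\<W>"
  proof
    fix x assume x: "x \<in> ?D"
    then have "(g, x) \<in> ?S" using in_product_topspace[OF g] by auto
    from loc[OF this] obtain W U' V a b where W: "openin (tp P) W" "(g, x) \<in> W" "W \<subseteq> ?S \<inter> (U' \<times> V)"
      and V: "openin (tp X) V" and a: "a \<in> product_sums (GL_fspace m) X U' V" and b: "b \<in> product_sums (GL_fspace m) X U' V"
      and eq: "\<forall>w\<in>W. b w \<noteq> 0 \<and> f ((\<lambda>(g, x). \<alpha> g x) w) = a w / b w" by blast
    define Wg where "Wg = {x \<in> topspace (tp X). (g, x) \<in> W}"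
    have Wg: "openin (tp X) Wg" unfolding Wg_def by (rule slice_open[OF W(1)])
    have WgV: "Wg \<subseteq> V" using W(3) by (auto simp: Wg_def)
    have ra: "(\<lambda>x. a (g, x)) \<in> reg X Wg" and rb: "(\<lambda>x. b (g, x)) \<in> reg X Wg"
      using reg_restrict[OF V Wg WgV] product_sums_slice[OF a V] product_sums_slice[OF b V] by auto
    have "{x \<in> Wg. b (g, x) \<noteq> 0} = Wg" using eq by (auto simp: Wg_def)
    then have "(\<lambda>x. inverse (b (g, x))) \<in> reg X Wg" using reg_inverse[OF Wg rb] by simp
    then have "(\<lambda>x. a (g, x) * inverse (b (g, x))) \<in> reg X Wg" by (rule reg_mult[OF Wg ra])
    then have "(\<lambda>x. f (\<alpha> g x)) \<in> reg X Wg"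
      by (rule reg_cong[OF Wg]) (use eq in \<open>auto simp: Wg_def divide_inverse\<close>)
    moreover have "Wg \<subseteq> ?D" using W(3) by (auto simp: Wg_def)
    moreover have "x \<in> Wg" using x W(2) by (simp add: Wg_def)
    ultimately show "x \<in> \<Union>\<W>" using Wg by (auto simp: \<W>_def)
  qed
  then have "\<Union>\<W> = ?D" by (auto simp: \<W>_def)
  moreover have "(\<lambda>x. f (\<alpha> g x)) \<in> reg X (\<Union>\<W>)" by (subst reg_Union) (auto simp: \<W>_def)
  ultimately show ?thesis by simp
qed

lemma \<alpha>_image:
  assumes g: "g \<in> carrier (GL m)" and U: "openin (tp X) U"
  shows "\<alpha> g ` U = {x \<in> topspace (tp X). \<alpha> (inv\<^bsub>GL m\<^esub> g) x \<in> U}"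
proof (intro equalityI subsetI)
  fix x assume "x \<in> \<alpha> g ` U"
  then obtain y where y: "y \<in> U" "x = \<alpha> g y" by blast
  then have "y \<in> topspace (tp X)" using openin_subset[OF U] by blast
  then show "x \<in> {x \<in> topspace (tp X). \<alpha> (inv\<^bsub>GL m\<^esub> g) x \<in> U}" using y \<alpha>_closed[OF g] \<alpha>_inv[OF g] by simp
next
  fix x assume "x \<in> {x \<in> topspace (tp X). \<alpha> (inv\<^bsub>GL m\<^esub> g) x \<in> U}"
  then show "x \<in> \<alpha> g ` U" using \<alpha>_inv'[OF g, of x] by (metis (mono_tags, lifting) imageI mem_Collect_eq)
qed

lemma act_valid:
  assumes g: "g \<in> carrier (GL m)" and U: "dom U" and f: "f \<in> reg X U"
  shows "dom (\<alpha> g ` U)" "(\<lambda>x. f (\<alpha> (inv\<^bsub>GL m\<^esub> g) x)) \<in> reg X (\<alpha> g ` U)"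
  using \<alpha>_preimage_open[OF GL_inv(4)[OF g] dom_open[OF U]] \<alpha>_regular[OF GL_inv(4)[OF g] dom_open[OF U] f] U
  unfolding \<alpha>_image[OF g dom_open[OF U], symmetric] by (auto simp: dom_def)

lemma act_RC:
  assumes g: "g \<in> carrier (GL m)" and U: "dom U" and f: "f \<in> reg X U"
  shows "act L g (RC U f) = RC (\<alpha> g ` U) (\<lambda>x. f (\<alpha> (inv\<^bsub>GL m\<^esub> g) x))"
proof -
  have eq: "RC (\<alpha> g ` V) (\<lambda>x. h (\<alpha> (inv\<^bsub>GL m\<^esub> g) x)) = RC (\<alpha> g ` U) (\<lambda>x. f (\<alpha> (inv\<^bsub>GL m\<^esub> g) x))"
    if "(V, h) \<in> RC U f" for V h
  proof (rule RC_eqI)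
    have V: "dom V" "h \<in> reg X V" "\<forall>x\<in>U \<inter> V. f x = h x" using that by (auto simp: RC_mem)
    show "dom (\<alpha> g ` V)" "(\<lambda>x. h (\<alpha> (inv\<^bsub>GL m\<^esub> g) x)) \<in> reg X (\<alpha> g ` V)" using act_valid[OF g V(1,2)] .
    show "dom (\<alpha> g ` U)" "(\<lambda>x. f (\<alpha> (inv\<^bsub>GL m\<^esub> g) x)) \<in> reg X (\<alpha> g ` U)" using act_valid[OF g U f] .
    show "h (\<alpha> (inv\<^bsub>GL m\<^esub> g) x) = f (\<alpha> (inv\<^bsub>GL m\<^esub> g) x)" if "x \<in> \<alpha> g ` V" "x \<in> \<alpha> g ` U" for x
      using that V(3) unfolding \<alpha>_image[OF g dom_open[OF V(1)]] \<alpha>_image[OF g dom_open[OF U]] by auto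
  qed
  have "(U, f) \<in> RC U f" using U f by (simp add: RC_mem)
  moreover have "act L g (RC U f) = (\<Union>(V, h)\<in>RC U f. RC (\<alpha> g ` V) (\<lambda>x. h (\<alpha> (inv\<^bsub>GL m\<^esub> g) x)))"
    by (simp add: function_field_def)
  ultimately show ?thesis using eq by fast
qed

lemma act_const:
  assumes g: "g \<in> carrier (GL m)" shows "act L g (sclr L c) = sclr L c"
proof -
  have "act L g (RC (topspace (tp X)) (\<lambda>_. c)) = RC (\<alpha> g ` topspace (tp X)) (\<lambda>_. c)"
    using act_RC[OF g dom_topspace reg_const[OF dom_open[OF dom_topspace]]] by simp
  then show ?thesis using L_consts(3)[OF dom_topspace]
      L_consts(3)[OF act_valid(1)[OF g dom_topspace reg_const[OF dom_open[OF dom_topspace]]]] by metis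
qed

lemma L_gring: "gring (GL m) L"
  unfolding gring_def
proof (intro conjI ballI)
  show "ring L" by (rule L.ring_axioms)
  fix g :: "'k mat" assume g: "g \<in> carrier (GL m)"
  have inj: "\<alpha> g ` U \<inter> \<alpha> g ` V = \<alpha> g ` (U \<inter> V)" if "dom U" "dom V" for U V
    using that unfolding \<alpha>_image[OF g dom_open[OF that(1)]] \<alpha>_image[OF g dom_open[OF that(2)]]
      \<alpha>_image[OF g dom_open[OF dom_Int[OF that]]] by auto
  show "act L g \<in> ring_hom L L"
  proof (rule ring_hom_memI)
    fix x y assume "x \<in> carrier L" "y \<in> carrier L"
    then obtain U f V h where x: "dom U" "f \<in> reg X U" "x = RC U f" and y: "dom V" "h \<in> reg X V" "y = RC V h"
      unfolding carrier_L by blast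
    note UV = dom_Int[OF x(1) y(1)]
    note fx = act_valid[OF g x(1,2)] and fy = act_valid[OF g y(1,2)]
    have f': "f \<in> reg X (U \<inter> V)" and h': "h \<in> reg X (U \<inter> V)"
      using reg_restrict[OF dom_open[OF x(1)] dom_open[OF UV] _ x(2)] reg_restrict[OF dom_open[OF y(1)] dom_open[OF UV] _ y(2)] by auto
    show "act L g x \<in> carrier L" unfolding x(3) act_RC[OF g x(1,2)] using fx by (rule RC_closed)
    show "act L g (x \<otimes>\<^bsub>L\<^esub> y) = act L g x \<otimes>\<^bsub>L\<^esub> act L g y"
      unfolding x(3) y(3) L_mult[OF x(1,2) y(1,2)] act_RC[OF g UV reg_mult[OF dom_open[OF UV] f' h']]
        act_RC[OF g x(1,2)] act_RC[OF g y(1,2)] L_mult[OF fx fy] inj[OF x(1) y(1)] ..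
    show "act L g (x \<oplus>\<^bsub>L\<^esub> y) = act L g x \<oplus>\<^bsub>L\<^esub> act L g y"
      unfolding x(3) y(3) L_add[OF x(1,2) y(1,2)] act_RC[OF g UV reg_add[OF dom_open[OF UV] f' h']]
        act_RC[OF g x(1,2)] act_RC[OF g y(1,2)] L_add[OF fx fy] inj[OF x(1) y(1)] ..
  next
    show "act L g \<one>\<^bsub>L\<^esub> = \<one>\<^bsub>L\<^esub>"
      using act_const[OF g, of 1] L_consts(1,3)[OF dom_topspace] by simp
  qed
  fix x assume "x \<in> carrier L"
  then obtain U f where x: "dom U" "f \<in> reg X U" "x = RC U f" unfolding carrier_L by blast
  note g' = GL_inv(4)[OF g]
  note v = act_valid[OF g' x(1,2)]
  show "act L g (act L (inv\<^bsub>GL m\<^esub> g) x) = x"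
    unfolding x(3) act_RC[OF g' x(1,2)] act_RC[OF g v]
  proof (rule RC_eqI[OF act_valid[OF g v] x(1,2)])
    fix z assume "z \<in> U"
    then have "z \<in> topspace (tp X)" using openin_subset[OF dom_open[OF x(1)]] by blast
    then show "f (\<alpha> (inv\<^bsub>GL m\<^esub> (inv\<^bsub>GL m\<^esub> g)) (\<alpha> (inv\<^bsub>GL m\<^esub> g) z)) = f z" using \<alpha>_inv[OF g'] by simp
  qed
qed

end

section \<open>The splitting homomorphism\<close>

locale UD_function_field = GL_function_field X m \<alpha>
  for X :: "('x, 'k::field_char_0) fspace" and m :: nat and \<alpha> :: "'k mat \<Rightarrow> 'x \<Rightarrow> 'x" +
  fixes n :: nat and \<iota> :: "'k gfrac mat \<Rightarrow> ('x set \<times> ('x \<Rightarrow> 'k)) set"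
  assumes n: "n \<ge> 1" and mn: "n * n \<le> m"
    and \<iota>: "\<iota> \<in> galg_hom (GL m) (galg_center (UD m n)) (function_field m X \<alpha>)"
begin

abbreviation A :: "('k gfrac mat, 'k, 'k mat) galg" where "A \<equiv> UD m n"

lemma center_A: "z \<in> carrier (galg_center A) \<longleftrightarrow> z \<in> UD_carrier m n \<and> (\<forall>a\<in>UD_carrier m n. z * a = a * z)"
  by (simp add: galg_center_def UD_simps)

sublocale ext: scalar_extension A L \<iota> "GL m"
proof (intro scalar_extension.intro equivariant_tensor.intro tensor_product.intro ring_pair.intro)
  have hom: "\<iota> \<in> ring_hom (galg_center A) L" using \<iota> by (simp add: galg_hom_def)
  show "ring A" by (rule UD_ring)
  show "ring L" by (rule L.ring_axioms)
  show "group (GL m)" by (rule GL_group)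
  show "field L" by (rule field_L)
  show "tensor_product_axioms A L (carrier (galg_center A)) (\<lambda>z. z) \<iota>"
  proof
    show "r \<otimes>\<^bsub>A\<^esub> a = a \<otimes>\<^bsub>A\<^esub> r" if "r \<in> carrier (galg_center A)" "a \<in> carrier A" for r a
      using that center_A by (simp add: UD_simps)
    show "r \<in> carrier A" if "r \<in> carrier (galg_center A)" for r
      using that center_A by (simp add: UD_simps)
    show "\<iota> r \<in> carrier L" if "r \<in> carrier (galg_center A)" for r
      using ring_hom_closed[OF hom that] .
    show "\<iota> r \<otimes>\<^bsub>L\<^esub> b = b \<otimes>\<^bsub>L\<^esub> \<iota> r" if "r \<in> carrier (galg_center A)" "b \<in> carrier L" for r b
      using ring_hom_closed[OF hom that(1)] that(2) by (rule L.m_comm)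
  qed
  show "equivariant_tensor_axioms A L (carrier (galg_center A)) (\<lambda>z. z) \<iota> (GL m)"
  proof
    fix g :: "'k mat" and r assume g: "g \<in> carrier (GL m)" and r: "r \<in> carrier (galg_center A)"
    have "act (galg_center A) g r \<in> carrier (galg_center A)"
      using ring_hom_closed[OF gring_hom[OF galg_center_gring[OF GL_group UD_gring] g] r] .
    then have c: "act A g r \<in> carrier (galg_center A)" by (simp add: galg_center_def)
    have "\<iota> (act (galg_center A) g r) = act L g (\<iota> r)" using \<iota> g r by (simp add: galg_hom_def)
    then have "\<iota> (act A g r) = act L g (\<iota> r)" by (simp add: galg_center_def)
    then show "\<exists>r'\<in>carrier (galg_center A). r' = act A g r \<and> \<iota> r' = act L g (\<iota> r)" using c by blast
  qed (rule UD_gring, rule L_gring)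
  show "scalar_extension_axioms A L \<iota>"
  proof
    show "\<iota> \<in> ring_hom (galg_center A) L" by (rule hom)
    show "\<exists>z'\<in>carrier (galg_center A). z' \<otimes>\<^bsub>A\<^esub> z = \<one>\<^bsub>A\<^esub>"
      if "z \<in> carrier (galg_center A)" "z \<noteq> \<zero>\<^bsub>A\<^esub>" for z
      using UD_center_inverse[OF n mn that] .
  qed
qed

lemma sclr_A_center: "sclr A c \<in> carrier (galg_center A)"
  unfolding center_A
proof (intro conjI ballI)
  fix a :: "'k gfrac mat" assume "a \<in> UD_carrier m n"
  then have "a \<in> carrier_mat n n" by (rule UD_closed)
  then show "sclr A c * a = a * sclr A c"
    using mult_smult_distrib[of a n n "1\<^sub>m n" n "gconst c"] mult_smult_assoc_mat[of "1\<^sub>m n" n n a n "gconst c"]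
    by (simp add: UD_simps)
qed (simp add: UD_simps UD_carrier.scalar)

lemma \<iota>_sclr: "\<iota> (sclr A c) = sclr L c"
  using \<iota> by (simp add: galg_hom_def galg_center_def)

text \<open>
  The scalars of the tensor product come from those of \<open>A\<close>, which are central and fixed.
\<close>

lemma matrix_units:
  assumes "galg_split (GL m) n ext.Q"
  shows "\<exists>e. is_matrix_units (GL m) n ext.Q e"
proof (rule matrix_units_of_split[OF GL_group ext.tensor_gring _ _ n assms])
  have sA: "sclr A c \<in> carrier A" for c using sclr_A_center ext.Z_carrier by blast
  have eq: "sclr ext.Q c = ext.scal (\<iota> (sclr A c))" for c
    using ext.tens_balanced[of "\<one>\<^bsub>A\<^esub>" "sclr A c" "\<one>\<^bsub>L\<^esub>"] sclr_A_center[of c] sA[of c] ext.\<iota>_closed[OF sclr_A_center[of c]]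
    by (simp add: ext.Q_simps(6))
  show "sclr ext.Q c \<in> carrier (galg_center ext.Q)" for c
    unfolding eq using ext.\<iota>_closed[OF sclr_A_center[of c]]
    by (intro galg_centerI ext.scal_closed ext.scal_central)
  show "act ext.Q g (sclr ext.Q c) = sclr ext.Q c" if g: "g \<in> carrier (GL m)" for g c
  proof -
    have "sclr A c \<in> galg_fixed (GL m) A" unfolding UD_fixed[OF mn] by (rule rangeI)
    then have "act A g (sclr A c) = sclr A c" using g by (simp add: galg_fixed_def)
    then show ?thesis
      unfolding ext.Q_simps(6) using g sA[of c] ring_hom_one[OF ext.actB[OF g]] by (simp add: ext.act_tens)
  qed
qed

end

locale split_UD = UD_function_field X m \<alpha> n \<iota>
  for X :: "('x, 'k::field_char_0) fspace" and m \<alpha> n \<iota> +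
  fixes e
  assumes units: "is_matrix_units (GL m) n ext.Q e"
begin

sublocale spl: split_extension A L \<iota> "GL m" n e
  by unfold_locales (rule units, rule n)

text \<open>
  The homomorphism from \<open>A\<close> to \<open>M\<^sub>n(L)\<close> that the splitting induces.
\<close>

definition \<Lambda> where "\<Lambda> a i j = spl.coord (ext.tens a \<one>\<^bsub>L\<^esub>) i j"

lemma tens_closed_UD: "a \<in> UD_carrier m n \<Longrightarrow> ext.tens a \<one>\<^bsub>L\<^esub> \<in> carrier ext.Q"
  by (rule ext.tens_closed) (simp_all add: UD_simps)

lemma \<Lambda>_closed: "a \<in> UD_carrier m n \<Longrightarrow> i < n \<Longrightarrow> j < n \<Longrightarrow> \<Lambda> a i j \<in> carrier L"
  unfolding \<Lambda>_def by (rule spl.coord(1)[OF tens_closed_UD])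

lemma \<Lambda>_add:
  assumes "a \<in> UD_carrier m n" "b \<in> UD_carrier m n" "i < n" "j < n"
  shows "\<Lambda> (a + b) i j = \<Lambda> a i j \<oplus>\<^bsub>L\<^esub> \<Lambda> b i j"
  using spl.coord_add[OF tens_closed_UD[OF assms(1)] tens_closed_UD[OF assms(2)] assms(3,4)]
    ext.tens_add_left[of a b "\<one>\<^bsub>L\<^esub>"] assms(1,2) by (simp add: \<Lambda>_def UD_simps)

lemma \<Lambda>_mult:
  assumes "a \<in> UD_carrier m n" "b \<in> UD_carrier m n" "i < n" "j < n"
  shows "\<Lambda> (a * b) i j = (\<Oplus>\<^bsub>L\<^esub>l\<in>{..<n}. \<Lambda> a i l \<otimes>\<^bsub>L\<^esub> \<Lambda> b l j)"
  using spl.coord_mult[OF tens_closed_UD[OF assms(1)] tens_closed_UD[OF assms(2)] assms(3,4)]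
    ext.tens_mult[of a "\<one>\<^bsub>L\<^esub>" b "\<one>\<^bsub>L\<^esub>"] assms(1,2) by (simp add: \<Lambda>_def UD_simps)

lemma \<Lambda>_center_mult:
  assumes z: "z \<in> carrier (galg_center A)" and a: "a \<in> UD_carrier m n" and ij: "i < n" "j < n"
  shows "\<Lambda> (a * z) i j = \<iota> z \<otimes>\<^bsub>L\<^esub> \<Lambda> a i j"
proof -
  have aA: "a \<in> carrier A" using a by (simp add: UD_simps)
  have "ext.tens (a \<otimes>\<^bsub>A\<^esub> z) \<one>\<^bsub>L\<^esub> = ext.tens a (\<iota> z \<otimes>\<^bsub>L\<^esub> \<one>\<^bsub>L\<^esub>)"
    by (rule ext.tens_balanced[OF aA z]) simp
  also have "\<dots> = ext.scal (\<iota> z) \<otimes>\<^bsub>ext.Q\<^esub> ext.tens a \<one>\<^bsub>L\<^esub>"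
    using aA ext.\<iota>_closed[OF z] by (simp add: ext.tens_mult)
  finally have "\<Lambda> (a * z) i j = spl.coord (ext.scal (\<iota> z) \<otimes>\<^bsub>ext.Q\<^esub> ext.tens a \<one>\<^bsub>L\<^esub>) i j"
    by (simp add: \<Lambda>_def UD_simps)
  then show ?thesis unfolding spl.coord_scal[OF ext.\<iota>_closed[OF z] tens_closed_UD[OF a] ij] \<Lambda>_def .
qed

lemma \<Lambda>_one: "i < n \<Longrightarrow> j < n \<Longrightarrow> \<Lambda> (1\<^sub>m n) i j = (if i = j then \<one>\<^bsub>L\<^esub> else \<zero>\<^bsub>L\<^esub>)"
  using spl.coord_one[of i j] unfolding \<Lambda>_def ext.tens_one by (simp add: UD_simps)

lemma \<Lambda>_center:
  assumes z: "z \<in> carrier (galg_center A)" and ij: "i < n" "j < n"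
  shows "\<Lambda> z i j = (if i = j then \<iota> z else \<zero>\<^bsub>L\<^esub>)"
proof -
  have "z \<in> carrier_mat n n" using z center_A UD_closed by blast
  then have "\<Lambda> z i j = \<Lambda> (1\<^sub>m n * z) i j" by simp
  also have "\<dots> = \<iota> z \<otimes>\<^bsub>L\<^esub> \<Lambda> (1\<^sub>m n) i j" by (rule \<Lambda>_center_mult[OF z UD_one ij])
  finally show ?thesis using ij ext.\<iota>_closed[OF z] by (simp add: \<Lambda>_one)
qed

lemma \<Lambda>_smult:
  assumes a: "a \<in> UD_carrier m n" and ij: "i < n" "j < n"
  shows "\<Lambda> (gconst c \<cdot>\<^sub>m a) i j = sclr L c \<otimes>\<^bsub>L\<^esub> \<Lambda> a i j"
proof -
  have "gconst c \<cdot>\<^sub>m a = a * sclr A c"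
    using UD_closed[OF a] mult_smult_distrib[of a n n "1\<^sub>m n" n "gconst c"] by (simp add: UD_simps)
  then show ?thesis using \<Lambda>_center_mult[OF sclr_A_center a ij, of c] by (simp add: \<iota>_sclr)
qed

lemma sclr_L_closed: "sclr L c \<in> carrier L"
  using ext.\<iota>_closed[OF sclr_A_center, of c] by (simp add: \<iota>_sclr)

lemma \<Lambda>_zero: "i < n \<Longrightarrow> j < n \<Longrightarrow> \<Lambda> (0\<^sub>m n n) i j = \<zero>\<^bsub>L\<^esub>"
  using \<Lambda>_center[OF ext.Z_zero, of i j] by (simp add: UD_simps ext.\<iota>_zero[unfolded UD_simps])

lemma \<Lambda>_combination:
  assumes "finite S" "\<And>l. l \<in> S \<Longrightarrow> a l \<in> UD_carrier m n" and ij: "i < n" "j < n"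
  shows "\<Lambda> (mat n n (\<lambda>p. \<Sum>l\<in>S. gconst (c l) * a l $$ p)) i j = (\<Oplus>\<^bsub>L\<^esub>l\<in>S. sclr L (c l) \<otimes>\<^bsub>L\<^esub> \<Lambda> (a l) i j)"
  using assms(1,2)
proof (induction S rule: finite_induct)
  case empty
  have "mat n n (\<lambda>p. 0) = (0\<^sub>m n n :: 'k gfrac mat)" by auto
  then show ?case using \<Lambda>_zero[OF ij] by simp
next
  case (insert l S)
  have eq: "mat n n (\<lambda>p. \<Sum>l\<in>insert l S. gconst (c l) * a l $$ p) =
      gconst (c l) \<cdot>\<^sub>m a l + mat n n (\<lambda>p. \<Sum>l\<in>S. gconst (c l) * a l $$ p)"
    using insert.hyps UD_closed[OF insert.prems[of l]] by (intro eq_matI) auto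
  have UD: "gconst (c l) \<cdot>\<^sub>m a l \<in> UD_carrier m n" "mat n n (\<lambda>p. \<Sum>l\<in>S. gconst (c l) * a l $$ p) \<in> UD_carrier m n"
    using insert.prems insert.hyps(1) by (auto intro!: UD_smult UD_combination)
  show ?case
    unfolding eq \<Lambda>_add[OF UD ij] using insert ij
    by (subst L.finsum_insert) (auto simp: \<Lambda>_smult \<Lambda>_closed sclr_L_closed Pi_iff)
qed

lemma \<Lambda>_act:
  assumes "g \<in> carrier (GL m)" "a \<in> UD_carrier m n" "i < n" "j < n"
  shows "\<Lambda> (act A g a) i j = act L g (\<Lambda> a i j)"
proof -
  have "act ext.Q g (ext.tens a \<one>\<^bsub>L\<^esub>) = ext.tens (act A g a) \<one>\<^bsub>L\<^esub>"
    using assms(1,2) ring_hom_one[OF ext.actB[OF assms(1)]] by (simp add: ext.act_tens UD_simps(1))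
  then show ?thesis
    using spl.coord_act[OF assms(1) tens_closed_UD[OF assms(2)] assms(3,4)] by (simp add: \<Lambda>_def)
qed

text \<open>
  The images of the variables. The following lemmas show that these elements of \<open>L\<close> behave like the
  coordinates of a point with dense orbit.
\<close>

definition y :: "var \<Rightarrow> ('x set \<times> ('x \<Rightarrow> 'k)) set" where
  "y = (\<lambda>(h, i, j). \<Lambda> (generic_mat n h) i j)"

lemma y_closed: "v \<in> gvars m n \<Longrightarrow> y v \<in> carrier L"
  by (auto simp: y_def gvars_def intro!: \<Lambda>_closed UD_carrier.generic)

text \<open>
  The rows of the left inverse are the coordinate vectors of the matrix units with respect to the
  images of the generic matrices.
\<close>

lemma left_inverse_exists:
  "\<exists>w. \<forall>e<n*n. (\<forall>h<n*n. w e h \<in> carrier L) \<and> (\<forall>i<n. \<forall>j<n.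
    (\<Oplus>\<^bsub>L\<^esub>h\<in>{..<n*n}. w e h \<otimes>\<^bsub>L\<^esub> y (h, i, j)) = (if e = i * n + j then \<one>\<^bsub>L\<^esub> else \<zero>\<^bsub>L\<^esub>))"
proof -
  have "\<exists>w. (\<forall>h<n*n. w h \<in> carrier L) \<and> (\<forall>i<n. \<forall>j<n.
    (\<Oplus>\<^bsub>L\<^esub>h\<in>{..<n*n}. w h \<otimes>\<^bsub>L\<^esub> y (h, i, j)) = (if e = i * n + j then \<one>\<^bsub>L\<^esub> else \<zero>\<^bsub>L\<^esub>))" if e: "e < n * n" for e
  proof -
    have "\<exists>w. (\<forall>h<n*n. w h \<in> carrier L) \<and> (\<forall>i<n. \<forall>j<n.
      (\<Oplus>\<^bsub>L\<^esub>h\<in>{..<n*n}. w h \<otimes>\<^bsub>L\<^esub> spl.coord (ext.tens (generic_mat n h) \<one>\<^bsub>L\<^esub>) i j) =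
        (if i = e div n \<and> j = e mod n then \<one>\<^bsub>L\<^esub> else \<zero>\<^bsub>L\<^esub>))"
    proof (rule spl.independent_imp_spanning)
      show "generic_mat n h \<in> carrier A" if "h < n * n" for h
        using that mn by (auto simp: UD_simps intro!: UD_carrier.generic)
      show "\<forall>h<n*n. c h = \<zero>\<^bsub>A\<^esub>" if "\<And>h. h < n * n \<Longrightarrow> c h \<in> carrier (galg_center A)"
        "(\<Oplus>\<^bsub>A\<^esub>h\<in>{..<n*n}. generic_mat n h \<otimes>\<^bsub>A\<^esub> c h) = \<zero>\<^bsub>A\<^esub>" for c
        using UD_generic_independent[OF n mn that] by blast
    qed (use spl.idx[OF e] in auto)
    then obtain w where w: "\<forall>h<n*n. w h \<in> carrier L" and eq: "\<forall>i<n. \<forall>j<n.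
      (\<Oplus>\<^bsub>L\<^esub>h\<in>{..<n*n}. w h \<otimes>\<^bsub>L\<^esub> spl.coord (ext.tens (generic_mat n h) \<one>\<^bsub>L\<^esub>) i j) =
        (if i = e div n \<and> j = e mod n then \<one>\<^bsub>L\<^esub> else \<zero>\<^bsub>L\<^esub>)" by (elim exE conjE)
    have "(\<Oplus>\<^bsub>L\<^esub>h\<in>{..<n*n}. w h \<otimes>\<^bsub>L\<^esub> y (h, i, j)) = (if e = i * n + j then \<one>\<^bsub>L\<^esub> else \<zero>\<^bsub>L\<^esub>)"
      if ij: "i < n" "j < n" for i j
      using eq[rule_format, OF ij] pair_index_iff[OF e ij] by (simp add: y_def \<Lambda>_def eq_commute)
    then show ?thesis using w by blast
  qed
  then have "\<forall>e. \<exists>w. e < n*n \<longrightarrow> (\<forall>h<n*n. w h \<in> carrier L) \<and> (\<forall>i<n. \<forall>j<n.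
    (\<Oplus>\<^bsub>L\<^esub>h\<in>{..<n*n}. w h \<otimes>\<^bsub>L\<^esub> y (h, i, j)) = (if e = i * n + j then \<one>\<^bsub>L\<^esub> else \<zero>\<^bsub>L\<^esub>))"
    unfolding ex_simps by (intro allI impI)
  from choice[OF this] show ?thesis .
qed

text \<open>
  All elements of \<open>L\<close> in question are regular on one open set, where the identities between them hold at
  every point by the identity principle.
\<close>

lemma coordinate_functions:
  "\<exists>U Y W. dom U \<and> (\<forall>v\<in>gvars m n. Y v \<in> reg X U \<and> y v = RC U (Y v)) \<and>
    (\<forall>u\<in>U. \<forall>e<n*n. \<forall>i<n. \<forall>j<n. (\<Sum>h<n*n. W u e h * Y (h, i, j) u) = (if e = i * n + j then 1 else 0))"
proof -
  obtain w where w: "\<And>e h. e < n * n \<Longrightarrow> h < n * n \<Longrightarrow> w e h \<in> carrier L"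
    and weq: "\<And>e i j. e < n * n \<Longrightarrow> i < n \<Longrightarrow> j < n \<Longrightarrow>
      (\<Oplus>\<^bsub>L\<^esub>h\<in>{..<n*n}. w e h \<otimes>\<^bsub>L\<^esub> y (h, i, j)) = (if e = i * n + j then \<one>\<^bsub>L\<^esub> else \<zero>\<^bsub>L\<^esub>)"
  proof -
    note conclude = that
    from left_inverse_exists obtain w where w: "\<forall>e<n*n. (\<forall>h<n*n. w e h \<in> carrier L) \<and> (\<forall>i<n. \<forall>j<n.
      (\<Oplus>\<^bsub>L\<^esub>h\<in>{..<n*n}. w e h \<otimes>\<^bsub>L\<^esub> y (h, i, j)) = (if e = i * n + j then \<one>\<^bsub>L\<^esub> else \<zero>\<^bsub>L\<^esub>))" ..
    show thesis
    proof (rule conclude[of w])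
      show "w e h \<in> carrier L" if "e < n * n" "h < n * n" for e h
        by (rule w[rule_format, OF that(1), THEN conjunct1, rule_format, OF that(2)])
      show "(\<Oplus>\<^bsub>L\<^esub>h\<in>{..<n*n}. w e h \<otimes>\<^bsub>L\<^esub> y (h, i, j)) = (if e = i * n + j then \<one>\<^bsub>L\<^esub> else \<zero>\<^bsub>L\<^esub>)"
        if "e < n * n" "i < n" "j < n" for e i j
        by (rule w[rule_format, OF that(1), THEN conjunct2, rule_format, OF that(2,3)])
    qed
  qed
  let ?S = "y ` gvars m n \<union> (\<lambda>(e, h). w e h) ` ({..<n*n} \<times> {..<n*n})"
  have "gvars m n \<subseteq> {..<m} \<times> {..<n} \<times> {..<n}" by (auto simp: gvars_def)
  then have "finite (gvars m n)" by (rule finite_subset) auto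
  then have "finite ?S" by simp
  moreover have "?S \<subseteq> carrier L"
  proof (intro Un_least image_subsetI)
    show "y v \<in> carrier L" if "v \<in> gvars m n" for v using that by (rule y_closed)
    show "(\<lambda>(e, h). w e h) p \<in> carrier L" if "p \<in> {..<n*n} \<times> {..<n*n}" for p
      using that w[of "fst p" "snd p"] by (simp add: case_prod_beta mem_Times_iff)
  qed
  ultimately have "\<exists>U F. dom U \<and> (\<forall>s\<in>?S. F s \<in> reg X U \<and> s = RC U (F s))" by (rule common_domain)
  then obtain U F where U: "dom U" and F0: "\<forall>s\<in>?S. F s \<in> reg X U \<and> s = RC U (F s)" by (elim exE conjE)
  note F = F0[rule_format]
  note Uo = dom_open[OF U]
  have Fy: "F (y v) \<in> reg X U \<and> y v = RC U (F (y v))" if "v \<in> gvars m n" for v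
    using that by (intro F UnI1 imageI)
  have Fw: "F (w e h) \<in> reg X U \<and> w e h = RC U (F (w e h))" if "e < n * n" "h < n * n" for e h
    using that by (intro F UnI2 rev_image_eqI[of "(e, h)"]) simp_all
  have "(\<Sum>h<n*n. F (w e h) u * F (y (h, i, j)) u) = (if e = i * n + j then 1 else 0)"
    if u: "u \<in> U" and e: "e < n * n" and ij: "i < n" "j < n" for u e i j
  proof -
    have v: "(h, i, j) \<in> gvars m n" if "h < n * n" for h using that ij mn by (auto simp: gvars_def)
    have r: "(\<lambda>u. F (w e h) u * F (y (h, i, j)) u) \<in> reg X U" if "h < n * n" for h
      using Fw[OF e that] Fy[OF v[OF that]] by (intro reg_mult[OF Uo]) auto
    have "(\<Oplus>\<^bsub>L\<^esub>h\<in>{..<n*n}. w e h \<otimes>\<^bsub>L\<^esub> y (h, i, j)) =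
        (\<Oplus>\<^bsub>L\<^esub>h\<in>{..<n*n}. RC U (\<lambda>u. F (w e h) u * F (y (h, i, j)) u))"
    proof (rule L.finsum_cong')
      fix h assume "h \<in> {..<n*n}"
      then have h: "h < n * n" by simp
      have "RC U (F (w e h)) \<otimes>\<^bsub>L\<^esub> RC U (F (y (h, i, j))) = RC U (\<lambda>u. F (w e h) u * F (y (h, i, j)) u)"
        using Fw[OF e h] Fy[OF v[OF h]] by (intro RC_mult[OF U]) auto
      then show "w e h \<otimes>\<^bsub>L\<^esub> y (h, i, j) = RC U (\<lambda>u. F (w e h) u * F (y (h, i, j)) u)"
        using Fw[OF e h] Fy[OF v[OF h]] by simp
    qed (use r in \<open>auto intro!: RC_closed[OF U]\<close>)
    also have "\<dots> = RC U (\<lambda>u. \<Sum>h<n*n. F (w e h) u * F (y (h, i, j)) u)"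
      using r by (intro RC_sum[OF U]) auto
    finally have "RC U (\<lambda>u. \<Sum>h<n*n. F (w e h) u * F (y (h, i, j)) u) = RC U (\<lambda>_. if e = i * n + j then 1 else 0)"
      using weq[OF e ij] L_consts(1,2)[OF U] by auto
    moreover have "(\<lambda>u. \<Sum>h<n*n. F (w e h) u * F (y (h, i, j)) u) \<in> reg X U"
      using r by (intro reg_sum[OF Uo]) auto
    ultimately show ?thesis
      using RC_eq_iff[OF U _ U reg_const[OF Uo]] u by blast
  qed
  then show ?thesis using U Fy by (intro exI[of _ U] exI[of _ "\<lambda>v. F (y v)"] exI[of _ "\<lambda>u e h. F (w e h) u"]) blast
qed

end

text \<open>
  On the open set \<open>U\<close>, the elements \<open>y v\<close> are the regular functions \<open>Y v\<close>, and the matrices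
  \<open>(Y (h, i, j) u)\<^sub>i\<^sub>j\<close> with \<open>h < n\<^sup>2\<close> have the left inverse \<open>W u\<close>.
\<close>

locale coordinate_domain = split_UD X m \<alpha> n \<iota> e
  for X :: "('x, 'k::field_char_0) fspace" and m \<alpha> n \<iota> e +
  fixes U :: "'x set" and Y :: "var \<Rightarrow> 'x \<Rightarrow> 'k" and W :: "'x \<Rightarrow> nat \<Rightarrow> nat \<Rightarrow> 'k"
  assumes U: "dom U" and Y: "\<And>v. v \<in> gvars m n \<Longrightarrow> Y v \<in> reg X U"
    and y_eq: "\<And>v. v \<in> gvars m n \<Longrightarrow> y v = RC U (Y v)"
    and W: "\<And>u e i j. u \<in> U \<Longrightarrow> e < n * n \<Longrightarrow> i < n \<Longrightarrow> j < n \<Longrightarrow>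
      (\<Sum>h<n*n. W u e h * Y (h, i, j) u) = (if e = i * n + j then 1 else 0)"
begin

abbreviation PV :: "'k gpoly set" where "PV \<equiv> polys_in (gvars m n)"

lemmas U_open = dom_open[OF U]

text \<open>The substitution of \<open>y\<close> for the variables.\<close>

definition \<theta> :: "'k gpoly \<Rightarrow> ('x set \<times> ('x \<Rightarrow> 'k)) set" where
  "\<theta> p = RC U (\<lambda>u. peval (\<lambda>v. Y v u) p)"

lemma \<theta>_regular: "p \<in> PV \<Longrightarrow> (\<lambda>u. peval (\<lambda>v. Y v u) p) \<in> reg X U"
  by (rule reg_peval[OF U_open _ Y])

lemma \<theta>_closed: "p \<in> PV \<Longrightarrow> \<theta> p \<in> carrier L"
  unfolding \<theta>_def by (rule RC_closed[OF U \<theta>_regular])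

lemma \<theta>_add: "p \<in> PV \<Longrightarrow> q \<in> PV \<Longrightarrow> \<theta> (p + q) = \<theta> p \<oplus>\<^bsub>L\<^esub> \<theta> q"
  unfolding \<theta>_def by (simp add: RC_add[OF U \<theta>_regular \<theta>_regular] peval.hom_add)

lemma \<theta>_mult: "p \<in> PV \<Longrightarrow> q \<in> PV \<Longrightarrow> \<theta> (p * q) = \<theta> p \<otimes>\<^bsub>L\<^esub> \<theta> q"
  unfolding \<theta>_def by (simp add: RC_mult[OF U \<theta>_regular \<theta>_regular] peval.hom_mult)

lemma \<theta>_const: "\<theta> (pconst c) = sclr L c"
  unfolding \<theta>_def by (simp add: L_consts(3)[OF U])

lemma \<theta>_one: "\<theta> 1 = \<one>\<^bsub>L\<^esub>"
  unfolding \<theta>_def by (simp add: L_consts(1)[OF U] peval.hom_one)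

lemma \<theta>_var: "v \<in> gvars m n \<Longrightarrow> \<theta> (pvar v) = y v"
  unfolding \<theta>_def by (simp add: y_eq)

lemma GL_point_regular:
  assumes "v \<in> gvars m n" shows "(\<lambda>u. GL_point m g (\<lambda>v. Y v u) v) \<in> reg X U"
proof -
  obtain h i j where v: "v = (h, i, j)" "h < m" "i < n" "j < n" using assms unfolding gvars_def by blast
  have "(\<lambda>u. \<Sum>l<m. g $$ (h, l) * Y (l, i, j) u) \<in> reg X U"
    using v by (intro reg_sum[OF U_open] reg_mult[OF U_open] reg_const[OF U_open] Y) (auto simp: gvars_def)
  then show ?thesis using v by (simp add: GL_point_def)
qed

text \<open>
  The map \<open>u \<mapsto> (Y v u)\<^sub>v\<close> is equivariant as far as it is defined: both \<open>u\<close> and \<open>g u\<close> have to lie in \<open>U\<close>.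
\<close>

lemma Y_equivariant:
  assumes g: "g \<in> carrier (GL m)" and v: "v \<in> gvars m n"
    and u: "u \<in> U" "u \<in> \<alpha> (inv\<^bsub>GL m\<^esub> g) ` U"
  shows "Y v (\<alpha> g u) = GL_point m g (\<lambda>v. Y v u) v"
proof -
  let ?k = "inv\<^bsub>GL m\<^esub> g"
  note k = GL_inv(4)[OF g] and kk = GL_inv(5)[OF g]
  obtain h i j where hij: "v = (h, i, j)" "h < m" "i < n" "j < n" using v unfolding gvars_def by blast
  have lv: "(l, i, j) \<in> gvars m n" if "l < m" for l using that hij by (auto simp: gvars_def)
  have "act L ?k (y v) = \<Lambda> (act A ?k (generic_mat n h)) i j"
    using \<Lambda>_act[OF k UD_carrier.generic[OF hij(2)] hij(3,4)] by (simp add: y_def hij(1))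
  also have "\<dots> = (\<Oplus>\<^bsub>L\<^esub>l\<in>{..<m}. sclr L (g $$ (h, l)) \<otimes>\<^bsub>L\<^esub> \<Lambda> (generic_mat n l) i j)"
    unfolding UD_act_generic[OF k hij(2)] kk by (rule \<Lambda>_combination) (auto intro: UD_carrier.generic hij)
  also have "\<dots> = (\<Oplus>\<^bsub>L\<^esub>l\<in>{..<m}. RC U (\<lambda>u. g $$ (h, l) * Y (l, i, j) u))"
  proof (rule L.finsum_cong')
    fix l assume "l \<in> {..<m}"
    then have l: "l < m" by simp
    have "\<Lambda> (generic_mat n l) i j = RC U (Y (l, i, j))" using y_eq[OF lv[OF l]] by (simp add: y_def)
    then show "sclr L (g $$ (h, l)) \<otimes>\<^bsub>L\<^esub> \<Lambda> (generic_mat n l) i j = RC U (\<lambda>u. g $$ (h, l) * Y (l, i, j) u)"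
      using RC_mult[OF U reg_const[OF U_open] Y[OF lv[OF l]]] by (simp add: L_consts(3)[OF U])
  qed (auto intro!: RC_closed[OF U] reg_mult[OF U_open] reg_const[OF U_open] Y lv)
  also have "\<dots> = RC U (\<lambda>u. \<Sum>l<m. g $$ (h, l) * Y (l, i, j) u)"
    by (rule RC_sum[OF U]) (auto intro!: reg_mult[OF U_open] reg_const[OF U_open] Y lv)
  also have "\<dots> = RC U (\<lambda>u. GL_point m g (\<lambda>v. Y v u) v)" using hij by (simp add: GL_point_def)
  finally have "RC (\<alpha> ?k ` U) (\<lambda>u. Y v (\<alpha> g u)) = RC U (\<lambda>u. GL_point m g (\<lambda>v. Y v u) v)"
    unfolding y_eq[OF v] act_RC[OF k U Y[OF v]] kk .
  moreover note act_valid[OF k U Y[OF v], unfolded kk]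
  ultimately have "\<forall>u\<in>\<alpha> ?k ` U \<inter> U. Y v (\<alpha> g u) = GL_point m g (\<lambda>v. Y v u) v"
    using RC_eq_iff[OF _ _ U GL_point_regular[OF v]] by blast
  then show ?thesis using u by blast
qed

text \<open>
  A polynomial that vanishes on the points \<open>Y u\<close> vanishes on \<open>Y (g u) = g Y u\<close> for \<open>u\<close> in the nonempty
  open set where this is defined, hence for all \<open>u\<close>, by the identity principle. So it vanishes on the
  \<open>G\<close>-orbit of \<open>Y u\<close>, which is dense.
\<close>

theorem \<theta>_injective:
  assumes p: "p \<in> PV" and zero: "\<theta> p = \<zero>\<^bsub>L\<^esub>"
  shows "p = 0"
proof -
  have pz: "peval (\<lambda>v. Y v u) p = 0" if "u \<in> U" for u
    using zero RC_eq_iff[OF U \<theta>_regular[OF p] U reg_const[OF U_open]] that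
    unfolding \<theta>_def L_consts(2)[OF U] by blast
  have gz: "peval (GL_point m g (\<lambda>v. Y v u)) p = 0" if g: "g \<in> carrier (GL m)" and u: "u \<in> U" for g u
  proof (rule reg_identity[OF U_open _ _ _ reg_const[OF U_open] _ u])
    let ?k = "inv\<^bsub>GL m\<^esub> g"
    note k = GL_inv(4)[OF g]
    have "dom (U \<inter> \<alpha> ?k ` U)" using dom_Int[OF U act_valid(1)[OF k U reg_const[OF U_open]]] .
    then show "openin (tp X) (U \<inter> \<alpha> ?k ` U)" "U \<inter> \<alpha> ?k ` U \<noteq> {}" by (simp_all add: dom_def)
    show "(\<lambda>u. peval (GL_point m g (\<lambda>v. Y v u)) p) \<in> reg X U"
      using reg_peval[OF U_open p, of "\<lambda>v u. GL_point m g (\<lambda>v. Y v u) v"] GL_point_regular by simp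
    fix z assume z: "z \<in> (U \<inter> \<alpha> ?k ` U) \<inter> U"
    have "\<alpha> g z \<in> U"
      using z unfolding \<alpha>_image[OF k U_open] by (simp add: GL_inv(5)[OF g])
    then have "peval (\<lambda>v. Y v (\<alpha> g z)) p = 0" by (rule pz)
    also have "peval (\<lambda>v. Y v (\<alpha> g z)) p = peval (GL_point m g (\<lambda>v. Y v z)) p"
      using z by (intro peval_cong[OF p] Y_equivariant[OF g]) auto
    finally show "peval (GL_point m g (\<lambda>v. Y v z)) p = 0" .
  qed
  obtain u where u: "u \<in> U" using U by (auto simp: dom_def)
  have "peval x p = 0" for x
  proof -
    obtain g where g: "g \<in> carrier_mat m m" "\<forall>v\<in>gvars m n. GL_point m g (\<lambda>v. Y v u) v = x v"
      using GL_orbit[OF mn W[OF u], of x] by blast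
    have "peval x p = peval (GL_point m g (\<lambda>v. Y v u)) p" by (rule peval_cong[OF p]) (use g in simp)
    also have "\<dots> = 0" using gz[OF _ u] g(1) by (rule GL_point_dense)
    finally show ?thesis .
  qed
  then show ?thesis by (rule poly_eq_zero_if_peval_zero)
qed

text \<open>
  The graph of the embedding that extends \<open>\<theta>\<close> to fractions: \<open>corr (p / q) l\<close> means \<open>l = \<theta> p / \<theta> q\<close>. As a
  relation it needs no choice of a representative; it is functional by \<open>corr_unique\<close>.
\<close>

definition corr :: "'k gfrac \<Rightarrow> ('x set \<times> ('x \<Rightarrow> 'k)) set \<Rightarrow> bool" where
  "corr r l \<longleftrightarrow> l \<in> carrier L \<and> (\<exists>p q. p \<in> PV \<and> q \<in> PV \<and> q \<noteq> 0 \<and> r = Fract p q \<and> l \<otimes>\<^bsub>L\<^esub> \<theta> q = \<theta> p)"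

lemma corr_closed: "corr r l \<Longrightarrow> l \<in> carrier L"
  by (simp add: corr_def)

lemma corr_poly: "p \<in> PV \<Longrightarrow> corr (to_frac p) (\<theta> p)"
  unfolding corr_def using polys_in_one \<theta>_closed by (intro conjI exI[of _ p] exI[of _ 1]) (auto simp: \<theta>_one)

lemma corr_gconst: "corr (gconst c) (sclr L c)"
  using corr_poly[OF polys_in_const, of c] by (simp add: gconst_to_frac \<theta>_const)

lemma corr_gvar: "v \<in> gvars m n \<Longrightarrow> corr (gvar v) (y v)"
  using corr_poly[OF polys_in_var, of v] by (simp add: gvar_to_frac \<theta>_var)

lemma corr_zero: "corr 0 \<zero>\<^bsub>L\<^esub>" and corr_one: "corr 1 \<one>\<^bsub>L\<^esub>"
  using corr_gconst[of 0] corr_gconst[of 1] L_consts[OF U]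
  by (simp_all add: E_gconst.hom_zero E_gconst.hom_one)

lemma \<theta>_nonzero: "q \<in> PV \<Longrightarrow> q \<noteq> 0 \<Longrightarrow> \<theta> q \<noteq> \<zero>\<^bsub>L\<^esub>"
  using \<theta>_injective by blast

lemma corr_exists: "r \<in> fracs_in (gvars m n) \<Longrightarrow> \<exists>l. corr r l"
proof -
  assume "r \<in> fracs_in (gvars m n)"
  then obtain p q where pq: "r = Fract p q" "p \<in> PV" "q \<in> PV" "q \<noteq> 0" unfolding fracs_in_def by blast
  have u: "\<theta> q \<in> Units L" using \<theta>_closed[OF pq(3)] \<theta>_nonzero[OF pq(3,4)] L.field_Units by blast
  note inverse = L.Units_l_inv[OF u] L.Units_inv_closed[OF u] L.Units_closed[OF u]
  have "(\<theta> p \<otimes>\<^bsub>L\<^esub> inv\<^bsub>L\<^esub> \<theta> q) \<otimes>\<^bsub>L\<^esub> \<theta> q = \<theta> p"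
    using inverse \<theta>_closed[OF pq(2)] by (simp add: L.m_assoc)
  then show ?thesis using pq inverse \<theta>_closed[OF pq(2)] unfolding corr_def by (intro exI[of _ "\<theta> p \<otimes>\<^bsub>L\<^esub> inv\<^bsub>L\<^esub> \<theta> q"]) auto
qed

lemma corr_add:
  assumes "corr r l" "corr s k" shows "corr (r + s) (l \<oplus>\<^bsub>L\<^esub> k)"
proof -
  obtain p q where r: "l \<in> carrier L" "p \<in> PV" "q \<in> PV" "q \<noteq> 0" "r = Fract p q" "l \<otimes>\<^bsub>L\<^esub> \<theta> q = \<theta> p"
    using assms(1) unfolding corr_def by blast
  obtain p' q' where s: "k \<in> carrier L" "p' \<in> PV" "q' \<in> PV" "q' \<noteq> 0" "s = Fract p' q'" "k \<otimes>\<^bsub>L\<^esub> \<theta> q' = \<theta> p'"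
    using assms(2) unfolding corr_def by blast
  note c = r(1) s(1) \<theta>_closed[OF r(2)] \<theta>_closed[OF r(3)] \<theta>_closed[OF s(2)] \<theta>_closed[OF s(3)]
  have "(l \<oplus>\<^bsub>L\<^esub> k) \<otimes>\<^bsub>L\<^esub> (\<theta> q \<otimes>\<^bsub>L\<^esub> \<theta> q') = l \<otimes>\<^bsub>L\<^esub> (\<theta> q \<otimes>\<^bsub>L\<^esub> \<theta> q') \<oplus>\<^bsub>L\<^esub> k \<otimes>\<^bsub>L\<^esub> (\<theta> q \<otimes>\<^bsub>L\<^esub> \<theta> q')"
    using c by (simp add: L.l_distr)
  also have "\<dots> = (l \<otimes>\<^bsub>L\<^esub> \<theta> q) \<otimes>\<^bsub>L\<^esub> \<theta> q' \<oplus>\<^bsub>L\<^esub> (k \<otimes>\<^bsub>L\<^esub> \<theta> q') \<otimes>\<^bsub>L\<^esub> \<theta> q"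
    using c by (simp add: L.m_ac)
  finally have "(l \<oplus>\<^bsub>L\<^esub> k) \<otimes>\<^bsub>L\<^esub> (\<theta> q \<otimes>\<^bsub>L\<^esub> \<theta> q') = (l \<otimes>\<^bsub>L\<^esub> \<theta> q) \<otimes>\<^bsub>L\<^esub> \<theta> q' \<oplus>\<^bsub>L\<^esub> (k \<otimes>\<^bsub>L\<^esub> \<theta> q') \<otimes>\<^bsub>L\<^esub> \<theta> q" .
  then have "(l \<oplus>\<^bsub>L\<^esub> k) \<otimes>\<^bsub>L\<^esub> \<theta> (q * q') = \<theta> (p * q' + p' * q)"
    using r s by (simp add: \<theta>_mult \<theta>_add polys_in_mult)
  then show ?thesis
    unfolding corr_def using r s by (intro conjI exI[of _ "p * q' + p' * q"] exI[of _ "q * q'"])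
      (auto intro!: polys_in_add polys_in_mult)
qed

lemma corr_mult:
  assumes "corr r l" "corr s k" shows "corr (r * s) (l \<otimes>\<^bsub>L\<^esub> k)"
proof -
  obtain p q where r: "l \<in> carrier L" "p \<in> PV" "q \<in> PV" "q \<noteq> 0" "r = Fract p q" "l \<otimes>\<^bsub>L\<^esub> \<theta> q = \<theta> p"
    using assms(1) unfolding corr_def by blast
  obtain p' q' where s: "k \<in> carrier L" "p' \<in> PV" "q' \<in> PV" "q' \<noteq> 0" "s = Fract p' q'" "k \<otimes>\<^bsub>L\<^esub> \<theta> q' = \<theta> p'"
    using assms(2) unfolding corr_def by blast
  note c = r(1) s(1) \<theta>_closed[OF r(2)] \<theta>_closed[OF r(3)] \<theta>_closed[OF s(2)] \<theta>_closed[OF s(3)]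
  have "(l \<otimes>\<^bsub>L\<^esub> k) \<otimes>\<^bsub>L\<^esub> (\<theta> q \<otimes>\<^bsub>L\<^esub> \<theta> q') = (l \<otimes>\<^bsub>L\<^esub> \<theta> q) \<otimes>\<^bsub>L\<^esub> (k \<otimes>\<^bsub>L\<^esub> \<theta> q')"
    using c by (simp add: L.m_ac)
  then have "(l \<otimes>\<^bsub>L\<^esub> k) \<otimes>\<^bsub>L\<^esub> \<theta> (q * q') = \<theta> (p * p')"
    using r s by (simp add: \<theta>_mult)
  then show ?thesis
    unfolding corr_def using r s by (intro conjI exI[of _ "p * p'"] exI[of _ "q * q'"])
      (auto intro!: polys_in_mult)
qed

lemma corr_unique:
  assumes "corr r l" "corr r k" shows "l = k"
proof -
  obtain p q where r: "l \<in> carrier L" "p \<in> PV" "q \<in> PV" "q \<noteq> 0" "r = Fract p q" "l \<otimes>\<^bsub>L\<^esub> \<theta> q = \<theta> p"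
    using assms(1) unfolding corr_def by blast
  obtain p' q' where s: "k \<in> carrier L" "p' \<in> PV" "q' \<in> PV" "q' \<noteq> 0" "r = Fract p' q'" "k \<otimes>\<^bsub>L\<^esub> \<theta> q' = \<theta> p'"
    using assms(2) unfolding corr_def by blast
  note c = r(1) s(1) \<theta>_closed[OF r(2)] \<theta>_closed[OF r(3)] \<theta>_closed[OF s(2)] \<theta>_closed[OF s(3)]
  have "p * q' = p' * q" using r s by (simp add: eq_fract)
  then have "\<theta> p \<otimes>\<^bsub>L\<^esub> \<theta> q' = \<theta> p' \<otimes>\<^bsub>L\<^esub> \<theta> q" using r s by (simp flip: \<theta>_mult)
  then have "(l \<otimes>\<^bsub>L\<^esub> \<theta> q) \<otimes>\<^bsub>L\<^esub> \<theta> q' = (k \<otimes>\<^bsub>L\<^esub> \<theta> q') \<otimes>\<^bsub>L\<^esub> \<theta> q" using r(6) s(6) by simp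
  then have "(\<theta> q \<otimes>\<^bsub>L\<^esub> \<theta> q') \<otimes>\<^bsub>L\<^esub> l = (\<theta> q \<otimes>\<^bsub>L\<^esub> \<theta> q') \<otimes>\<^bsub>L\<^esub> k" using c by (simp add: L.m_ac)
  moreover have "\<theta> q \<otimes>\<^bsub>L\<^esub> \<theta> q' \<noteq> \<zero>\<^bsub>L\<^esub>"
    using L.integral[OF _ c(4,6)] \<theta>_nonzero[OF r(3,4)] \<theta>_nonzero[OF s(3,4)] by metis
  ultimately show ?thesis using c L.m_lcancel[of "\<theta> q \<otimes>\<^bsub>L\<^esub> \<theta> q'" l k] by simp
qed

lemma corr_zero_imp: "corr r \<zero>\<^bsub>L\<^esub> \<Longrightarrow> r = 0"
proof -
  assume "corr r \<zero>\<^bsub>L\<^esub>"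
  then obtain p q where r: "p \<in> PV" "q \<in> PV" "q \<noteq> 0" "r = Fract p q" "\<zero>\<^bsub>L\<^esub> \<otimes>\<^bsub>L\<^esub> \<theta> q = \<theta> p"
    unfolding corr_def by blast
  then have "p = 0" using \<theta>_closed[OF r(2)] by (intro \<theta>_injective) auto
  then show ?thesis using r by (simp add: fract_collapse)
qed

lemma corr_sum:
  assumes "finite J" "\<And>j. j \<in> J \<Longrightarrow> corr (r j) (l j)"
  shows "corr (\<Sum>j\<in>J. r j) (\<Oplus>\<^bsub>L\<^esub>j\<in>J. l j)"
  using assms
proof (induction J rule: finite_induct)
  case (insert j J)
  then show ?case using corr_closed by (subst L.finsum_insert) (auto intro!: corr_add simp: Pi_iff)
qed (simp add: corr_zero)

lemma corr_prod:
  assumes "finite J" "\<And>j. j \<in> J \<Longrightarrow> corr (r j) (l j)"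
  shows "corr (\<Prod>j\<in>J. r j) (\<Otimes>\<^bsub>L\<^esub>j\<in>J. l j)"
  using assms
proof (induction J rule: finite_induct)
  case (insert j J)
  then show ?case using corr_closed by (subst L.finprod_insert) (auto intro!: corr_mult simp: Pi_iff)
qed (simp add: corr_one)

lemma corr_power: "corr r l \<Longrightarrow> corr (r ^ k) (l [^]\<^bsub>L\<^esub> (k::nat))"
proof (induction k)
  case (Suc k)
  then show ?case using corr_mult[of "r ^ k" "l [^]\<^bsub>L\<^esub> k" r l] by (simp add: mult.commute)
qed (simp add: corr_one)

text \<open>
  The embedding takes the entries of \<open>a\<close> to the entries of \<open>\<Lambda> a\<close>, so that it is compatible with \<open>\<iota>\<close> on the
  center. For the inverse \<open>b\<close> of \<open>a\<close>, the entries of \<open>b\<close> correspond to those of some element \<open>c\<close> of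
  \<open>A \<otimes> L\<close>, which turns out to be a left inverse of \<open>a \<otimes> 1\<close>, and therefore equal to \<open>b \<otimes> 1\<close>.
\<close>

theorem corr_entries:
  assumes "a \<in> UD_carrier m n" "i < n" "j < n"
  shows "corr (a $$ (i, j)) (\<Lambda> a i j)"
  using assms
proof (induction arbitrary: i j rule: UD_carrier.induct)
  case (scalar c)
  have "\<Lambda> (gconst c \<cdot>\<^sub>m 1\<^sub>m n) i j = (if i = j then sclr L c else \<zero>\<^bsub>L\<^esub>)"
    using \<Lambda>_center[OF sclr_A_center, of i j c] scalar by (simp add: UD_simps \<iota>_sclr[unfolded UD_simps])
  then show ?case using scalar corr_gconst corr_zero by simp
next
  case (generic h)
  have v: "(h, i, j) \<in> gvars m n" using generic by (auto simp: gvars_def)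
  have "y (h, i, j) = \<Lambda> (generic_mat n h) i j" by (simp add: y_def)
  then show ?case using corr_gvar[OF v] generic by (simp add: generic_mat_def)
next
  case (add a b)
  then show ?case using UD_closed[OF add(1)] UD_closed[OF add(2)] by (simp add: \<Lambda>_add corr_add)
next
  case (mult a b)
  show ?case
    unfolding mat_mult_entry[OF UD_closed[OF mult(1)] UD_closed[OF mult(2)] mult.prems] \<Lambda>_mult[OF mult(1,2) mult.prems]
    using mult by (intro corr_sum corr_mult) auto
next
  case (inverse a b)
  have bUD: "b \<in> UD_carrier m n" by (rule UD_carrier.inverse[OF inverse(1-4)])
  have "\<exists>l. corr (b $$ (i, j)) l" if "i < n" "j < n" for i j
    by (rule corr_exists[OF UD_entries[OF bUD that]])
  then obtain l where l: "\<And>i j. i < n \<Longrightarrow> j < n \<Longrightarrow> corr (b $$ (i, j)) (l i j)" by metis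
  obtain c where c: "c \<in> carrier ext.Q" and cl: "\<And>i j. i < n \<Longrightarrow> j < n \<Longrightarrow> spl.coord c i j = l i j"
    using spl.coord_surj[of l] corr_closed[OF l] by blast
  let ?ta = "ext.tens a \<one>\<^bsub>L\<^esub>" and ?tb = "ext.tens b \<one>\<^bsub>L\<^esub>"
  note ta = tens_closed_UD[OF inverse(1)] and tb = tens_closed_UD[OF bUD]
  have "c \<otimes>\<^bsub>ext.Q\<^esub> ?ta = \<one>\<^bsub>ext.Q\<^esub>"
  proof (rule spl.coord_eq_imp_eq)
    show "c \<otimes>\<^bsub>ext.Q\<^esub> ?ta \<in> carrier ext.Q" "\<one>\<^bsub>ext.Q\<^esub> \<in> carrier ext.Q" using c ta by simp_all
    fix i j assume ij: "i < n" "j < n"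
    have coord: "spl.coord (c \<otimes>\<^bsub>ext.Q\<^esub> ?ta) i j = (\<Oplus>\<^bsub>L\<^esub>k\<in>{..<n}. l i k \<otimes>\<^bsub>L\<^esub> \<Lambda> a k j)"
      unfolding spl.coord_mult[OF c ta ij]
      using ij corr_closed[OF l] \<Lambda>_closed[OF inverse(1)] by (intro L.finsum_cong') (auto simp: cl \<Lambda>_def)
    have "corr (\<Sum>k<n. b $$ (i, k) * a $$ (k, j)) (\<Oplus>\<^bsub>L\<^esub>k\<in>{..<n}. l i k \<otimes>\<^bsub>L\<^esub> \<Lambda> a k j)"
      using ij l inverse.IH by (intro corr_sum corr_mult) auto
    moreover have "(\<Sum>k<n. b $$ (i, k) * a $$ (k, j)) = (if i = j then 1 else 0)"
      unfolding mat_mult_entry[OF inverse(2) UD_closed[OF inverse(1)] ij, symmetric] inverse(4) using ij by simp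
    ultimately have "corr (if i = j then 1 else 0) (spl.coord (c \<otimes>\<^bsub>ext.Q\<^esub> ?ta) i j)"
      unfolding coord by (simp only:)
    moreover have "corr (if i = j then 1 else 0) (spl.coord \<one>\<^bsub>ext.Q\<^esub> i j)"
      unfolding spl.coord_one[OF ij] by (simp add: corr_one corr_zero)
    ultimately show "spl.coord (c \<otimes>\<^bsub>ext.Q\<^esub> ?ta) i j = spl.coord \<one>\<^bsub>ext.Q\<^esub> i j" by (rule corr_unique)
  qed
  moreover have "?ta \<otimes>\<^bsub>ext.Q\<^esub> ?tb = \<one>\<^bsub>ext.Q\<^esub>"
    using inverse(1,3) bUD by (simp add: ext.tens_mult ext.tens_one UD_simps)
  ultimately have "c = ?tb"
    using c ta tb ext.Q.m_assoc[of c ?ta ?tb] by simp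
  then have "\<Lambda> b i j = l i j" using cl[OF inverse.prems] by (simp add: \<Lambda>_def)
  then show ?case using l[OF inverse.prems] by simp
qed

section \<open>The transcendence degree of a splitting field\<close>

lemma column_vars_subset: "column_vars n \<subseteq> gvars m n"
proof -
  have "n \<le> m" using mn n by (metis le_trans le_square mult.commute)
  then show ?thesis using n by (auto simp: column_vars_def gvars_def)
qed

text \<open>
  Distinct variables differ at some point, so their images under the embedding are distinct.
\<close>

lemma y_inj: "inj_on y (gvars m n)"
proof (rule inj_onI)
  fix v v' assume v: "v \<in> gvars m n" "v' \<in> gvars m n" "y v = y v'"
  have "corr (gvar v + gconst (- 1) * gvar v') (y v \<oplus>\<^bsub>L\<^esub> sclr L (- 1) \<otimes>\<^bsub>L\<^esub> y v')"
    by (intro corr_add corr_mult corr_gvar corr_gconst v)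
  moreover have "y v \<oplus>\<^bsub>L\<^esub> sclr L (- 1) \<otimes>\<^bsub>L\<^esub> y v' = \<zero>\<^bsub>L\<^esub>"
  proof -
    have "sclr L (- 1) \<oplus>\<^bsub>L\<^esub> \<one>\<^bsub>L\<^esub> = \<zero>\<^bsub>L\<^esub>"
      unfolding L_consts[OF U] by (subst RC_add[OF U reg_const[OF U_open] reg_const[OF U_open]]) simp
    then have "(sclr L (- 1) \<oplus>\<^bsub>L\<^esub> \<one>\<^bsub>L\<^esub>) \<otimes>\<^bsub>L\<^esub> y v' = \<zero>\<^bsub>L\<^esub>" using y_closed[OF v(2)] by simp
    then show ?thesis using y_closed[OF v(2)] sclr_L_closed[of "- 1"] v(3) by (simp add: L.l_distr L.a_comm)
  qed
  ultimately have "gvar v + gconst (- 1) * gvar v' = (0 :: 'k gfrac)" using corr_zero_imp by simp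
  then have "gvar v = (gvar v' :: 'k gfrac)" by (simp add: E_gconst.hom_uminus E_gconst.hom_one)
  then have eq: "(pvar v :: 'k gpoly) = pvar v'" by (simp add: gvar_to_frac)
  have "peval (\<lambda>w. if w = v then 1 else 0 :: 'k) (pvar v) = peval (\<lambda>w. if w = v then 1 else 0) (pvar v')"
    unfolding eq ..
  then show "v = v'" unfolding peval_var by (simp split: if_splits)
qed

lemma card_column_vars: "finite (column_vars n)" "card (column_vars n) = n ^ 2 - 1"
proof -
  have eq: "column_vars n = (\<lambda>(i, a). (i, a, 0)) ` ({..<n} \<times> {..<n} - {(0, 0)})"
    by (auto simp: column_vars_def)
  show "finite (column_vars n)" unfolding eq by simp
  have "card (column_vars n) = card ({..<n} \<times> {..<n} - {(0, 0 :: nat)})"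
    unfolding eq by (rule card_image) (auto simp: inj_on_def)
  also have "\<dots> = n ^ 2 - 1" using n by (subst card_Diff_singleton) (auto simp: power2_eq_square)
  finally show "card (column_vars n) = n ^ 2 - 1" .
qed

text \<open>The exponent function on variables that corresponds to an exponent function on the elements \<open>y v\<close>.\<close>

definition pull :: "(('x set \<times> ('x \<Rightarrow> 'k)) set \<Rightarrow>\<^sub>0 nat) \<Rightarrow> var \<Rightarrow>\<^sub>0 nat" where
  "pull u = (\<Sum>v\<in>column_vars n. Poly_Mapping.single v (Poly_Mapping.lookup u (y v)))"

lemma lookup_pull: "Poly_Mapping.lookup (pull u) v = (if v \<in> column_vars n then Poly_Mapping.lookup u (y v) else 0)"
proof -
  have "Poly_Mapping.lookup (pull u) v = (\<Sum>w\<in>column_vars n. if w = v then Poly_Mapping.lookup u (y v) else 0)"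
    unfolding pull_def lookup_sum by (rule sum.cong) (auto simp: lookup_single when_def)
  then show ?thesis using card_column_vars(1) by simp
qed

lemma keys_pull: "Poly_Mapping.keys (pull u) = {v \<in> column_vars n. y v \<in> Poly_Mapping.keys u}"
  by (auto simp: in_keys_iff lookup_pull split: if_splits)

lemma pull_inj: "inj_on pull {u. Poly_Mapping.keys u \<subseteq> y ` column_vars n}"
proof (rule inj_onI, rule poly_mapping_eqI)
  fix u u' s assume u: "u \<in> {u. Poly_Mapping.keys u \<subseteq> y ` column_vars n}" "u' \<in> {u. Poly_Mapping.keys u \<subseteq> y ` column_vars n}"
    and eq: "pull u = pull u'"
  show "Poly_Mapping.lookup u s = Poly_Mapping.lookup u' s"
  proof (cases "s \<in> y ` column_vars n")
    case True
    then obtain v where v: "v \<in> column_vars n" "s = y v" by blast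
    then show ?thesis using lookup_pull[of u v] lookup_pull[of u' v] eq by simp
  next
    case False
    then have "s \<notin> Poly_Mapping.keys u" "s \<notin> Poly_Mapping.keys u'" using u by auto
    then show ?thesis by (simp add: in_keys_iff)
  qed
qed

lemma corr_monomial:
  assumes u: "Poly_Mapping.keys u \<subseteq> y ` column_vars n"
  shows "corr (monomial gvar (pull u)) (\<Otimes>\<^bsub>L\<^esub>s\<in>Poly_Mapping.keys u. s [^]\<^bsub>L\<^esub> Poly_Mapping.lookup u s)"
proof -
  let ?K = "Poly_Mapping.keys (pull u)"
  have K: "?K \<subseteq> column_vars n" "?K \<subseteq> gvars m n" using column_vars_subset by (auto simp: keys_pull)
  have img: "Poly_Mapping.keys u = y ` ?K" using u by (auto simp: keys_pull)
  have "(\<Otimes>\<^bsub>L\<^esub>s\<in>Poly_Mapping.keys u. s [^]\<^bsub>L\<^esub> Poly_Mapping.lookup u s) = (\<Otimes>\<^bsub>L\<^esub>v\<in>?K. y v [^]\<^bsub>L\<^esub> Poly_Mapping.lookup u (y v))"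
    unfolding img
  proof (rule L.finprod_reindex)
    show "(\<lambda>s. s [^]\<^bsub>L\<^esub> Poly_Mapping.lookup u s) \<in> y ` ?K \<rightarrow> carrier L" using K y_closed by auto
    show "inj_on y ?K" using inj_on_subset[OF y_inj K(2)] .
  qed
  moreover have "corr (\<Prod>v\<in>?K. gvar v ^ Poly_Mapping.lookup (pull u) v) (\<Otimes>\<^bsub>L\<^esub>v\<in>?K. y v [^]\<^bsub>L\<^esub> Poly_Mapping.lookup u (y v))"
  proof (rule corr_prod)
    fix v assume v: "v \<in> ?K"
    then have "Poly_Mapping.lookup (pull u) v = Poly_Mapping.lookup u (y v)" using K(1) by (auto simp: lookup_pull)
    moreover have "v \<in> gvars m n" using v K(2) by blast
    ultimately show "corr (gvar v ^ Poly_Mapping.lookup (pull u) v) (y v [^]\<^bsub>L\<^esub> Poly_Mapping.lookup u (y v))"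
      using corr_power corr_gvar by simp
  qed simp
  ultimately show ?thesis by (simp add: monomial_def)
qed

text \<open>
  The embedding pulls a relation between the elements \<open>y v\<close> with coefficients in \<open>\<iota> Z(A)\<close> back to a relation
  between the variables \<open>v\<close> with coefficients in \<open>Z(A)\<close>.
\<close>

theorem columns_alg_independent:
  "alg_independent L (\<iota> ` carrier (galg_center A)) (y ` column_vars n)"
  unfolding alg_independent_def
proof (intro conjI allI impI)
  show "y ` column_vars n \<subseteq> carrier L" using y_closed column_vars_subset by blast
  fix M :: "(('x set \<times> ('x \<Rightarrow> 'k)) set \<Rightarrow>\<^sub>0 nat) set" and c
  assume M: "finite M" and u: "\<forall>u\<in>M. Poly_Mapping.keys u \<subseteq> y ` column_vars n \<and> c u \<in> \<iota> ` carrier (galg_center A)"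
    and zero: "(\<Oplus>\<^bsub>L\<^esub>u\<in>M. c u \<otimes>\<^bsub>L\<^esub> (\<Otimes>\<^bsub>L\<^esub>s\<in>Poly_Mapping.keys u. s [^]\<^bsub>L\<^esub> Poly_Mapping.lookup u s)) = \<zero>\<^bsub>L\<^esub>"
  have "\<forall>u\<in>M. \<exists>z. z \<in> carrier (galg_center A) \<and> c u = \<iota> z" using u by blast
  then obtain z where z: "\<And>u. u \<in> M \<Longrightarrow> z u \<in> carrier (galg_center A)" "\<And>u. u \<in> M \<Longrightarrow> c u = \<iota> (z u)" by metis
  define \<zeta> where "\<zeta> u = z u $$ (0, 0)" for u
  have z_eq: "z u = \<zeta> u \<cdot>\<^sub>m 1\<^sub>m n" if "u \<in> M" for u unfolding \<zeta>_def using UD_center[OF n mn z(1)[OF that]] .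
  have corr_\<zeta>: "corr (\<zeta> u) (c u)" if u: "u \<in> M" for u
  proof -
    have "z u \<in> UD_carrier m n" using z(1)[OF u] center_A by blast
    then show ?thesis
      using corr_entries[of "z u" 0 0] n \<Lambda>_center[OF z(1)[OF u], of 0 0] z(2)[OF u] by (simp add: \<zeta>_def)
  qed
  have "corr (\<Sum>u\<in>M. \<zeta> u * monomial gvar (pull u)) \<zero>\<^bsub>L\<^esub>"
    unfolding zero[symmetric] using u corr_\<zeta> corr_monomial by (intro corr_sum[OF M] corr_mult) auto
  then have sum: "(\<Sum>u\<in>M. \<zeta> u * monomial gvar (pull u)) = 0" by (rule corr_zero_imp)
  have inj: "inj_on pull M" by (rule inj_on_subset[OF pull_inj]) (use u in blast)
  define \<zeta>' where "\<zeta>' w = \<zeta> (the_inv_into M pull w)" for w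
  have \<zeta>': "\<zeta>' (pull u) = \<zeta> u" if "u \<in> M" for u
    unfolding \<zeta>'_def using the_inv_into_f_f[OF inj that] by simp
  have "\<forall>w\<in>pull ` M. \<zeta>' w = 0"
  proof (rule column_vars_independent[OF n])
    show "finite (pull ` M)" using M by simp
    show "Poly_Mapping.keys w \<subseteq> column_vars n" if "w \<in> pull ` M" for w
      using that keys_pull by auto
    show "\<zeta>' w \<cdot>\<^sub>m 1\<^sub>m n \<in> UD_carrier m n" if w: "w \<in> pull ` M" for w
    proof -
      obtain u where u: "u \<in> M" "w = pull u" using w by blast
      have "z u \<in> UD_carrier m n" using z(1)[OF u(1)] center_A by blast
      then show ?thesis using z_eq[OF u(1)] \<zeta>'[OF u(1)] u(2) by simp
    qed
    show "(\<Sum>w\<in>pull ` M. \<zeta>' w * monomial gvar w) = 0"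
      using sum by (simp add: sum.reindex[OF inj] \<zeta>')
  qed
  then have "\<zeta> u = 0" if "u \<in> M" for u using that \<zeta>' by auto
  then show "\<forall>u\<in>M. c u = \<zero>\<^bsub>L\<^esub>" using corr_\<zeta> corr_zero corr_unique by metis
qed

theorem trdeg_bound: "trdeg L (\<iota> ` carrier (galg_center A)) \<ge> enat (n ^ 2 - 1)"
proof -
  have "inj_on y (column_vars n)" using inj_on_subset[OF y_inj column_vars_subset] .
  then have "card (y ` column_vars n) = n ^ 2 - 1" using card_image card_column_vars(2) by metis
  then show ?thesis
    unfolding trdeg_def using columns_alg_independent card_column_vars(1)
    by (intro SUP_upper2[of "y ` column_vars n"]) auto
qed

end

theorem proposition13p1:
  fixes m n :: nat
    and A :: "('k::{alg_closed_field, field_char_0} gfrac mat, 'k, 'k mat) galg"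
  assumes "n \<ge> 1" and "m \<ge> 2" and "m \<ge> n^2"
    and "A = UD m n"
  shows "galg_fixed (GL m) A = range (sclr A) \<and>
    (\<forall>(X\<^sub>0 :: ('x, 'k) fspace) \<alpha> \<iota>.
       GL_variety m X\<^sub>0 \<alpha> \<longrightarrow> irreducible_fspace X\<^sub>0 \<longrightarrow>
       G_splitting_field (GL m) n A (function_field m X\<^sub>0 \<alpha>) \<iota> \<longrightarrow>
       trdeg (function_field m X\<^sub>0 \<alpha>) (\<iota> ` carrier (galg_center A)) \<ge> enat (n^2 - 1))"
proof -
  have mn: "n * n \<le> m" using assms(3) by (simp add: power2_eq_square)
  have fixed: "galg_fixed (GL m) A = range (sclr A)" unfolding assms(4) by (rule UD_fixed[OF mn])
  have bound: "trdeg (function_field m X \<alpha>) (\<iota> ` carrier (galg_center A)) \<ge> enat (n^2 - 1)"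
    if GLv: "GL_variety m X \<alpha>" and irr: "irreducible_fspace X"
    and split: "G_splitting_field (GL m) n A (function_field m X \<alpha>) \<iota>"
    for X :: "('x, 'k) fspace" and \<alpha> \<iota>
  proof -
    interpret F: UD_function_field X m \<alpha> n \<iota>
    proof (intro UD_function_field.intro UD_function_field_axioms.intro GL_function_field.intro
        GL_function_field_axioms.intro irreducible_space.intro)
      show "space_with_functions X" using GLv by (simp add: GL_variety_def variety_def)
      show "irreducible_fspace X" by (rule irr)
      show "GL_variety m X \<alpha>" by (rule GLv)
      show "field (function_field m X \<alpha>)" using split by (simp add: G_splitting_field_def)
      show "1 \<le> n" "n * n \<le> m" by (rule assms(1), rule mn)
      show "\<iota> \<in> galg_hom (GL m) (galg_center (UD m n)) (function_field m X \<alpha>)"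
        using split assms(4) by (simp add: G_splitting_field_def)
    qed
    have "galg_split (GL m) n F.ext.Q" using split assms(4) by (simp add: G_splitting_field_def)
    then obtain e where e: "is_matrix_units (GL m) n F.ext.Q e" using F.matrix_units by blast
    interpret S: split_UD X m \<alpha> n \<iota> e by unfold_locales (rule e)
    obtain U Y W where U: "F.dom U" "\<forall>v\<in>gvars m n. Y v \<in> reg X U \<and> S.y v = F.RC U (Y v)"
      "\<forall>u\<in>U. \<forall>e<n*n. \<forall>i<n. \<forall>j<n. (\<Sum>h<n*n. W u e h * Y (h, i, j) u) = (if e = i * n + j then 1 else 0)"
      using S.coordinate_functions by (elim exE conjE)
    interpret C: coordinate_domain X m \<alpha> n \<iota> e U Y W by unfold_locales (use U in blast)+
    show ?thesis unfolding assms(4) by (rule C.trdeg_bound)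
  qed
  show ?thesis using fixed bound by blast
qed

end
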